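(* Let $D\subset\mathbb R^2$ be a bounded simply connected domain with smooth boundary, let $\alpha>0$, and let $x_1,\dots,x_k\in D$ be $k$ different isolated (local) maximum points of $\psi_0$. Then there exist $r_0>0$ and $\delta_0>0$ such that for each $\vec{\kappa}\in\mathbb K^{\alpha}$ with $|\vec{\kappa}|<\delta_0$ there is a weak solution $\omega^{\vec{\kappa}}\in L^\infty(D)$ of the vorticity equation in $D$ of the form $$\omega^{\vec{\kappa}}=1-I_{\cup_{i=1}^kA_i^{\vec{\kappa}}},\qquad |A_i^{\vec{\kappa}}|=\kappa_i,\qquad A_i^{\vec{\kappa}}=\{x\in D\mid G\omega^{\vec{\kappa}}(x)=\mu_i^{\vec{\kappa}}\}\cap B_{r_0}(x_i)\quad(i=1,\dots,k),$$ where each $\mu_i^{\vec{\kappa}}$ is a positive real number depending on $\vec{\kappa}$ (while $r_0$ does not depend on $\vec{\kappa}$), and such that the velocity field $\mathbf v=\nabla^\perp G\omega^{\vec{\kappa}}$ vanishes a.e. on each $A_i^{\vec{\kappa}}$. Moreover, as $|\vec{\kappa}|\to0$, each $A_i^{\vec{\kappa}}$ shrinks to $x_i$: for every $\varepsilon>0$ there is $\delta_\varepsilon\in(0,\delta_0)$ such that $A_i^{\vec{\kappa}}\subset B_\varepsilon(x_i)$ for all $i$ and all $\vec{\kappa}\in\mathbb K^\alpha$ with $|\vec{\kappa}|<\delta_\varepsilon$.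
   Context: $\psi_0$ is the solution of $-\Delta\psi_0=1$ in $D$, $\psi_0=0$ on $\partial D$. A point $x_i\in D$ is an isolated maximum point of $\psi_0$ if for all sufficiently small $r>0$ it is the unique maximum point of $\psi_0$ on $\overline{B_r(x_i)}$. For $\alpha>0$, $\mathbb K^{\alpha}$ is the set of $\vec{\kappa}=(\kappa_1,\dots,\kappa_k)\in\mathbb R^k$ with all $\kappa_i>0$ and $\max_{i,j}\kappa_i/\kappa_j\le\alpha$; $|\vec{\kappa}|:=\sum_{i=1}^k\kappa_i$. $I_A$ is the characteristic function of $A$, $|A|$ is the Lebesgue measure of $A$, and $B_r(x)$ is the open disc of radius $r$ centered at $x$. $G$ is the Green's function of $-\Delta$ in $D$ with zero Dirichlet boundary data and $G\omega(x):=\int_DG(x,y)\omega(y)\,dy$ (a continuous function on $\overline D$ for $\omega\in L^\infty(D)$). For $\mathbf b=(b_1,b_2)$, $\mathbf b^\perp=(b_2,-b_1)$, and $\nabla^\perp f=(\nabla f)^\perp$. A function $\omega\in L^\infty(D)$ is a weak solution of the vorticity equation ($\nabla^\perp G\omega\cdot\nabla\omega=0$) if $\int_D\omega\,\nabla^\perp G\omega\cdot\nabla\phi\,dx=0$ for all $\phi\in C_c^\infty(D)$. *)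

theory Defs
  imports "HOL-Analysis.Analysis"
begin

definition partial_deriv :: "2 \<Rightarrow> (real^2 \<Rightarrow> real) \<Rightarrow> real^2 \<Rightarrow> real" where
  "partial_deriv i f x = frechet_derivative f (at x) (axis i 1)"

definition grad :: "(real^2 \<Rightarrow> real) \<Rightarrow> real^2 \<Rightarrow> real^2" where
  "grad f x = (\<chi> i. partial_deriv i f x)"

definition perp :: "real^2 \<Rightarrow> real^2" where
  "perp b = vector [b $ 2, - (b $ 1)]"

definition perp_grad :: "(real^2 \<Rightarrow> real) \<Rightarrow> real^2 \<Rightarrow> real^2" where
  "perp_grad f x = perp (grad f x)"

definition laplacian :: "(real^2 \<Rightarrow> real) \<Rightarrow> real^2 \<Rightarrow> real" where
  "laplacian f x = (\<Sum>i\<in>UNIV. partial_deriv i (partial_deriv i f) x)"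

(* Meant for open S only: "differentiable_on" takes derivatives within S,
   "partial_deriv" takes them at the point. *)
primrec Ck_on :: "nat \<Rightarrow> (real^2 \<Rightarrow> real) \<Rightarrow> (real^2) set \<Rightarrow> bool" where
  "Ck_on 0 f S \<longleftrightarrow> continuous_on S f"
| "Ck_on (Suc k) f S \<longleftrightarrow> f differentiable_on S \<and> (\<forall>i. Ck_on k (partial_deriv i f) S)"

definition smooth_on :: "(real^2 \<Rightarrow> real) \<Rightarrow> (real^2) set \<Rightarrow> bool" where
  "smooth_on f S \<longleftrightarrow> (\<forall>k. Ck_on k f S)"

definition test_function :: "(real^2) set \<Rightarrow> (real^2 \<Rightarrow> real) \<Rightarrow> bool" where
  "test_function D \<phi> \<longleftrightarrow> smooth_on \<phi> UNIV \<and>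
     compact (closure {x. \<phi> x \<noteq> 0}) \<and> closure {x. \<phi> x \<noteq> 0} \<subseteq> D"

(* Near each boundary point, D is the sublevel set of a smooth function without
   critical points; so D lies on one side of its boundary, a smooth curve. *)
definition smooth_boundary :: "(real^2) set \<Rightarrow> bool" where
  "smooth_boundary D \<longleftrightarrow> (\<forall>p\<in>frontier D. \<exists>U g. open U \<and> p \<in> U \<and> smooth_on g U \<and>
     (\<forall>x\<in>U. grad g x \<noteq> 0) \<and> D \<inter> U = {x\<in>U. g x < 0})"

definition harmonic_on :: "(real^2 \<Rightarrow> real) \<Rightarrow> (real^2) set \<Rightarrow> bool" where
  "harmonic_on h D \<longleftrightarrow> Ck_on 2 h D \<and> (\<forall>x\<in>D. laplacian h x = 0)"

(* The (classical) solution of - Laplace psi = 1 in D, psi = 0 on the boundary.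
   Values outside the closure of D are unconstrained. *)
definition solves_unit_poisson :: "(real^2) set \<Rightarrow> (real^2 \<Rightarrow> real) \<Rightarrow> bool" where
  "solves_unit_poisson D \<psi> \<longleftrightarrow> Ck_on 2 \<psi> D \<and> continuous_on (closure D) \<psi> \<and>
     (\<forall>x\<in>D. - laplacian \<psi> x = 1) \<and> (\<forall>x\<in>frontier D. \<psi> x = 0)"

(* For each pole y, G(., y) is the fundamental solution - ln |x - y| / (2 pi) plus a
   harmonic correction h that cancels it on the boundary.  Values on the diagonal and
   for x outside the closure of D or y outside D are unconstrained. *)
definition dirichlet_green :: "(real^2) set \<Rightarrow> (real^2 \<Rightarrow> real^2 \<Rightarrow> real) \<Rightarrow> bool" where
  "dirichlet_green D G \<longleftrightarrow> (\<forall>y\<in>D. \<exists>h. harmonic_on h D \<and> continuous_on (closure D) h \<and>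
     (\<forall>x\<in>closure D - {y}. G x y = - ln (norm (x - y)) / (2 * pi) + h x) \<and>
     (\<forall>x\<in>frontier D. G x y = 0))"

definition green_op ::
  "(real^2) set \<Rightarrow> (real^2 \<Rightarrow> real^2 \<Rightarrow> real) \<Rightarrow> (real^2 \<Rightarrow> real) \<Rightarrow> real^2 \<Rightarrow> real" where
  "green_op D G \<omega> x = (LINT y|lebesgue_on D. G x y * \<omega> y)"

definition L_infinity :: "(real^2) set \<Rightarrow> (real^2 \<Rightarrow> real) set" where
  "L_infinity D = {\<omega>. \<omega> \<in> borel_measurable (lebesgue_on D) \<and>
     (\<exists>C. AE x in lebesgue_on D. \<bar>\<omega> x\<bar> \<le> C)}"

(* "has_bochner_integral ... 0" says that the integrand is Lebesgue integrable over D
   and that its integral is 0. *)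
definition weak_vorticity_solution ::
  "(real^2) set \<Rightarrow> (real^2 \<Rightarrow> real^2 \<Rightarrow> real) \<Rightarrow> (real^2 \<Rightarrow> real) \<Rightarrow> bool" where
  "weak_vorticity_solution D G \<omega> \<longleftrightarrow> \<omega> \<in> L_infinity D \<and>
     (\<forall>\<phi>. test_function D \<phi> \<longrightarrow>
        has_bochner_integral (lebesgue_on D)
          (\<lambda>x. \<omega> x * (perp_grad (green_op D G \<omega>) x \<bullet> grad \<phi> x)) 0)"

definition isolated_max_point :: "(real^2 \<Rightarrow> real) \<Rightarrow> real^2 \<Rightarrow> bool" where
  "isolated_max_point f x \<longleftrightarrow>
     (\<forall>\<^sub>F r in at_right 0. {y \<in> cball x r. \<forall>z \<in> cball x r. f z \<le> f y} = {x})"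

(* The index type 'k plays the role of {1, ..., k}. *)
definition strengths :: "real \<Rightarrow> (real^'k) set" where
  "strengths \<alpha> = {\<kappa>. (\<forall>i. \<kappa> $ i > 0) \<and> Max (range (\<lambda>(i, j). \<kappa> $ i / \<kappa> $ j)) \<le> \<alpha>}"

definition total_strength :: "real^'k \<Rightarrow> real" where
  "total_strength \<kappa> = (\<Sum>i\<in>UNIV. \<kappa> $ i)"

end

theory Submission
  imports Defs
begin

text \<open>Minimise \<open>E v = 1/2 \<integral> v G v - \<integral> \<psi>\<^sub>0 v\<close> over all \<open>0 \<le> v \<le> 1\<close> that live on small discs around the \<open>x\<^sub>i\<close> and have
  mass \<open>\<kappa>\<^sub>i\<close> on the \<open>i\<close>-th disc; up to a constant this is the kinetic energy of \<open>1 - v\<close>. The energy is convex, so a minimiser exists,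
  and its first variation together with the bathtub principle yields levels \<open>\<mu>\<^sub>i\<close> such that, on the \<open>i\<close>-th disc, \<open>\<psi> = \<psi>\<^sub>0 - G v\<close>
  satisfies \<open>v = 1\<close> where \<open>\<psi> > \<mu>\<^sub>i\<close> and \<open>v = 0\<close> where \<open>\<psi> < \<mu>\<^sub>i\<close>. As \<open>G v\<close> is uniformly small for small total mass, \<open>{\<psi> \<ge> \<mu>\<^sub>i}\<close>
  concentrates at the strict maximum point \<open>x\<^sub>i\<close> of \<open>\<psi>\<^sub>0\<close>. On \<open>{\<psi> > \<mu>\<^sub>i}\<close> the function \<open>\<psi>\<close> is harmonic, so the maximum principle
  gives \<open>\<psi> \<le> \<mu>\<^sub>i\<close>: this is an obstacle problem. Its solution detaches at most quadratically from the contact set \<open>{\<psi> = \<mu>\<^sub>i}\<close>,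
  so that \<open>\<nabla>\<psi>\<close> vanishes there and \<open>v\<close> is almost everywhere the characteristic function of the contact sets.
  Hence \<open>\<omega> = 1 - v\<close> satisfies \<open>\<omega> \<nabla>\<^sup>\<bottom>\<psi> = \<nabla>\<^sup>\<bottom>\<psi>\<close>, which is divergence free.\<close>

section \<open>Integration by parts in the plane\<close>

text \<open>A minimiser \<open>v\<close> is only known to be bounded and measurable, so
  \<open>G v\<close> need not be twice differentiable and the equation for the stream function
  cannot be read pointwise. The proof therefore works with a mean value form of Poisson's equation.
  The splitting \<open>log_kernel = smooth_log r + log_gap r\<close> has a \<open>C^2\<close> first
  part with Laplacian \<open>- bump r\<close>, where \<open>bump r\<close> is a probability density
  on the disc of radius \<open>r\<close>, and a second part that is nonnegative, supported in the
  same disc and of integral \<open>r^2 / 16\<close>. Testing \<open>- Laplace u = f\<close> with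
  \<open>log_gap r\<close> compares \<open>u x\<close> with its \<open>bump\<close> average, which
  makes sense for continuous \<open>u\<close> and bounded \<open>f\<close>. Maximum principle, sign
  and symmetry of the Green's function, interior gradient bounds and positivity of the energy all
  come from this identity. The delicate point is \<open>v = 1\<close> almost everywhere on the
  contact set. The missing density \<open>1 - v\<close> is integrated against
  \<open>log_gap\<close>; quadratic detachment bounds the result by a multiple of the area of a thin
  shell around the contact set, and such shells shrink to the empty set.\<close>

lemma lborel_integral_translate:
  fixes f :: "'a::euclidean_space \<Rightarrow> real"
  assumes [measurable]: "f \<in> borel_measurable borel"
  shows "integral\<^sup>L lborel (\<lambda>x. f (x + a)) = integral\<^sup>L lborel f"
proof -
  have "integral\<^sup>L lborel f = integral\<^sup>L (distr lborel borel ((+) a)) f"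
    by (simp add: lborel_distr_plus)
  also have "\<dots> = integral\<^sup>L lborel (\<lambda>x. f (a + x))"
    by (subst integral_distr) auto
  finally show ?thesis by (simp add: add.commute)
qed

lemma lborel_integrable_translate:
  fixes f :: "'a::euclidean_space \<Rightarrow> real"
  assumes "integrable lborel f"
  shows "integrable lborel (\<lambda>x. f (x + a))"
proof -
  have "integrable (distr lborel borel ((+) a)) f"
    using assms by (simp add: lborel_distr_plus)
  then have "integrable lborel (\<lambda>x. f (a + x))"
    by (subst (asm) integrable_distr_eq) (use assms in auto)
  then show ?thesis by (simp add: add.commute)
qed

lemma integrable_bounded_support:
  fixes f :: "'a::euclidean_space \<Rightarrow> real"
  assumes "f \<in> borel_measurable borel" and "bounded S" and "\<And>x. x \<notin> S \<Longrightarrow> f x = 0"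
    and "\<And>x. \<bar>f x\<bar> \<le> B"
  shows "integrable lborel f"
proof -
  obtain a b where ab: "S \<subseteq> cbox a b" using bounded_subset_cbox_symmetric[OF assms(2)] by blast
  show ?thesis
  proof (rule integrableI_bounded_set[where A = "cbox a b" and B = B])
    show "emeasure lborel (cbox a b) < \<infinity>" by (rule emeasure_lborel_cbox_finite)
    show "AE x in lborel. x \<notin> cbox a b \<longrightarrow> f x = 0" using assms(3) ab by auto
  qed (use assms in auto)
qed

text \<open>Translation invariance gives each difference quotient of \<open>F\<close> along
  \<open>e\<close> integral zero, the Lipschitz bound dominates the quotients, and dominated
  convergence passes to the derivative. Asking for the derivative only almost everywhere admits
  functions with a kink on a circle.\<close>

lemma integral_directional_derivative_eq_0:
  fixes F :: "'a::euclidean_space \<Rightarrow> real"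
  assumes lip: "\<And>x y. \<bar>F x - F y\<bar> \<le> C * norm (x - y)"
    and supp: "\<And>x. norm x > R \<Longrightarrow> F x = 0"
    and g[measurable]: "g \<in> borel_measurable borel"
    and deriv: "AE x in lborel. \<exists>F'. (F has_derivative F') (at x) \<and> F' e = g x"
  shows "integrable lborel g" and "integral\<^sup>L lborel g = 0"
proof -
  have C0: "0 \<le> C * norm e" for e :: 'a
    using order_trans[OF _ lip[of e 0], of 0] by simp
  have "C-lipschitz_on UNIV F" if "0 \<le> C"
    using lip that by (auto simp: lipschitz_on_def dist_norm)
  moreover have "0 \<le> C"
  proof -
    obtain b :: 'a where "norm b = 1" using vector_choose_size[of 1] by auto
    then show ?thesis using C0[of b] by simp
  qed
  ultimately have "continuous_on UNIV F" by (blast intro: lipschitz_on_continuous_on)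
  then have Fm[measurable]: "F \<in> borel_measurable borel" by (rule borel_measurable_continuous_onI)
  have Fi: "integrable lborel F"
  proof (rule integrable_bounded_support)
    show "bounded (cball (0::'a) R)" by simp
    \<comment> \<open>A point outside the support: comparing with \<open>F y = 0\<close> turns the
      Lipschitz bound into a bound on \<open>F\<close>.\<close>
    obtain y :: 'a where y: "norm y = \<bar>R\<bar> + 1" using vector_choose_size[of "\<bar>R\<bar>+1"] by auto
    show "\<bar>F x\<bar> \<le> C * (\<bar>R\<bar> + (\<bar>R\<bar> + 1))" for x
    proof (cases "norm x > R")
      case True then show ?thesis using supp \<open>0 \<le> C\<close> by simp
    next
      case False
      have "\<bar>F x\<bar> \<le> C * norm (x - y)" using lip[of x y] supp[of y] y by simp
      also have "\<dots> \<le> C * (\<bar>R\<bar> + (\<bar>R\<bar> + 1))"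
        using \<open>0 \<le> C\<close> False norm_triangle_ineq4[of x y] y by (intro mult_left_mono) auto
      finally show ?thesis .
    qed
  qed (use supp in \<open>auto simp: not_le\<close>)
  define d where "d n x = real (Suc n) * (F (x + e /\<^sub>R real (Suc n)) - F x)" for n x
  \<comment> \<open>The shifts \<open>e / (n + 1)\<close> are no longer than \<open>e\<close>, so
    all quotients live on the ball enlarged by \<open>norm e\<close>.\<close>
  define w where "w x = C * norm e * indicator (cball 0 (R + norm e)) x" for x :: 'a
  have wi: "integrable lborel w"
    unfolding w_def by (intro integrable_mult_right integrable_real_indicator)
      (use emeasure_lborel_cball_finite in auto)
  have dw: "\<bar>d n x\<bar> \<le> w x" for n x
  proof (cases "norm x \<le> R + norm e")
    case True
    have "\<bar>F (x + e /\<^sub>R real (Suc n)) - F x\<bar> \<le> C * norm (e /\<^sub>R real (Suc n))"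
      using lip[of "x + e /\<^sub>R real (Suc n)" x] by simp
    also have "\<dots> = C * norm e / real (Suc n)" by (simp add: field_simps)
    finally have "real (Suc n) * \<bar>F (x + e /\<^sub>R real (Suc n)) - F x\<bar> \<le> C * norm e"
      by (simp add: pos_le_divide_eq mult.commute del: of_nat_Suc)
    then show ?thesis using True by (simp add: d_def w_def abs_mult del: of_nat_Suc)
  next
    case False
    have "norm (e /\<^sub>R real (Suc n)) \<le> norm e" by (simp add: field_simps)
    then have "norm (x + e /\<^sub>R real (Suc n)) > R"
      using False norm_triangle_ineq4[of "x + e /\<^sub>R real (Suc n)" "e /\<^sub>R real (Suc n)"] by simp
    moreover have "norm x > R" using False norm_ge_zero[of e] by linarith
    ultimately have "F (x + e /\<^sub>R real (Suc n)) = 0" "F x = 0" using supp by blast+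
    then show ?thesis using False by (simp add: d_def w_def)
  qed
  have lim: "AE x in lborel. (\<lambda>n. d n x) \<longlonglongrightarrow> g x"
    using deriv
  proof eventually_elim
    case (elim x)
    then obtain F' where F': "(F has_derivative F') (at x)" "F' e = g x" by blast
    then have lin: "bounded_linear F'" by (blast dest: has_derivative_bounded_linear)
    have "((\<lambda>t. F (x + t *\<^sub>R e)) has_derivative (\<lambda>t. F' (t *\<^sub>R e))) (at 0)"
      by (rule has_derivative_compose[of "\<lambda>t. x + t *\<^sub>R e" "\<lambda>t. t *\<^sub>R e" 0 UNIV F F'])
         (use F' in \<open>auto intro!: derivative_eq_intros\<close>)
    then have "((\<lambda>t. F (x + t *\<^sub>R e)) has_real_derivative g x) (at 0)"
      by (simp add: has_field_derivative_def linear_cmul bounded_linear.linear[OF lin] F'(2) mult_commute_abs)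
    then have "(\<lambda>h. (F (x + h *\<^sub>R e) - F x) / h) \<midarrow>0\<rightarrow> g x"
      by (simp add: DERIV_def)
    then have "(\<lambda>n. (F (x + (1 / real (Suc n)) *\<^sub>R e) - F x) / (1 / real (Suc n))) \<longlonglongrightarrow> g x"
    proof (rule filterlim_compose)
      show "filterlim (\<lambda>n. 1 / real (Suc n)) (at 0) sequentially"
        unfolding filterlim_at using LIMSEQ_inverse_real_of_nat by (auto simp: inverse_eq_divide)
    qed
    then show ?case by (simp add: d_def inverse_eq_divide mult.commute)
  qed
  have dm: "d n \<in> borel_measurable lborel" for n unfolding d_def by measurable
  show gi: "integrable lborel g"
    by (rule integrable_dominated_convergence[where s = d and w = w])
      (use wi dw lim dm in auto)
  have "(\<lambda>n. integral\<^sup>L lborel (d n)) \<longlonglongrightarrow> integral\<^sup>L lborel g"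
    by (rule integral_dominated_convergence[where w = w]) (use wi dw lim dm in auto)
  moreover have "integral\<^sup>L lborel (d n) = 0" for n
    unfolding d_def using Fi lborel_integrable_translate[OF Fi] lborel_integral_translate[OF Fm]
    by simp
  ultimately show "integral\<^sup>L lborel g = 0" using LIMSEQ_unique[of "\<lambda>n. 0"] by auto
qed

text \<open>A bounded gradient makes \<open>F\<close> Lipschitz by the mean value inequality. The
  gradient may be discontinuous; it is measurable as a limit of difference quotients. This
  generality serves the stream function, whose gradient is only shown to be bounded on compact
  sets.\<close>

lemma integral_gradient_eq_0:
  fixes F :: "real^'n \<Rightarrow> real"
  assumes deriv: "\<And>x. (F has_derivative (\<lambda>v. v \<bullet> g x)) (at x)"
    and supp: "\<And>x. norm x > R \<Longrightarrow> F x = 0"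
    and bound: "\<And>x. norm (g x) \<le> B"
  shows "integrable lborel (\<lambda>x. g x $ i)" and "integral\<^sup>L lborel (\<lambda>x. g x $ i) = 0"
proof -
  have B: "onorm (\<lambda>v. v \<bullet> g x) \<le> B" for x
  proof (rule onorm_bound)
    show "0 \<le> B" using bound[of x] norm_ge_zero order_trans by blast
    show "norm (v \<bullet> g x) \<le> B * norm v" for v
      using Cauchy_Schwarz_ineq2[of v "g x"] mult_left_mono[OF bound[of x], of "norm v"]
      by (simp add: mult.commute)
  qed
  have lip: "\<bar>F x - F y\<bar> \<le> B * norm (x - y)" for x y
    using differentiable_bound[of UNIV F "\<lambda>x v. v \<bullet> g x" B x y] deriv B by simp
  have "F \<in> borel_measurable borel"
    using deriv by (intro borel_measurable_continuous_onI continuous_at_imp_continuous_on ballI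
        has_derivative_continuous) blast
  then have dm: "(\<lambda>x. real (Suc n) * (F (x + axis i 1 /\<^sub>R real (Suc n)) - F x)) \<in> borel_measurable borel" for n
    by measurable
  have g: "(\<lambda>x. g x $ i) \<in> borel_measurable borel"
  proof (rule borel_measurable_LIMSEQ_real[OF _ dm])
    fix x :: "real^'n"
    let ?e = "axis i 1 :: real^'n"
    have "((\<lambda>t. F (x + t *\<^sub>R ?e)) has_derivative (\<lambda>t. (t *\<^sub>R ?e) \<bullet> g x)) (at 0)"
      by (rule has_derivative_compose[of "\<lambda>t. x + t *\<^sub>R ?e" "\<lambda>t. t *\<^sub>R ?e" 0 UNIV F "\<lambda>v. v \<bullet> g x"])
         (use deriv in \<open>auto intro!: derivative_eq_intros\<close>)
    then have "((\<lambda>t. F (x + t *\<^sub>R ?e)) has_real_derivative g x $ i) (at 0)"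
      by (simp add: has_field_derivative_def inner_axis' mult_commute_abs)
    then have "(\<lambda>h. (F (x + h *\<^sub>R ?e) - F x) / h) \<midarrow>0\<rightarrow> g x $ i"
      by (simp add: DERIV_def)
    then have "(\<lambda>n. (F (x + (1 / real (Suc n)) *\<^sub>R ?e) - F x) / (1 / real (Suc n))) \<longlonglongrightarrow> g x $ i"
    proof (rule filterlim_compose)
      show "filterlim (\<lambda>n. 1 / real (Suc n)) (at 0) sequentially"
        unfolding filterlim_at using LIMSEQ_inverse_real_of_nat by (auto simp: inverse_eq_divide)
    qed
    then show "(\<lambda>n. real (Suc n) * (F (x + ?e /\<^sub>R real (Suc n)) - F x)) \<longlonglongrightarrow> g x $ i"
      by (simp add: inverse_eq_divide mult.commute)
  qed
  have *: "AE x in lborel. \<exists>F'. (F has_derivative F') (at x) \<and> F' (axis i 1) = g x $ i"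
    using deriv by (intro AE_I2 exI[of _ "\<lambda>v. v \<bullet> g x" for x] conjI) (auto simp: inner_axis')
  show "integrable lborel (\<lambda>x. g x $ i)" "integral\<^sup>L lborel (\<lambda>x. g x $ i) = 0"
    using integral_directional_derivative_eq_0[OF lip supp g *] by auto
qed

lemma gradient_zero_outside_support:
  assumes deriv: "(\<phi> has_derivative (\<lambda>v. v \<bullet> g)) (at z)"
    and "closed C" "\<And>x. x \<notin> C \<Longrightarrow> \<phi> x = 0" "z \<notin> C"
  shows "g = 0"
proof -
  have "(\<phi> has_derivative (\<lambda>v. 0)) (at z)"
    by (rule has_derivative_transform_within_open[of "\<lambda>_. 0" "\<lambda>_. 0" z UNIV "- C"])
      (use assms in auto)
  from has_derivative_unique[OF deriv this] have "v \<bullet> g = 0" for v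
    by meson
  from this[of g] show ?thesis by simp
qed

text \<open>The divergence of \<open>u grad \<phi> - \<phi> grad u\<close> integrates to zero.
  Gradients and Hessian rows are passed as explicit functions so that the identity also applies to
  kernels given by closed formulas.\<close>

lemma green_identity:
  fixes u \<phi> :: "real^2 \<Rightarrow> real" and ug pg :: "real^2 \<Rightarrow> real^2" and uh ph :: "2 \<Rightarrow> real^2 \<Rightarrow> real^2"
  assumes D: "open D" and C: "compact C" "C \<subseteq> D"
    and u1: "\<And>z. z \<in> D \<Longrightarrow> (u has_derivative (\<lambda>v. v \<bullet> ug z)) (at z)"
    and u2: "\<And>i z. z \<in> D \<Longrightarrow> ((\<lambda>z. ug z $ i) has_derivative (\<lambda>v. v \<bullet> uh i z)) (at z)"
    and u3: "\<And>i. continuous_on D (uh i)"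
    and p1: "\<And>z. (\<phi> has_derivative (\<lambda>v. v \<bullet> pg z)) (at z)"
    and p2: "\<And>i z. ((\<lambda>z. pg z $ i) has_derivative (\<lambda>v. v \<bullet> ph i z)) (at z)"
    and p3: "\<And>i. continuous_on UNIV (ph i)"
    and supp: "\<And>z. z \<notin> C \<Longrightarrow> \<phi> z = 0"
  shows "(LINT z|lborel. indicator D z * u z * (\<Sum>i\<in>UNIV. ph i z $ i)) =
         (LINT z|lborel. indicator D z * \<phi> z * (\<Sum>i\<in>UNIV. uh i z $ i))"
proof -
  have clC: "closed C" using C compact_imp_closed by blast
  have pg0: "pg z = 0" if "z \<notin> C" for z
    using gradient_zero_outside_support[OF p1 clC supp that] .
  have ph0: "ph i z = 0" if "z \<notin> C" for z i
    using gradient_zero_outside_support[OF p2 clC _ that] pg0 by simp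
  \<comment> \<open>Component \<open>i\<close> of \<open>u grad \<phi> - \<phi> grad u\<close>,
    extended by zero: \<open>\<phi>\<close> vanishes off the compact set \<open>C\<close>, so the
    extension is differentiable on the whole plane.\<close>
  define F where "F i z = (if z \<in> D then u z * pg z $ i - \<phi> z * ug z $ i else 0)" for i z
  define g where "g i z = (if z \<in> D then pg z $ i *\<^sub>R ug z + u z *\<^sub>R ph i z - ug z $ i *\<^sub>R pg z
      - \<phi> z *\<^sub>R uh i z else 0)" for i z
  have zero: "F i z = 0" "g i z = 0" if "z \<notin> C" for i z
    using pg0[OF that] ph0[OF that] supp[OF that] by (auto simp: F_def g_def)
  have deriv: "(F i has_derivative (\<lambda>v. v \<bullet> g i z)) (at z)" for i z
  proof (cases "z \<in> D")
    case True
    have "((\<lambda>z. u z * pg z $ i - \<phi> z * ug z $ i) has_derivative (\<lambda>v. v \<bullet> g i z)) (at z)"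
      using True by (auto intro!: derivative_eq_intros u1 u2 p1 p2 simp: g_def algebra_simps inner_simps)
    then show ?thesis
      by (rule has_derivative_transform_within_open[OF _ D True]) (simp add: F_def)
  next
    case False
    then have "z \<notin> C" using C by auto
    then have "g i z = 0" by (rule zero)
    moreover have "(F i has_derivative (\<lambda>v. 0)) (at z)"
      by (rule has_derivative_transform_within_open[of "\<lambda>_. 0" "\<lambda>_. 0" z UNIV "- C"])
        (use clC \<open>z \<notin> C\<close> zero in auto)
    ultimately show ?thesis by simp
  qed
  have cont: "continuous_on D u" "continuous_on D (\<lambda>z. ug z $ i)" "continuous_on UNIV \<phi>"
      "continuous_on UNIV (\<lambda>z. pg z $ i)" for i
    by (auto intro!: continuous_at_imp_continuous_on intro: has_derivative_continuous u1 u2 p1 p2)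
  have cont2: "continuous_on D ug" "continuous_on UNIV pg"
    using continuous_on_vec_lambda[of D "\<lambda>i z. ug z $ i"] continuous_on_vec_lambda[of UNIV "\<lambda>i z. pg z $ i"]
      cont(2,4) by simp_all
  have gc: "continuous_on C (g i)" for i
  proof (rule continuous_on_eq)
    show "continuous_on C (\<lambda>z. pg z $ i *\<^sub>R ug z + u z *\<^sub>R ph i z - ug z $ i *\<^sub>R pg z - \<phi> z *\<^sub>R uh i z)"
      by (intro continuous_intros continuous_on_subset[OF cont(1)] continuous_on_subset[OF cont(2)]
        continuous_on_subset[OF cont(3)] continuous_on_subset[OF cont(4)] continuous_on_subset[OF cont2(1)]
        continuous_on_subset[OF cont2(2)] continuous_on_subset[OF u3] continuous_on_subset[OF p3])
       (use C in auto)
  qed (use C in \<open>auto simp: g_def\<close>)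
  obtain R where R: "\<And>z. z \<in> C \<Longrightarrow> norm z \<le> R"
    using compact_imp_bounded[OF C(1)] unfolding bounded_iff by blast
  have *: "integrable lborel (\<lambda>x. g i x $ i)" "integral\<^sup>L lborel (\<lambda>x. g i x $ i) = 0" for i
  proof -
    have "bounded (g i ` C)" by (intro compact_imp_bounded compact_continuous_image gc C)
    then obtain B where B: "\<And>z. z \<in> C \<Longrightarrow> norm (g i z) \<le> B"
      unfolding bounded_iff by blast
    have "norm (g i z) \<le> max B 0" for z using B[of z] zero(2)[of z i] by (cases "z \<in> C") auto
    from integral_gradient_eq_0[OF deriv _ this, of R]
    show "integrable lborel (\<lambda>x. g i x $ i)" "integral\<^sup>L lborel (\<lambda>x. g i x $ i) = 0"
      using R zero(1) leD by blast+
  qed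
  have I: "integrable lborel (\<lambda>z. indicator D z * f z)"
    if "continuous_on D f" "\<And>z. z \<notin> C \<Longrightarrow> f z = 0" for f :: "real^2 \<Rightarrow> real"
  proof -
    have "integrable lborel (\<lambda>z. indicator C z *\<^sub>R f z)"
      by (rule borel_integrable_compact) (use C that continuous_on_subset in auto)
    moreover have "(\<lambda>z. indicator C z *\<^sub>R f z) = (\<lambda>z. indicator D z * f z)"
      using that(2) C by (auto simp: indicator_def fun_eq_iff)
    ultimately show ?thesis by (simp only:)
  qed
  have cuh: "continuous_on D (\<lambda>z. uh i z $ i)" "continuous_on D (\<lambda>z. ph i z $ i)" for i
    using u3[of i] p3[of i] continuous_on_subset by (auto intro!: continuous_intros)
  have cD: "continuous_on D \<phi>" using cont(3) continuous_on_subset by blast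
  have I1: "integrable lborel (\<lambda>z. indicator D z * u z * (\<Sum>i\<in>UNIV. ph i z $ i))"
    using I[of "\<lambda>z. u z * (\<Sum>i\<in>UNIV. ph i z $ i)"] cont cuh ph0
    by (simp add: continuous_on_mult continuous_on_sum mult.assoc)
  have I2: "integrable lborel (\<lambda>z. indicator D z * \<phi> z * (\<Sum>i\<in>UNIV. uh i z $ i))"
    using I[of "\<lambda>z. \<phi> z * (\<Sum>i\<in>UNIV. uh i z $ i)"] cD cuh supp
    by (simp add: continuous_on_mult continuous_on_sum mult.assoc)
  have "(LINT z|lborel. indicator D z * u z * (\<Sum>i\<in>UNIV. ph i z $ i)) -
         (LINT z|lborel. indicator D z * \<phi> z * (\<Sum>i\<in>UNIV. uh i z $ i)) =
     (LINT z|lborel. indicator D z * u z * (\<Sum>i\<in>UNIV. ph i z $ i) - indicator D z * \<phi> z * (\<Sum>i\<in>UNIV. uh i z $ i))"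
    using I1 I2 by simp
  also have "\<dots> = (LINT z|lborel. (\<Sum>i\<in>UNIV. g i z $ i))"
    by (intro Bochner_Integration.integral_cong)
      (auto simp: g_def sum_2 algebra_simps)
  also have "\<dots> = 0" using * by simp
  finally show ?thesis by simp
qed

lemma has_real_derivative_If_le:
  fixes a :: real
  assumes f: "t \<le> a \<Longrightarrow> (f has_real_derivative f' t) (at t)"
    and g: "a \<le> t \<Longrightarrow> (g has_real_derivative g' t) (at t)" and eq: "f a = g a" "f' a = g' a"
  shows "((\<lambda>t. if t \<le> a then f t else g t) has_real_derivative (if t \<le> a then f' t else g' t)) (at t)"
proof -
  have S: "{..a} \<union> closure {..a} \<inter> closure {a<..} = {..a}" "{a<..} \<union> closure {..a} \<inter> closure {a<..} = {a..}"
    by auto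
  have t: "t = a" if "t \<in> closure {..a}" "t \<in> closure {a<..}" using that by simp
  have "((\<lambda>t. if t \<in> {..a} then f t else g t) has_vector_derivative (if t \<in> {..a} then f' t else g' t)) (at t within UNIV)"
  proof (rule has_vector_derivative_If_within_closures[where T = "{a<..}"], unfold S)
    show "t \<in> {..a} \<union> {a<..}" "UNIV = {..a} \<union> {a<..}" by auto
    show "f t = g t" "f' t = g' t" if "t \<in> closure {..a}" "t \<in> closure {a<..}"
      using t[OF that] eq by blast+
    show "(f has_vector_derivative f' t) (at t within {..a})" if "t \<in> {..a}"
      using f that has_vector_derivative_at_within
      by (metis atMost_iff has_real_derivative_iff_has_vector_derivative)
    show "(g has_vector_derivative g' t) (at t within {a..})" if "t \<in> {a..}"
      using g that has_vector_derivative_at_within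
      by (metis atLeast_iff has_real_derivative_iff_has_vector_derivative)
  qed
  then show ?thesis unfolding atMost_iff has_real_derivative_iff_has_vector_derivative .
qed

section \<open>A regularised logarithmic kernel\<close>

text \<open>A probability density on the disc of radius \<open>r\<close>. The square makes it
  \<open>C^1\<close> across the circle with a quadratic Taylor remainder, and with this prefactor it
  is exactly minus the Laplacian of \<open>smooth_log r\<close>.\<close>

definition bump :: "real \<Rightarrow> real^2 \<Rightarrow> real" where
  "bump r z = 3 / (pi * r ^ 6) * (max 0 (r\<^sup>2 - z \<bullet> z))\<^sup>2"

text \<open>Here \<open>t\<close> stands for \<open>\<bar>z\<bar>\<^sup>2\<close>. Inside the disc of radius \<open>r\<close> the logarithm is replaced by its third Taylor
  polynomial at \<open>r\<^sup>2\<close>, which makes \<open>smooth_log\<close> below of class \<open>C\<^sup>2\<close>.\<close>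

definition log_profile :: "real \<Rightarrow> real \<Rightarrow> real" where
  "log_profile r t = (if t \<le> r\<^sup>2
     then (- ln (r\<^sup>2) + (1 - t / r\<^sup>2) + (1 - t / r\<^sup>2)\<^sup>2 / 2 + (1 - t / r\<^sup>2) ^ 3 / 3) / (4 * pi)
     else - ln t / (4 * pi))"

definition smooth_log :: "real \<Rightarrow> real^2 \<Rightarrow> real" where
  "smooth_log r z = log_profile r (z \<bullet> z)"

definition log_kernel :: "real^2 \<Rightarrow> real" where
  "log_kernel z = - ln (norm z) / (2 * pi)"

text \<open>In the sense of distributions its negative Laplacian is the unit mass at the origin
  minus \<open>bump r\<close>. Since it vanishes off the disc, it is the weight that measures how
  far a function is from its \<open>bump\<close> average.\<close>

definition log_gap :: "real \<Rightarrow> real^2 \<Rightarrow> real" where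
  "log_gap r z = log_kernel z - smooth_log r z"

text \<open>First derivative of \<open>log_profile r\<close>, as \<open>log_profile2\<close> is the
  second; \<open>max\<close> merges both branches into one formula whose continuity is
  evident.\<close>

definition log_profile1 :: "real \<Rightarrow> real \<Rightarrow> real" where
  "log_profile1 r t = - (1 + max 0 (1 - t / r\<^sup>2) + (max 0 (1 - t / r\<^sup>2))\<^sup>2) / (4 * pi * max t (r\<^sup>2))"

definition log_profile2 :: "real \<Rightarrow> real \<Rightarrow> real" where
  "log_profile2 r t = (1 + 2 * max 0 (1 - t / r\<^sup>2)) / (4 * pi * (max t (r\<^sup>2))\<^sup>2)"

lemma DERIV_log_profile:
  assumes "r > 0"
  shows "(log_profile r has_real_derivative log_profile1 r t) (at t)"
proof -
  let ?f = "\<lambda>t. (- ln (r\<^sup>2) + (1 - t / r\<^sup>2) + (1 - t / r\<^sup>2)\<^sup>2 / 2 + (1 - t / r\<^sup>2) ^ 3 / 3) / (4 * pi)"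
  have "((\<lambda>t. if t \<le> r\<^sup>2 then ?f t else - ln t / (4 * pi)) has_real_derivative
     (if t \<le> r\<^sup>2 then (- 1 - (1 - t / r\<^sup>2) - (1 - t / r\<^sup>2)\<^sup>2) / r\<^sup>2 / (4 * pi) else - 1 / t / (4 * pi))) (at t)"
  proof (rule has_real_derivative_If_le)
    have *: "((\<lambda>t. k * (c + (1 - t * a) + (1 - t * a)\<^sup>2 / 2 + (1 - t * a) ^ 3 / 3)) has_real_derivative
        k * ((- 1 - (1 - t * a) - (1 - t * a)\<^sup>2) * a)) (at t)" for a c k :: real
      by (auto intro!: derivative_eq_intros simp: field_simps power2_eq_square)
    show "(?f has_real_derivative (- 1 - (1 - t / r\<^sup>2) - (1 - t / r\<^sup>2)\<^sup>2) / r\<^sup>2 / (4 * pi)) (at t)"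
      using *[of "1 / (4 * pi)" "- ln (r\<^sup>2)" "1 / r\<^sup>2"] by (simp add: mult_ac)
    assume "r\<^sup>2 \<le> t"
    then have "t > 0" using assms by (smt (verit) zero_less_power)
    then show "((\<lambda>t. - ln t / (4 * pi)) has_real_derivative - 1 / t / (4 * pi)) (at t)"
      by (auto intro!: derivative_eq_intros simp: field_simps)
  qed (use assms in auto)
  moreover have "(if t \<le> r\<^sup>2 then (- 1 - (1 - t / r\<^sup>2) - (1 - t / r\<^sup>2)\<^sup>2) / r\<^sup>2 / (4 * pi) else - 1 / t / (4 * pi))
     = log_profile1 r t"
    using assms by (auto simp: log_profile1_def max_def divide_simps not_le)
  ultimately show ?thesis unfolding log_profile_def[abs_def] by simp
qed

lemma DERIV_log_profile1:
  assumes "r > 0"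
  shows "(log_profile1 r has_real_derivative log_profile2 r t) (at t)"
proof -
  let ?f = "\<lambda>t. (- 1 - (1 - t / r\<^sup>2) - (1 - t / r\<^sup>2)\<^sup>2) / r\<^sup>2 / (4 * pi)"
  have "((\<lambda>t. if t \<le> r\<^sup>2 then ?f t else - 1 / t / (4 * pi)) has_real_derivative
     (if t \<le> r\<^sup>2 then (1 + 2 * (1 - t / r\<^sup>2)) / (r\<^sup>2)\<^sup>2 / (4 * pi) else 1 / t\<^sup>2 / (4 * pi))) (at t)"
  proof (rule has_real_derivative_If_le)
    have *: "((\<lambda>t. k * ((- 1 - (1 - t * a) - (1 - t * a)\<^sup>2) * a)) has_real_derivative
        k * ((1 + 2 * (1 - t * a)) * a\<^sup>2)) (at t)" for a k :: real
      by (auto intro!: derivative_eq_intros simp: algebra_simps power2_eq_square)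
    show "(?f has_real_derivative (1 + 2 * (1 - t / r\<^sup>2)) / (r\<^sup>2)\<^sup>2 / (4 * pi)) (at t)"
      using *[of "1 / (4 * pi)" "1 / r\<^sup>2"] by (simp add: power_divide mult_ac)
    assume "r\<^sup>2 \<le> t"
    then have "t > 0" using assms by (smt (verit) zero_less_power)
    then show "((\<lambda>t. - 1 / t / (4 * pi)) has_real_derivative 1 / t\<^sup>2 / (4 * pi)) (at t)"
      by (auto intro!: derivative_eq_intros simp: field_simps power2_eq_square)
  qed (use assms in auto)
  moreover have "(if t \<le> r\<^sup>2 then (1 + 2 * (1 - t / r\<^sup>2)) / (r\<^sup>2)\<^sup>2 / (4 * pi) else 1 / t\<^sup>2 / (4 * pi))
     = log_profile2 r t"
    using assms by (auto simp: log_profile2_def max_def divide_simps not_le)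
  moreover have "(if t \<le> r\<^sup>2 then ?f t else - 1 / t / (4 * pi)) = log_profile1 r t" for t
    using assms by (auto simp: log_profile1_def max_def divide_simps not_le)
  ultimately show ?thesis by simp
qed

lemma continuous_log_profile2: "r > 0 \<Longrightarrow> continuous_on UNIV (log_profile2 r)"
  unfolding log_profile2_def[abs_def] by (intro continuous_intros) (auto simp: max_def)

lemma has_derivative_smooth_log:
  assumes "r > 0"
  shows "(smooth_log r has_derivative (\<lambda>v. v \<bullet> ((2 * log_profile1 r (z \<bullet> z)) *\<^sub>R z))) (at z)"
proof -
  have "((\<lambda>z. log_profile r (z \<bullet> z)) has_derivative (\<lambda>v. (v \<bullet> z + z \<bullet> v) * log_profile1 r (z \<bullet> z))) (at z)"
    by (rule has_derivative_eq_rhs[OF has_derivative_compose[OF _ DERIV_log_profile[OF assms, unfolded has_field_derivative_def]]])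
       (auto intro!: derivative_eq_intros)
  then show ?thesis
    by (simp add: smooth_log_def[abs_def] inner_commute algebra_simps)
qed

lemma has_derivative_grad_smooth_log:
  fixes z :: "real^2"
  assumes "r > 0"
  shows "((\<lambda>z. ((2 * log_profile1 r (z \<bullet> z)) *\<^sub>R z) $ i) has_derivative (\<lambda>v. v \<bullet>
    ((2 * log_profile1 r (z \<bullet> z)) *\<^sub>R axis i 1 + (4 * log_profile2 r (z \<bullet> z) * z $ i) *\<^sub>R z))) (at z)"
proof -
  have *: "((\<lambda>z::real^2. log_profile1 r (z \<bullet> z)) has_derivative (\<lambda>v. (v \<bullet> z + z \<bullet> v) * log_profile2 r (z \<bullet> z))) (at z)"
    by (rule has_derivative_eq_rhs[OF has_derivative_compose[OF _ DERIV_log_profile1[OF assms, unfolded has_field_derivative_def]]])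
       (auto intro!: derivative_eq_intros)
  have **: "((\<lambda>z::real^2. z $ i) has_derivative (\<lambda>v. v $ i)) (at z)"
    by (rule bounded_linear.has_derivative[OF bounded_linear_vec_nth]) simp
  show ?thesis unfolding vector_scaleR_component real_scaleR_def
    by (rule has_derivative_eq_rhs[OF has_derivative_mult[OF has_derivative_mult_right[OF *] **]])
       (auto simp: inner_simps inner_axis inner_commute algebra_simps fun_eq_iff)
qed

lemma inner_real2: "z \<bullet> z = (z $ 1)\<^sup>2 + (z $ 2)\<^sup>2" for z :: "real^2"
  by (simp add: inner_vec_def sum_2 power2_eq_square)

text \<open>A planar function \<open>g(t)\<close> of \<open>t = z \<bullet> z\<close> has Laplacian
  \<open>4 g' + 4 t g''\<close>. Outside the disc the terms cancel since the logarithm is harmonic;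
  inside, with \<open>s = 1 - t / r^2\<close>, the cubic Taylor polynomial leaves
  \<open>- 3 s^2 / (pi r^2)\<close>.\<close>

lemma laplacian_smooth_log:
  fixes z :: "real^2"
  assumes "r > 0"
  shows "(\<Sum>i\<in>UNIV. ((2 * log_profile1 r (z \<bullet> z)) *\<^sub>R axis i 1 + (4 * log_profile2 r (z \<bullet> z) * z $ i) *\<^sub>R z) $ i)
    = - bump r z"
proof -
  let ?t = "z \<bullet> z"
  have "(\<Sum>i\<in>UNIV. ((2 * log_profile1 r ?t) *\<^sub>R axis i 1 + (4 * log_profile2 r ?t * z $ i) *\<^sub>R z) $ i)
     = 4 * log_profile1 r ?t + 4 * log_profile2 r ?t * ((z $ 1)\<^sup>2 + (z $ 2)\<^sup>2)"
    by (simp add: sum_2 axis_def power2_eq_square algebra_simps)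
  also have "\<dots> = 4 * log_profile1 r ?t + 4 * log_profile2 r ?t * ?t" by (simp only: inner_real2)
  also have "\<dots> = - bump r z"
  proof (cases "?t \<le> r\<^sup>2")
    case True
    define s where "s = 1 - ?t / r\<^sup>2"
    have t: "?t = r\<^sup>2 * (1 - s)" using assms by (simp add: s_def)
    have s0: "s \<ge> 0" using True assms by (simp add: s_def)
    have l: "log_profile1 r ?t = - (1 + s + s\<^sup>2) / (4 * pi * r\<^sup>2)" "log_profile2 r ?t = (1 + 2 * s) / (4 * pi * (r\<^sup>2)\<^sup>2)"
      unfolding log_profile1_def log_profile2_def s_def[symmetric] using True s0 by (simp_all add: max_def)
    have "4 * log_profile1 r ?t + 4 * log_profile2 r ?t * ?t
      = - 3 * s\<^sup>2 / (pi * r\<^sup>2)"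
      unfolding l unfolding t using assms by (simp add: field_simps power2_eq_square)
    also have "\<dots> = - 3 * (r\<^sup>2 * s)\<^sup>2 / (pi * r ^ 6)"
      using assms by (simp add: field_simps power2_eq_square eval_nat_numeral)
    also have "r\<^sup>2 * s = max 0 (r\<^sup>2 - ?t)" using True t by (simp add: algebra_simps)
    finally show ?thesis by (simp add: bump_def)
  next
    case False
    then have "?t > 0" using assms by (smt (verit) zero_less_power)
    moreover have "1 - ?t / r\<^sup>2 \<le> 0" using False assms by (simp add: field_simps)
    ultimately show ?thesis using False
      by (simp add: log_profile1_def log_profile2_def bump_def max_absorb1 power2_eq_square)
  qed
  finally show ?thesis .
qed

text \<open>Prepares the divergence theorem on the disc: the field, cut off at the circle, must be
  Lipschitz. The truncated factor \<open>w\<close> is \<open>2 r\<close>-Lipschitz, and powers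
  follow by induction with the product rule.\<close>

lemma ball_moment_deriv:
  fixes r :: real
  assumes "r > 0"
  defines "w \<equiv> \<lambda>z::real^2. max 0 (r\<^sup>2 - z \<bullet> z)"
  shows "\<exists>C. \<forall>x y. \<bar>x $ i * w x ^ Suc m - y $ i * w y ^ Suc m\<bar> \<le> C * norm (x - y)"
proof -
  have w0: "w x = 0" if "norm x > r" for x
    using that assms by (simp add: w_def power2_norm_eq_inner[symmetric] power_mono)
  have w1: "\<bar>w x\<bar> \<le> r\<^sup>2" for x by (simp add: w_def)
  have lw0: "\<bar>w x - w y\<bar> \<le> 2 * r * norm (x - y)" if "norm x \<le> norm y" "norm x \<le> r" for x y
  proof -
    have a: "w x = r\<^sup>2 - norm x ^ 2" using that power_mono[OF that(2), of 2] by (simp add: w_def power2_norm_eq_inner)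
    \<comment> \<open>Clipping \<open>norm y\<close> at \<open>r\<close> brings both points into the
      range where \<open>w\<close> is given by the polynomial.\<close>
    define s where "s = min r (norm y)"
    have s: "w y = r\<^sup>2 - s ^ 2" "norm x \<le> s" "s \<le> norm y" "s \<le> r"
      using that assms unfolding w_def power2_norm_eq_inner[symmetric] s_def
      by (auto simp: min_def max_def)
    have "\<bar>w x - w y\<bar> = (s - norm x) * (s + norm x)"
      using s a by (simp add: power2_eq_square algebra_simps) (smt (verit) mult_mono norm_ge_zero)
    also have "\<dots> \<le> norm (x - y) * (2 * r)"
      using s that norm_triangle_ineq2[of y x] by (intro mult_mono) (auto simp: norm_minus_commute intro: add_nonneg_nonneg order_trans[OF norm_ge_zero])
    finally show ?thesis by (simp add: mult_ac)
  qed
  have lw: "\<bar>w x - w y\<bar> \<le> 2 * r * norm (x - y)" for x y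
  proof (cases "norm x > r \<and> norm y > r")
    case True then show ?thesis using w0 assms by simp
  next
    case False
    then show ?thesis using lw0[of x y] lw0[of y x] by (cases "norm x \<le> norm y") (auto simp: norm_minus_commute abs_minus_commute)
  qed
  show ?thesis
  proof (induction m)
    case 0
    have *: "\<bar>x $ i * w x - y $ i * w y\<bar> \<le> 3 * r\<^sup>2 * norm (x - y)" if "norm y \<le> r" for x y
    proof -
      have "x $ i * w x - y $ i * w y = (x - y) $ i * w x + y $ i * (w x - w y)"
        by (simp add: algebra_simps)
      also have "\<bar>\<dots>\<bar> \<le> \<bar>(x - y) $ i\<bar> * \<bar>w x\<bar> + \<bar>y $ i\<bar> * \<bar>w x - w y\<bar>"
        by (metis abs_mult abs_triangle_ineq)
      also have "\<dots> \<le> norm (x - y) * r\<^sup>2 + r * (2 * r * norm (x - y))"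
        using component_le_norm_cart[of "x - y" i] component_le_norm_cart[of y i] that w1[of x] lw[of x y] assms
        by (intro add_mono mult_mono) auto
      finally show ?thesis by (simp add: power2_eq_square algebra_simps)
    qed
    have "\<bar>x $ i * w x - y $ i * w y\<bar> \<le> 3 * r\<^sup>2 * norm (x - y)" for x y
      using *[of y x] *[of x y] w0[of x] w0[of y]
      by (cases "norm y \<le> r"; cases "norm x \<le> r") (auto simp: norm_minus_commute abs_minus_commute)
    then show ?case by auto
  next
    case (Suc m)
    then obtain C where C: "\<And>x y. \<bar>x $ i * w x ^ Suc m - y $ i * w y ^ Suc m\<bar> \<le> C * norm (x - y)" by blast
    have b: "\<bar>y $ i * w y ^ Suc m\<bar> \<le> r * (r\<^sup>2) ^ Suc m" for y
    proof (cases "norm y > r")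
      case True then show ?thesis using w0 assms by simp
    next
      case False
      then have "\<bar>y $ i\<bar> \<le> r" using component_le_norm_cart[of y i] by linarith
      moreover have "\<bar>w y\<bar> ^ Suc m \<le> (r\<^sup>2) ^ Suc m" using w1 by (intro power_mono) auto
      ultimately show ?thesis using assms unfolding abs_mult power_abs by (intro mult_mono) auto
    qed
    have "\<bar>x $ i * w x ^ Suc (Suc m) - y $ i * w y ^ Suc (Suc m)\<bar>
      \<le> (C * r\<^sup>2 + r * (r\<^sup>2) ^ Suc m * (2 * r)) * norm (x - y)" for x y
    proof -
      have "x $ i * w x ^ Suc (Suc m) - y $ i * w y ^ Suc (Suc m)
        = (x $ i * w x ^ Suc m - y $ i * w y ^ Suc m) * w x + (y $ i * w y ^ Suc m) * (w x - w y)"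
        by (simp add: algebra_simps)
      also have "\<bar>\<dots>\<bar> \<le> \<bar>x $ i * w x ^ Suc m - y $ i * w y ^ Suc m\<bar> * \<bar>w x\<bar> + \<bar>y $ i * w y ^ Suc m\<bar> * \<bar>w x - w y\<bar>"
        by (metis abs_mult abs_triangle_ineq)
      also have "\<dots> \<le> (C * norm (x - y)) * r\<^sup>2 + (r * (r\<^sup>2) ^ Suc m) * (2 * r * norm (x - y))"
        by (rule add_mono[OF mult_mono[OF C w1] mult_mono[OF b lw]])
          (use order_trans[OF abs_ge_zero C] assms in auto)
      finally show ?thesis by (simp add: algebra_simps)
    qed
    then show ?case by blast
  qed
qed

text \<open>The moments \<open>m = 2\<close> and \<open>m = 3\<close> yield mass and second moment
  of \<open>bump\<close>; a recursion starting from the area of the disc takes the place of polar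
  coordinates.\<close>

definition ball_moment :: "nat \<Rightarrow> real \<Rightarrow> real" where
  "ball_moment m r = (LINT z|lborel. indicator (ball (0 :: real^2) r) z * (r\<^sup>2 - z \<bullet> z) ^ m)"

lemma integrable_ball_moment: "integrable lborel (\<lambda>z::real^2. indicator (ball 0 r) z * (r\<^sup>2 - z \<bullet> z) ^ m)"
proof (rule integrable_bounded_support[where S = "ball 0 r" and B = "(r\<^sup>2) ^ m"])
  show "\<bar>indicator (ball 0 r) z * (r\<^sup>2 - z \<bullet> z) ^ m\<bar> \<le> (r\<^sup>2) ^ m" for z :: "real^2"
  proof (cases "z \<in> ball 0 r")
    case True
    then have "z \<bullet> z \<le> r\<^sup>2" by (simp add: power2_norm_eq_inner[symmetric] power_mono)
    then have "\<bar>r\<^sup>2 - z \<bullet> z\<bar> ^ m \<le> (r\<^sup>2) ^ m" by (intro power_mono) auto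
    then show ?thesis using True by (simp add: power_abs)
  qed auto
  show "(\<lambda>z::real^2. indicator (ball 0 r) z * (r\<^sup>2 - z \<bullet> z) ^ m) \<in> borel_measurable borel"
    by (intro borel_measurable_times borel_measurable_indicator borel_measurable_continuous_onI continuous_intros) auto
qed auto

lemma ball_moment_0: "r > 0 \<Longrightarrow> ball_moment 0 r = pi * r\<^sup>2"
  using circle_area[of r 0] by (simp add: ball_moment_def)

text \<open>The divergence theorem for the vector field \<^term>\<open>\<lambda>z::real^2. (r\<^sup>2 - z \<bullet> z) ^ Suc m *\<^sub>R z\<close> on the disc.\<close>

lemma ball_moment_Suc:
  assumes r: "r > 0"
  shows "(real m + 2) * ball_moment (Suc m) r = (real m + 1) * r\<^sup>2 * ball_moment m r"
proof -
  define w where "w z = max 0 (r\<^sup>2 - z \<bullet> z)" for z :: "real^2"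
  \<comment> \<open>Partial derivative along axis \<open>i\<close> of component \<open>i\<close> of
    the field, valid off the circle.\<close>
  define g where "g i z = indicator (ball 0 r) z * ((r\<^sup>2 - z \<bullet> z) ^ Suc m - 2 * (real m + 1) * (z $ i)\<^sup>2 * (r\<^sup>2 - z \<bullet> z) ^ m)"
    for i and z :: "real^2"
  have *: "integrable lborel (g i)" "integral\<^sup>L lborel (g i) = 0" for i
  proof -
    obtain C where C: "\<And>x y. \<bar>x $ i * w x ^ Suc m - y $ i * w y ^ Suc m\<bar> \<le> C * norm (x - y)"
      using ball_moment_deriv[OF r, of i m] unfolding w_def by blast
    have w0: "w x = 0" if "norm x > r" for x
      using that r by (simp add: w_def power2_norm_eq_inner[symmetric] power_mono)
    have m: "g i \<in> borel_measurable borel" unfolding g_def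
      by (intro borel_measurable_times borel_measurable_indicator borel_measurable_continuous_onI continuous_intros) auto
    have "sphere (0::real^2) r \<in> null_sets lborel"
      using negligible_sphere[of "0::real^2" r] by (simp add: negligible_iff_null_sets null_sets_completion_iff)
    then have "AE z::real^2 in lborel. z \<notin> sphere 0 r" by (rule AE_not_in)
    then have d: "AE z in lborel. \<exists>F'. ((\<lambda>z. z $ i * w z ^ Suc m) has_derivative F') (at z) \<and> F' (axis i 1) = g i z"
    proof eventually_elim
      case (elim z)
      show ?case
      proof (cases "norm z < r")
        case True
        have **: "((\<lambda>z::real^2. z $ i) has_derivative (\<lambda>v. v $ i)) (at z)"
          by (rule bounded_linear.has_derivative[OF bounded_linear_vec_nth]) simp
        have "((\<lambda>z. z $ i * (r\<^sup>2 - z \<bullet> z) ^ Suc m) has_derivative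
          (\<lambda>v. z $ i * (of_nat (Suc m) * (- (z \<bullet> v + v \<bullet> z)) * (r\<^sup>2 - z \<bullet> z) ^ m) + v $ i * (r\<^sup>2 - z \<bullet> z) ^ Suc m)) (at z)"
          by (rule has_derivative_eq_rhs[OF has_derivative_mult[OF ** has_derivative_power]])
             (auto intro!: derivative_eq_intros)
        then have "((\<lambda>z. z $ i * w z ^ Suc m) has_derivative
          (\<lambda>v. z $ i * (of_nat (Suc m) * (- (z \<bullet> v + v \<bullet> z)) * (r\<^sup>2 - z \<bullet> z) ^ m) + v $ i * (r\<^sup>2 - z \<bullet> z) ^ Suc m)) (at z)"
        proof (rule has_derivative_transform_within_open[of _ _ _ _ "ball 0 r"])
          show "x $ i * (r\<^sup>2 - x \<bullet> x) ^ Suc m = x $ i * w x ^ Suc m" if "x \<in> ball 0 r" for x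
            using that by (simp add: w_def power2_norm_eq_inner[symmetric] power_mono max_def)
        qed (use True in auto)
        then show ?thesis using True
          by (intro exI conjI) (assumption, simp add: g_def inner_axis inner_axis' power2_eq_square algebra_simps)
      next
        case False
        then have "norm z > r" using elim by auto
        have "((\<lambda>z. z $ i * w z ^ Suc m) has_derivative (\<lambda>v. 0)) (at z)"
        proof (rule has_derivative_transform_within_open[of "\<lambda>_. 0" _ _ _ "- cball 0 r"])
          show "0 = x $ i * w x ^ Suc m" if "x \<in> - cball 0 r" for x using that w0[of x] by simp
        qed (use \<open>norm z > r\<close> in auto)
        then show ?thesis using False by (intro exI conjI) (assumption, simp add: g_def)
      qed
    qed
    have "x $ i * w x ^ Suc m = 0" if "norm x > r" for x using w0[OF that] by simp
    from integral_directional_derivative_eq_0[OF C this m d]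
    show "integrable lborel (g i)" "integral\<^sup>L lborel (g i) = 0" by auto
  qed
  have "0 = integral\<^sup>L lborel (\<lambda>z. g 1 z + g 2 z)" using * by simp
  \<comment> \<open>Replacing \<open>|z|^2\<close> by \<open>r^2 - (r^2 - |z|^2)\<close> in the
    divergence leaves only the moments \<open>m + 1\<close> and \<open>m\<close>.\<close>
  also have "\<dots> = (LINT z|lborel. 2 * (real m + 2) * (indicator (ball (0 :: real^2) r) z * (r\<^sup>2 - z \<bullet> z) ^ Suc m)
      - 2 * (real m + 1) * r\<^sup>2 * (indicator (ball (0 :: real^2) r) z * (r\<^sup>2 - z \<bullet> z) ^ m))"
  proof (intro Bochner_Integration.integral_cong refl)
    fix z :: "real^2"
    have z2: "(z $ 2)\<^sup>2 = z \<bullet> z - (z $ 1)\<^sup>2" by (simp add: inner_real2)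
    show "g 1 z + g 2 z = 2 * (real m + 2) * (indicator (ball (0 :: real^2) r) z * (r\<^sup>2 - z \<bullet> z) ^ Suc m)
      - 2 * (real m + 1) * r\<^sup>2 * (indicator (ball (0 :: real^2) r) z * (r\<^sup>2 - z \<bullet> z) ^ m)"
      unfolding g_def z2 by (simp add: algebra_simps)
  qed
  also have "\<dots> = 2 * (real m + 2) * ball_moment (Suc m) r - 2 * (real m + 1) * r\<^sup>2 * ball_moment m r"
    unfolding ball_moment_def using integrable_ball_moment[of r "Suc m"] integrable_ball_moment[of r m] by simp
  finally have "2 * ((real m + 2) * ball_moment (Suc m) r) = 2 * ((real m + 1) * r\<^sup>2 * ball_moment m r)"
    by (simp only: mult.assoc)
  then show ?thesis by (simp only: mult_cancel_left) simp
qed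

lemma ball_moment_values:
  assumes "r > 0"
  shows "ball_moment 2 r = pi * r ^ 6 / 3" "ball_moment 3 r = pi * r ^ 8 / 4"
proof -
  have 1: "ball_moment 1 r = pi * r ^ 4 / 2"
    using ball_moment_Suc[OF assms, of 0] ball_moment_0[OF assms] by (simp add: power2_eq_square power4_eq_xxxx mult_ac)
  have "(1 + 2) * ball_moment 2 r = 2 * r\<^sup>2 * (pi * r ^ 4 / 2)"
    using ball_moment_Suc[OF assms, of 1] 1 by (simp add: numeral_2_eq_2)
  then show 2: "ball_moment 2 r = pi * r ^ 6 / 3"
    by (simp add: eval_nat_numeral mult_ac)
  have "(2 + 2) * ball_moment 3 r = 3 * r\<^sup>2 * (pi * r ^ 6 / 3)"
    using ball_moment_Suc[OF assms, of 2] 2 by (simp add: numeral_3_eq_3)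
  then show "ball_moment 3 r = pi * r ^ 8 / 4"
    by (simp add: eval_nat_numeral mult_ac)
qed

section \<open>Bounds, mass and second moment of the bump\<close>

lemma bump_nonneg: "r > 0 \<Longrightarrow> bump r z \<ge> 0"
  by (simp add: bump_def)

lemma inner_self_le_iff: "r > 0 \<Longrightarrow> z \<bullet> z \<le> r\<^sup>2 \<longleftrightarrow> norm z \<le> r"
  and inner_self_less_iff: "r > 0 \<Longrightarrow> z \<bullet> z < r\<^sup>2 \<longleftrightarrow> norm z < r"
  unfolding power2_norm_eq_inner[symmetric]
  by (auto simp: power_mono power_strict_mono intro: power2_le_imp_le power2_less_imp_less)

lemma bump_eq_0: "r > 0 \<Longrightarrow> norm z \<ge> r \<Longrightarrow> bump r z = 0"
  using inner_self_less_iff[of r z] by (simp add: bump_def max_def)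

lemma bump_pos: "r > 0 \<Longrightarrow> norm z < r \<Longrightarrow> bump r z > 0"
  using inner_self_less_iff[of r z] by (simp add: bump_def max_def)

lemma bump_le: "r > 0 \<Longrightarrow> bump r z \<le> 3 / (pi * r\<^sup>2)"
proof -
  assume r: "r > 0"
  have "(max 0 (r\<^sup>2 - z \<bullet> z))\<^sup>2 \<le> (r\<^sup>2)\<^sup>2" by (intro power_mono) auto
  then have "bump r z \<le> 3 / (pi * r ^ 6) * (r\<^sup>2)\<^sup>2"
    using r unfolding bump_def by (intro mult_left_mono) auto
  also have "\<dots> = 3 / (pi * r\<^sup>2)" using r by (simp add: field_simps eval_nat_numeral)
  finally show ?thesis .
qed

lemma bump_minus: "bump r (x - y) = bump r (y - x)"
  by (simp add: bump_def norm_minus_commute power2_norm_eq_inner[symmetric])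

lemma continuous_bump: "continuous_on S (\<lambda>x. bump r (f x))" if "continuous_on S f"
  unfolding bump_def by (intro continuous_intros that)

lemma borel_measurable_bump[measurable]: "bump r \<in> borel_measurable borel"
  by (intro borel_measurable_continuous_onI continuous_bump continuous_intros)

lemma bump_indicator: "r > 0 \<Longrightarrow> bump r z = 3 / (pi * r ^ 6) * (indicator (ball 0 r) z * (r\<^sup>2 - z \<bullet> z)\<^sup>2)"
  using inner_self_less_iff[of r z] by (auto simp: bump_def indicator_def max_def)

lemma integrable_bump: "r > 0 \<Longrightarrow> integrable lborel (bump r)"
  and integral_bump: "r > 0 \<Longrightarrow> integral\<^sup>L lborel (bump r) = 1"
proof -
  assume r: "r > 0"
  have *: "bump r = (\<lambda>z. 3 / (pi * r ^ 6) * (indicator (ball 0 r) z * (r\<^sup>2 - z \<bullet> z)\<^sup>2))"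
    using bump_indicator[OF r] by blast
  show "integrable lborel (bump r)" unfolding * by (intro integrable_mult_right integrable_ball_moment)
  have "integral\<^sup>L lborel (bump r) = 3 / (pi * r ^ 6) * ball_moment 2 r"
    unfolding * ball_moment_def by simp
  then show "integral\<^sup>L lborel (bump r) = 1" using r by (simp add: ball_moment_values)
qed

lemma integrable_bump_diff: "r > 0 \<Longrightarrow> integrable lborel (\<lambda>z. bump r (z - x))"
  and integral_bump_diff: "r > 0 \<Longrightarrow> (LINT z|lborel. bump r (z - x)) = 1"
  using lborel_integrable_translate[of "bump r" "- x"] lborel_integral_translate[of "bump r" "- x"]
    integrable_bump[of r] integral_bump[of r] by auto

text \<open>Writing \<open>|z|^2 = r^2 - (r^2 - |z|^2)\<close> reduces this to the moments 2 and 3.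
  The value determines the integral of \<open>log_gap\<close>.\<close>

lemma bump_second_moment:
  assumes r: "r > 0"
  shows "integrable lborel (\<lambda>z. (z \<bullet> z) * bump r z)" "(LINT z|lborel. (z \<bullet> z) * bump r z) = r\<^sup>2 / 4"
proof -
  have *: "(z \<bullet> z) * bump r z = 3 / (pi * r ^ 6) * (r\<^sup>2 * (indicator (ball 0 r) z * (r\<^sup>2 - z \<bullet> z)\<^sup>2)
    - indicator (ball 0 r) z * (r\<^sup>2 - z \<bullet> z) ^ 3)" for z :: "real^2"
    using r by (simp add: bump_indicator power3_eq_cube power2_eq_square algebra_simps)
  show "integrable lborel (\<lambda>z. (z \<bullet> z) * bump r z)"
    unfolding * by (intro integrable_mult_right Bochner_Integration.integrable_diff integrable_ball_moment)
  have "(LINT z|lborel. (z \<bullet> z) * bump r z) = 3 / (pi * r ^ 6) * (r\<^sup>2 * ball_moment 2 r - ball_moment 3 r)"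
    unfolding * ball_moment_def using integrable_ball_moment[of r 2] integrable_ball_moment[of r 3] by simp
  also have "\<dots> = r\<^sup>2 / 4"
    unfolding ball_moment_values[OF r] using r by (simp add: field_simps eval_nat_numeral)
  finally show "(LINT z|lborel. (z \<bullet> z) * bump r z) = r\<^sup>2 / 4" .
qed

text \<open>One formula for both branches: besides the logarithm there remains
  \<open>ln (1 - s)\<close> minus its third Taylor polynomial, so sign and monotonicity questions
  become questions about a Taylor remainder.\<close>

lemma smooth_log_pos:
  assumes "r > 0" "z \<noteq> 0"
  defines "s \<equiv> max 0 (1 - (z \<bullet> z) / r\<^sup>2)"
  shows "smooth_log r z = (- ln (z \<bullet> z) + (ln (1 - s) + s + s\<^sup>2 / 2 + s ^ 3 / 3)) / (4 * pi)"
proof (cases "z \<bullet> z \<le> r\<^sup>2")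
  case True
  then have s: "s = 1 - (z \<bullet> z) / r\<^sup>2" using assms by (simp add: s_def)
  have "ln (1 - s) = ln (z \<bullet> z) - ln (r\<^sup>2)" using assms by (simp add: s ln_div)
  then show ?thesis using True by (simp add: smooth_log_def log_profile_def s)
next
  case False
  then have "1 - (z \<bullet> z) / r\<^sup>2 \<le> 0" using assms by (simp add: field_simps)
  then have "s = 0" by (simp add: s_def)
  then show ?thesis using False by (simp add: smooth_log_def log_profile_def)
qed

section \<open>Sign and monotonicity of the regularisation error\<close>

lemma log_kernel_inner: "z \<noteq> 0 \<Longrightarrow> log_kernel z = - ln (z \<bullet> z) / (4 * pi)"
  by (simp add: log_kernel_def power2_norm_eq_inner[symmetric] ln_realpow field_simps)

text \<open>The derivative in \<open>s\<close> is \<open>- s^3 / (1 - s)\<close>.\<close>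

lemma ln_taylor_antimono:
  fixes s t :: real
  assumes "0 \<le> s" "s \<le> t" "t < 1"
  shows "ln (1 - t) + t + t\<^sup>2 / 2 + t ^ 3 / 3 \<le> ln (1 - s) + s + s\<^sup>2 / 2 + s ^ 3 / 3"
proof (rule DERIV_nonpos_imp_nonincreasing[OF assms(2)])
  fix x assume x: "s \<le> x" "x \<le> t"
  have "((\<lambda>s. ln (1 - s) + s + s\<^sup>2 / 2 + s ^ 3 / 3) has_real_derivative (- (x ^ 3) / (1 - x))) (at x)"
    using x assms by (auto intro!: derivative_eq_intros simp: divide_simps) (simp add: algebra_simps eval_nat_numeral)
  moreover have "- (x ^ 3) / (1 - x) \<le> 0" using x assms by (simp add: divide_nonpos_pos)
  ultimately show "\<exists>y. ((\<lambda>s. ln (1 - s) + s + s\<^sup>2 / 2 + s ^ 3 / 3) has_real_derivative y) (at x) \<and> y \<le> 0" by blast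
qed

text \<open>A smaller radius gives a smaller Taylor variable and hence a larger remainder. This is
  the monotonicity behind the monotone convergence of the regularised logarithms.\<close>

lemma smooth_log_antimono:
  assumes "0 < s" "s \<le> r" "z \<noteq> 0"
  shows "smooth_log r z \<le> smooth_log s z"
proof -
  have "s\<^sup>2 \<le> r\<^sup>2" using assms by (intro power_mono) auto
  then have "z \<bullet> z / r\<^sup>2 \<le> z \<bullet> z / s\<^sup>2" using assms by (intro divide_left_mono) auto
  moreover have "z \<bullet> z / r\<^sup>2 > 0" using assms by simp
  ultimately show ?thesis
    using assms unfolding smooth_log_pos[OF \<open>0 < s\<close> \<open>z \<noteq> 0\<close>] smooth_log_pos[OF less_le_trans[OF \<open>0 < s\<close> \<open>s \<le> r\<close>] \<open>z \<noteq> 0\<close>]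
    by (intro divide_right_mono add_left_mono ln_taylor_antimono) auto
qed

lemma log_gap_nonneg:
  assumes "0 < r" "z \<noteq> 0"
  shows "log_gap r z \<ge> 0"
proof -
  define s where "s = max 0 (1 - (z \<bullet> z) / r\<^sup>2)"
  have "z \<bullet> z / r\<^sup>2 > 0" using assms by simp
  then have "ln (1 - s) + s + s\<^sup>2 / 2 + s ^ 3 / 3 \<le> 0"
    using ln_taylor_antimono[of 0 s] by (simp add: s_def)
  moreover have "log_gap r z = - (ln (1 - s) + s + s\<^sup>2 / 2 + s ^ 3 / 3) / (4 * pi)"
    unfolding log_gap_def log_kernel_inner[OF assms(2)] smooth_log_pos[OF assms] s_def[symmetric]
    by (simp add: diff_divide_distrib add_divide_distrib)
  ultimately show ?thesis by (simp add: divide_nonpos_pos)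
qed

lemma log_gap_eq_0: "0 < r \<Longrightarrow> r \<le> norm z \<Longrightarrow> log_gap r z = 0"
proof -
  assume r: "0 < r" "r \<le> norm z"
  then have "z \<noteq> 0" "max 0 (1 - (z \<bullet> z) / r\<^sup>2) = 0"
    using inner_self_less_iff[of r z] by (auto simp: max_def field_simps)
  then show ?thesis using r by (simp add: log_gap_def smooth_log_pos log_kernel_inner)
qed

lemma smooth_log_eq_log_kernel: "0 < r \<Longrightarrow> r \<le> norm z \<Longrightarrow> smooth_log r z = log_kernel z"
  using log_gap_eq_0[of r z] by (simp add: log_gap_def)

lemma continuous_smooth_log: "0 < r \<Longrightarrow> continuous_on UNIV (smooth_log r)"
  by (intro continuous_at_imp_continuous_on ballI has_derivative_continuous[OF has_derivative_smooth_log])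

lemma borel_measurable_kernels[measurable]:
  "log_kernel \<in> borel_measurable borel" "0 < r \<Longrightarrow> smooth_log r \<in> borel_measurable borel"
  "0 < r \<Longrightarrow> log_gap r \<in> borel_measurable borel"
proof -
  show 1: "log_kernel \<in> borel_measurable borel" unfolding log_kernel_def by measurable
  show 2: "0 < r \<Longrightarrow> smooth_log r \<in> borel_measurable borel"
    by (intro borel_measurable_continuous_onI continuous_smooth_log)
  show "0 < r \<Longrightarrow> log_gap r \<in> borel_measurable borel" unfolding log_gap_def using 1 2 by measurable
qed

lemma smooth_log_minus: "smooth_log r (x - y) = smooth_log r (y - x)"
  and log_kernel_minus: "log_kernel (x - y) = log_kernel (y - x)"
  and log_gap_minus: "log_gap r (x - y) = log_gap r (y - x)"
proof -
  show 1: "smooth_log r (x - y) = smooth_log r (y - x)"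
    by (simp add: smooth_log_def norm_minus_commute power2_norm_eq_inner[symmetric])
  show 2: "log_kernel (x - y) = log_kernel (y - x)"
    by (simp add: log_kernel_def norm_minus_commute)
  show "log_gap r (x - y) = log_gap r (y - x)" by (simp add: log_gap_def 1 2)
qed

section \<open>The Poisson equation in averaged form\<close>

lemma has_derivative_shift:
  assumes "(f has_derivative f') (at (z - x))"
  shows "((\<lambda>z. f (z - x)) has_derivative f') (at z)"
  by (rule has_derivative_compose[of "\<lambda>z. z - x" "\<lambda>v. v" z UNIV f f'])
    (use assms in \<open>auto intro!: derivative_eq_intros\<close>)

text \<open>Both regularisations agree with the logarithm off the disc of radius \<open>r\<close>,
  so their difference is a compactly supported \<open>C^2\<close> test function for Green's
  identity, with Laplacian \<open>bump r - bump s\<close>.\<close>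

lemma kernel_identity:
  fixes u f :: "real^2 \<Rightarrow> real" and ug :: "real^2 \<Rightarrow> real^2" and uh :: "2 \<Rightarrow> real^2 \<Rightarrow> real^2"
  assumes D: "open D" and x: "cball x r \<subseteq> D" and rs: "0 < s" "s \<le> r"
    and u1: "\<And>z. z \<in> D \<Longrightarrow> (u has_derivative (\<lambda>v. v \<bullet> ug z)) (at z)"
    and u2: "\<And>i z. z \<in> D \<Longrightarrow> ((\<lambda>z. ug z $ i) has_derivative (\<lambda>v. v \<bullet> uh i z)) (at z)"
    and u3: "\<And>i. continuous_on D (uh i)"
    and f: "\<And>z. z \<in> D \<Longrightarrow> (\<Sum>i\<in>UNIV. uh i z $ i) = - f z"
  shows "(LINT z|lborel. (bump s (z - x) - bump r (z - x)) * u z) =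
         (LINT z|lborel. (smooth_log s (z - x) - smooth_log r (z - x)) * f z)"
proof -
  have r: "r > 0" using rs by simp
  define pg where "pg z = (2 * log_profile1 s ((z - x) \<bullet> (z - x))) *\<^sub>R (z - x) - (2 * log_profile1 r ((z - x) \<bullet> (z - x))) *\<^sub>R (z - x)" for z
  define ph where "ph i z = ((2 * log_profile1 s ((z - x) \<bullet> (z - x))) *\<^sub>R axis i 1 + (4 * log_profile2 s ((z - x) \<bullet> (z - x)) * (z - x) $ i) *\<^sub>R (z - x))
    - ((2 * log_profile1 r ((z - x) \<bullet> (z - x))) *\<^sub>R axis i 1 + (4 * log_profile2 r ((z - x) \<bullet> (z - x)) * (z - x) $ i) *\<^sub>R (z - x))" for i z
  have supp: "smooth_log s (z - x) - smooth_log r (z - x) = 0" if "z \<notin> cball x r" for z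
    using that rs by (simp add: smooth_log_eq_log_kernel dist_norm norm_minus_commute)
  have suppb: "bump s (z - x) - bump r (z - x) = 0" if "z \<notin> cball x r" for z
    using that rs by (simp add: bump_eq_0 dist_norm norm_minus_commute)
  have "(LINT z|lborel. indicator D z * u z * (\<Sum>i\<in>UNIV. ph i z $ i)) =
         (LINT z|lborel. indicator D z * (smooth_log s (z - x) - smooth_log r (z - x)) * (\<Sum>i\<in>UNIV. uh i z $ i))"
  proof (rule green_identity[OF D compact_cball x u1 u2 u3 _ _ _ supp])
    show "((\<lambda>z. smooth_log s (z - x) - smooth_log r (z - x)) has_derivative (\<lambda>v. v \<bullet> pg z)) (at z)" for z
      by (rule has_derivative_eq_rhs[OF has_derivative_diff[OF has_derivative_shift[OF has_derivative_smooth_log[OF rs(1)]]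
          has_derivative_shift[OF has_derivative_smooth_log[OF r]]]])
        (simp only: pg_def inner_diff_right[of _ "_ *\<^sub>R _"])
    show "((\<lambda>z. pg z $ i) has_derivative (\<lambda>v. v \<bullet> ph i z)) (at z)" for i z
      unfolding pg_def vector_minus_component[of "_ *\<^sub>R _"]
      by (rule has_derivative_eq_rhs[OF has_derivative_diff[OF has_derivative_shift[OF has_derivative_grad_smooth_log[OF rs(1)]]
          has_derivative_shift[OF has_derivative_grad_smooth_log[OF r]]]])
        (simp only: ph_def inner_diff_right[of _ "_ + _"])
    have c: "continuous_on UNIV (\<lambda>z. log_profile1 r ((z - x) \<bullet> (z - x)))" "continuous_on UNIV (\<lambda>z. log_profile2 r ((z - x) \<bullet> (z - x)))" if "r > 0" for r
    proof -
      have "continuous_on UNIV (log_profile1 r)"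
        using DERIV_log_profile1[OF that] by (intro continuous_at_imp_continuous_on ballI DERIV_isCont)
      then show "continuous_on UNIV (\<lambda>z. log_profile1 r ((z - x) \<bullet> (z - x)))"
        by (rule continuous_on_compose2) (auto intro!: continuous_intros)
      show "continuous_on UNIV (\<lambda>z. log_profile2 r ((z - x) \<bullet> (z - x)))"
        by (rule continuous_on_compose2[OF continuous_log_profile2[OF that]]) (auto intro!: continuous_intros)
    qed
    show "continuous_on UNIV (ph i)" for i
      unfolding ph_def[abs_def] by (intro continuous_intros c rs r)
  qed
  moreover have "(\<Sum>i\<in>UNIV. ph i z $ i) = - (bump s (z - x) - bump r (z - x))" for z
    using laplacian_smooth_log[OF rs(1), of "z - x"] laplacian_smooth_log[OF r, of "z - x"]
    unfolding ph_def vector_minus_component sum_subtractf by simp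
  moreover have "indicator D z * u z * - (bump s (z - x) - bump r (z - x)) = - ((bump s (z - x) - bump r (z - x)) * u z)" for z
    using suppb[of z] x by (cases "z \<in> D"; cases "z \<in> cball x r") (auto simp: algebra_simps)
  moreover have "indicator D z * (smooth_log s (z - x) - smooth_log r (z - x)) * (\<Sum>i\<in>UNIV. uh i z $ i)
     = - ((smooth_log s (z - x) - smooth_log r (z - x)) * f z)" for z
    using supp[of z] x f[of z] by (cases "z \<in> D"; cases "z \<in> cball x r") (auto simp: algebra_simps)
  ultimately show ?thesis by simp
qed

lemma integrable_compact_support:
  fixes f :: "'a::euclidean_space \<Rightarrow> real"
  assumes "continuous_on C f" "compact C" "\<And>z. z \<notin> C \<Longrightarrow> f z = 0"
  shows "integrable lborel f"
proof -
  have "integrable lborel (\<lambda>z. indicator C z *\<^sub>R f z)" by (rule borel_integrable_compact[OF assms(2,1)])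
  moreover have "(\<lambda>z. indicator C z *\<^sub>R f z) = f"
    using assms(3) by (auto simp: indicator_def fun_eq_iff)
  ultimately show ?thesis by simp
qed

text \<open>The kernel identity for \<open>u z = z \<bullet> z\<close>, where
  \<open>- Laplace u = - 4\<close>, expresses the integral by the second moments
  \<open>s^2 / 4\<close> and \<open>r^2 / 4\<close> of the bumps.\<close>

lemma integral_smooth_log_diff:
  assumes rs: "0 < s" "s \<le> r"
  shows "integrable lborel (\<lambda>z. smooth_log s z - smooth_log r z)"
    and "(LINT z|lborel. smooth_log s z - smooth_log r z) = (r\<^sup>2 - s\<^sup>2) / 16"
proof -
  have r: "r > 0" using rs by simp
  show I: "integrable lborel (\<lambda>z. smooth_log s z - smooth_log r z)"
  proof (rule integrable_compact_support[of "cball 0 r"])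
    show "continuous_on (cball 0 r) (\<lambda>z. smooth_log s z - smooth_log r z)"
      using continuous_on_subset[OF continuous_smooth_log] rs r by (intro continuous_on_diff) auto
    show "smooth_log s z - smooth_log r z = 0" if "z \<notin> cball 0 r" for z
      using that rs r by (simp add: smooth_log_eq_log_kernel)
  qed simp
  have c: "((\<lambda>z::real^2. ((2::real) *\<^sub>R z) $ i) has_derivative (\<lambda>v. v \<bullet> ((2::real) *\<^sub>R axis i 1))) (at z)" for i z
  proof -
    have "((\<lambda>z::real^2. z $ i) has_derivative (\<lambda>v. v $ i)) (at z)"
      by (rule bounded_linear.has_derivative[OF bounded_linear_vec_nth]) simp
    then show ?thesis by (auto intro!: derivative_eq_intros simp: inner_axis fun_eq_iff)
  qed
  have "(LINT z|lborel. (bump s (z - 0) - bump r (z - 0)) * (z \<bullet> z)) =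
         (LINT z|lborel. (smooth_log s (z - 0) - smooth_log r (z - 0)) * (- 4))"
  proof (rule kernel_identity[where D = UNIV and ug = "\<lambda>z. 2 *\<^sub>R z" and uh = "\<lambda>i z. 2 *\<^sub>R axis i 1", OF _ _ rs])
    show "((\<lambda>z. z \<bullet> z) has_derivative (\<lambda>v. v \<bullet> 2 *\<^sub>R z)) (at z)" for z :: "real^2"
      by (auto intro!: derivative_eq_intros simp: inner_commute)
  qed (auto simp only: c, auto simp: sum_2 axis_def)
  moreover have "(LINT z|lborel. (smooth_log s (z - 0) - smooth_log r (z - 0)) * (- 4)) = - 4 * (LINT z|lborel. smooth_log s z - smooth_log r z)"
    by (subst integral_mult_left_zero) simp
  ultimately have "- 4 * (LINT z|lborel. smooth_log s z - smooth_log r z) = (LINT z|lborel. (z \<bullet> z) * bump s z - (z \<bullet> z) * bump r z)"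
    by (simp add: right_diff_distrib mult.commute)
  also have "\<dots> = s\<^sup>2 / 4 - r\<^sup>2 / 4"
    using bump_second_moment[OF rs(1)] bump_second_moment[OF r] by simp
  finally show "(LINT z|lborel. smooth_log s z - smooth_log r z) = (r\<^sup>2 - s\<^sup>2) / 16" by simp
qed

text \<open>Monotone convergence of \<open>smooth_log s - smooth_log r\<close> along the radii
  \<open>s = r / (n + 1)\<close>.\<close>

lemma integral_log_gap:
  assumes r: "0 < r"
  shows "integrable lborel (log_gap r)" and "integral\<^sup>L lborel (log_gap r) = r\<^sup>2 / 16"
proof -
  let ?s = "\<lambda>n. r / real (Suc n)"
  have s: "0 < ?s n" "?s n \<le> r" for n using r by (auto simp: field_simps)
  have sm: "?s m \<le> ?s n" if "n \<le> m" for m n using r that by (intro divide_left_mono) auto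
  have s0: "?s \<longlonglongrightarrow> 0" using tendsto_mult[OF tendsto_const[of r] LIMSEQ_inverse_real_of_nat] by (simp add: divide_inverse)
  have i: "integrable lborel (\<lambda>z. smooth_log (?s n) z - smooth_log r z)" for n
    by (rule integral_smooth_log_diff[OF s])
  have nz: "AE z::real^2 in lborel. z \<noteq> 0" by (rule AE_lborel_singleton)
  then have mono: "AE z in lborel. mono (\<lambda>n. smooth_log (?s n) z - smooth_log r z)"
    by eventually_elim (intro monoI diff_right_mono smooth_log_antimono s sm)
  have lim: "AE z in lborel. (\<lambda>n. smooth_log (?s n) z - smooth_log r z) \<longlonglongrightarrow> log_gap r z"
    using nz
  proof eventually_elim
    case (elim z)
    have "\<forall>\<^sub>F n in sequentially. ?s n < norm z"
      using s0 elim by (intro order_tendstoD(2)[OF s0]) auto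
    then have "\<forall>\<^sub>F n in sequentially. smooth_log (?s n) z - smooth_log r z = log_gap r z"
      by eventually_elim (use s smooth_log_eq_log_kernel in \<open>simp add: log_gap_def\<close>)
    then show ?case by (rule tendsto_eventually)
  qed
  have "(\<lambda>n. (r\<^sup>2 - (?s n)\<^sup>2) / 16) \<longlonglongrightarrow> (r\<^sup>2 - 0\<^sup>2) / 16" by (intro tendsto_intros s0) simp
  then have l: "(\<lambda>n. LINT z|lborel. smooth_log (?s n) z - smooth_log r z) \<longlonglongrightarrow> r\<^sup>2 / 16"
    by (simp only: integral_smooth_log_diff(2)[OF s]) simp
  have m: "log_gap r \<in> borel_measurable lborel" using borel_measurable_kernels(3)[OF r] by simp
  show "integrable lborel (log_gap r)" by (rule integrable_monotone_convergence[OF i mono lim l m])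
  show "integral\<^sup>L lborel (log_gap r) = r\<^sup>2 / 16" by (rule integral_monotone_convergence[OF i mono lim l m])
qed

lemma integral_log_gap_diff:
  assumes "0 < r"
  shows "integrable lborel (\<lambda>z. log_gap r (z - x))" and "(LINT z|lborel. log_gap r (z - x)) = r\<^sup>2 / 16"
  using lborel_integrable_translate[OF integral_log_gap(1)[OF assms], of "- x"]
    lborel_integral_translate[of "log_gap r" "- x"] integral_log_gap(2)[OF assms] borel_measurable_kernels(3)[OF assms]
  by auto

lemma log_gap_mult:
  fixes f :: "real^2 \<Rightarrow> real"
  assumes r: "0 < r" and f[measurable]: "f \<in> borel_measurable borel" and B: "\<And>z. \<bar>f z\<bar> \<le> B"
  shows "integrable lborel (\<lambda>z. log_gap r (z - x) * f z)"
    and "\<bar>LINT z|lborel. log_gap r (z - x) * f z\<bar> \<le> B * r\<^sup>2 / 16"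
proof -
  note [measurable] = borel_measurable_kernels(3)[OF r]
  have i: "integrable lborel (\<lambda>z. B * log_gap r (z - x))" using integral_log_gap_diff[OF r] by simp
  \<comment> \<open>At the pole \<open>log_kernel\<close> has only a default value, so the sign of
    \<open>log_gap\<close> is available off \<open>x\<close> only.\<close>
  have nz: "AE z in lborel. z \<noteq> x" by (rule AE_lborel_singleton)
  then have b: "AE z in lborel. norm (log_gap r (z - x) * f z) \<le> B * log_gap r (z - x)"
  proof eventually_elim
    case (elim z)
    then show ?case using log_gap_nonneg[OF r, of "z - x"] B[of z] by (simp add: abs_mult mult.commute mult_right_mono)
  qed
  show I: "integrable lborel (\<lambda>z. log_gap r (z - x) * f z)"
    by (rule Bochner_Integration.integrable_bound[OF i]) (use b in \<open>measurable, auto elim!: eventually_mono\<close>)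
  have "\<bar>LINT z|lborel. log_gap r (z - x) * f z\<bar> \<le> (LINT z|lborel. \<bar>log_gap r (z - x) * f z\<bar>)"
    by (rule integral_abs_bound)
  also have "\<dots> \<le> (LINT z|lborel. B * log_gap r (z - x))"
    by (rule integral_mono_AE) (use I i b in auto)
  finally have "\<bar>LINT z|lborel. log_gap r (z - x) * f z\<bar> \<le> (LINT z|lborel. B * log_gap r (z - x))" .
  then show "\<bar>LINT z|lborel. log_gap r (z - x) * f z\<bar> \<le> B * r\<^sup>2 / 16"
    using integral_log_gap_diff(2)[OF r, of x] by simp
qed

section \<open>Averages against the bump and the averaged Poisson equation\<close>

lemma integrable_bump_mult:
  assumes "0 < r" "continuous_on (cball x r) u"
  shows "integrable lborel (\<lambda>z. bump r (z - x) * u z)"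
proof (rule integrable_compact_support[of "cball x r"])
  show "continuous_on (cball x r) (\<lambda>z. bump r (z - x) * u z)"
    by (intro continuous_intros continuous_bump assms)
  show "bump r (z - x) * u z = 0" if "z \<notin> cball x r" for z
    using that assms by (simp add: bump_eq_0 dist_norm norm_minus_commute)
qed simp

lemma bump_average_bound:
  assumes r: "0 < r" and u: "continuous_on (cball x r) u" and B: "\<And>z. z \<in> ball x r \<Longrightarrow> \<bar>u z - a\<bar> \<le> B"
  shows "\<bar>(LINT z|lborel. bump r (z - x) * u z) - a\<bar> \<le> B"
proof -
  have i1: "integrable lborel (\<lambda>z. bump r (z - x) * u z)" using r u by (rule integrable_bump_mult)
  have i2: "integrable lborel (\<lambda>z. bump r (z - x) * c)" for c using integrable_bump_diff[OF r] by simp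
  have "(LINT z|lborel. bump r (z - x) * u z) - a = (LINT z|lborel. bump r (z - x) * u z - bump r (z - x) * a)"
    using i1 i2 integral_bump_diff[OF r] by simp
  also have "\<bar>\<dots>\<bar> \<le> (LINT z|lborel. \<bar>bump r (z - x) * u z - bump r (z - x) * a\<bar>)"
    by (rule integral_abs_bound)
  also have "\<dots> \<le> (LINT z|lborel. bump r (z - x) * B)"
  proof (rule integral_mono)
    show "integrable lborel (\<lambda>z. \<bar>bump r (z - x) * u z - bump r (z - x) * a\<bar>)" using i1 i2 by auto
    show "\<bar>bump r (z - x) * u z - bump r (z - x) * a\<bar> \<le> bump r (z - x) * B" for z
    proof (cases "z \<in> ball x r")
      case True
      then show ?thesis using B[OF True] bump_nonneg[OF r, of "z - x"]
        by (simp add: right_diff_distrib[symmetric] abs_mult mult_left_mono)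
    next
      case False then show ?thesis using r by (simp add: bump_eq_0 dist_norm norm_minus_commute)
    qed
  qed (use i2 in auto)
  also have "\<dots> = B" using integral_bump_diff[OF r] by simp
  finally show ?thesis .
qed

lemma bump_average_tendsto:
  assumes "open U" "x \<in> U" and u: "continuous_on U u"
  shows "((\<lambda>s. LINT z|lborel. bump s (z - x) * u z) \<longlongrightarrow> u x) (at_right 0)"
proof (rule tendstoI)
  fix e :: real assume e: "e > 0"
  have "isCont u x" using assms by (simp add: continuous_on_eq_continuous_at)
  then obtain d1 where d1: "d1 > 0" "\<And>z. dist z x < d1 \<Longrightarrow> dist (u z) (u x) < e / 2"
    using e unfolding continuous_at_eps_delta by (metis half_gt_zero)
  obtain d2 where d2: "d2 > 0" "cball x d2 \<subseteq> U" using assms open_contains_cball by blast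
  show "\<forall>\<^sub>F s in at_right 0. dist (LINT z|lborel. bump s (z - x) * u z) (u x) < e"
    unfolding eventually_at_right_field
  proof (intro exI[of _ "min d1 d2"] conjI allI impI)
    fix s :: real assume s: "0 < s" "s < min d1 d2"
    have "continuous_on (cball x s) u" by (rule continuous_on_subset[OF u]) (use s d2 in auto)
    moreover have "\<bar>u z - u x\<bar> \<le> e / 2" if "z \<in> ball x s" for z
      using d1(2)[of z] that s by (auto simp: dist_real_def dist_commute)
    ultimately have "\<bar>(LINT z|lborel. bump s (z - x) * u z) - u x\<bar> \<le> e / 2"
      using s by (intro bump_average_bound) auto
    then show "dist (LINT z|lborel. bump s (z - x) * u z) (u x) < e" using e by (simp add: dist_real_def)
  qed (use d1 d2 in auto)
qed

text \<open>The equation \<open>- \<Delta> u = f\<close> tested against \<^term>\<open>log_gap r\<close>: since \<^term>\<open>bump r\<close> is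
  \<open>- \<Delta>\<close> of \<^term>\<open>smooth_log r\<close>, this is Green's identity, and it makes sense for continuous \<open>u\<close> and bounded measurable \<open>f\<close>.\<close>

definition poisson_on :: "(real^2) set \<Rightarrow> (real^2 \<Rightarrow> real) \<Rightarrow> (real^2 \<Rightarrow> real) \<Rightarrow> bool" where
  "poisson_on U u f \<longleftrightarrow> (\<forall>x r. 0 < r \<longrightarrow> cball x r \<subseteq> U \<longrightarrow>
     u x - (LINT z|lborel. bump r (z - x) * u z) = (LINT z|lborel. log_gap r (z - x) * f z))"

lemma poisson_onD:
  "poisson_on U u f \<Longrightarrow> 0 < r \<Longrightarrow> cball x r \<subseteq> U \<Longrightarrow>
     u x - (LINT z|lborel. bump r (z - x) * u z) = (LINT z|lborel. log_gap r (z - x) * f z)"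
  by (simp add: poisson_on_def)

text \<open>The kernels differ from \<open>log_gap r\<close> by \<open>log_gap s\<close>, whose
  integral is of order \<open>s^2\<close>.\<close>

lemma smooth_log_diff_tendsto:
  fixes f :: "real^2 \<Rightarrow> real"
  assumes r: "0 < r" and f: "f \<in> borel_measurable borel" "\<And>z. \<bar>f z\<bar> \<le> B"
  shows "((\<lambda>s. LINT z|lborel. (smooth_log s (z - x) - smooth_log r (z - x)) * f z) \<longlongrightarrow>
      (LINT z|lborel. log_gap r (z - x) * f z)) (at_right 0)"
proof -
  have "\<forall>\<^sub>F s in at_right 0. (LINT z|lborel. (smooth_log s (z - x) - smooth_log r (z - x)) * f z) =
     (LINT z|lborel. log_gap r (z - x) * f z) - (LINT z|lborel. log_gap s (z - x) * f z)"
    unfolding eventually_at_right_field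
  proof (intro exI[of _ 1] conjI allI impI)
    fix s :: real assume "0 < s" "s < 1"
    then show "(LINT z|lborel. (smooth_log s (z - x) - smooth_log r (z - x)) * f z) =
     (LINT z|lborel. log_gap r (z - x) * f z) - (LINT z|lborel. log_gap s (z - x) * f z)"
      using log_gap_mult(1)[OF r f, of x] log_gap_mult(1)[OF _ f, of s x]
      by (subst Bochner_Integration.integral_diff[symmetric]) (auto simp: log_gap_def algebra_simps)
  qed auto
  moreover have "((\<lambda>s. LINT z|lborel. log_gap s (z - x) * f z) \<longlongrightarrow> 0) (at_right 0)"
  proof (rule Lim_null_comparison)
    show "\<forall>\<^sub>F s in at_right 0. norm (LINT z|lborel. log_gap s (z - x) * f z) \<le> B * s\<^sup>2 / 16"
      unfolding eventually_at_right_field using log_gap_mult(2)[OF _ f, of _ x] by (intro exI[of _ 1]) auto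
    have "((\<lambda>s. B * s\<^sup>2 / 16) \<longlongrightarrow> B * 0\<^sup>2 / 16) (at_right 0)" by (intro tendsto_intros) simp
    then show "((\<lambda>s. B * s\<^sup>2 / 16) \<longlongrightarrow> 0) (at_right 0)" by simp
  qed
  then have "((\<lambda>s. (LINT z|lborel. log_gap r (z - x) * f z) - (LINT z|lborel. log_gap s (z - x) * f z)) \<longlongrightarrow>
     (LINT z|lborel. log_gap r (z - x) * f z) - 0) (at_right 0)"
    by (intro tendsto_intros)
  ultimately show ?thesis by (simp add: filterlim_cong)
qed

text \<open>Letting \<open>s\<close> tend to 0 turns the average over the small disc into the value
  at the centre and the kernel difference into \<open>log_gap r\<close>.\<close>

lemma average_limit:
  fixes f :: "real^2 \<Rightarrow> real"
  assumes U: "open U" "x \<in> U" "0 < r" and u: "continuous_on U u" "integrable lborel (\<lambda>z. bump r (z - x) * u z)"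
    and f: "f \<in> borel_measurable borel" "\<And>z. \<bar>f z\<bar> \<le> B"
    and eq: "\<And>s. 0 < s \<Longrightarrow> s \<le> r \<Longrightarrow> (LINT z|lborel. (bump s (z - x) - bump r (z - x)) * u z) =
         (LINT z|lborel. (smooth_log s (z - x) - smooth_log r (z - x)) * f z)"
  shows "u x - (LINT z|lborel. bump r (z - x) * u z) = (LINT z|lborel. log_gap r (z - x) * f z)"
proof -
  obtain d where d: "d > 0" "cball x d \<subseteq> U" using U open_contains_cball by blast
  have "\<forall>\<^sub>F s in at_right 0. (LINT z|lborel. bump s (z - x) * u z) - (LINT z|lborel. bump r (z - x) * u z) =
    (LINT z|lborel. (smooth_log s (z - x) - smooth_log r (z - x)) * f z)"
    unfolding eventually_at_right_field
  proof (intro exI[of _ "min r d"] conjI allI impI)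
    fix s assume s: "0 < s" "s < min r d"
    have "cball x s \<subseteq> U" using s d(2) subset_cball[of s d x] by auto
    then have "integrable lborel (\<lambda>z. bump s (z - x) * u z)"
      using s continuous_on_subset[OF u(1)] by (intro integrable_bump_mult) auto
    then show "(LINT z|lborel. bump s (z - x) * u z) - (LINT z|lborel. bump r (z - x) * u z) =
    (LINT z|lborel. (smooth_log s (z - x) - smooth_log r (z - x)) * f z)"
      using eq[of s] s u(2) by (simp add: left_diff_distrib)
  qed (use d U in auto)
  moreover have "((\<lambda>s. (LINT z|lborel. bump s (z - x) * u z) - (LINT z|lborel. bump r (z - x) * u z)) \<longlongrightarrow>
      u x - (LINT z|lborel. bump r (z - x) * u z)) (at_right 0)"
    by (intro tendsto_intros bump_average_tendsto[OF U(1,2) u(1)])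
  ultimately have "((\<lambda>s. LINT z|lborel. (smooth_log s (z - x) - smooth_log r (z - x)) * f z) \<longlongrightarrow>
      u x - (LINT z|lborel. bump r (z - x) * u z)) (at_right 0)"
    by (simp add: filterlim_cong)
  from tendsto_unique[OF _ this smooth_log_diff_tendsto[OF U(3) f]] show ?thesis
    by simp
qed

section \<open>From classical solutions to the averaged equation\<close>

lemma differentiable_gradient:
  assumes "f differentiable (at z)"
  shows "(f has_derivative (\<lambda>v. v \<bullet> grad f z)) (at z)"
proof -
  let ?F = "frechet_derivative f (at z)"
  have F: "(f has_derivative ?F) (at z)" using assms frechet_derivative_works by blast
  then have lin: "linear ?F" by (simp add: has_derivative_linear)
  have "?F v = v \<bullet> grad f z" for v
  proof -
    have "v = v $ 1 *\<^sub>R axis 1 1 + v $ 2 *\<^sub>R axis 2 1"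
      by (simp add: vec_eq_iff forall_2 axis_def)
    then have "?F v = v $ 1 * ?F (axis 1 1) + v $ 2 * ?F (axis 2 1)"
      using linear_add[OF lin] linear_cmul[OF lin] by (metis real_scaleR_def)
    then show ?thesis by (simp add: inner_vec_def sum_2 grad_def partial_deriv_def)
  qed
  then have "?F = (\<lambda>v. v \<bullet> grad f z)" by blast
  then show ?thesis using F by simp
qed

lemma grad_eqI:
  assumes "(f has_derivative (\<lambda>v. v \<bullet> g)) (at z)"
  shows "grad f z = g"
  using frechet_derivative_at[OF assms, symmetric]
  by (simp add: grad_def partial_deriv_def vec_eq_iff inner_axis')

lemma Ck_on_2_derivatives:
  assumes "Ck_on 2 u D" "open D"
  shows "z \<in> D \<Longrightarrow> (u has_derivative (\<lambda>v. v \<bullet> grad u z)) (at z)"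
    and "z \<in> D \<Longrightarrow> ((\<lambda>z. grad u z $ i) has_derivative (\<lambda>v. v \<bullet> grad (partial_deriv i u) z)) (at z)"
    and "continuous_on D (grad (partial_deriv i u))"
proof -
  have u: "u differentiable_on D" "\<And>i. partial_deriv i u differentiable_on D"
    "\<And>i j. continuous_on D (partial_deriv j (partial_deriv i u))"
    using assms(1) by (auto simp: numeral_2_eq_2)
  show "z \<in> D \<Longrightarrow> (u has_derivative (\<lambda>v. v \<bullet> grad u z)) (at z)"
    using u(1) assms(2) by (intro differentiable_gradient) (simp add: differentiable_on_eq_differentiable_at)
  have "(\<lambda>z. grad u z $ i) = partial_deriv i u" by (simp add: grad_def fun_eq_iff)
  then show "z \<in> D \<Longrightarrow> ((\<lambda>z. grad u z $ i) has_derivative (\<lambda>v. v \<bullet> grad (partial_deriv i u) z)) (at z)"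
    using u(2) assms(2) differentiable_gradient[of "partial_deriv i u" z] by (simp add: differentiable_on_eq_differentiable_at)
  show "continuous_on D (grad (partial_deriv i u))"
    unfolding grad_def[abs_def] by (intro continuous_on_vec_lambda u)
qed

text \<open>Entry point for the given data: \<open>c = 0\<close> serves the harmonic corrections of
  the Green's function, \<open>c = 1\<close> the function \<open>\<psi>\<^sub>0\<close>.\<close>

lemma classical_poisson_on:
  assumes u: "Ck_on 2 u D" and D: "open D" and c: "\<And>x. x \<in> D \<Longrightarrow> laplacian u x = - c"
  shows "poisson_on D u (\<lambda>_. c)"
  unfolding poisson_on_def
proof (intro allI impI)
  fix x r assume r: "0 < (r::real)" "cball x r \<subseteq> D"
  note d = Ck_on_2_derivatives[OF u D]
  have uc: "continuous_on D u"
    using d(1) by (intro continuous_at_imp_continuous_on ballI has_derivative_continuous) blast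
  show "u x - (LINT z|lborel. bump r (z - x) * u z) = (LINT z|lborel. log_gap r (z - x) * c)"
  proof (rule average_limit[OF D _ r(1) uc, of x "\<lambda>_. c" "\<bar>c\<bar>"])
    show "x \<in> D" using r by auto
    show "integrable lborel (\<lambda>z. bump r (z - x) * u z)"
      by (rule integrable_bump_mult[OF r(1) continuous_on_subset[OF uc r(2)]])
    fix s assume "0 < s" "s \<le> r"
    then show "(LINT z|lborel. (bump s (z - x) - bump r (z - x)) * u z) =
         (LINT z|lborel. (smooth_log s (z - x) - smooth_log r (z - x)) * c)"
      by (rule kernel_identity[OF D r(2) _ _ d])
        (use c in \<open>auto simp: laplacian_def grad_def\<close>)
  qed auto
qed

section \<open>Averages of the logarithm itself\<close>

lemma integrable_bump_log_gap:
  assumes "0 < r" "0 < s"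
  shows "integrable lborel (\<lambda>z. bump r (z - x) * log_gap s (z - a))"
    and "(LINT z|lborel. bump r (z - x) * log_gap s (z - a)) \<ge> 0"
    and "(LINT z|lborel. bump r (z - x) * log_gap s (z - a)) \<le> 3 / (pi * r\<^sup>2) * s\<^sup>2 / 16"
proof -
  have B: "\<bar>bump r (z - x)\<bar> \<le> 3 / (pi * r\<^sup>2)" for z
    using bump_le[OF assms(1)] bump_nonneg[OF assms(1)] by simp
  have m: "(\<lambda>z. bump r (z - x)) \<in> borel_measurable borel" by measurable
  show "integrable lborel (\<lambda>z. bump r (z - x) * log_gap s (z - a))"
    using log_gap_mult(1)[OF assms(2) m B, of a] by (simp add: mult.commute)
  show "(LINT z|lborel. bump r (z - x) * log_gap s (z - a)) \<le> 3 / (pi * r\<^sup>2) * s\<^sup>2 / 16"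
    using log_gap_mult(2)[OF assms(2) m B, of a] by (simp add: mult.commute)
  have "AE z in lborel. z \<noteq> a" by (rule AE_lborel_singleton)
  then show "(LINT z|lborel. bump r (z - x) * log_gap s (z - a)) \<ge> 0"
    by (intro integral_nonneg_AE) (auto elim!: eventually_mono intro!: mult_nonneg_nonneg bump_nonneg log_gap_nonneg assms)
qed

lemma integrable_bump_smooth_log:
  assumes "0 < r" "0 < s"
  shows "integrable lborel (\<lambda>z. bump r (z - x) * smooth_log s (z - a))"
proof (rule integrable_bump_mult[OF assms(1)])
  show "continuous_on (cball x r) (\<lambda>z. smooth_log s (z - a))"
    by (rule continuous_on_compose2[OF continuous_smooth_log[OF assms(2)]]) (auto intro!: continuous_intros)
qed

lemma integrable_bump_log_kernel:
  assumes "0 < r"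
  shows "integrable lborel (\<lambda>z. bump r (z - x) * log_kernel (z - a))"
  using Bochner_Integration.integrable_add[OF integrable_bump_smooth_log[OF assms zero_less_one, of x a] integrable_bump_log_gap(1)[OF assms zero_less_one, of x a]]
  by (simp add: log_gap_def algebra_simps)

lemma smooth_log_split: "log_kernel z = smooth_log s z + log_gap s z"
  by (simp add: log_gap_def)

text \<open>The logarithm is singular at \<open>a\<close>, so the kernel identity is applied to
  \<open>smooth_log e\<close> about \<open>a\<close> instead. Its negative Laplacian is
  \<open>bump e\<close>, an approximate identity at \<open>a\<close>, and \<open>e\<close> tends to
  0 on both sides.\<close>

lemma bump_diff_log_kernel:
  assumes s: "0 < s" "s \<le> r"
  shows "(LINT z|lborel. (bump s (z - x) - bump r (z - x)) * log_kernel (z - a)) = smooth_log s (a - x) - smooth_log r (a - x)"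
proof -
  have r: "0 < r" using s by simp
  let ?L = "LINT z|lborel. (bump s (z - x) - bump r (z - x)) * log_kernel (z - a)"
  let ?g = "\<lambda>e. (LINT z|lborel. bump s (z - x) * log_gap e (z - a)) - (LINT z|lborel. bump r (z - x) * log_gap e (z - a))"
  have eq: "?L - ?g e = (LINT z|lborel. bump e (z - a) * (smooth_log s (z - x) - smooth_log r (z - x)))" if e: "0 < e" for e
  proof -
    have "?L = (LINT z|lborel. (bump s (z - x) - bump r (z - x)) * smooth_log e (z - a)) + ?g e"
      using integrable_bump_smooth_log[OF s(1) e, of x a] integrable_bump_smooth_log[OF r e, of x a]
        integrable_bump_log_gap(1)[OF s(1) e, of x a] integrable_bump_log_gap(1)[OF r e, of x a]
      by (simp add: smooth_log_split[where s = e] left_diff_distrib distrib_left)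
    also have "(LINT z|lborel. (bump s (z - x) - bump r (z - x)) * smooth_log e (z - a)) =
      (LINT z|lborel. (smooth_log s (z - x) - smooth_log r (z - x)) * bump e (z - a))"
    proof (rule kernel_identity[where D = UNIV and ug = "\<lambda>z. (2 * log_profile1 e ((z - a) \<bullet> (z - a))) *\<^sub>R (z - a)"
         and uh = "\<lambda>i z. (2 * log_profile1 e ((z - a) \<bullet> (z - a))) *\<^sub>R axis i 1 + (4 * log_profile2 e ((z - a) \<bullet> (z - a)) * (z - a) $ i) *\<^sub>R (z - a)", OF _ _ s])
      show "((\<lambda>z. smooth_log e (z - a)) has_derivative (\<lambda>v. v \<bullet> (2 * log_profile1 e ((z - a) \<bullet> (z - a))) *\<^sub>R (z - a))) (at z)" for z
        by (rule has_derivative_shift[OF has_derivative_smooth_log[OF e]])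
      show "((\<lambda>z. ((2 * log_profile1 e ((z - a) \<bullet> (z - a))) *\<^sub>R (z - a)) $ i) has_derivative (\<lambda>v. v \<bullet>
         ((2 * log_profile1 e ((z - a) \<bullet> (z - a))) *\<^sub>R axis i 1 + (4 * log_profile2 e ((z - a) \<bullet> (z - a)) * (z - a) $ i) *\<^sub>R (z - a)))) (at z)" for i z
        by (rule has_derivative_shift[OF has_derivative_grad_smooth_log[OF e]])
      have "continuous_on UNIV (log_profile1 e)"
        using DERIV_log_profile1[OF e] by (intro continuous_at_imp_continuous_on ballI DERIV_isCont)
      then have "continuous_on UNIV (\<lambda>z. log_profile1 e ((z - a) \<bullet> (z - a)))"
        by (rule continuous_on_compose2) (auto intro!: continuous_intros)
      moreover have "continuous_on UNIV (\<lambda>z. log_profile2 e ((z - a) \<bullet> (z - a)))"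
        by (rule continuous_on_compose2[OF continuous_log_profile2[OF e]]) (auto intro!: continuous_intros)
      ultimately show "continuous_on UNIV (\<lambda>z. (2 * log_profile1 e ((z - a) \<bullet> (z - a))) *\<^sub>R axis i 1 + (4 * log_profile2 e ((z - a) \<bullet> (z - a)) * (z - a) $ i) *\<^sub>R (z - a))" for i
        by (intro continuous_intros)
      show "(\<Sum>i\<in>UNIV. ((2 * log_profile1 e ((z - a) \<bullet> (z - a))) *\<^sub>R axis i 1 + (4 * log_profile2 e ((z - a) \<bullet> (z - a)) * (z - a) $ i) *\<^sub>R (z - a)) $ i) = - bump e (z - a)" for z
        by (rule laplacian_smooth_log[OF e])
    qed auto
    finally show ?thesis by (simp add: mult.commute)
  qed
  have sq0: "((\<lambda>e. c * e\<^sup>2 / 16) \<longlongrightarrow> 0) (at_right 0)" for c :: real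
  proof -
    have "((\<lambda>e. c * e\<^sup>2 / 16) \<longlongrightarrow> c * 0\<^sup>2 / 16) (at_right 0)" by (intro tendsto_intros) simp
    then show ?thesis by simp
  qed
  have lim0: "((\<lambda>e. LINT z|lborel. bump q (z - x) * log_gap e (z - a)) \<longlongrightarrow> 0) (at_right 0)" if q: "0 < q" for q
  proof (rule tendsto_sandwich[OF _ _ tendsto_const sq0[of "3 / (pi * q\<^sup>2)"]])
    show "\<forall>\<^sub>F e in at_right 0. 0 \<le> (LINT z|lborel. bump q (z - x) * log_gap e (z - a))"
      "\<forall>\<^sub>F e in at_right 0. (LINT z|lborel. bump q (z - x) * log_gap e (z - a)) \<le> 3 / (pi * q\<^sup>2) * e\<^sup>2 / 16"
      unfolding eventually_at_right_field using integrable_bump_log_gap[OF q] by (auto intro!: exI[of _ 1])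
  qed
  have "((\<lambda>e. ?L - ?g e) \<longlongrightarrow> ?L - (0 - 0)) (at_right 0)"
    by (intro tendsto_intros lim0 r s)
  moreover have "\<forall>\<^sub>F e in at_right 0. ?L - ?g e = (LINT z|lborel. bump e (z - a) * (smooth_log s (z - x) - smooth_log r (z - x)))"
    unfolding eventually_at_right_field using eq by (intro exI[of _ 1]) auto
  ultimately have "((\<lambda>e. LINT z|lborel. bump e (z - a) * (smooth_log s (z - x) - smooth_log r (z - x))) \<longlongrightarrow> ?L) (at_right 0)"
    by (simp add: filterlim_cong)
  moreover have "((\<lambda>e. LINT z|lborel. bump e (z - a) * (smooth_log s (z - x) - smooth_log r (z - x))) \<longlongrightarrow>
     smooth_log s (a - x) - smooth_log r (a - x)) (at_right 0)"
  proof (rule bump_average_tendsto[of UNIV])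
    have "continuous_on UNIV (\<lambda>z. smooth_log q (z - x))" if "0 < q" for q
      by (rule continuous_on_compose2[OF continuous_smooth_log[OF that]]) (auto intro!: continuous_intros)
    then show "continuous_on UNIV (\<lambda>z. smooth_log s (z - x) - smooth_log r (z - x))"
      using s r by (intro continuous_on_diff) auto
  qed auto
  ultimately show ?thesis by (rule tendsto_unique[rotated]) simp
qed

lemma continuous_log_kernel: "0 \<notin> S \<Longrightarrow> continuous_on S log_kernel"
  unfolding log_kernel_def[abs_def] by (intro continuous_intros) auto

text \<open>Once \<open>s\<close> is below the distance of the two points,
  \<open>smooth_log s\<close> is the logarithm itself, so letting \<open>s\<close> tend to 0 in the
  previous identity yields the average. Thus \<open>smooth_log r\<close> is the convolution of
  \<open>log_kernel\<close> with \<open>bump r\<close>.\<close>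

lemma bump_average_log_kernel:
  assumes r: "0 < r" and "x \<noteq> a"
  shows "(LINT z|lborel. bump r (z - x) * log_kernel (z - a)) = smooth_log r (x - a)"
proof -
  let ?L = "LINT z|lborel. bump r (z - x) * log_kernel (z - a)"
  have "continuous_on (- {a}) (\<lambda>z. log_kernel (z - a))"
    by (rule continuous_on_compose2[OF continuous_log_kernel[of "- {0}"]]) (auto intro!: continuous_intros)
  then have l: "((\<lambda>s. LINT z|lborel. bump s (z - x) * log_kernel (z - a)) \<longlongrightarrow> log_kernel (x - a)) (at_right 0)"
    using assms by (intro bump_average_tendsto[of "- {a}"]) auto
  have "\<forall>\<^sub>F s in at_right 0. (LINT z|lborel. bump s (z - x) * log_kernel (z - a)) = log_kernel (x - a) - smooth_log r (x - a) + ?L"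
    unfolding eventually_at_right_field
  proof (intro exI[of _ "min r (norm (a - x))"] conjI allI impI)
    fix s assume s: "0 < s" "s < min r (norm (a - x))"
    then have "(LINT z|lborel. (bump s (z - x) - bump r (z - x)) * log_kernel (z - a)) = log_kernel (a - x) - smooth_log r (a - x)"
      using bump_diff_log_kernel[of s r x a] by (simp add: smooth_log_eq_log_kernel)
    then show "(LINT z|lborel. bump s (z - x) * log_kernel (z - a)) = log_kernel (x - a) - smooth_log r (x - a) + ?L"
      using integrable_bump_log_kernel[OF r, of x a] integrable_bump_log_kernel[OF s(1), of x a]
      by (simp add: left_diff_distrib log_kernel_minus[of a x] smooth_log_minus[of r a x])
  qed (use assms in auto)
  then have "((\<lambda>s. LINT z|lborel. bump s (z - x) * log_kernel (z - a)) \<longlongrightarrow> log_kernel (x - a) - smooth_log r (x - a) + ?L) (at_right 0)"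
    by (rule tendsto_eventually)
  from tendsto_unique[OF _ this l] show ?thesis by simp
qed

section \<open>Maximum principle and logarithmic potentials\<close>

lemma bounded_cball0: "bounded S \<Longrightarrow> \<exists>R. S \<subseteq> cball (0::'a::real_normed_vector) R"
  unfolding bounded_iff by (auto simp: subset_iff)

text \<open>The set \<open>T\<close> where a positive maximum \<open>M\<close> is attained is
  compact. At its point \<open>q\<close> with largest first coordinate the submean inequality forces
  \<open>u = M\<close> on a whole disc, although points to the right of \<open>q\<close> lie outside
  \<open>T\<close>. The boundary condition is phrased through compact subsets, so it also suits
  functions that are controlled only inside an open set.\<close>

lemma max_principle:
  fixes u :: "real^2 \<Rightarrow> real"
  assumes U: "open U" "bounded U" and u: "continuous_on U u"
    and sub: "\<And>x. x \<in> U \<Longrightarrow> \<exists>r>0. cball x r \<subseteq> U \<and> u x \<le> (LINT z|lborel. bump r (z - x) * u z)"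
    and bd: "\<And>e. 0 < e \<Longrightarrow> \<exists>C. compact C \<and> C \<subseteq> U \<and> (\<forall>x\<in>U - C. u x \<le> e)"
    and x: "x \<in> U"
  shows "u x \<le> 0"
proof (rule ccontr)
  assume "\<not> u x \<le> 0"
  then have pos: "u x > 0" by simp
  then obtain C where C: "compact C" "C \<subseteq> U" "\<And>y. y \<in> U - C \<Longrightarrow> u y \<le> u x / 2"
    using bd[of "u x / 2"] by auto
  have xC: "x \<in> C" using C(3)[of x] x pos by fastforce
  have uC: "continuous_on C u" using u C(2) continuous_on_subset by blast
  obtain p where p: "p \<in> C" "\<And>y. y \<in> C \<Longrightarrow> u y \<le> u p"
    using continuous_attains_sup[OF C(1) _ uC] xC by blast
  define M where "M = u p"
  have M: "M \<ge> u x" using p xC by (simp add: M_def)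
  have le: "u y \<le> M" if "y \<in> U" for y
    using C(3)[of y] p(2)[of y] that M pos by (cases "y \<in> C") (auto simp: M_def)
  define T where "T = C \<inter> u -` {M}"
  have "closed T" unfolding T_def
    by (rule continuous_closed_preimage[OF uC compact_imp_closed[OF C(1)]]) simp
  then have T: "compact T" using C(1) unfolding T_def by (metis compact_Int_closed inf.left_idem)
  have "p \<in> T" using p by (simp add: T_def M_def)
  then obtain q where q: "q \<in> T" "\<And>y. y \<in> T \<Longrightarrow> y $ 1 \<le> q $ 1"
    using continuous_attains_sup[OF T, of "\<lambda>y. y $ 1"] continuous_on_component[OF continuous_on_id, of T 1] by blast
  have qU: "q \<in> U" "u q = M" using q C by (auto simp: T_def)
  obtain r where r: "r > 0" "cball q r \<subseteq> U" "M \<le> (LINT z|lborel. bump r (z - q) * u z)"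
    using sub[OF qU(1)] qU(2) by auto
  define y where "y = q + (r / 2) *\<^sub>R axis 1 1"
  have y: "y \<in> ball q r" using r by (simp add: y_def dist_norm)
  have "y $ 1 > q $ 1" using r by (simp add: y_def)
  then have "y \<notin> T" using q(2)[of y] by linarith
  moreover have yU: "y \<in> U" using y r by auto
  ultimately have "u y < M" using le[OF yU] C(3)[of y] M pos by (cases "y \<in> C") (auto simp: T_def)
  moreover have "isCont u y" using u U yU by (simp add: continuous_on_eq_continuous_at)
  ultimately have uy: "u y < M" "isCont u y" by auto
  then obtain d1 where d1: "d1 > 0" "\<And>z. dist z y < d1 \<Longrightarrow> u z < M"
    using order_tendstoD(2)[of u "u y" "at y" M] unfolding isCont_def eventually_at
    by (metis UNIV_I dist_eq_0_iff)
  obtain d2 where d2: "d2 > 0" "ball y d2 \<subseteq> ball q r" using y open_ball open_contains_ball by blast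
  define d where "d = min d1 d2"
  have d: "d > 0" using d1 d2 by (simp add: d_def)
  have cu: "continuous_on (cball q r) u" using u r(2) continuous_on_subset by blast
  have i: "integrable lborel (\<lambda>z. bump r (z - q) * (M - u z))"
    by (rule integrable_bump_mult[OF r(1)]) (intro continuous_intros cu)
  have nn: "0 \<le> bump r (z - q) * (M - u z)" for z
  proof (cases "z \<in> cball q r")
    case True then show ?thesis using le[of z] r bump_nonneg[OF r(1)] by auto
  next
    case False then show ?thesis using r by (simp add: bump_eq_0 dist_norm norm_minus_commute)
  qed
  \<comment> \<open>The nonnegative function \<open>bump r (z - q) * (M - u z)\<close> gets integral
    zero, yet it is positive on a disc around \<open>y\<close>.\<close>
  have "(LINT z|lborel. bump r (z - q) * (M - u z)) = M - (LINT z|lborel. bump r (z - q) * u z)"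
    using integrable_bump_mult[OF r(1) cu] integrable_bump_diff[OF r(1), of q] integral_bump_diff[OF r(1), of q]
    by (simp add: right_diff_distrib)
  then have "(LINT z|lborel. bump r (z - q) * (M - u z)) = 0"
    using r(3) integral_nonneg_AE[of "\<lambda>z. bump r (z - q) * (M - u z)" lborel] nn by simp
  then have "AE z in lborel. bump r (z - q) * (M - u z) = 0"
    using integral_nonneg_eq_0_iff_AE[OF i] nn by simp
  then have "AE z in lborel. z \<notin> ball y d"
  proof eventually_elim
    case (elim z)
    show ?case
    proof
      assume z: "z \<in> ball y d"
      then have "u z < M" using d1(2)[of z] by (simp add: d_def dist_commute)
      moreover have "z \<in> ball q r" using z d2(2) by (auto simp: d_def)
      then have "bump r (z - q) > 0" using r by (intro bump_pos) (auto simp: dist_norm norm_minus_commute)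
      ultimately show False using elim by simp
    qed
  qed
  then have "emeasure lborel (ball y d) = 0"
    by (subst (asm) AE_iff_measurable[of "ball y d"]) auto
  then show False using d content_ball_gt_0_iff[of y d] by (simp add: measure_def)
qed

lemma poisson_max_principle:
  fixes u :: "real^2 \<Rightarrow> real"
  assumes U: "open U" "bounded U" and u: "continuous_on U u" and p: "poisson_on U u f"
    and f: "\<And>x r. 0 < r \<Longrightarrow> cball x r \<subseteq> U \<Longrightarrow> (LINT z|lborel. log_gap r (z - x) * f z) \<le> 0"
    and bd: "\<And>e. 0 < e \<Longrightarrow> \<exists>C. compact C \<and> C \<subseteq> U \<and> (\<forall>x\<in>U - C. u x \<le> e)"
    and x: "x \<in> U"
  shows "u x \<le> 0"
proof (rule max_principle[OF U u _ bd x])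
  fix x assume "x \<in> U"
  then obtain r where "r > 0" "cball x r \<subseteq> U" using U open_contains_cball by blast
  then show "\<exists>r>0. cball x r \<subseteq> U \<and> u x \<le> (LINT z|lborel. bump r (z - x) * u z)"
    using poisson_onD[OF p, of r x] f[of r x] by (intro exI[of _ r]) auto
qed

lemma poisson_on_const_diff:
  assumes "poisson_on U u f" "continuous_on U u"
  shows "poisson_on U (\<lambda>x. c - u x) (\<lambda>x. - f x)" "poisson_on U (\<lambda>x. u x - c) f"
proof -
  have *: "integrable lborel (\<lambda>z. bump r (z - x) * u z)" if "0 < r" "cball x r \<subseteq> U" for x r
    using that assms continuous_on_subset by (intro integrable_bump_mult) auto
  show "poisson_on U (\<lambda>x. c - u x) (\<lambda>x. - f x)" "poisson_on U (\<lambda>x. u x - c) f"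
    using assms(1) integrable_bump_diff integral_bump_diff * unfolding poisson_on_def
    by (fastforce simp: right_diff_distrib)+
qed

lemma poisson_on_diff:
  assumes "poisson_on U u f" "continuous_on U u" "poisson_on U v g" "continuous_on U v"
    and f: "f \<in> borel_measurable borel" "\<And>z. \<bar>f z\<bar> \<le> B" and g: "g \<in> borel_measurable borel" "\<And>z. \<bar>g z\<bar> \<le> B'"
  shows "poisson_on U (\<lambda>x. u x - v x) (\<lambda>x. f x - g x)"
  unfolding poisson_on_def
proof (intro allI impI)
  fix x r assume r: "0 < (r::real)" "cball x r \<subseteq> U"
  have *: "integrable lborel (\<lambda>z. bump r (z - x) * u z)" "integrable lborel (\<lambda>z. bump r (z - x) * v z)"
    using r assms continuous_on_subset by (auto intro!: integrable_bump_mult)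
  show "u x - v x - (LINT z|lborel. bump r (z - x) * (u z - v z)) = (LINT z|lborel. log_gap r (z - x) * (f z - g z))"
    using poisson_onD[OF assms(1) r] poisson_onD[OF assms(3) r] * log_gap_mult(1)[OF r(1) f, of x] log_gap_mult(1)[OF r(1) g, of x]
    by (simp add: right_diff_distrib)
qed

lemma poisson_on_subset: "poisson_on U u f \<Longrightarrow> V \<subseteq> U \<Longrightarrow> poisson_on V u f"
  unfolding poisson_on_def by blast

lemma harmonic_le_frontier:
  fixes u :: "real^2 \<Rightarrow> real"
  assumes D: "open D" "bounded D" and u: "continuous_on (closure D) u" and p: "poisson_on D u (\<lambda>_. 0)"
    and bd: "\<And>z. z \<in> frontier D \<Longrightarrow> u z \<le> M" and x: "x \<in> closure D"
  shows "u x \<le> M"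
proof (cases "x \<in> D")
  case False
  then show ?thesis using x bd D(1) by (simp add: frontier_def interior_open)
next
  case True
  have uD: "continuous_on D u" using u closure_subset continuous_on_subset by blast
  have "u x - M \<le> 0"
  proof (rule poisson_max_principle[OF D _ poisson_on_const_diff(2)[OF p uD] _ _ True])
    show "continuous_on D (\<lambda>x. u x - M)" by (intro continuous_intros uD)
    fix e :: real assume e: "0 < e"
    \<comment> \<open>The bound on the frontier keeps this closed set inside
      \<open>D\<close>.\<close>
    let ?C = "closure D \<inter> u -` {M + e..}"
    have "closed ?C" by (rule continuous_closed_preimage[OF u]) auto
    moreover have "bounded ?C" using D by (meson bounded_closure bounded_subset inf_le1)
    ultimately have "compact ?C" by (simp add: compact_eq_bounded_closed)
    moreover have "?C \<subseteq> D" using bd e D(1) by (force simp: frontier_def interior_open)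
    moreover have "\<forall>x\<in>D - ?C. u x - M \<le> e" using closure_subset by auto
    ultimately show "\<exists>C. compact C \<and> C \<subseteq> D \<and> (\<forall>x\<in>D - C. u x - M \<le> e)" by blast
  qed auto
  then show ?thesis by simp
qed

lemma harmonic_abs_le_frontier:
  fixes u :: "real^2 \<Rightarrow> real"
  assumes D: "open D" "bounded D" and u: "continuous_on (closure D) u" and p: "poisson_on D u (\<lambda>_. 0)"
    and bd: "\<And>z. z \<in> frontier D \<Longrightarrow> \<bar>u z\<bar> \<le> M" and x: "x \<in> closure D"
  shows "\<bar>u x\<bar> \<le> M"
proof -
  have uD: "continuous_on D u" using u closure_subset continuous_on_subset by blast
  have "u x \<le> M" by (rule harmonic_le_frontier[OF D u p _ x]) (use bd in fastforce)
  moreover have "0 - u x \<le> M"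
    by (rule harmonic_le_frontier[OF D _ _ _ x])
      (use bd poisson_on_const_diff(1)[OF p uD, of 0] u in \<open>fastforce intro!: continuous_intros\<close>)+
  ultimately show ?thesis by simp
qed

lemma continuous_on_param_integral:
  fixes f :: "'a::euclidean_space \<Rightarrow> real" and k :: "'b::metric_space \<Rightarrow> 'a \<Rightarrow> real"
  assumes f: "\<And>y. \<bar>f y\<bar> \<le> B" and S: "bounded S" "\<And>y. y \<notin> S \<Longrightarrow> f y = 0"
    and m: "\<And>x. x \<in> X \<Longrightarrow> (\<lambda>y. k x y * f y) \<in> borel_measurable borel"
    and b: "\<And>x y. x \<in> X \<Longrightarrow> y \<in> S \<Longrightarrow> \<bar>k x y\<bar> \<le> M"
    and c: "\<And>y. y \<in> S \<Longrightarrow> continuous_on X (\<lambda>x. k x y)"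
  shows "continuous_on X (\<lambda>x. LINT y|lborel. k x y * f y)"
  unfolding continuous_on_sequentially
proof (intro allI ballI impI)
  fix s :: "nat \<Rightarrow> 'b" and a assume a: "a \<in> X" and s: "(\<forall>n. s n \<in> X) \<and> s \<longlonglongrightarrow> a"
  obtain R where R: "S \<subseteq> cball 0 R" using bounded_cball0[OF S(1)] by blast
  let ?w = "\<lambda>y. \<bar>M * B\<bar> * indicator (cball 0 R) y :: real"
  have "(\<lambda>n. LINT y|lborel. k (s n) y * f y) \<longlonglongrightarrow> (LINT y|lborel. k a y * f y)"
  proof (rule integral_dominated_convergence[where w = ?w])
    show "integrable lborel ?w"
      by (intro integrable_mult_right integrable_real_indicator) (use emeasure_lborel_cball_finite in auto)
    show "AE y in lborel. (\<lambda>n. k (s n) y * f y) \<longlonglongrightarrow> k a y * f y"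
    proof (rule AE_I2)
      fix y
      show "(\<lambda>n. k (s n) y * f y) \<longlonglongrightarrow> k a y * f y"
      proof (cases "y \<in> S")
        case True
        then have "(\<lambda>n. k (s n) y) \<longlonglongrightarrow> k a y"
          using c[OF True] a s unfolding continuous_on_sequentially comp_def by blast
        then show ?thesis by (intro tendsto_intros)
      qed (simp add: S)
    qed
    show "AE y in lborel. norm (k (s n) y * f y) \<le> ?w y" for n
    proof (rule AE_I2)
      fix y
      show "norm (k (s n) y * f y) \<le> ?w y"
      proof (cases "y \<in> S")
        case True
        then have "\<bar>k (s n) y\<bar> \<le> \<bar>M\<bar>" using b s by (meson abs_ge_self order_trans)
        moreover have "\<bar>f y\<bar> \<le> \<bar>B\<bar>" using f by (meson abs_ge_self order_trans)
        ultimately have "\<bar>k (s n) y\<bar> * \<bar>f y\<bar> \<le> \<bar>M\<bar> * \<bar>B\<bar>" by (intro mult_mono) auto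
        then show ?thesis using True R by (auto simp: abs_mult)
      qed (simp add: S)
    qed
  qed (use m a s in auto)
  then show "((\<lambda>x. LINT y|lborel. k x y * f y) \<circ> s) \<longlonglongrightarrow> (LINT y|lborel. k a y * f y)" by (simp add: comp_def)
qed

section \<open>Logarithmic potentials of bounded densities\<close>

definition log_potential :: "(real^2 \<Rightarrow> real) \<Rightarrow> real^2 \<Rightarrow> real" where
  "log_potential f x = (LINT y|lborel. log_kernel (x - y) * f y)"

context
  fixes f :: "real^2 \<Rightarrow> real" and B :: real and S
  assumes f[measurable]: "f \<in> borel_measurable borel" and fB: "\<And>y. \<bar>f y\<bar> \<le> B"
    and S: "bounded S" "\<And>y. y \<notin> S \<Longrightarrow> f y = 0"
begin

lemma integrable_smooth_log_mult:
  assumes e: "0 < e"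
  shows "integrable lborel (\<lambda>y. smooth_log e (x - y) * f y)"
proof -
  note [measurable] = borel_measurable_kernels(2)[OF e]
  obtain R where R: "S \<subseteq> cball 0 R" using bounded_cball0[OF S(1)] by blast
  have "continuous_on (cball 0 R) (\<lambda>y. smooth_log e (x - y))"
    by (rule continuous_on_compose2[OF continuous_smooth_log[OF e]]) (auto intro!: continuous_intros)
  then have "bounded ((\<lambda>y. smooth_log e (x - y)) ` cball 0 R)"
    by (intro compact_imp_bounded compact_continuous_image) auto
  then obtain M where M: "\<And>y. y \<in> cball 0 R \<Longrightarrow> \<bar>smooth_log e (x - y)\<bar> \<le> M"
    unfolding bounded_iff by fastforce
  show ?thesis
  proof (rule integrable_bounded_support[OF _ S(1)])
    show "\<bar>smooth_log e (x - y) * f y\<bar> \<le> \<bar>M\<bar> * \<bar>B\<bar>" for y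
    proof (cases "y \<in> S")
      case True
      then have "\<bar>smooth_log e (x - y)\<bar> \<le> \<bar>M\<bar>" using R M by (meson abs_ge_self order_trans subsetD)
      moreover have "\<bar>f y\<bar> \<le> \<bar>B\<bar>" using fB by (meson abs_ge_self order_trans)
      ultimately show ?thesis unfolding abs_mult by (intro mult_mono) auto
    qed (simp add: S)
  qed (auto simp: S)
qed

lemma integrable_log_kernel_mult: "integrable lborel (\<lambda>y. log_kernel (x - y) * f y)"
  and log_potential_split: "0 < e \<Longrightarrow> log_potential f x = (LINT y|lborel. smooth_log e (x - y) * f y) + (LINT y|lborel. log_gap e (x - y) * f y)"
proof -
  have g: "integrable lborel (\<lambda>y. log_gap e (x - y) * f y)" if "0 < e" for e
    using log_gap_mult(1)[OF that f fB, of x] by (simp add: log_gap_minus)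
  have *: "log_kernel (x - y) * f y = smooth_log e (x - y) * f y + log_gap e (x - y) * f y" for e y
    by (simp add: log_gap_def algebra_simps)
  show "integrable lborel (\<lambda>y. log_kernel (x - y) * f y)"
    unfolding *[of _ 1] using g[of 1] integrable_smooth_log_mult[of 1 x] by simp
  show "0 < e \<Longrightarrow> log_potential f x = (LINT y|lborel. smooth_log e (x - y) * f y) + (LINT y|lborel. log_gap e (x - y) * f y)"
    unfolding log_potential_def *[of _ e] using g[of e] integrable_smooth_log_mult[of e x] by simp
qed

text \<open>The potentials with kernel \<open>smooth_log (1 / (n + 1))\<close> are continuous and
  differ from the logarithmic one by at most \<open>B / (16 (n + 1)^2)\<close>, uniformly in
  \<open>x\<close>.\<close>

lemma continuous_log_potential: "continuous_on X (log_potential f)"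
proof -
  have "continuous_on (cball 0 R) (log_potential f)" for R
  proof (rule uniform_limit_theorem)
    let ?e = "\<lambda>n. 1 / real (Suc n)"
    have sc: "continuous_on UNIV (\<lambda>(x, y). smooth_log (?e n) (x - y))" for n
      unfolding case_prod_beta
      by (rule continuous_on_compose2[OF continuous_smooth_log]) (auto intro!: continuous_intros)
    show "\<forall>\<^sub>F n in sequentially. continuous_on (cball 0 R) (\<lambda>x. LINT y|lborel. smooth_log (?e n) (x - y) * f y)"
    proof (intro always_eventually allI)
      fix n
      obtain R' where R': "S \<subseteq> cball 0 R'" using bounded_cball0[OF S(1)] by blast
      have "bounded ((\<lambda>(x, y). smooth_log (?e n) (x - y)) ` (cball 0 R \<times> cball 0 R'))"
        by (intro compact_imp_bounded compact_continuous_image continuous_on_subset[OF sc] compact_Times) auto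
      then obtain M where M: "\<And>x y. x \<in> cball 0 R \<Longrightarrow> y \<in> cball 0 R' \<Longrightarrow> \<bar>smooth_log (?e n) (x - y)\<bar> \<le> M"
        unfolding bounded_iff by fastforce
      note [measurable] = borel_measurable_kernels(2)[of "?e n"]
      show "continuous_on (cball 0 R) (\<lambda>x. LINT y|lborel. smooth_log (?e n) (x - y) * f y)"
      proof (rule continuous_on_param_integral[OF fB S, where M = M])
        show "(\<lambda>y. smooth_log (?e n) (x - y) * f y) \<in> borel_measurable borel" for x by measurable
        show "\<bar>smooth_log (?e n) (x - y)\<bar> \<le> M" if "x \<in> cball 0 R" "y \<in> S" for x y using M R' that by blast
        show "continuous_on (cball 0 R) (\<lambda>x. smooth_log (?e n) (x - y))" for y
          by (rule continuous_on_compose2[OF continuous_smooth_log]) (auto intro!: continuous_intros)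
      qed
    qed
    show "uniform_limit (cball 0 R) (\<lambda>n x. LINT y|lborel. smooth_log (?e n) (x - y) * f y) (log_potential f) sequentially"
    proof (rule uniform_limitI)
      fix d :: real assume d: "0 < d"
      have l: "(\<lambda>n. B * (?e n)\<^sup>2 / 16) \<longlonglongrightarrow> B * 0\<^sup>2 / 16"
        using LIMSEQ_inverse_real_of_nat by (intro tendsto_intros) (simp_all add: inverse_eq_divide)
      have "\<forall>\<^sub>F n in sequentially. B * (?e n)\<^sup>2 / 16 < d"
        by (rule order_tendstoD(2)[OF l]) (use d in simp)
      then show "\<forall>\<^sub>F n in sequentially. \<forall>x\<in>cball 0 R. dist (LINT y|lborel. smooth_log (?e n) (x - y) * f y) (log_potential f x) < d"
      proof eventually_elim
        case (elim n)
        have *: "\<bar>LINT y|lborel. log_gap (?e n) (x - y) * f y\<bar> \<le> B * (?e n)\<^sup>2 / 16" for x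
          using log_gap_mult(2)[OF _ f fB, of "?e n" x] by (simp add: log_gap_minus)
        show ?case
        proof
          fix x
          have "dist (LINT y|lborel. smooth_log (?e n) (x - y) * f y) (log_potential f x) = \<bar>LINT y|lborel. log_gap (?e n) (x - y) * f y\<bar>"
            using log_potential_split[of "?e n" x] by (simp add: dist_real_def)
          also have "\<dots> < d" using * elim by (rule le_less_trans)
          finally show "dist (LINT y|lborel. smooth_log (?e n) (x - y) * f y) (log_potential f x) < d" .
        qed
      qed
    qed
  qed simp
  then have "continuous (at x) (log_potential f)" for x
  proof -
    assume *: "\<And>R. continuous_on (cball 0 R) (log_potential f)"
    have "continuous_on (ball 0 (norm x + 1)) (log_potential f)"
      by (rule continuous_on_subset[OF *[of "norm x + 1"]]) auto
    then show ?thesis by (simp add: continuous_on_eq_continuous_at)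
  qed
  then show ?thesis by (simp add: continuous_at_imp_continuous_on)
qed

text \<open>Absolute integrability on the product comes from splitting the kernel:
  \<open>smooth_log 1\<close> is bounded on the supports, and \<open>log_gap 1\<close> is
  nonnegative off its pole with bounded averages. After the exchange the inner integral is the known
  average of the logarithm.\<close>

lemma Fubini_bump_log_kernel:
  assumes r: "0 < r"
  shows "(LINT z|lborel. bump r (z - x) * log_potential f z) = (LINT y|lborel. smooth_log r (x - y) * f y)"
proof -
  note [measurable] = borel_measurable_kernels(1) borel_measurable_kernels(2)[OF zero_less_one] borel_measurable_kernels(3)[OF zero_less_one]
  let ?P = "\<lambda>k (y, z). bump r (z - x) * k (z - y) * f y"
  have I1: "integrable (lborel \<Otimes>\<^sub>M lborel) (?P (smooth_log 1))"
  proof -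
    have sc: "continuous_on UNIV (\<lambda>(x, y). smooth_log 1 (x - y))"
      unfolding case_prod_beta
      by (rule continuous_on_compose2[OF continuous_smooth_log]) (auto intro!: continuous_intros)
    obtain R' where R': "S \<subseteq> cball 0 R'" using bounded_cball0[OF S(1)] by blast
    have "bounded ((\<lambda>(x, y). smooth_log 1 (x - y)) ` (cball x r \<times> cball 0 R'))"
      by (intro compact_imp_bounded compact_continuous_image continuous_on_subset[OF sc] compact_Times) auto
    then obtain M where M: "\<And>z y. z \<in> cball x r \<Longrightarrow> y \<in> cball 0 R' \<Longrightarrow> \<bar>smooth_log 1 (z - y)\<bar> \<le> M"
      unfolding bounded_iff by fastforce
    show ?thesis unfolding lborel_prod
    proof (rule integrable_bounded_support[where S = "cball 0 R' \<times> cball x r" and B = "3 / (pi * r\<^sup>2) * \<bar>M\<bar> * \<bar>B\<bar>"])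
      show "?P (smooth_log 1) \<in> borel_measurable borel"
        unfolding borel_prod[symmetric] case_prod_beta by measurable
      show "bounded (cball 0 R' \<times> cball x r)" by (intro bounded_Times) auto
      show z: "?P (smooth_log 1) p = 0" if "p \<notin> cball 0 R' \<times> cball x r" for p
      proof -
        have "fst p \<notin> S \<or> snd p \<notin> cball x r" using that R' by (cases p) auto
        then have "f (fst p) = 0 \<or> bump r (snd p - x) = 0"
          using S(2)[of "fst p"] bump_eq_0[OF r, of "snd p - x"] by (auto simp: dist_norm norm_minus_commute)
        then show ?thesis by (auto simp: case_prod_beta)
      qed
      show "\<bar>?P (smooth_log 1) p\<bar> \<le> 3 / (pi * r\<^sup>2) * \<bar>M\<bar> * \<bar>B\<bar>" for p
      proof (cases "p \<in> cball 0 R' \<times> cball x r")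
        case True
        then obtain y z where p: "p = (y, z)" "y \<in> cball 0 R'" "z \<in> cball x r" by auto
        have "\<bar>smooth_log 1 (z - y)\<bar> \<le> \<bar>M\<bar>" using M[OF p(3,2)] by linarith
        moreover have "\<bar>bump r (z - x)\<bar> \<le> 3 / (pi * r\<^sup>2)" using bump_le[OF r] bump_nonneg[OF r] by simp
        moreover have "\<bar>f y\<bar> \<le> \<bar>B\<bar>" using fB by (meson abs_ge_self order_trans)
        ultimately show ?thesis unfolding p abs_mult prod.case by (intro mult_mono) auto
      next
        case False
        then have "?P (smooth_log 1) p = 0" by (rule z)
        then show ?thesis by simp
      qed
    qed
  qed
  have I2: "integrable (lborel \<Otimes>\<^sub>M lborel) (?P (log_gap 1))"
  proof (rule lborel_pair.Fubini_integrable)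
    show "?P (log_gap 1) \<in> borel_measurable (lborel \<Otimes>\<^sub>M lborel)"
      unfolding case_prod_beta by measurable
    have i: "integrable lborel (\<lambda>z. bump r (z - x) * log_gap 1 (z - y))" for y
      by (rule integrable_bump_log_gap(1)[OF r zero_less_one])
    then show "AE y in lborel. integrable lborel (\<lambda>z. ?P (log_gap 1) (y, z))" by simp
    have eq: "(LINT z|lborel. norm (?P (log_gap 1) (y, z))) = (LINT z|lborel. bump r (z - x) * log_gap 1 (z - y)) * \<bar>f y\<bar>" for y
    proof -
      have "(LINT z|lborel. norm (?P (log_gap 1) (y, z))) = (LINT z|lborel. bump r (z - x) * log_gap 1 (z - y) * \<bar>f y\<bar>)"
      proof (rule integral_cong_AE)
        have "AE z in lborel. z \<noteq> y" by (rule AE_lborel_singleton)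
        then show "AE z in lborel. norm (?P (log_gap 1) (y, z)) = bump r (z - x) * log_gap 1 (z - y) * \<bar>f y\<bar>"
          by eventually_elim (simp add: abs_mult bump_nonneg[OF r] log_gap_nonneg)
        show "(\<lambda>z. norm (?P (log_gap 1) (y, z))) \<in> borel_measurable lborel"
          unfolding prod.case by measurable
        show "(\<lambda>z. bump r (z - x) * log_gap 1 (z - y) * \<bar>f y\<bar>) \<in> borel_measurable lborel" by measurable
      qed
      then show ?thesis by simp
    qed
    show "integrable lborel (\<lambda>y. LINT z|lborel. norm (?P (log_gap 1) (y, z)))"
      unfolding eq
    proof (rule integrable_bounded_support[OF _ S(1)])
      show "\<bar>(LINT z|lborel. bump r (z - x) * log_gap 1 (z - y)) * \<bar>f y\<bar>\<bar> \<le> 3 / (pi * r\<^sup>2) * 1\<^sup>2 / 16 * \<bar>B\<bar>" for y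
        unfolding abs_mult using integrable_bump_log_gap[OF r zero_less_one, of x y] fB[of y]
        by (intro mult_mono) auto
    qed (auto simp: S)
  qed
  have "?P log_kernel = (\<lambda>p. ?P (smooth_log 1) p + ?P (log_gap 1) p)"
    by (auto simp: fun_eq_iff log_gap_def algebra_simps)
  then have I: "integrable (lborel \<Otimes>\<^sub>M lborel) (?P log_kernel)" using I1 I2 by simp
  have "(LINT z|lborel. bump r (z - x) * log_potential f z) = (LINT z|lborel. LINT y|lborel. bump r (z - x) * log_kernel (z - y) * f y)"
    unfolding log_potential_def integral_mult_right_zero[symmetric] by (simp add: mult.assoc)
  also have "\<dots> = (LINT y|lborel. LINT z|lborel. bump r (z - x) * log_kernel (z - y) * f y)"
    by (rule lborel_pair.Fubini_integral[OF I])
  also have "\<dots> = (LINT y|lborel. (LINT z|lborel. bump r (z - x) * log_kernel (z - y)) * f y)"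
    by simp
  also have "\<dots> = (LINT y|lborel. smooth_log r (x - y) * f y)"
  proof (rule integral_cong_AE)
    have "AE y in lborel. y \<noteq> x" by (rule AE_lborel_singleton)
    then show "AE y in lborel. (LINT z|lborel. bump r (z - x) * log_kernel (z - y)) * f y = smooth_log r (x - y) * f y"
      by eventually_elim (use bump_average_log_kernel[OF r] in auto)
    note [measurable] = borel_measurable_kernels(2)[OF r]
    show "(\<lambda>y. smooth_log r (x - y) * f y) \<in> borel_measurable lborel" by measurable
  qed measurable
  finally show ?thesis .
qed

text \<open>The averaged equation is the splitting
  \<open>log_kernel = smooth_log r + log_gap r\<close> itself: the \<open>bump r\<close> average of
  the potential is its \<open>smooth_log r\<close> part.\<close>

lemma poisson_on_log_potential: "poisson_on U (log_potential f) f"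
  unfolding poisson_on_def
proof (intro allI impI)
  fix x r assume r: "0 < (r::real)"
  show "log_potential f x - (LINT z|lborel. bump r (z - x) * log_potential f z) = (LINT z|lborel. log_gap r (z - x) * f z)"
    using log_potential_split[OF r, of x] Fubini_bump_log_kernel[OF r, of x] by (simp add: log_gap_minus)
qed

end

section \<open>The Green's function\<close>

text \<open>From \<open>ln t \<le> t - 1\<close> with \<open>t\<close> the quotient of the norms;
  \<open>1 / (2 pi)\<close> is estimated by \<open>1 / 2\<close>.\<close>

lemma abs_log_kernel_diff:
  assumes "0 < m" "m \<le> norm a" "m \<le> norm b"
  shows "\<bar>log_kernel a - log_kernel b\<bar> \<le> norm (a - b) / (2 * m)"
proof -
  have *: "ln (norm a) - ln (norm b) \<le> norm (a - b) / m" if "m \<le> norm a" "m \<le> norm b" for a b :: "real^2"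
  proof -
    have pos: "norm a > 0" "norm b > 0" using assms(1) that by linarith+
    then have "ln (norm a) - ln (norm b) = ln (norm a / norm b)" by (simp only: ln_div) auto
    also have "\<dots> \<le> norm a / norm b - 1" using pos by (intro ln_le_minus_one divide_pos_pos)
    also have "\<dots> = (norm a - norm b) / norm b" using pos by (simp add: field_simps)
    also have "\<dots> \<le> norm (a - b) / norm b" using norm_triangle_ineq2[of a b] by (intro divide_right_mono) auto
    also have "\<dots> \<le> norm (a - b) / m" using assms(1) that pos by (intro divide_left_mono mult_pos_pos norm_ge_zero)
    finally show ?thesis .
  qed
  have "\<bar>ln (norm a) - ln (norm b)\<bar> \<le> norm (a - b) / m"
    using *[OF assms(2,3)] *[OF assms(3,2)] by (simp add: norm_minus_commute)
  then have "\<bar>ln (norm a) - ln (norm b)\<bar> / (2 * pi) \<le> norm (a - b) / m / (2 * 1)"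
    using assms(1) pi_ge_two by (intro frac_le) auto
  moreover have "\<bar>log_kernel a - log_kernel b\<bar> = \<bar>ln (norm a) - ln (norm b)\<bar> / (2 * pi)"
    unfolding log_kernel_def by (simp add: diff_divide_distrib[symmetric] abs_minus_commute)
  ultimately show ?thesis by (simp add: mult.commute)
qed

lemma poisson_on_log_kernel:
  assumes "a \<notin> U"
  shows "poisson_on U (\<lambda>x. log_kernel (x - a)) (\<lambda>_. 0)"
  unfolding poisson_on_def
proof (intro allI impI)
  fix x r assume r: "0 < (r::real)" "cball x r \<subseteq> U"
  then have "a \<notin> cball x r" using assms by blast
  then have "norm (x - a) > r" by (simp add: dist_norm)
  then show "log_kernel (x - a) - (LINT z|lborel. bump r (z - x) * log_kernel (z - a)) = (LINT z|lborel. log_gap r (z - x) * 0)"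
    using bump_average_log_kernel[OF r(1), of x a] r(1) smooth_log_eq_log_kernel[of r "x - a"] by (cases "x = a") auto
qed

lemma poisson_on_add:
  assumes "poisson_on U u (\<lambda>_. 0)" "continuous_on U u" "poisson_on U v (\<lambda>_. 0)" "continuous_on U v"
  shows "poisson_on U (\<lambda>x. u x + v x) (\<lambda>_. 0)"
  unfolding poisson_on_def
proof (intro allI impI)
  fix x r assume r: "0 < (r::real)" "cball x r \<subseteq> U"
  have *: "integrable lborel (\<lambda>z. bump r (z - x) * u z)" "integrable lborel (\<lambda>z. bump r (z - x) * v z)"
    using r assms continuous_on_subset by (auto intro!: integrable_bump_mult)
  show "u x + v x - (LINT z|lborel. bump r (z - x) * (u z + v z)) = (LINT z|lborel. log_gap r (z - x) * 0)"
    using poisson_onD[OF assms(1) r] poisson_onD[OF assms(3) r] * by (simp add: distrib_left)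
qed

text \<open>The Green's function enters through its correction term: \<open>h y x\<close> has the
  pole \<open>y\<close> first, and off the diagonal \<open>log_kernel (x - y) + h y x\<close> is the
  Green's function. Continuity in the pole, sign and symmetry are deduced from the boundary values
  by the maximum principle.\<close>

locale dirichlet_domain =
  fixes D :: "(real^2) set" and h :: "real^2 \<Rightarrow> real^2 \<Rightarrow> real"
  assumes open_D: "open D" and bounded_D: "bounded D"
    and h_poisson: "\<And>y. y \<in> D \<Longrightarrow> poisson_on D (h y) (\<lambda>_. 0)"
    and h_cont: "\<And>y. y \<in> D \<Longrightarrow> continuous_on (closure D) (h y)"
    and h_frontier: "\<And>y z. y \<in> D \<Longrightarrow> z \<in> frontier D \<Longrightarrow> h y z = - log_kernel (z - y)"
begin

section \<open>Dependence of the correction on point and pole\<close>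

lemma frontier_not_in: "z \<in> frontier D \<Longrightarrow> z \<notin> D"
  using open_D by (simp add: frontier_def interior_open)

lemma closure_cases: "z \<in> closure D \<Longrightarrow> z \<in> D \<or> z \<in> frontier D"
  using open_D by (simp add: frontier_def interior_open)

lemma D_subset_closure: "D \<subseteq> closure D" by (rule closure_subset)

lemma compact_closure_D: "compact (closure D)"
  using bounded_D by (simp add: compact_closure)

lemma h_cont_D: "y \<in> D \<Longrightarrow> continuous_on D (h y)"
  by (rule continuous_on_subset[OF h_cont closure_subset])

text \<open>On the frontier the two corrections are logarithms with nearby poles, both at distance
  at least \<open>d / 2\<close>, and so differ by at most \<open>dist y' y / d\<close>; the maximum
  principle carries this to the closure.\<close>

lemma h_lipschitz:
  assumes y: "y \<in> D" "0 < d" "cball y d \<subseteq> D" "dist y' y \<le> d / 2" and x: "x \<in> closure D"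
  shows "\<bar>h y' x - h y x\<bar> \<le> dist y' y / d"
proof -
  have y': "y' \<in> D" using y by (auto simp: dist_commute subset_iff)
  show ?thesis
  proof (rule harmonic_abs_le_frontier[OF open_D bounded_D _ _ _ x])
    show "continuous_on (closure D) (\<lambda>x. h y' x - h y x)" by (intro continuous_intros h_cont y y')
    show "poisson_on D (\<lambda>x. h y' x - h y x) (\<lambda>_. 0)"
      using poisson_on_diff[OF h_poisson[OF y'] h_cont_D[OF y'] h_poisson[OF y(1)] h_cont_D[OF y(1)], of 0 0] by simp
    fix z assume z: "z \<in> frontier D"
    then have "z \<notin> cball y d" using y frontier_not_in by blast
    then have "d \<le> norm (z - y)" by (simp add: dist_norm norm_minus_commute)
    moreover have "norm (z - y) \<le> norm (z - y') + dist y' y"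
      using norm_triangle_ineq[of "z - y'" "y' - y"] by (simp add: dist_norm)
    ultimately have "\<bar>log_kernel (z - y) - log_kernel (z - y')\<bar> \<le> norm ((z - y) - (z - y')) / (2 * (d / 2))"
      using y by (intro abs_log_kernel_diff) auto
    then show "\<bar>h y' z - h y z\<bar> \<le> dist y' y / d"
      using h_frontier[OF y(1) z] h_frontier[OF y' z] by (simp add: dist_norm)
  qed
qed

text \<open>The Lipschitz bound in the pole is uniform in \<open>x\<close>, so it combines with
  continuity in \<open>x\<close> for a fixed pole.\<close>

lemma h_joint_continuous: "continuous_on (closure D \<times> D) (\<lambda>p. h (snd p) (fst p))"
  unfolding continuous_on_iff
proof (intro ballI allI impI)
  fix p :: "(real^2) \<times> (real^2)" and e :: real assume p: "p \<in> closure D \<times> D" and e: "0 < e"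
  obtain x y where xy: "p = (x, y)" "x \<in> closure D" "y \<in> D" using p by auto
  obtain d where d: "0 < d" "cball y d \<subseteq> D" using xy open_D open_contains_cball by blast
  obtain d1 where d1: "0 < d1" "\<And>x'. x' \<in> closure D \<Longrightarrow> dist x' x < d1 \<Longrightarrow> dist (h y x') (h y x) < e / 2"
    using h_cont[OF xy(3)] xy(2) e unfolding continuous_on_iff by (meson half_gt_zero)
  define d2 where "d2 = min d1 (min (d / 2) (e * d / 2))"
  have d2: "d2 > 0" "d2 \<le> d1" "d2 \<le> d / 2" "d2 \<le> e * d / 2" using d1 d e by (auto simp: d2_def)
  show "\<exists>d>0. \<forall>q\<in>closure D \<times> D. dist q p < d \<longrightarrow> dist (h (snd q) (fst q)) (h (snd p) (fst p)) < e"
  proof (intro exI[of _ d2] conjI ballI impI d2)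
    fix q assume q: "q \<in> closure D \<times> D" "dist q p < d2"
    obtain x' y' where q': "q = (x', y')" "x' \<in> closure D" "y' \<in> D" using q by auto
    have dx: "dist x' x < d2" and dy: "dist y' y < d2"
      using q(2) dist_fst_le[of q p] dist_snd_le[of q p] by (auto simp: q' xy)
    have "\<bar>h y' x' - h y x'\<bar> \<le> dist y' y / d"
      by (rule h_lipschitz[OF xy(3) d _ q'(2)]) (use dy d2 in auto)
    also have "\<dots> \<le> e / 2" using dy d2 d by (simp add: field_simps)
    finally have "\<bar>h y' x' - h y x'\<bar> \<le> e / 2" .
    moreover have "\<bar>h y x' - h y x\<bar> < e / 2" using d1(2)[OF q'(2)] dx d2 by (simp add: dist_real_def)
    ultimately have "\<bar>(h y' x' - h y x') + (h y x' - h y x)\<bar> < e" by linarith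
    then show "dist (h (snd q) (fst q)) (h (snd p) (fst p)) < e"
      by (simp add: q' xy dist_real_def)
  qed
qed

lemma h_continuous_pole: "x \<in> closure D \<Longrightarrow> continuous_on D (\<lambda>y. h y x)"
  by (rule continuous_on_compose2[OF h_joint_continuous, of D "\<lambda>y. (x, y)", simplified])
    (auto intro!: continuous_intros)

lemma h_bounded:
  assumes "compact C" "C \<subseteq> D"
  shows "\<exists>M. \<forall>y\<in>C. \<forall>x\<in>closure D. \<bar>h y x\<bar> \<le> M"
proof -
  have "bounded ((\<lambda>p. h (snd p) (fst p)) ` (closure D \<times> C))"
    by (intro compact_imp_bounded compact_continuous_image continuous_on_subset[OF h_joint_continuous]
        compact_Times compact_closure_D) (use assms in auto)
  then show ?thesis unfolding bounded_iff by fastforce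
qed

lemma h_measurable_pole:
  assumes "x \<in> closure D" and [measurable]: "f \<in> borel_measurable borel" and "\<And>y. y \<notin> D \<Longrightarrow> f y = 0"
  shows "(\<lambda>y. h y x * f y) \<in> borel_measurable borel"
proof -
  have [measurable]: "(\<lambda>y. indicator D y *\<^sub>R h y x) \<in> borel_measurable borel"
    by (intro borel_measurable_continuous_on_indicator h_continuous_pole assms borel_open open_D)
  have "(\<lambda>y. (indicator D y *\<^sub>R h y x) * f y) \<in> borel_measurable borel" by measurable
  moreover have "(\<lambda>y. (indicator D y *\<^sub>R h y x) * f y) = (\<lambda>y. h y x * f y)"
    using assms(3) by (auto simp: fun_eq_iff indicator_def)
  ultimately show ?thesis by (simp only:)
qed

text \<open>Each \<open>h y\<close> has the mean value property, so the claim is an exchange of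
  integrals; the bound \<open>M\<close> provides integrability.\<close>

lemma h_average:
  assumes r: "0 < r" "cball x r \<subseteq> D" and f[measurable]: "f \<in> borel_measurable borel" and fB: "\<And>y. \<bar>f y\<bar> \<le> B"
    and S: "S \<subseteq> D" "\<And>y. y \<notin> S \<Longrightarrow> f y = 0"
    and M: "\<And>y z. y \<in> S \<Longrightarrow> z \<in> cball x r \<Longrightarrow> \<bar>h y z\<bar> \<le> M"
  shows "(LINT z|lborel. bump r (z - x) * (LINT y|lborel. h y z * f y)) = (LINT y|lborel. h y x * f y)"
proof -
  let ?P = "\<lambda>(y, z). bump r (z - x) * h y z * f y"
  have x: "x \<in> D" using r by auto
  have hm: "(\<lambda>p. indicator (D \<times> D) p *\<^sub>R h (snd p) (fst p)) \<in> borel_measurable borel"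
    by (intro borel_measurable_continuous_on_indicator continuous_on_subset[OF h_joint_continuous] borel_open open_Times open_D)
       (use D_subset_closure in auto)
  have z: "?P p = 0" if "p \<notin> S \<times> cball x r" for p
  proof -
    have "fst p \<notin> S \<or> snd p \<notin> cball x r" using that by (cases p) auto
    then have "f (fst p) = 0 \<or> bump r (snd p - x) = 0"
      using S(2)[of "fst p"] bump_eq_0[OF r(1), of "snd p - x"] by (auto simp: dist_norm norm_minus_commute)
    then show ?thesis by (auto simp: case_prod_beta)
  qed
  have I: "integrable (lborel \<Otimes>\<^sub>M lborel) ?P"
    unfolding lborel_prod
  proof (rule integrable_bounded_support[where S = "S \<times> cball x r" and B = "3 / (pi * r\<^sup>2) * \<bar>M\<bar> * \<bar>B\<bar>"])
    \<comment> \<open>Joint measurability of the correction is available on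
      \<open>D \<times> D\<close>, so the kernel is cut off to that set.\<close>
    have "?P = (\<lambda>p. bump r (snd p - x) * (indicator (D \<times> D) (snd p, fst p) *\<^sub>R h (fst p) (snd p)) * f (fst p))"
    proof
      fix p
      show "?P p = bump r (snd p - x) * (indicator (D \<times> D) (snd p, fst p) *\<^sub>R h (fst p) (snd p)) * f (fst p)"
        using z[of p] S(1) r(2) by (cases "p \<in> S \<times> cball x r") (auto simp: case_prod_beta indicator_def subset_iff)
    qed
    also have "\<dots> \<in> borel_measurable (borel \<Otimes>\<^sub>M borel)"
    proof -
      have "(\<lambda>p. (snd p, fst p)) \<in> borel \<Otimes>\<^sub>M borel \<rightarrow>\<^sub>M (borel :: ((real^2) \<times> (real^2)) measure)"
        unfolding borel_prod[symmetric] by measurable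
      from measurable_compose[OF this hm] show ?thesis by simp
    qed
    finally show "?P \<in> borel_measurable borel" by (simp add: borel_prod)
    show "bounded (S \<times> cball x r)" using bounded_D S(1) bounded_subset by (intro bounded_Times) auto
    show "\<bar>?P p\<bar> \<le> 3 / (pi * r\<^sup>2) * \<bar>M\<bar> * \<bar>B\<bar>" for p
    proof (cases "p \<in> S \<times> cball x r")
      case True
      then obtain y z where p: "p = (y, z)" "y \<in> S" "z \<in> cball x r" by auto
      have "\<bar>h y z\<bar> \<le> \<bar>M\<bar>" using M[OF p(2,3)] by linarith
      moreover have "\<bar>bump r (z - x)\<bar> \<le> 3 / (pi * r\<^sup>2)" using bump_le[OF r(1)] bump_nonneg[OF r(1)] by simp
      moreover have "\<bar>f y\<bar> \<le> \<bar>B\<bar>" using fB by (meson abs_ge_self order_trans)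
      ultimately show ?thesis unfolding p abs_mult prod.case by (intro mult_mono) auto
    next
      case False
      then have "?P p = 0" by (rule z)
      then show ?thesis by simp
    qed
  qed (use z in auto)
  have "(LINT z|lborel. bump r (z - x) * (LINT y|lborel. h y z * f y)) = (LINT z|lborel. LINT y|lborel. bump r (z - x) * h y z * f y)"
    unfolding integral_mult_right_zero[symmetric] by (simp add: mult.assoc)
  also have "\<dots> = (LINT y|lborel. LINT z|lborel. bump r (z - x) * h y z * f y)"
    by (rule lborel_pair.Fubini_integral[OF I])
  also have "\<dots> = (LINT y|lborel. (LINT z|lborel. bump r (z - x) * h y z) * f y)"
    by simp
  also have "\<dots> = (LINT y|lborel. h y x * f y)"
  proof (intro Bochner_Integration.integral_cong refl)
    fix y
    show "(LINT z|lborel. bump r (z - x) * h y z) * f y = h y x * f y"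
      using poisson_onD[OF h_poisson r, of y] S by (cases "y \<in> S") auto
  qed
  finally show ?thesis .
qed

text \<open>A density supported in a compact subset of \<open>D\<close> keeps the poles away from
  the frontier, which is why continuity reaches the closure.\<close>

lemma h_integral_compact:
  assumes f: "f \<in> borel_measurable borel" "\<And>y. \<bar>f y\<bar> \<le> B"
    and C: "compact C" "C \<subseteq> D" "\<And>y. y \<notin> C \<Longrightarrow> f y = 0"
  shows "continuous_on (closure D) (\<lambda>x. LINT y|lborel. h y x * f y)"
    and "poisson_on D (\<lambda>x. LINT y|lborel. h y x * f y) (\<lambda>_. 0)"
proof -
  obtain M where M: "\<And>y x. y \<in> C \<Longrightarrow> x \<in> closure D \<Longrightarrow> \<bar>h y x\<bar> \<le> M" using h_bounded[OF C(1,2)] by blast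
  show "continuous_on (closure D) (\<lambda>x. LINT y|lborel. h y x * f y)"
  proof (rule continuous_on_param_integral[OF f(2) compact_imp_bounded[OF C(1)] C(3)])
    show "(\<lambda>y. h y x * f y) \<in> borel_measurable borel" if "x \<in> closure D" for x
      by (rule h_measurable_pole[OF that f(1)]) (use C in auto)
    show "\<bar>h y x\<bar> \<le> M" if "x \<in> closure D" "y \<in> C" for x y using M that by blast
    show "continuous_on (closure D) (h y)" if "y \<in> C" for y using h_cont C that by blast
  qed
  show "poisson_on D (\<lambda>x. LINT y|lborel. h y x * f y) (\<lambda>_. 0)"
    unfolding poisson_on_def
  proof (intro allI impI)
    fix x r assume r: "0 < (r::real)" "cball x r \<subseteq> D"
    have "(LINT z|lborel. bump r (z - x) * (LINT y|lborel. h y z * f y)) = (LINT y|lborel. h y x * f y)"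
      by (rule h_average[OF r f C(2,3), of M]) (use M D_subset_closure r(2) in \<open>auto simp: subset_iff\<close>)
    then show "(LINT y|lborel. h y x * f y) - (LINT z|lborel. bump r (z - x) * (LINT y|lborel. h y z * f y)) = (LINT z|lborel. log_gap r (z - x) * 0)"
      by simp
  qed
qed

text \<open>Minimum principle on \<open>D\<close> without the pole: the sum vanishes on the
  frontier, and near the pole the logarithm outweighs the bounded correction.\<close>

lemma green_nonneg:
  assumes "x \<in> D" "y \<in> D" "x \<noteq> y"
  shows "log_kernel (x - y) + h y x \<ge> 0"
proof -
  let ?U = "D - {y}" and ?w = "\<lambda>x. log_kernel (x - y) + h y x"
  have U: "open ?U" "bounded ?U" using open_D bounded_D bounded_subset by (auto intro: open_delete)
  have lc: "continuous_on S (\<lambda>x. log_kernel (x - y))" if "y \<notin> S" for S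
    by (rule continuous_on_compose2[OF continuous_log_kernel[of "- {0}"]]) (use that in \<open>auto intro!: continuous_intros\<close>)
  have hc: "continuous_on ?U (h y)" using h_cont_D[OF assms(2)] continuous_on_subset by blast
  have wc: "continuous_on ?U ?w" by (intro continuous_intros lc hc) auto
  have wp: "poisson_on ?U ?w (\<lambda>_. 0)"
    by (intro poisson_on_add poisson_on_log_kernel lc hc poisson_on_subset[OF h_poisson[OF assms(2)]]) auto
  have "0 - ?w x \<le> 0"
  proof (rule poisson_max_principle[OF U _ poisson_on_const_diff(1)[OF wp wc, of 0]])
    show "continuous_on ?U (\<lambda>x. 0 - ?w x)" by (intro continuous_intros wc)
    fix e :: real assume e: "0 < e"
    obtain M where M: "\<And>x. x \<in> closure D \<Longrightarrow> \<bar>h y x\<bar> \<le> M"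
      using h_bounded[of "{y}"] assms by auto
    \<comment> \<open>At distance \<open>d\<close> from the pole the logarithmic term equals
      \<open>\<bar>M\<bar>\<close>, a bound for the correction.\<close>
    define d where "d = exp (- 2 * pi * \<bar>M\<bar>)"
    have near: "?w x \<ge> 0" if "x \<in> D" "x \<noteq> y" "norm (x - y) < d" for x
    proof -
      have "norm (x - y) > 0" using that by simp
    then have "ln (norm (x - y)) \<le> ln d" using that(3) by (subst ln_le_cancel_iff) (auto simp: d_def)
      then have "log_kernel (x - y) \<ge> \<bar>M\<bar>" by (simp add: log_kernel_def d_def field_simps)
      then show ?thesis using M[of x] that D_subset_closure by force
    qed
    let ?K = "(closure D - ball y d)"
    let ?C = "?K \<inter> (\<lambda>x. 0 - ?w x) -` {e..}"
    have yK: "y \<notin> ?K" by (simp add: d_def)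
    have "continuous_on ?K (\<lambda>x. 0 - ?w x)"
      by (intro continuous_intros lc yK continuous_on_subset[OF h_cont[OF assms(2)]]) auto
    then have "closed ?C" by (rule continuous_closed_preimage) (auto intro: closed_Diff)
    moreover have "bounded ?C" using bounded_D by (meson Diff_subset bounded_closure bounded_subset inf_le1)
    ultimately have "compact ?C" by (simp add: compact_eq_bounded_closed)
    moreover have "?C \<subseteq> ?U"
    proof
      fix x assume x: "x \<in> ?C"
      then have "x \<noteq> y" using yK by auto
      moreover have "x \<notin> frontier D" using x h_frontier[OF assms(2), of x] e by auto
      ultimately show "x \<in> ?U" using x closure_cases by blast
    qed
    moreover have "\<forall>x\<in>?U - ?C. 0 - ?w x \<le> e"
    proof
      fix x assume x: "x \<in> ?U - ?C"
      show "0 - ?w x \<le> e"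
      proof (cases "x \<in> ball y d")
        case True
        then show ?thesis using near[of x] x e by (auto simp: dist_norm norm_minus_commute)
      next
        case False
        then show ?thesis using x D_subset_closure by auto
      qed
    qed
    ultimately show "\<exists>C. compact C \<and> C \<subseteq> ?U \<and> (\<forall>x\<in>?U - C. 0 - ?w x \<le> e)" by blast
  qed (use assms in auto)
  then show ?thesis by simp
qed

text \<open>The correction term is harmonic in the pole as well: averaging the poles over a disc averages the
  boundary data, and the average of the logarithm over a disc is its value at the centre.\<close>

lemma h_poisson_pole:
  assumes x: "x \<in> D"
  shows "poisson_on D (\<lambda>y. h y x) (\<lambda>_. 0)"
  unfolding poisson_on_def
proof (intro allI impI)
  fix a r assume r: "0 < (r::real)" "cball a r \<subseteq> D"
  have a: "a \<in> D" using r by auto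
  let ?f = "\<lambda>y. bump r (y - a)"
  have f: "?f \<in> borel_measurable borel" "\<And>y. \<bar>?f y\<bar> \<le> 3 / (pi * r\<^sup>2)" "\<And>y. y \<notin> cball a r \<Longrightarrow> ?f y = 0"
    using bump_le[OF r(1)] bump_nonneg[OF r(1)] bump_eq_0[OF r(1)]
    by (auto simp: dist_norm norm_minus_commute)
  note H = h_integral_compact[OF f(1,2) compact_cball r(2) f(3), simplified]
  have "\<bar>(LINT y|lborel. h y x * ?f y) - h a x\<bar> \<le> 0"
  proof (rule harmonic_abs_le_frontier[OF open_D bounded_D, of "\<lambda>x. (LINT y|lborel. h y x * ?f y) - h a x"])
    show "continuous_on (closure D) (\<lambda>x. (LINT y|lborel. h y x * ?f y) - h a x)"
      by (intro continuous_on_diff H h_cont a)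
    show "poisson_on D (\<lambda>x. (LINT y|lborel. h y x * ?f y) - h a x) (\<lambda>_. 0)"
      using poisson_on_diff[OF H(2) continuous_on_subset[OF H(1) D_subset_closure] h_poisson[OF a] h_cont_D[OF a], of 0 0] by simp
    show "x \<in> closure D" using x D_subset_closure by blast
    fix z assume z: "z \<in> frontier D"
    have "z \<notin> cball a r" using z r frontier_not_in by blast
    then have az: "a \<noteq> z" "r \<le> norm (a - z)" using r(1) by (auto simp: dist_norm)
    have "(LINT y|lborel. h y z * ?f y) = (LINT y|lborel. - (bump r (y - a) * log_kernel (y - z)))"
    proof (intro Bochner_Integration.integral_cong refl)
      fix y
      show "h y z * ?f y = - (bump r (y - a) * log_kernel (y - z))"
        using f(3)[of y] h_frontier[OF _ z, of y] r(2) by (cases "y \<in> cball a r") (auto simp: log_kernel_minus[of z y])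
    qed
    also have "\<dots> = - smooth_log r (a - z)" using bump_average_log_kernel[OF r(1) az(1)] by simp
    also have "\<dots> = h a z" using h_frontier[OF a z] smooth_log_eq_log_kernel[OF r(1) az(2)] by (simp add: log_kernel_minus)
    finally show "\<bar>(LINT y|lborel. h y z * ?f y) - h a z\<bar> \<le> 0" by simp
  qed
  then show "h a x - (LINT y|lborel. bump r (y - a) * h y x) = (LINT y|lborel. log_gap r (y - a) * 0)"
    by (simp add: mult.commute)
qed

section \<open>Symmetry of the Green's function\<close>

lemma green_boundary_decay:
  assumes x: "x \<in> D" and e: "0 < e"
  shows "\<exists>C. compact C \<and> C \<subseteq> D \<and> (\<forall>y\<in>D - C. log_kernel (y - x) + h x y \<le> e)"
proof -
  obtain d where d: "0 < d" "cball x d \<subseteq> D" using x open_D open_contains_cball by blast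
  let ?w = "\<lambda>y. log_kernel (y - x) + h x y"
  let ?K = "closure D - ball x d"
  let ?C = "cball x d \<union> (?K \<inter> ?w -` {e..})"
  have "continuous_on ?K ?w"
    by (intro continuous_intros continuous_on_compose2[OF continuous_log_kernel[of "- {0}"]] continuous_on_subset[OF h_cont[OF x]])
       (use d in auto)
  then have "closed (?K \<inter> ?w -` {e..})" by (rule continuous_closed_preimage) (auto intro: closed_Diff)
  moreover have "bounded (?K \<inter> ?w -` {e..})" using bounded_D by (meson Diff_subset bounded_closure bounded_subset inf_le1)
  ultimately have "compact ?C" by (intro compact_Un compact_cball) (simp add: compact_eq_bounded_closed)
  moreover have "?C \<subseteq> D" using d closure_cases h_frontier[OF x] e by force
  moreover have "\<forall>y\<in>D - ?C. ?w y \<le> e" using D_subset_closure by auto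
  ultimately show ?thesis by blast
qed

text \<open>For fixed \<open>x\<close> the difference is harmonic in \<open>y\<close>. Adding and
  subtracting the logarithm shows that near the frontier it is a Green's function tending to 0 minus
  one that is nonnegative. Exchanging the points then gives equality.\<close>

lemma h_symmetric_le:
  assumes x: "x \<in> D" and y: "y \<in> D"
  shows "h x y \<le> h y x"
proof -
  have xc: "x \<in> closure D" using x D_subset_closure by blast
  have "h x y - h y x \<le> 0"
  proof (rule poisson_max_principle[OF open_D bounded_D _ _ _ _ y, of "\<lambda>y. h x y - h y x"])
    show "continuous_on D (\<lambda>y. h x y - h y x)" by (intro continuous_on_diff h_cont_D h_continuous_pole x xc)
    show "poisson_on D (\<lambda>y. h x y - h y x) (\<lambda>_. 0)"
      using poisson_on_diff[OF h_poisson[OF x] h_cont_D[OF x] h_poisson_pole[OF x] h_continuous_pole[OF xc], of 0 0] by simp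
    fix e :: real assume e: "0 < e"
    obtain C where C: "compact C" "C \<subseteq> D" "\<And>y. y \<in> D - C \<Longrightarrow> log_kernel (y - x) + h x y \<le> e"
      using green_boundary_decay[OF x e] by blast
    have "h x y - h y x \<le> e" if "y \<in> D - C" for y
    proof (cases "y = x")
      case False
      then show ?thesis using C(3)[OF that] green_nonneg[OF x, of y] that by (simp add: log_kernel_minus[of x y])
    qed (use e in simp)
    then show "\<exists>C. compact C \<and> C \<subseteq> D \<and> (\<forall>y\<in>D - C. h x y - h y x \<le> e)" using C by blast
  qed auto
  then show ?thesis by simp
qed

lemma h_symmetric: "x \<in> D \<Longrightarrow> y \<in> D \<Longrightarrow> h x y = h y x"
  by (rule antisym[OF h_symmetric_le h_symmetric_le])

end

section \<open>The Green operator\<close>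

lemma smooth_log_le_0: "0 < r \<Longrightarrow> smooth_log r z \<le> smooth_log r 0"
proof -
  assume r: "0 < r"
  have neg: "log_profile1 r x \<le> 0" for x
  proof -
    define n d where "n = 1 + max 0 (1 - x / r\<^sup>2) + (max 0 (1 - x / r\<^sup>2))\<^sup>2" and "d = max x (r\<^sup>2)"
    have "0 < d" using r by (simp add: d_def less_max_iff_disj)
    moreover have "0 \<le> n" unfolding n_def by (intro add_nonneg_nonneg) auto
    moreover have "log_profile1 r x = - n / (4 * pi * d)" by (simp only: log_profile1_def n_def d_def)
    ultimately show ?thesis by (simp add: divide_nonneg_pos)
  qed
  have "log_profile r (z \<bullet> z) \<le> log_profile r 0"
    by (rule DERIV_nonpos_imp_nonincreasing) (use DERIV_log_profile[OF r] neg in auto)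
  then show ?thesis by (simp add: smooth_log_def)
qed

lemma poisson_on_cong_AE:
  assumes "poisson_on U u f" and "f \<in> borel_measurable borel" "g \<in> borel_measurable borel"
    and "AE z in lborel. z \<in> U \<longrightarrow> f z = g z"
  shows "poisson_on U u g"
  unfolding poisson_on_def
proof (intro allI impI)
  fix x r assume r: "0 < (r::real)" "cball x r \<subseteq> U"
  note [measurable] = borel_measurable_kernels(3)[OF r(1)] assms(2,3)
  have "(LINT z|lborel. log_gap r (z - x) * f z) = (LINT z|lborel. log_gap r (z - x) * g z)"
  proof (rule integral_cong_AE)
    show "AE z in lborel. log_gap r (z - x) * f z = log_gap r (z - x) * g z"
      using assms(4)
    proof eventually_elim
      case (elim z)
      have "z \<in> U \<or> r \<le> norm (z - x)" using r(2) by (auto simp: subset_iff dist_norm norm_minus_commute)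
      then show ?case using elim log_gap_eq_0[OF r(1), of "z - x"] by auto
    qed
  qed measurable
  then show "u x - (LINT z|lborel. bump r (z - x) * u z) = (LINT z|lborel. log_gap r (z - x) * g z)"
    using poisson_onD[OF assms(1) r] by simp
qed

lemma compact_exhaustion_measure:
  fixes D :: "'a::euclidean_space set"
  assumes "open D" "bounded D" "0 < e"
  obtains C where "compact C" "C \<subseteq> D" "emeasure lborel (D - C) < ennreal e"
proof -
  obtain T where T: "closed T" "T \<subseteq> D" "emeasure lebesgue (D - T) < ennreal e"
    using sets_lebesgue_inner_closed[of D e] assms borel_open[of D] by (metis sets_completionI_sets sets_lborel)
  have "emeasure lborel (D - T) < ennreal e"
    using T assms by (subst (asm) emeasure_completion) (auto simp: main_part_sets)
  then show ?thesis using T that assms(2) by (meson bounded_subset compact_eq_bounded_closed)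
qed

section \<open>Green potentials of bounded densities on \<open>D\<close>\<close>

context dirichlet_domain
begin

text \<open>Extension by zero lets integrals over the plane stand for integrals over
  \<open>D\<close>. On the diagonal the value is a default, so sign statements exclude it.\<close>

definition green :: "real^2 \<Rightarrow> real^2 \<Rightarrow> real" where
  "green x y = (if x \<in> D \<and> y \<in> D then log_kernel (x - y) + h y x else 0)"

definition green_pot :: "(real^2 \<Rightarrow> real) \<Rightarrow> real^2 \<Rightarrow> real" where
  "green_pot f x = (LINT y|lborel. green x y * f y)"

definition admissible :: "real \<Rightarrow> (real^2 \<Rightarrow> real) \<Rightarrow> bool" where
  "admissible B f \<longleftrightarrow> f \<in> borel_measurable borel \<and> (\<forall>y. \<bar>f y\<bar> \<le> B) \<and> (\<forall>y. y \<notin> D \<longrightarrow> f y = 0)"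

lemma admissibleD:
  assumes "admissible B f"
  shows "f \<in> borel_measurable borel" "\<bar>f y\<bar> \<le> B" "y \<notin> D \<Longrightarrow> f y = 0" "0 \<le> B"
  using assms order_trans[OF abs_ge_zero] by (auto simp: admissible_def)

lemma admissible_integrable: "admissible B f \<Longrightarrow> integrable lborel f"
  using admissibleD by (intro integrable_bounded_support[OF _ bounded_D]) blast+

lemma green_symmetric: "green x y = green y x"
  by (simp add: green_def h_symmetric[of x y] log_kernel_minus[of x y])

lemma green_nonneg': "x \<noteq> y \<Longrightarrow> 0 \<le> green x y"
  by (simp add: green_def green_nonneg)

text \<open>Symmetry moves the compactness requirement from the pole to the argument.\<close>

lemma h_bounded':
  assumes "compact C" "C \<subseteq> D"
  shows "\<exists>M. \<forall>x\<in>C. \<forall>y\<in>D. \<bar>h y x\<bar> \<le> M"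
proof -
  obtain M where "\<forall>y\<in>C. \<forall>x\<in>closure D. \<bar>h y x\<bar> \<le> M" using h_bounded[OF assms] by blast
  then show ?thesis using h_symmetric D_subset_closure assms(2) by (metis subsetD)
qed

lemma green_measurable: "(\<lambda>p. green (fst p) (snd p)) \<in> borel_measurable (borel \<Otimes>\<^sub>M borel)"
proof -
  have hm: "(\<lambda>p. indicator (D \<times> D) p *\<^sub>R h (snd p) (fst p)) \<in> borel_measurable (borel \<Otimes>\<^sub>M borel)"
    unfolding borel_prod
    by (intro borel_measurable_continuous_on_indicator continuous_on_subset[OF h_joint_continuous] borel_open open_Times open_D)
       (use D_subset_closure in auto)
  have im: "(\<lambda>p. indicator (D \<times> D) p :: real) \<in> borel_measurable (borel \<Otimes>\<^sub>M borel)"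
    unfolding borel_prod by (intro borel_measurable_indicator borel_open open_Times open_D)
  have "(\<lambda>p. indicator (D \<times> D) p * log_kernel (fst p - snd p) + indicator (D \<times> D) p *\<^sub>R h (snd p) (fst p)) \<in> borel_measurable (borel \<Otimes>\<^sub>M borel)"
    using borel_measurable_kernels(1) by (intro borel_measurable_add borel_measurable_times hm im) measurable
  moreover have "(\<lambda>p. indicator (D \<times> D) p * log_kernel (fst p - snd p) + indicator (D \<times> D) p *\<^sub>R h (snd p) (fst p)) = (\<lambda>p. green (fst p) (snd p))"
    by (auto simp: fun_eq_iff green_def indicator_def)
  ultimately show ?thesis by (simp only:)
qed

lemma green_measurable1[measurable]: "green x \<in> borel_measurable borel"
proof -
  have "(\<lambda>y. (x, y)) \<in> borel \<rightarrow>\<^sub>M (borel \<Otimes>\<^sub>M borel)" by measurable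
  from measurable_compose[OF this green_measurable] show ?thesis by simp
qed

lemma green_pot_measurable:
  assumes [measurable]: "f \<in> borel_measurable borel"
  shows "green_pot f \<in> borel_measurable borel"
proof -
  have "(\<lambda>p. green (fst p) (snd p) * f (snd p)) \<in> borel_measurable (borel \<Otimes>\<^sub>M lborel)"
    using green_measurable by (simp add: measurable_cong_sets[OF sets_pair_measure_cong[OF refl sets_lborel] refl])
  then have "(\<lambda>x. LINT y|lborel. green x y * f y) \<in> borel_measurable borel"
    by (intro lborel.borel_measurable_lebesgue_integral) (simp add: case_prod_beta)
  then show ?thesis by (simp add: green_pot_def[abs_def])
qed

text \<open>On the frontier the correction is \<open>ln (norm (z - y)) / (2 * pi)\<close>, and a
  bounded domain bounds \<open>norm (z - y)\<close>.\<close>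

lemma h_upper_bound: "\<exists>c. \<forall>x\<in>D. \<forall>y\<in>D. h y x \<le> c"
proof -
  obtain R where R: "D \<subseteq> cball 0 R" using bounded_cball0[OF bounded_D] by blast
  have R': "closure D \<subseteq> cball 0 R" by (rule closure_minimal[OF R]) simp
  have "h y x \<le> ln (2 * \<bar>R\<bar> + 1) / (2 * pi)" if "x \<in> D" "y \<in> D" for x y
  proof (rule harmonic_le_frontier[OF open_D bounded_D h_cont[OF that(2)] h_poisson[OF that(2)]])
    show "x \<in> closure D" using that D_subset_closure by blast
    fix z assume z: "z \<in> frontier D"
    then have "norm z \<le> R" "norm y \<le> R" using R R' that by (auto simp: frontier_def)
    then have "norm (z - y) \<le> 2 * \<bar>R\<bar> + 1" using norm_triangle_ineq4[of z y] by linarith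
    moreover have "norm (z - y) > 0" using z that frontier_not_in by auto
    ultimately have "ln (norm (z - y)) \<le> ln (2 * \<bar>R\<bar> + 1)" by simp
    then show "h y z \<le> ln (2 * \<bar>R\<bar> + 1) / (2 * pi)"
      using h_frontier[OF that(2) z] by (simp add: log_kernel_def divide_right_mono)
  qed
  then show ?thesis by blast
qed

text \<open>A constant depending on \<open>r\<close> only: it splits the Green's function, uniformly
  in both points, into a part with small integral and a bounded part.\<close>

definition green_const :: "real \<Rightarrow> real" where
  "green_const r = (SOME c. 0 \<le> c \<and> (\<forall>x y. x \<noteq> y \<longrightarrow> green x y \<le> log_gap r (y - x) + c))"

lemma green_const:
  assumes r: "0 < r"
  shows "0 \<le> green_const r" and "x \<noteq> y \<Longrightarrow> green x y \<le> log_gap r (y - x) + green_const r"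
proof -
  obtain c where c: "\<And>x y. x \<in> D \<Longrightarrow> y \<in> D \<Longrightarrow> h y x \<le> c" using h_upper_bound by blast
  have "green x y \<le> log_gap r (y - x) + max 0 (smooth_log r 0 + c)" if "x \<noteq> y" for x y
  proof (cases "x \<in> D \<and> y \<in> D")
    case True
    then show ?thesis
      using c[of x y] smooth_log_le_0[OF r, of "y - x"]
      by (simp add: green_def log_gap_def log_kernel_minus[of x y])
  next
    case False
    then show ?thesis using log_gap_nonneg[OF r, of "y - x"] that by (auto simp: green_def)
  qed
  then have "\<exists>c. 0 \<le> c \<and> (\<forall>x y. x \<noteq> y \<longrightarrow> green x y \<le> log_gap r (y - x) + c)"
    by (intro exI[of _ "max 0 (smooth_log r 0 + c)"]) auto
  then have "0 \<le> green_const r \<and> (\<forall>x y. x \<noteq> y \<longrightarrow> green x y \<le> log_gap r (y - x) + green_const r)"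
    unfolding green_const_def by (rule someI_ex)
  then show "0 \<le> green_const r" and "x \<noteq> y \<Longrightarrow> green x y \<le> log_gap r (y - x) + green_const r" by auto
qed

text \<open>The \<open>log_gap\<close> part costs \<open>B r^2 / 16\<close> whatever the mass, while
  the bounded part is proportional to the mass. Choosing first \<open>r\<close> and then the mass
  makes a potential uniformly small.\<close>

lemma green_mult:
  assumes f: "admissible B f" and r: "0 < r"
  shows "integrable lborel (\<lambda>y. green x y * f y)"
    and "(LINT y|lborel. \<bar>green x y * f y\<bar>) \<le> B * r\<^sup>2 / 16 + green_const r * (LINT y|lborel. \<bar>f y\<bar>)"
    and "\<bar>green_pot f x\<bar> \<le> B * r\<^sup>2 / 16 + green_const r * (LINT y|lborel. \<bar>f y\<bar>)"
proof -
  note [measurable] = admissibleD(1)[OF f]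
  note fi = admissible_integrable[OF f]
  have am: "(\<lambda>y. \<bar>f y\<bar>) \<in> borel_measurable borel" "\<And>y. \<bar>\<bar>f y\<bar>\<bar> \<le> B" using admissibleD[OF f] by auto
  let ?w = "\<lambda>y. log_gap r (y - x) * \<bar>f y\<bar> + green_const r * \<bar>f y\<bar>"
  have wi: "integrable lborel ?w"
    using log_gap_mult(1)[OF r am, of x] fi by (intro Bochner_Integration.integrable_add integrable_mult_right) auto
  have nz: "AE y in lborel. y \<noteq> x" by (rule AE_lborel_singleton)
  then have b: "AE y in lborel. \<bar>green x y * f y\<bar> \<le> ?w y"
  proof eventually_elim
    case (elim y)
    then have "\<bar>green x y\<bar> \<le> log_gap r (y - x) + green_const r"
      using green_nonneg'[of x y] green_const(2)[OF r, of x y] by auto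
    then show ?case by (simp add: abs_mult distrib_right[symmetric] mult_right_mono)
  qed
  show I: "integrable lborel (\<lambda>y. green x y * f y)"
    by (rule Bochner_Integration.integrable_bound[OF wi]) (use b in \<open>measurable, auto elim!: eventually_mono\<close>)
  have "(LINT y|lborel. \<bar>green x y * f y\<bar>) \<le> (LINT y|lborel. ?w y)"
    by (rule integral_mono_AE) (use I wi b in auto)
  also have "\<dots> = (LINT y|lborel. log_gap r (y - x) * \<bar>f y\<bar>) + green_const r * (LINT y|lborel. \<bar>f y\<bar>)"
    using log_gap_mult(1)[OF r am, of x] fi by simp
  also have "\<dots> \<le> B * r\<^sup>2 / 16 + green_const r * (LINT y|lborel. \<bar>f y\<bar>)"
    using log_gap_mult(2)[OF r am, of x] by simp
  finally show L: "(LINT y|lborel. \<bar>green x y * f y\<bar>) \<le> B * r\<^sup>2 / 16 + green_const r * (LINT y|lborel. \<bar>f y\<bar>)" .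
  have "\<bar>green_pot f x\<bar> \<le> (LINT y|lborel. \<bar>green x y * f y\<bar>)"
    unfolding green_pot_def by (rule integral_abs_bound)
  with L show "\<bar>green_pot f x\<bar> \<le> B * r\<^sup>2 / 16 + green_const r * (LINT y|lborel. \<bar>f y\<bar>)" by simp
qed

lemma green_pot_bounded:
  "\<exists>K\<ge>0. \<forall>B f x. admissible B f \<longrightarrow> \<bar>green_pot f x\<bar> \<le> K * B \<and> (LINT y|lborel. \<bar>green x y * f y\<bar>) \<le> K * B"
proof -
  let ?K = "1 / 16 + green_const 1 * measure lborel D"
  have fin: "emeasure lborel D < \<infinity>" using bounded_D by (rule emeasure_bounded_finite)
  have bd: "1\<^sup>2 * B / 16 + green_const 1 * (LINT y|lborel. \<bar>f y\<bar>) \<le> ?K * B" if f: "admissible B f" for B f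
  proof -
    have "(LINT y|lborel. \<bar>f y\<bar>) \<le> (LINT y|lborel. B * indicator D y)"
    proof (rule integral_mono)
      show "integrable lborel (\<lambda>y. B * indicator D y :: real)"
        using fin open_D by (intro integrable_mult_right integrable_real_indicator) auto
    qed (use admissible_integrable[OF f] admissibleD[OF f] in \<open>auto simp: indicator_def\<close>)
    also have "\<dots> = B * measure lborel D" using open_D by simp
    finally have "green_const 1 * (LINT y|lborel. \<bar>f y\<bar>) \<le> green_const 1 * (B * measure lborel D)"
      using green_const(1)[of 1] by (intro mult_left_mono) auto
    then show ?thesis by (simp add: algebra_simps)
  qed
  show ?thesis
  proof (intro exI[of _ ?K] conjI allI impI)
    show "0 \<le> ?K" using green_const(1)[of 1] by simp
    fix B f x assume f: "admissible B f"
    show "\<bar>green_pot f x\<bar> \<le> ?K * B" "(LINT y|lborel. \<bar>green x y * f y\<bar>) \<le> ?K * B"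
      using green_mult(2,3)[OF f zero_less_one, of x] bd[OF f] by (simp_all add: algebra_simps)
  qed
qed

lemma green_pot_nonneg: "(\<And>y. 0 \<le> f y) \<Longrightarrow> 0 \<le> green_pot f x"
proof -
  assume f: "\<And>y. 0 \<le> f y"
  have "AE y in lborel. y \<noteq> x" by (rule AE_lborel_singleton)
  then show ?thesis unfolding green_pot_def
    by (intro integral_nonneg_AE) (auto elim!: eventually_mono intro!: mult_nonneg_nonneg green_nonneg' f)
qed

lemma integrable_h_mult:
  assumes f: "admissible B f" and x: "x \<in> D"
  shows "integrable lborel (\<lambda>y. h y x * f y)"
proof -
  obtain M where M: "\<And>y. y \<in> D \<Longrightarrow> \<bar>h y x\<bar> \<le> M" using h_bounded'[of "{x}"] x by auto
  show ?thesis
  proof (rule integrable_bounded_support[OF _ bounded_D])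
    show "(\<lambda>y. h y x * f y) \<in> borel_measurable borel"
      using admissibleD[OF f] x D_subset_closure by (intro h_measurable_pole) auto
    show "\<bar>h y x * f y\<bar> \<le> \<bar>M\<bar> * \<bar>B\<bar>" for y
    proof (cases "y \<in> D")
      case True
      then have "\<bar>h y x\<bar> \<le> \<bar>M\<bar>" "\<bar>f y\<bar> \<le> \<bar>B\<bar>" using M[of y] admissibleD(2)[OF f, of y] by linarith+
      then show ?thesis unfolding abs_mult by (intro mult_mono) auto
    qed (use admissibleD[OF f] in simp)
  qed (use admissibleD[OF f] in simp)
qed

lemma green_pot_eq:
  assumes f: "admissible B f" and x: "x \<in> D"
  shows "green_pot f x = log_potential f x + (LINT y|lborel. h y x * f y)"
proof -
  have "green_pot f x = (LINT y|lborel. log_kernel (x - y) * f y + h y x * f y)"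
    unfolding green_pot_def using admissibleD(3)[OF f] x
    by (intro Bochner_Integration.integral_cong) (auto simp: green_def distrib_right)
  also have "\<dots> = log_potential f x + (LINT y|lborel. h y x * f y)"
    unfolding log_potential_def
    by (intro Bochner_Integration.integral_add integrable_h_mult[OF f x] integrable_log_kernel_mult[where B = B and S = D])
       (use admissibleD[OF f] bounded_D in auto)
  finally show ?thesis .
qed

lemma continuous_h_integral:
  assumes f: "admissible B f"
  shows "continuous_on D (\<lambda>x. LINT y|lborel. h y x * f y)"
proof -
  have "isCont (\<lambda>x. LINT y|lborel. h y x * f y) x" if x: "x \<in> D" for x
  proof -
    obtain d where d: "0 < d" "cball x d \<subseteq> D" using x open_D open_contains_cball by blast
    obtain M where M: "\<And>z y. z \<in> cball x d \<Longrightarrow> y \<in> D \<Longrightarrow> \<bar>h y z\<bar> \<le> M" using h_bounded'[OF compact_cball d(2)] by blast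
    have "continuous_on (cball x d) (\<lambda>x. LINT y|lborel. h y x * f y)"
    proof (rule continuous_on_param_integral[OF admissibleD(2)[OF f] bounded_D admissibleD(3)[OF f]])
      show "(\<lambda>y. h y z * f y) \<in> borel_measurable borel" if "z \<in> cball x d" for z
        using admissibleD[OF f] that d D_subset_closure by (intro h_measurable_pole) auto
      show "\<bar>h y z\<bar> \<le> M" if "z \<in> cball x d" "y \<in> D" for z y using M that by blast
      show "continuous_on (cball x d) (h y)" if "y \<in> D" for y using h_cont_D[OF that] d continuous_on_subset by blast
    qed
    then show ?thesis using d(1) by (meson ball_subset_cball centre_in_ball continuous_on_eq_continuous_at continuous_on_subset open_ball)
  qed
  then show ?thesis by (simp add: continuous_at_imp_continuous_on)
qed

lemma continuous_green_pot: "admissible B f \<Longrightarrow> continuous_on D (green_pot f)"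
proof -
  assume f: "admissible B f"
  have "continuous_on D (\<lambda>x. log_potential f x + (LINT y|lborel. h y x * f y))"
    using admissibleD[OF f] bounded_D
    by (intro continuous_on_add continuous_log_potential continuous_h_integral[OF f]) auto
  then show ?thesis using green_pot_eq[OF f] by (simp cong: continuous_on_cong)
qed

text \<open>The logarithmic potential carries the density, and the potential of the correction
  equals its own averages.\<close>

lemma poisson_on_green_pot:
  assumes f: "admissible B f"
  shows "poisson_on D (green_pot f) f"
  unfolding poisson_on_def
proof (intro allI impI)
  fix x r assume r: "0 < (r::real)" "cball x r \<subseteq> D"
  have x: "x \<in> D" using r by auto
  obtain M where M: "\<And>z y. z \<in> cball x r \<Longrightarrow> y \<in> D \<Longrightarrow> \<bar>h y z\<bar> \<le> M" using h_bounded'[OF compact_cball r(2)] by blast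
  let ?H = "\<lambda>x. LINT y|lborel. h y x * f y"
  have lp: "poisson_on UNIV (log_potential f) f"
    using admissibleD[OF f] bounded_D by (intro poisson_on_log_potential) auto
  have lc: "continuous_on (cball x r) (log_potential f)"
    using admissibleD[OF f] bounded_D by (intro continuous_log_potential) auto
  have hc: "continuous_on (cball x r) ?H" using continuous_h_integral[OF f] r(2) continuous_on_subset by blast
  have "(LINT z|lborel. bump r (z - x) * green_pot f z) = (LINT z|lborel. bump r (z - x) * log_potential f z + bump r (z - x) * ?H z)"
  proof (intro Bochner_Integration.integral_cong refl)
    fix z
    show "bump r (z - x) * green_pot f z = bump r (z - x) * log_potential f z + bump r (z - x) * ?H z"
      using green_pot_eq[OF f, of z] r bump_eq_0[OF r(1), of "z - x"]
      by (cases "z \<in> cball x r") (auto simp: distrib_left dist_norm norm_minus_commute)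
  qed
  also have "\<dots> = (LINT z|lborel. bump r (z - x) * log_potential f z) + (LINT z|lborel. bump r (z - x) * ?H z)"
    by (intro Bochner_Integration.integral_add integrable_bump_mult r lc hc)
  also have "(LINT z|lborel. bump r (z - x) * ?H z) = ?H x"
    using admissibleD[OF f] M by (intro h_average[OF r, where B = B and S = D and M = M]) auto
  finally show "green_pot f x - (LINT z|lborel. bump r (z - x) * green_pot f z) = (LINT z|lborel. log_gap r (z - x) * f z)"
    using poisson_onD[OF lp r(1), of x] green_pot_eq[OF f x] by simp
qed

lemma green_pot_small_mass:
  assumes "0 < e" "0 \<le> B"
  shows "\<exists>d>0. \<forall>f x. admissible B f \<longrightarrow> (LINT y|lborel. \<bar>f y\<bar>) \<le> d \<longrightarrow> \<bar>green_pot f x\<bar> \<le> e"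
proof -
  \<comment> \<open>Chosen so that \<open>B * r^2 / 16\<close> is at most half of
    \<open>e\<close>.\<close>
  define r where "r = sqrt (8 * e / (B + 1))"
  have r: "0 < r" using assms by (simp add: r_def)
  have Br: "B * r\<^sup>2 / 16 \<le> e / 2" using assms by (simp add: r_def field_simps)
  define d where "d = e / 2 / (green_const r + 1)"
  have c: "0 \<le> green_const r" by (rule green_const(1)[OF r])
  have d: "0 < d" "green_const r * d \<le> e / 2" using c assms by (simp_all add: d_def field_simps)
  show ?thesis
  proof (intro exI[of _ d] conjI allI impI d(1))
    fix f x assume f: "admissible B f" "(LINT y|lborel. \<bar>f y\<bar>) \<le> d"
    have "green_const r * (LINT y|lborel. \<bar>f y\<bar>) \<le> green_const r * d" using f(2) c by (rule mult_left_mono)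
    then show "\<bar>green_pot f x\<bar> \<le> e" using green_mult(3)[OF f(1) r, of x] Br d(2) by linarith
  qed
qed

lemma green_pot_diff:
  assumes "admissible B f" "admissible B' g"
  shows "green_pot (\<lambda>y. a * f y - b * g y) x = a * green_pot f x - b * green_pot g x"
    and "green_pot (\<lambda>y. a * f y + b * g y) x = a * green_pot f x + b * green_pot g x"
  unfolding green_pot_def
  using green_mult(1)[OF assms(1) zero_less_one, of x] green_mult(1)[OF assms(2) zero_less_one, of x]
  by (simp_all add: right_diff_distrib distrib_left mult.left_commute)

text \<open>Every admissible potential is dominated by \<open>B\<close> times that of the indicator
  of \<open>D\<close>. A compact \<open>K\<close> that exhausts \<open>D\<close> up to small area
  splits the latter into a part continuous up to the frontier with boundary values 0 and a part with
  uniformly small potential.\<close>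

lemma green_pot_decay:
  assumes e: "0 < e" and B: "0 \<le> B"
  shows "\<exists>C. compact C \<and> C \<subseteq> D \<and> (\<forall>f x. admissible B f \<longrightarrow> x \<notin> C \<longrightarrow> \<bar>green_pot f x\<bar> \<le> e)"
proof -
  \<comment> \<open>Each of the two parts contributes \<open>e'\<close>, hence the requirement
    \<open>2 * B * e' \<le> e\<close>.\<close>
  define e' where "e' = e / (2 * (B + 1))"
  have e': "0 < e'" "2 * B * e' \<le> e" using e B by (auto simp: e'_def field_simps)
  obtain d where d: "0 < d" "\<And>f x. admissible 1 f \<Longrightarrow> (LINT y|lborel. \<bar>f y\<bar>) \<le> d \<Longrightarrow> \<bar>green_pot f x\<bar> \<le> e'"
    using green_pot_small_mass[OF e'(1), of 1] by auto
  obtain K where K: "compact K" "K \<subseteq> D" "emeasure lborel (D - K) < ennreal d"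
    using compact_exhaustion_measure[OF open_D bounded_D d(1)] by blast
  let ?f = "indicator K :: real^2 \<Rightarrow> real" and ?g = "indicator (D - K) :: real^2 \<Rightarrow> real"
  have Ks: "K \<in> sets borel" "D - K \<in> sets borel" using K(1) open_D borel_compact by (auto intro!: sets.Diff)
  have adm: "admissible 1 ?f" "admissible 1 ?g" "admissible 1 (indicator D)"
    using K(2) open_D
    by (auto simp: admissible_def intro!: borel_measurable_indicator Ks split: split_indicator)
  have "(LINT y|lborel. \<bar>?g y\<bar>) = measure lborel (D - K)" using Ks by simp
  also have "\<dots> \<le> d" using K(3) d(1) unfolding measure_def by (intro enn2real_leI) auto
  finally have g: "\<bar>green_pot ?g x\<bar> \<le> e'" for x using d(2)[OF adm(2)] by blast
  \<comment> \<open>The potential of the indicator of \<open>K\<close>, written in the form that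
    makes sense on the closure and vanishes on the frontier.\<close>
  let ?W = "\<lambda>x. log_potential ?f x + (LINT y|lborel. h y x * ?f y)"
  have Wc: "continuous_on (closure D) ?W"
    by (intro continuous_on_add continuous_log_potential[where B = 1 and S = K] h_integral_compact[where B = 1 and C = K])
       (use Ks K compact_imp_bounded in \<open>auto simp: indicator_def\<close>)
  have W0: "?W z = 0" if z: "z \<in> frontier D" for z
  proof -
    have "(LINT y|lborel. h y z * ?f y) = (LINT y|lborel. - (log_kernel (z - y) * ?f y))"
      using h_frontier[OF _ z] K(2) by (intro Bochner_Integration.integral_cong) (auto simp: indicator_def)
    then show ?thesis by (simp add: log_potential_def)
  qed
  let ?C = "closure D \<inter> ?W -` {e'..}"
  have "closed ?C" by (rule continuous_closed_preimage[OF Wc]) auto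
  moreover have "bounded ?C" using bounded_D by (meson bounded_closure bounded_subset inf_le1)
  ultimately have C: "compact ?C" by (simp add: compact_eq_bounded_closed)
  have CD: "?C \<subseteq> D" using W0 e'(1) closure_cases by force
  have D1: "green_pot (indicator D) x \<le> 2 * e'" if x: "x \<in> D" "x \<notin> ?C" for x
  proof -
    have "?W x < e'" using x D_subset_closure by auto
    moreover have "green_pot ?f x = ?W x" by (rule green_pot_eq[OF adm(1) x(1)])
    moreover have "green_pot (indicator D) x = green_pot ?f x + green_pot ?g x"
    proof -
      have eq: "indicator D = (\<lambda>y. 1 * ?f y + 1 * ?g y)" using K(2) by (auto simp: indicator_def fun_eq_iff)
      show ?thesis unfolding eq using green_pot_diff(2)[OF adm(1,2), of 1 1 x] by simp
    qed
    ultimately show ?thesis using g[of x] by linarith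
  qed
  show ?thesis
  proof (intro exI[of _ ?C] conjI allI impI C CD)
    fix f x assume f: "admissible B f" and x: "x \<notin> ?C"
    show "\<bar>green_pot f x\<bar> \<le> e"
    proof (cases "x \<in> D")
      case False
      then show ?thesis using e by (simp add: green_pot_def green_def)
    next
      case True
      have "\<bar>green_pot f x\<bar> \<le> (LINT y|lborel. \<bar>green x y * f y\<bar>)"
        unfolding green_pot_def by (rule integral_abs_bound)
      also have "\<dots> \<le> (LINT y|lborel. B * (green x y * indicator D y))"
      proof (rule integral_mono_AE)
        have "AE y in lborel. y \<noteq> x" by (rule AE_lborel_singleton)
        then show "AE y in lborel. \<bar>green x y * f y\<bar> \<le> B * (green x y * indicator D y)"
        proof eventually_elim
          case (elim y)
          then show ?case using green_nonneg'[of x y] admissibleD(2,3)[OF f, of y]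
            by (auto simp: abs_mult indicator_def mult.commute mult_right_mono)
        qed
      qed (use green_mult(1)[OF f zero_less_one, of x] green_mult(1)[OF adm(3) zero_less_one, of x] in auto)
      also have "\<dots> = B * green_pot (indicator D) x" by (simp add: green_pot_def)
      also have "\<dots> \<le> B * (2 * e')" using D1[OF True x] B by (intro mult_left_mono)
      also have "\<dots> \<le> e" using e' by (simp add: mult.left_commute mult.commute)
      finally show ?thesis .
    qed
  qed
qed

text \<open>Both functions solve the same averaged equation and tend to 0 at the frontier, so the
  maximum principle applies to their difference in both directions.\<close>

lemma green_pot_one:
  assumes p: "poisson_on D \<psi> (\<lambda>_. 1)" and c: "continuous_on (closure D) \<psi>" and b: "\<And>z. z \<in> frontier D \<Longrightarrow> \<psi> z = 0"
    and x: "x \<in> D"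
  shows "green_pot (indicator D) x = \<psi> x"
proof -
  have adm: "admissible 1 (indicator D)" using open_D by (auto simp: admissible_def indicator_def)
  have \<psi>c: "continuous_on D \<psi>" using c D_subset_closure continuous_on_subset by blast
  have "poisson_on D \<psi> (indicator D)"
    by (rule poisson_on_cong_AE[OF p]) (use open_D in auto)
  then have d: "poisson_on D (\<lambda>x. \<psi> x - green_pot (indicator D) x) (\<lambda>_. 0)"
    using poisson_on_diff[OF _ \<psi>c poisson_on_green_pot[OF adm] continuous_green_pot[OF adm], of "indicator D" 1 1] admissibleD(1,2)[OF adm] by simp
  have dc: "continuous_on D (\<lambda>x. \<psi> x - green_pot (indicator D) x)"
    by (intro continuous_on_diff \<psi>c continuous_green_pot[OF adm])
  have d': "poisson_on D (\<lambda>x. 0 - (\<psi> x - green_pot (indicator D) x)) (\<lambda>_. 0)"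
    using poisson_on_const_diff(1)[OF d dc, of 0] by simp
  have bd: "\<exists>C. compact C \<and> C \<subseteq> D \<and> (\<forall>x\<in>D - C. \<bar>\<psi> x - green_pot (indicator D) x\<bar> \<le> e)" if e: "0 < e" for e
  proof -
    obtain C where C: "compact C" "C \<subseteq> D" "\<And>x. x \<notin> C \<Longrightarrow> \<bar>green_pot (indicator D) x\<bar> \<le> e / 2"
      using green_pot_decay[of "e / 2" 1] e adm by auto
    let ?C = "closure D \<inter> (\<lambda>x. \<bar>\<psi> x\<bar>) -` {e / 2..}"
    have "closed ?C" by (rule continuous_closed_preimage) (auto intro!: continuous_intros c)
    moreover have "bounded ?C" using bounded_D by (meson bounded_closure bounded_subset inf_le1)
    ultimately have C2: "compact ?C" by (simp add: compact_eq_bounded_closed)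
    have CD: "?C \<subseteq> D" using b e closure_cases by force
    have "\<bar>\<psi> x - green_pot (indicator D) x\<bar> \<le> e" if "x \<in> D - (C \<union> ?C)" for x
    proof -
      have "\<bar>\<psi> x\<bar> < e / 2" using that D_subset_closure by auto
      then show ?thesis using C(3)[of x] that by auto
    qed
    then show ?thesis using C C2 CD by (intro exI[of _ "C \<union> ?C"]) auto
  qed
  have "\<psi> x - green_pot (indicator D) x \<le> 0"
    by (rule poisson_max_principle[OF open_D bounded_D dc d _ _ x]) (auto, use bd in \<open>meson abs_le_D1\<close>)
  moreover have "0 - (\<psi> x - green_pot (indicator D) x) \<le> 0"
  proof (rule poisson_max_principle[OF open_D bounded_D _ d' _ _ x])
    show "continuous_on D (\<lambda>x. 0 - (\<psi> x - green_pot (indicator D) x))" by (intro continuous_on_diff continuous_on_const dc \<psi>c continuous_green_pot[OF adm])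
    fix e :: real assume "0 < e"
    then obtain C where "compact C" "C \<subseteq> D" "\<forall>x\<in>D - C. \<bar>\<psi> x - green_pot (indicator D) x\<bar> \<le> e" using bd by blast
    then show "\<exists>C. compact C \<and> C \<subseteq> D \<and> (\<forall>x\<in>D - C. 0 - (\<psi> x - green_pot (indicator D) x) \<le> e)" by (intro exI[of _ C]) force
  qed auto
  ultimately show ?thesis by linarith
qed

end

section \<open>Positivity of the energy\<close>

context dirichlet_domain
begin

lemma green_form_symmetric:
  assumes f: "admissible B f" and g: "admissible B' g"
  shows "(LINT x|lborel. f x * green_pot g x) = (LINT x|lborel. g x * green_pot f x)"
proof -
  note [measurable] = admissibleD(1)[OF f] admissibleD(1)[OF g] green_measurable
  obtain K where K0: "0 \<le> K" "\<And>B f x. admissible B f \<Longrightarrow> \<bar>green_pot f x\<bar> \<le> K * B"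
    and K: "\<And>B f x. admissible B f \<Longrightarrow> (LINT y|lborel. \<bar>green x y * f y\<bar>) \<le> K * B"
    using green_pot_bounded by blast
  let ?P = "\<lambda>(x, y). f x * (green x y * g y)"
  have I: "integrable (lborel \<Otimes>\<^sub>M lborel) ?P"
  proof (rule lborel_pair.Fubini_integrable)
    have "(\<lambda>p. f (fst p) * (green (fst p) (snd p) * g (snd p))) \<in> borel_measurable (borel \<Otimes>\<^sub>M borel)"
      by measurable
    then show "?P \<in> borel_measurable (lborel \<Otimes>\<^sub>M lborel)"
      by (simp add: case_prod_beta measurable_cong_sets[OF sets_pair_measure_cong[OF sets_lborel sets_lborel] refl])
    show "AE x in lborel. integrable lborel (\<lambda>y. ?P (x, y))"
      using green_mult(1)[OF g zero_less_one] by simp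
    have eq: "(LINT y|lborel. norm (?P (x, y))) = \<bar>f x\<bar> * (LINT y|lborel. \<bar>green x y * g y\<bar>)" for x
      by (simp add: abs_mult)
    have m: "(\<lambda>x. LINT y|lborel. \<bar>green x y * g y\<bar>) \<in> borel_measurable borel"
    proof -
      have "(\<lambda>p. \<bar>green (fst p) (snd p) * g (snd p)\<bar>) \<in> borel_measurable (borel \<Otimes>\<^sub>M borel)" by measurable
      then have "(\<lambda>p. \<bar>green (fst p) (snd p) * g (snd p)\<bar>) \<in> borel_measurable (borel \<Otimes>\<^sub>M lborel)"
        by (simp add: measurable_cong_sets[OF sets_pair_measure_cong[OF refl sets_lborel] refl])
      then show ?thesis by (intro lborel.borel_measurable_lebesgue_integral) (simp add: case_prod_beta)
    qed
    show "integrable lborel (\<lambda>x. LINT y|lborel. norm (?P (x, y)))"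
      unfolding eq
    proof (rule integrable_bounded_support[OF _ bounded_D])
      show "(\<lambda>x. \<bar>f x\<bar> * (LINT y|lborel. \<bar>green x y * g y\<bar>)) \<in> borel_measurable borel"
        using m by measurable
      show "\<bar>\<bar>f x\<bar> * (LINT y|lborel. \<bar>green x y * g y\<bar>)\<bar> \<le> B * (K * B')" for x
        unfolding abs_mult[of "\<bar>f x\<bar>"] using K[OF g, of x] admissibleD(2)[OF f, of x] admissibleD(4)[OF f]
        by (intro mult_mono) auto
    qed (use admissibleD[OF f] in simp)
  qed
  have "(LINT x|lborel. f x * green_pot g x) = (LINT x|lborel. LINT y|lborel. f x * (green x y * g y))"
    by (simp add: green_pot_def)
  also have "\<dots> = (LINT y|lborel. LINT x|lborel. f x * (green x y * g y))"
    using lborel_pair.Fubini_integral[OF I] by simp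
  also have "\<dots> = (LINT y|lborel. LINT x|lborel. g y * (green y x * f x))"
    by (simp add: green_symmetric mult_ac)
  also have "\<dots> = (LINT x|lborel. g x * green_pot f x)" by (simp add: green_pot_def)
  finally show ?thesis .
qed

end

text \<open>\<open>T\<close> is monotone, within \<open>e\<close> of the identity and 0 on small
  arguments. Applied to a potential that is small near the frontier it produces a compactly
  supported test function.\<close>

lemma soft_threshold:
  fixes e t s :: real
  assumes "0 < e"
  defines "T \<equiv> \<lambda>t. t - max (- e) (min e t)"
  shows "\<bar>t\<bar> \<le> e \<Longrightarrow> T t = 0" "\<bar>T t - t\<bar> \<le> e" "0 \<le> (t - s) * (T t - T s)" "\<bar>T t\<bar> \<le> \<bar>t\<bar>"
proof -
  show "\<bar>t\<bar> \<le> e \<Longrightarrow> T t = 0" "\<bar>T t - t\<bar> \<le> e" "\<bar>T t\<bar> \<le> \<bar>t\<bar>" using assms by (auto simp: T_def min_def max_def)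
  have mono: "T a \<le> T b" if "a \<le> b" for a b using that assms by (auto simp: T_def min_def max_def)
  show "0 \<le> (t - s) * (T t - T s)"
    using mono[of t s] mono[of s t] by (cases "t \<le> s") (auto intro: mult_nonneg_nonneg mult_nonpos_nonpos)
qed

text \<open>Exchanging \<open>x\<close> and \<open>y\<close> shows that twice the integral has the
  integrand \<open>bump r (y - x) * ((u x - u y) * (b x - b y))\<close>. It is a nonlocal
  counterpart of the integral of \<open>grad u \<bullet> grad b\<close>.\<close>

lemma symmetric_form_nonneg:
  fixes u b :: "real^2 \<Rightarrow> real"
  assumes r: "0 < r" and u[measurable]: "u \<in> borel_measurable borel" and uB: "\<And>x. \<bar>u x\<bar> \<le> M"
    and b[measurable]: "b \<in> borel_measurable borel" and bB: "\<And>x. \<bar>b x\<bar> \<le> M"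
    and C: "bounded C" "\<And>x. x \<notin> C \<Longrightarrow> b x = 0"
    and mono: "\<And>x y. 0 \<le> (u x - u y) * (b x - b y)"
  shows "0 \<le> (LINT x|lborel. LINT y|lborel. bump r (y - x) * (b x * (u x - u y)))"
proof -
  let ?F = "\<lambda>(x, y). bump r (y - x) * (b x * (u x - u y))"
  obtain R where R: "C \<subseteq> cball 0 R" using bounded_cball0[OF C(1)] by blast
  have Fm: "?F \<in> borel_measurable (borel \<Otimes>\<^sub>M borel)" unfolding case_prod_beta by measurable
  have z: "?F p = 0" if "p \<notin> cball 0 R \<times> cball 0 (R + r)" for p
  proof (cases p)
    case (Pair x y)
    show ?thesis
    proof (cases "x \<in> C")
      case True
      then have "norm x \<le> R" using R by auto
      then have "norm (y - x) > r" using that Pair norm_triangle_ineq2[of y x] by auto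
      then show ?thesis using Pair r by (simp add: bump_eq_0)
    qed (use Pair C in simp)
  qed
  have I: "integrable (lborel \<Otimes>\<^sub>M lborel) ?F"
    unfolding lborel_prod
  proof (rule integrable_bounded_support[where S = "cball 0 R \<times> cball 0 (R + r)" and B = "3 / (pi * r\<^sup>2) * (M * (2 * M))"])
    show "?F \<in> borel_measurable borel" using Fm by (simp add: borel_prod)
    show "\<bar>?F p\<bar> \<le> 3 / (pi * r\<^sup>2) * (M * (2 * M))" for p
    proof (cases p)
      case (Pair x y)
      have "\<bar>u x - u y\<bar> \<le> 2 * M" using uB[of x] uB[of y] by linarith
      moreover have "0 \<le> M" using bB[of x] by simp
      ultimately show ?thesis unfolding Pair prod.case abs_mult
        using bump_le[OF r, of "y - x"] bump_nonneg[OF r, of "y - x"] bB[of x]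
        by (intro mult_mono) auto
    qed
  qed (use z in \<open>auto intro: bounded_Times\<close>)
  have I': "integrable (lborel \<Otimes>\<^sub>M lborel) (\<lambda>(x, y). ?F (y, x))"
    using lborel_pair.integrable_product_swap[OF I] by (simp add: case_prod_beta)
  let ?J = "LINT x|lborel. LINT y|lborel. ?F (x, y)"
  have J: "?J = integral\<^sup>L (lborel \<Otimes>\<^sub>M lborel) ?F" by (rule lborel_pair.integral_fst'[OF I])
  also have "\<dots> = integral\<^sup>L (lborel \<Otimes>\<^sub>M lborel) (\<lambda>(x, y). ?F (y, x))"
    using lborel_pair.integral_product_swap[of ?F] I by (simp add: case_prod_beta borel_measurable_integrable)
  finally have "2 * ?J = integral\<^sup>L (lborel \<Otimes>\<^sub>M lborel) ?F + integral\<^sup>L (lborel \<Otimes>\<^sub>M lborel) (\<lambda>(x, y). ?F (y, x))"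
    using J by simp
  also have "\<dots> = integral\<^sup>L (lborel \<Otimes>\<^sub>M lborel) (\<lambda>p. ?F p + (\<lambda>(x, y). ?F (y, x)) p)"
    by (rule Bochner_Integration.integral_add[symmetric, OF I I'])
  also have "\<dots> \<ge> 0"
  proof (rule integral_nonneg_AE, rule AE_I2)
    fix p :: "(real^2) \<times> (real^2)"
    obtain x y where p: "p = (x, y)" by (cases p)
    have "?F p + (\<lambda>(x, y). ?F (y, x)) p = bump r (y - x) * ((u x - u y) * (b x - b y))"
      by (simp add: p bump_minus[of r x y] algebra_simps)
    also have "\<dots> \<ge> 0" by (rule mult_nonneg_nonneg[OF bump_nonneg[OF r] mono])
    finally show "0 \<le> ?F p + (\<lambda>(x, y). ?F (y, x)) p" .
  qed
  finally show ?thesis by simp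
qed

text \<open>As \<open>log_gap r\<close> has total mass \<open>r^2 / 16\<close> and lives on the disc
  of radius \<open>r\<close>, uniform continuity of \<open>b\<close> controls the relative
  error.\<close>

lemma log_gap_average_uniform:
  fixes b :: "real^2 \<Rightarrow> real"
  assumes b: "continuous_on UNIV b" and C: "compact C" "\<And>x. x \<notin> C \<Longrightarrow> b x = 0" and e: "0 < e"
  obtains r0 where "0 < r0" "\<And>r x. 0 < r \<Longrightarrow> r < r0 \<Longrightarrow> \<bar>(LINT z|lborel. log_gap r (z - x) * b z) - r\<^sup>2 / 16 * b x\<bar> \<le> e * r\<^sup>2 / 16"
proof -
  obtain R where R: "C \<subseteq> cball 0 R" using bounded_cball0[OF compact_imp_bounded[OF C(1)]] by blast
  have "uniformly_continuous_on (cball 0 (R + 1)) b"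
    by (rule compact_uniformly_continuous) (use b continuous_on_subset in auto)
  then obtain d where d: "0 < d" "\<And>x y. x \<in> cball 0 (R + 1) \<Longrightarrow> y \<in> cball 0 (R + 1) \<Longrightarrow> dist y x < d \<Longrightarrow> dist (b y) (b x) < e"
    unfolding uniformly_continuous_on_def using e by blast
  have close: "\<bar>b z - b x\<bar> \<le> e" if "norm (z - x) < min d 1" for x z
  proof (cases "x \<in> cball 0 (R + 1) \<and> z \<in> cball 0 (R + 1)")
    case True
    then show ?thesis using d(2)[of x z] that by (simp add: dist_norm dist_real_def)
  next
    case False
    have "\<bar>norm z - norm x\<bar> < 1" using norm_triangle_ineq3[of z x] that by linarith
    then have "x \<notin> C" "z \<notin> C" using False R by auto
    then show ?thesis using C(2) e by simp
  qed
  have "bounded (b ` C)" using b C(1) continuous_on_subset by (intro compact_imp_bounded compact_continuous_image) auto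
  then obtain M where M: "\<And>x. x \<in> C \<Longrightarrow> \<bar>b x\<bar> \<le> M" unfolding bounded_iff by auto
  have bM: "\<bar>b x\<bar> \<le> \<bar>M\<bar>" for x using M[of x] C(2)[of x] by (cases "x \<in> C") auto
  have bm[measurable]: "b \<in> borel_measurable borel" using b by (rule borel_measurable_continuous_onI)
  show ?thesis
  proof (rule that[of "min d 1"])
    fix r :: real and x assume r: "0 < r" "r < min d 1"
    note [measurable] = borel_measurable_kernels(3)[OF r(1)]
    let ?c = "\<lambda>z. if norm (z - x) < r then b z - b x else 0"
    have i1: "integrable lborel (\<lambda>z. log_gap r (z - x) * b z)" by (rule log_gap_mult(1)[OF r(1) bm bM])
    have "(LINT z|lborel. log_gap r (z - x) * b z) - r\<^sup>2 / 16 * b x = (LINT z|lborel. log_gap r (z - x) * b z - log_gap r (z - x) * b x)"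
      using i1 integral_log_gap_diff[OF r(1), of x] by simp
    also have "\<dots> = (LINT z|lborel. log_gap r (z - x) * ?c z)"
      using log_gap_eq_0[OF r(1)] by (intro Bochner_Integration.integral_cong) (auto simp: right_diff_distrib)
    also have "\<bar>\<dots>\<bar> \<le> e * r\<^sup>2 / 16"
      by (rule log_gap_mult(2)[OF r(1)]) (use close r e in \<open>measurable, auto\<close>)
    finally show "\<bar>(LINT z|lborel. log_gap r (z - x) * b z) - r\<^sup>2 / 16 * b x\<bar> \<le> e * r\<^sup>2 / 16" .
  qed (use d in simp)
qed

lemma integral_log_gap_swap:
  fixes f b :: "real^2 \<Rightarrow> real"
  assumes r: "0 < r" and f[measurable]: "f \<in> borel_measurable borel" and fB: "\<And>x. \<bar>f x\<bar> \<le> B"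
    and b[measurable]: "b \<in> borel_measurable borel" and bB: "\<And>x. \<bar>b x\<bar> \<le> M"
    and C: "bounded C" "\<And>x. x \<notin> C \<Longrightarrow> b x = 0"
  shows "(LINT x|lborel. b x * (LINT z|lborel. log_gap r (z - x) * f z)) = (LINT z|lborel. f z * (LINT x|lborel. log_gap r (x - z) * b x))"
proof -
  note [measurable] = borel_measurable_kernels(3)[OF r]
  let ?P = "\<lambda>(x, z). b x * (log_gap r (z - x) * f z)"
  have M0: "0 \<le> M" "0 \<le> B" using bB[of 0] fB[of 0] by auto
  have I: "integrable (lborel \<Otimes>\<^sub>M lborel) ?P"
  proof (rule lborel_pair.Fubini_integrable)
    show "?P \<in> borel_measurable (lborel \<Otimes>\<^sub>M lborel)" unfolding case_prod_beta by measurable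
    show "AE x in lborel. integrable lborel (\<lambda>z. ?P (x, z))" using log_gap_mult(1)[OF r f fB] by simp
    have eq: "(LINT z|lborel. norm (?P (x, z))) = \<bar>b x\<bar> * (LINT z|lborel. \<bar>log_gap r (z - x) * f z\<bar>)" for x
      by (simp add: abs_mult)
    have bd: "(LINT z|lborel. \<bar>log_gap r (z - x) * f z\<bar>) \<le> B * r\<^sup>2 / 16" for x
    proof -
      have "AE z in lborel. z \<noteq> x" by (rule AE_lborel_singleton)
      then have "(LINT z|lborel. \<bar>log_gap r (z - x) * f z\<bar>) = (LINT z|lborel. log_gap r (z - x) * \<bar>f z\<bar>)"
        by (intro integral_cong_AE) (measurable, auto elim!: eventually_mono simp: abs_mult log_gap_nonneg[OF r])
      also have "\<dots> \<le> B * r\<^sup>2 / 16" using log_gap_mult(2)[OF r, of "\<lambda>z. \<bar>f z\<bar>" B x] fB by simp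
      finally show ?thesis .
    qed
    show "integrable lborel (\<lambda>x. LINT z|lborel. norm (?P (x, z)))"
      unfolding eq
    proof (rule integrable_bounded_support[OF _ C(1)])
      show "(\<lambda>x. \<bar>b x\<bar> * (LINT z|lborel. \<bar>log_gap r (z - x) * f z\<bar>)) \<in> borel_measurable borel" by measurable
      show "\<bar>\<bar>b x\<bar> * (LINT z|lborel. \<bar>log_gap r (z - x) * f z\<bar>)\<bar> \<le> M * (B * r\<^sup>2 / 16)" for x
        unfolding abs_mult[of "\<bar>b x\<bar>"] using bd[of x] bB[of x] M0 by (intro mult_mono) auto
    qed (simp add: C)
  qed
  have "(LINT x|lborel. b x * (LINT z|lborel. log_gap r (z - x) * f z)) = (LINT x|lborel. LINT z|lborel. b x * (log_gap r (z - x) * f z))"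
    by simp
  also have "\<dots> = (LINT z|lborel. LINT x|lborel. b x * (log_gap r (z - x) * f z))"
    using lborel_pair.Fubini_integral[OF I] by simp
  also have "\<dots> = (LINT z|lborel. LINT x|lborel. f z * (log_gap r (x - z) * b x))"
    by (simp add: log_gap_minus mult_ac)
  also have "\<dots> = (LINT z|lborel. f z * (LINT x|lborel. log_gap r (x - z) * b x))"
    by simp
  finally show ?thesis .
qed

context dirichlet_domain
begin

text \<open>The energy is tested against a truncation of the potential that vanishes near the boundary, so that
  no boundary regularity is needed; \<^const>\<open>bump\<close> averages replace the Dirichlet form.\<close>

lemma green_energy_nonneg:
  assumes f: "admissible B f"
  shows "0 \<le> (LINT x|lborel. f x * green_pot f x)"
proof -
  let ?u = "green_pot f"
  note fm[measurable] = admissibleD(1)[OF f]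
  note fi = admissible_integrable[OF f]
  have um[measurable]: "?u \<in> borel_measurable borel" by (rule green_pot_measurable[OF fm])
  obtain K where K: "0 \<le> K" "\<And>B f x. admissible B f \<Longrightarrow> \<bar>green_pot f x\<bar> \<le> K * B"
    and K': "\<And>B f x. admissible B f \<Longrightarrow> (LINT y|lborel. \<bar>green x y * f y\<bar>) \<le> K * B"
    using green_pot_bounded by blast
  have uB: "\<bar>?u x\<bar> \<le> K * B" for x by (rule K(2)[OF f])
  define A where "A = (LINT x|lborel. \<bar>f x\<bar>)"
  have A: "0 \<le> A" by (simp add: A_def)
  have fuI: "integrable lborel (\<lambda>x. f x * ?u x)"
  proof (rule integrable_bounded_support[OF _ bounded_D])
    show "\<bar>f x * ?u x\<bar> \<le> B * (K * B)" for x
      unfolding abs_mult using uB[of x] admissibleD(2,4)[OF f] by (intro mult_mono) auto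
  qed (use admissibleD(3)[OF f] in auto)
  \<comment> \<open>The error \<open>2 * e * A\<close> consists of \<open>e * A\<close> for
    replacing the \<open>log_gap\<close> average of \<open>b\<close> by \<open>b\<close> itself, and
    \<open>e * A\<close> for replacing the potential by its truncation \<open>b\<close>.\<close>
  have main: "- (2 * e * A) \<le> (LINT x|lborel. f x * ?u x)" if e: "0 < e" for e
  proof -
    obtain C where C: "compact C" "C \<subseteq> D" and C': "\<And>f x. admissible B f \<Longrightarrow> x \<notin> C \<Longrightarrow> \<bar>green_pot f x\<bar> \<le> e"
      using green_pot_decay[OF e admissibleD(4)[OF f]] by blast
    define T where "T t = t - max (- e) (min e t)" for t
    note T = soft_threshold[OF e, folded T_def]
    define b where "b x = T (?u x)" for x
    have b0: "b x = 0" if "x \<notin> C" for x using T(1)[OF C'[OF f that]] by (simp add: b_def)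
    have bc: "continuous_on UNIV b"
    proof -
      have "continuous_on D b" unfolding b_def[abs_def] T_def
        by (intro continuous_intros continuous_green_pot[OF f])
      moreover have "continuous_on (- C) b" by (rule continuous_on_eq[OF continuous_on_const[of _ 0]]) (use b0 in auto)
      ultimately have "continuous_on (D \<union> - C) b"
        using open_D C(1) by (intro continuous_on_open_Un) (auto simp: compact_imp_closed)
      moreover have "D \<union> - C = UNIV" using C(2) by blast
      ultimately show ?thesis by simp
    qed
    have bm[measurable]: "b \<in> borel_measurable borel" using bc by (rule borel_measurable_continuous_onI)
    have bB: "\<bar>b x\<bar> \<le> K * B" for x unfolding b_def by (rule order_trans[OF T(4) uB])
    obtain r0 where r0: "0 < r0" "\<And>r x. 0 < r \<Longrightarrow> r < r0 \<Longrightarrow> \<bar>(LINT z|lborel. log_gap r (z - x) * b z) - r\<^sup>2 / 16 * b x\<bar> \<le> e * r\<^sup>2 / 16"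
      using log_gap_average_uniform[OF bc C(1) b0 e] by blast
    obtain r1 where r1: "0 < r1" "\<And>x. x \<in> C \<Longrightarrow> cball x r1 \<subseteq> D"
    proof -
      obtain d where d: "0 < d" "(\<Union>x\<in>C. cball x d) \<subseteq> D"
        using compact_subset_open_imp_cball_epsilon_subset[OF C(1) open_D C(2)] by blast
      show ?thesis by (rule that[of d]) (use d in blast)+
    qed
    \<comment> \<open>Discs of radius \<open>r\<close> about points of \<open>C\<close> lie in
      \<open>D\<close>, and \<open>log_gap r\<close> averages of \<open>b\<close> are accurate up to
      \<open>e\<close>.\<close>
    define r where "r = min r0 r1 / 2"
    have r: "0 < r" "r < r0" "r < r1" using r0 r1 by (auto simp: r_def)
    have fbI: "integrable lborel (\<lambda>x. f x * b x)"
    proof (rule integrable_bounded_support[OF _ bounded_D])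
      show "\<bar>f x * b x\<bar> \<le> B * (K * B)" for x
        unfolding abs_mult using bB[of x] admissibleD(2,4)[OF f] by (intro mult_mono) auto
    qed (use admissibleD(3)[OF f] in auto)
    have "0 \<le> (LINT x|lborel. LINT y|lborel. bump r (y - x) * (b x * (?u x - ?u y)))"
      by (rule symmetric_form_nonneg[OF r(1) um uB bm bB compact_imp_bounded[OF C(1)] b0])
         (use T(3) in \<open>auto simp: b_def\<close>)
    \<comment> \<open>By the averaged equation the deviation of the potential from its mean is the
      \<open>log_gap\<close> integral of \<open>f\<close>; off \<open>C\<close> both sides vanish
      with \<open>b\<close>.\<close>
    also have "\<dots> = (LINT x|lborel. b x * (LINT z|lborel. log_gap r (z - x) * f z))"
    proof (intro Bochner_Integration.integral_cong refl)
      fix x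
      show "(LINT y|lborel. bump r (y - x) * (b x * (?u x - ?u y))) = b x * (LINT z|lborel. log_gap r (z - x) * f z)"
      proof (cases "x \<in> C")
        case True
        then have cD: "cball x r \<subseteq> D" using r1(2)[OF True] subset_cball[of r r1 x] r by auto
        have i: "integrable lborel (\<lambda>z. bump r (z - x) * ?u z)"
          by (rule integrable_bump_mult[OF r(1) continuous_on_subset[OF continuous_green_pot[OF f] cD]])
        have "(LINT y|lborel. bump r (y - x) * (b x * (?u x - ?u y))) = (LINT y|lborel. b x * (bump r (y - x) * ?u x - bump r (y - x) * ?u y))"
          by (simp add: algebra_simps)
        also have "\<dots> = b x * (?u x - (LINT y|lborel. bump r (y - x) * ?u y))"
          using i integrable_bump_diff[OF r(1), of x] integral_bump_diff[OF r(1), of x] by simp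
        finally show ?thesis using poisson_onD[OF poisson_on_green_pot[OF f] r(1) cD] by simp
      qed (simp add: b0)
    qed
    also have "\<dots> = (LINT z|lborel. f z * (LINT x|lborel. log_gap r (x - z) * b x))"
      by (rule integral_log_gap_swap[OF r(1) fm admissibleD(2)[OF f] bm bB compact_imp_bounded[OF C(1)] b0])
    also have "\<dots> \<le> (LINT z|lborel. r\<^sup>2 / 16 * (f z * b z) + e * r\<^sup>2 / 16 * \<bar>f z\<bar>)"
    proof (rule integral_mono)
      have *: "\<bar>(LINT z|lborel. log_gap r (z - x) * b z)\<bar> \<le> K * B * r\<^sup>2 / 16" for x by (rule log_gap_mult(2)[OF r(1) bm bB])
      have [measurable]: "(\<lambda>z. LINT x|lborel. log_gap r (x - z) * b x) \<in> borel_measurable borel"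
        using borel_measurable_kernels(3)[OF r(1)] by measurable
      show "integrable lborel (\<lambda>z. f z * (LINT x|lborel. log_gap r (x - z) * b x))"
      proof (rule integrable_bounded_support[OF _ bounded_D])
        show "\<bar>f z * (LINT x|lborel. log_gap r (x - z) * b x)\<bar> \<le> B * (K * B * r\<^sup>2 / 16)" for z
          unfolding abs_mult using *[of z] admissibleD(2,4)[OF f] by (intro mult_mono) auto
      qed (use admissibleD(3)[OF f] in auto)
      show "integrable lborel (\<lambda>z. r\<^sup>2 / 16 * (f z * b z) + e * r\<^sup>2 / 16 * \<bar>f z\<bar>)"
        using fbI fi by (intro Bochner_Integration.integrable_add integrable_mult_right) auto
      fix z
      have "f z * ((LINT x|lborel. log_gap r (x - z) * b x) - r\<^sup>2 / 16 * b z) \<le> \<bar>f z\<bar> * (e * r\<^sup>2 / 16)"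
        using mult_left_mono[OF r0(2)[OF r(1,2), of z], of "\<bar>f z\<bar>"] by (simp add: abs_mult[symmetric])
      then show "f z * (LINT x|lborel. log_gap r (x - z) * b x) \<le> r\<^sup>2 / 16 * (f z * b z) + e * r\<^sup>2 / 16 * \<bar>f z\<bar>"
        by (simp add: algebra_simps)
    qed
    also have "\<dots> = r\<^sup>2 / 16 * ((LINT z|lborel. f z * b z) + e * A)"
      using fbI fi by (simp add: A_def distrib_left)
    finally have 1: "0 \<le> (LINT z|lborel. f z * b z) + e * A"
      using r(1) by (simp add: zero_le_mult_iff)
    have "(LINT z|lborel. f z * b z) \<le> (LINT z|lborel. f z * ?u z + e * \<bar>f z\<bar>)"
    proof (rule integral_mono[OF fbI])
      show "integrable lborel (\<lambda>z. f z * ?u z + e * \<bar>f z\<bar>)" using fuI fi by auto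
      fix z
      have "f z * (b z - ?u z) \<le> \<bar>f z\<bar> * e"
        using mult_left_mono[OF T(2)[of "?u z"], of "\<bar>f z\<bar>"] by (simp add: b_def abs_mult[symmetric])
      then show "f z * b z \<le> f z * ?u z + e * \<bar>f z\<bar>" by (simp add: algebra_simps)
    qed
    also have "\<dots> = (LINT z|lborel. f z * ?u z) + e * A" using fuI fi by (simp add: A_def)
    finally show ?thesis using 1 by linarith
  qed
  show ?thesis
  proof (rule field_le_epsilon)
    fix e :: real assume e: "0 < e"
    have "2 * (e / (2 * (A + 1))) * A \<le> e" using A e by (simp add: field_simps)
    then show "0 \<le> (LINT x|lborel. f x * ?u x) + e" using main[of "e / (2 * (A + 1))"] A e by simp
  qed
qed

end

section \<open>Energy minimisers\<close>

text \<open>An exchange argument: if \<open>v\<close> had room where \<open>\<psi>\<close> is at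
  least \<open>b\<close> and mass where it is at most \<open>a < b\<close>, moving equal mass
  upwards would increase the integral. The level is the supremum of the values at or below which
  \<open>v\<close> carries no mass.\<close>

lemma bathtub:
  fixes \<psi> v :: "real^2 \<Rightarrow> real"
  assumes S[measurable]: "S \<in> sets borel" and bS: "bounded S"
    and \<psi>[measurable]: "\<psi> \<in> borel_measurable borel" and M: "\<And>y. \<bar>\<psi> y\<bar> \<le> M"
    and v[measurable]: "v \<in> borel_measurable borel" and v01: "\<And>y. 0 \<le> v y" "\<And>y. v y \<le> 1"
    and mass: "0 < (LINT y|lborel. indicator S y * v y)"
    and opt: "\<And>w. w \<in> borel_measurable borel \<Longrightarrow> (\<And>y. 0 \<le> w y) \<Longrightarrow> (\<And>y. w y \<le> 1) \<Longrightarrow>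
       (\<And>y. y \<notin> S \<Longrightarrow> w y = v y) \<Longrightarrow>
       (LINT y|lborel. indicator S y * w y) = (LINT y|lborel. indicator S y * v y) \<Longrightarrow>
       (LINT y|lborel. indicator S y * (\<psi> y * w y)) \<le> (LINT y|lborel. indicator S y * (\<psi> y * v y))"
  shows "\<exists>\<mu>. AE y in lborel. y \<in> S \<longrightarrow> (\<mu> < \<psi> y \<longrightarrow> v y = 1) \<and> (\<psi> y < \<mu> \<longrightarrow> v y = 0)"
proof -
  have int: "integrable lborel f" if "f \<in> borel_measurable borel" "\<And>y. y \<notin> S \<Longrightarrow> f y = 0" "\<And>y. \<bar>f y\<bar> \<le> B"
    for f :: "real^2 \<Rightarrow> real" and B
    using integrable_bounded_support[OF that(1) bS that(2,3)] .
  \<comment> \<open>Nonempty because \<open>\<psi>\<close> is bounded below, bounded above because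
    \<open>v\<close> has positive mass on \<open>S\<close>.\<close>
  define A where "A = {a. AE y in lborel. y \<in> S \<longrightarrow> \<psi> y \<le> a \<longrightarrow> v y = 0}"
  have down: "b \<in> A" if "a \<in> A" "b \<le> a" for a b
    using that unfolding A_def by (auto elim!: eventually_mono)
  have "- M - 1 \<in> A" using M unfolding A_def by (auto intro!: AE_I2) (smt (verit) M)
  then have ne: "A \<noteq> {}" by blast
  have bdd: "a < M" if "a \<in> A" for a
  proof (rule ccontr)
    assume "\<not> a < M"
    then have *: "\<psi> y \<le> a" for y using M[of y] by linarith
    have "AE y in lborel. indicator S y * v y = 0"
      using that unfolding A_def by (auto elim!: eventually_mono simp: * indicator_def)
    then have "(LINT y|lborel. indicator S y * v y) = 0" by (rule integral_eq_zero_AE)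
    then show False using mass by simp
  qed
  then have bddA: "bdd_above A" by (meson bdd_aboveI less_imp_le)
  define \<mu> where "\<mu> = Sup A"
  have lowA: "a \<in> A" if "a < \<mu>" for a
    using that less_cSup_iff[OF ne bddA] down unfolding \<mu>_def by (meson less_imp_le)
  have highA: "a \<notin> A" if "\<mu> < a" for a
    using that cSup_upper[OF _ bddA, of a] unfolding \<mu>_def by auto
  have low: "AE y in lborel. y \<in> S \<longrightarrow> \<psi> y < \<mu> \<longrightarrow> v y = 0"
  proof -
    have "\<forall>n. AE y in lborel. y \<in> S \<longrightarrow> \<psi> y \<le> \<mu> - 1 / real (Suc n) \<longrightarrow> v y = 0"
      using lowA[of "\<mu> - 1 / real (Suc n)" for n] unfolding A_def by simp
    then have "AE y in lborel. \<forall>n. y \<in> S \<longrightarrow> \<psi> y \<le> \<mu> - 1 / real (Suc n) \<longrightarrow> v y = 0"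
      by (rule AE_all_countable[THEN iffD2])
    then show ?thesis
    proof eventually_elim
      case (elim y)
      show ?case
      proof (intro impI)
        assume y: "y \<in> S" "\<psi> y < \<mu>"
        then obtain n where "1 / real (Suc n) < \<mu> - \<psi> y"
          using nat_approx_posE[of "\<mu> - \<psi> y"] by auto
        then show "v y = 0" using elim y by (metis less_imp_le less_diff_eq add.commute)
      qed
    qed
  qed
  have high: "AE y in lborel. y \<in> S \<longrightarrow> b \<le> \<psi> y \<longrightarrow> v y = 1" if b: "\<mu> < b" for b
  proof (rule ccontr)
    assume nb: "\<not> (AE y in lborel. y \<in> S \<longrightarrow> b \<le> \<psi> y \<longrightarrow> v y = 1)"
    define a where "a = (\<mu> + b) / 2"
    have ab: "\<mu> < a" "a < b" using b by (auto simp: a_def)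
    \<comment> \<open>\<open>p\<close> is the room left at values of at least \<open>b\<close>,
      \<open>q\<close> the mass lying at values of at most \<open>a\<close>; both have positive
      integral.\<close>
    define p where "p y = (if y \<in> S \<and> b \<le> \<psi> y then 1 - v y else 0)" for y
    define q where "q y = (if y \<in> S \<and> \<psi> y \<le> a then v y else 0)" for y
    have pm[measurable]: "p \<in> borel_measurable borel" and qm[measurable]: "q \<in> borel_measurable borel"
      unfolding p_def[abs_def] q_def[abs_def] by measurable
    have p01: "0 \<le> p y" "p y \<le> 1 - v y" and q01: "0 \<le> q y" "q y \<le> v y" and pq: "p y = 0 \<or> q y = 0"
      and S0: "y \<notin> S \<Longrightarrow> p y = 0" "y \<notin> S \<Longrightarrow> q y = 0" for y
      using v01[of y] ab by (auto simp: p_def q_def)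
    have pb: "\<bar>p y\<bar> \<le> 1" "\<bar>q y\<bar> \<le> 1" for y using p01[of y] q01[of y] v01[of y] by auto
    have pi: "integrable lborel p" by (rule int[OF pm S0(1) pb(1)])
    have qi: "integrable lborel q" by (rule int[OF qm S0(2) pb(2)])
    have pp: "0 < integral\<^sup>L lborel p"
    proof (rule ccontr)
      assume "\<not> 0 < integral\<^sup>L lborel p"
      then have "integral\<^sup>L lborel p = 0" using Bochner_Integration.integral_nonneg[of lborel p, OF p01(1)] by linarith
      then have "AE y in lborel. p y = 0" using integral_nonneg_eq_0_iff_AE[OF pi] p01 by simp
      then have "AE y in lborel. y \<in> S \<longrightarrow> b \<le> \<psi> y \<longrightarrow> v y = 1"
        by eventually_elim (simp add: p_def split: if_splits)
      then show False using nb by contradiction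
    qed
    have qq: "0 < integral\<^sup>L lborel q"
    proof (rule ccontr)
      assume "\<not> 0 < integral\<^sup>L lborel q"
      then have "integral\<^sup>L lborel q = 0" using Bochner_Integration.integral_nonneg[of lborel q, OF q01(1)] by linarith
      then have "AE y in lborel. q y = 0" using integral_nonneg_eq_0_iff_AE[OF qi] q01 by simp
      then have "AE y in lborel. y \<in> S \<longrightarrow> \<psi> y \<le> a \<longrightarrow> v y = 0"
        by eventually_elim (simp add: q_def split: if_splits)
      then have "a \<in> A" unfolding A_def by simp
      then show False using highA[OF ab(1)] by simp
    qed
    \<comment> \<open>The largest amount that can be moved; the factors \<open>cp\<close> and
      \<open>cq\<close> make gain and loss of mass equal.\<close>
    define t where "t = min (integral\<^sup>L lborel p) (integral\<^sup>L lborel q)"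
    define cp where "cp = t / integral\<^sup>L lborel p"
    define cq where "cq = t / integral\<^sup>L lborel q"
    have c: "0 < cp" "cp \<le> 1" "0 < cq" "cq \<le> 1" "cp * integral\<^sup>L lborel p = t" "cq * integral\<^sup>L lborel q = t" "0 < t"
      using pp qq by (auto simp: cp_def cq_def t_def)
    define w where "w y = v y + (cp * p y - cq * q y)" for y
    have wm: "w \<in> borel_measurable borel" unfolding w_def[abs_def] by measurable
    have cpq: "0 \<le> cp * p y" "cp * p y \<le> p y" "0 \<le> cq * q y" "cq * q y \<le> q y" for y
      using c p01[of y] q01[of y] by (auto simp: mult_left_le_one_le)
    have w01: "0 \<le> w y" "w y \<le> 1" for y
      using cpq[of y] p01[of y] q01[of y] v01[of y] pq[of y] by (auto simp: w_def)
    have vi: "integrable lborel (\<lambda>y. indicator S y * v y)"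
      by (rule int[of _ 1]) (use v01 in \<open>auto simp: indicator_def\<close>)
    have S1: "indicator S y * p y = p y" "indicator S y * q y = q y" for y
      using S0[of y] by (auto simp: indicator_def)
    have eq: "indicator S y * w y = indicator S y * v y + (cp * p y - cq * q y)" for y
      using S0[of y] by (auto simp: w_def indicator_def)
    have "(LINT y|lborel. indicator S y * w y) = (LINT y|lborel. indicator S y * v y) + (cp * integral\<^sup>L lborel p - cq * integral\<^sup>L lborel q)"
      unfolding eq using vi pi qi by simp
    then have "(LINT y|lborel. indicator S y * w y) = (LINT y|lborel. indicator S y * v y)" using c by simp
    then have le: "(LINT y|lborel. indicator S y * (\<psi> y * w y)) \<le> (LINT y|lborel. indicator S y * (\<psi> y * v y))"
      by (intro opt wm w01) (simp_all add: w_def S0)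
    have M0: "0 \<le> M" using M[of 0] by linarith
    have bnd: "\<bar>\<psi> y * f y\<bar> \<le> M" if "0 \<le> f y" "f y \<le> 1" for f :: "real^2 \<Rightarrow> real" and y
      unfolding abs_mult using M[of y] that M0 mult_mono[of "\<bar>\<psi> y\<bar>" M "\<bar>f y\<bar>" 1] by simp
    have "p y \<le> 1" "q y \<le> 1" for y using p01[of y] q01[of y] v01[of y] by linarith+
    then have ii: "integrable lborel (\<lambda>y. indicator S y * (\<psi> y * v y))" "integrable lborel (\<lambda>y. \<psi> y * p y)" "integrable lborel (\<lambda>y. \<psi> y * q y)"
      using S0 bnd[of v] bnd[of p] bnd[of q] v01 p01 q01 M0
      by (intro int[of _ M]; simp add: indicator_def)+
    have "indicator S y * (\<psi> y * w y) = indicator S y * (\<psi> y * v y) + (cp * (\<psi> y * p y) - cq * (\<psi> y * q y))" for y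
      using S0[of y] by (auto simp: w_def indicator_def algebra_simps)
    then have "(LINT y|lborel. indicator S y * (\<psi> y * w y)) = (LINT y|lborel. indicator S y * (\<psi> y * v y)) +
       (cp * (LINT y|lborel. \<psi> y * p y) - cq * (LINT y|lborel. \<psi> y * q y))"
      using ii by simp
    then have "cp * (LINT y|lborel. \<psi> y * p y) \<le> cq * (LINT y|lborel. \<psi> y * q y)" using le by simp
    moreover have "b * integral\<^sup>L lborel p \<le> (LINT y|lborel. \<psi> y * p y)"
    proof -
      have "(LINT y|lborel. b * p y) \<le> (LINT y|lborel. \<psi> y * p y)"
      proof (rule integral_mono[OF _ ii(2)])
        show "b * p y \<le> \<psi> y * p y" for y
          using p01(1)[of y] by (cases "p y = 0") (auto simp: p_def split: if_splits intro: mult_right_mono)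
      qed (use pi in simp)
      then show ?thesis by simp
    qed
    moreover have "(LINT y|lborel. \<psi> y * q y) \<le> a * integral\<^sup>L lborel q"
    proof -
      have "(LINT y|lborel. \<psi> y * q y) \<le> (LINT y|lborel. a * q y)"
      proof (rule integral_mono[OF ii(3)])
        show "\<psi> y * q y \<le> a * q y" for y
          using q01(1)[of y] by (cases "q y = 0") (auto simp: q_def split: if_splits intro: mult_right_mono)
      qed (use qi in simp)
      then show ?thesis by simp
    qed
    ultimately have "cp * (b * integral\<^sup>L lborel p) \<le> cq * (a * integral\<^sup>L lborel q)"
      using c by (meson mult_left_mono less_imp_le order_trans)
    then have "b * t \<le> a * t" using c by (metis mult.left_commute)
    then show False using ab c by simp
  qed
  have "AE y in lborel. y \<in> S \<longrightarrow> \<mu> < \<psi> y \<longrightarrow> v y = 1"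
  proof -
    have "\<forall>n. AE y in lborel. y \<in> S \<longrightarrow> \<mu> + 1 / real (Suc n) \<le> \<psi> y \<longrightarrow> v y = 1"
      using high by simp
    then have "AE y in lborel. \<forall>n. y \<in> S \<longrightarrow> \<mu> + 1 / real (Suc n) \<le> \<psi> y \<longrightarrow> v y = 1"
      by (rule AE_all_countable[THEN iffD2])
    then show ?thesis
    proof eventually_elim
      case (elim y)
      show ?case
      proof (intro impI)
        assume y: "y \<in> S" "\<mu> < \<psi> y"
        then obtain n where "1 / real (Suc n) < \<psi> y - \<mu>"
          using nat_approx_posE[of "\<psi> y - \<mu>"] by auto
        then show "v y = 1" using elim y by (metis less_imp_le less_diff_eq add.commute)
      qed
    qed
  qed
  then have "AE y in lborel. y \<in> S \<longrightarrow> (\<mu> < \<psi> y \<longrightarrow> v y = 1) \<and> (\<psi> y < \<mu> \<longrightarrow> v y = 0)"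
    using low by eventually_elim blast
  then show ?thesis by blast
qed

text \<open>Convex relaxation of the characteristic functions of patches with prescribed areas. It
  is stable under convex combinations and, up to null sets, under almost everywhere limits.\<close>

definition patch_class :: "('k::finite \<Rightarrow> (real^2) set) \<Rightarrow> ('k \<Rightarrow> real) \<Rightarrow> (real^2 \<Rightarrow> real) set" where
  "patch_class S \<kappa> = {v. v \<in> borel_measurable borel \<and> (\<forall>y. 0 \<le> v y \<and> v y \<le> 1) \<and> (\<forall>y. y \<notin> (\<Union>i. S i) \<longrightarrow> v y = 0) \<and>
     (\<forall>i. (LINT y|lborel. indicator (S i) y * v y) = \<kappa> i)}"

lemma patch_classD:
  assumes "v \<in> patch_class S \<kappa>"
  shows "v \<in> borel_measurable borel" "0 \<le> v y" "v y \<le> 1" "y \<notin> (\<Union>i. S i) \<Longrightarrow> v y = 0"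
    "(LINT y|lborel. indicator (S i) y * v y) = \<kappa> i"
  using assms by (auto simp: patch_class_def)

lemma patch_class_convex:
  assumes S: "\<And>i. bounded (S i)" "\<And>i. S i \<in> sets borel" and v: "v \<in> patch_class S \<kappa>" "w \<in> patch_class S \<kappa>" and t: "0 \<le> t" "t \<le> 1"
  shows "(\<lambda>y. (1 - t) * v y + t * w y) \<in> patch_class S \<kappa>"
proof -
  note [measurable] = patch_classD(1)[OF v(1)] patch_classD(1)[OF v(2)] S(2)
  have i: "integrable lborel (\<lambda>y. indicator (S i) y * u y)" if "u \<in> patch_class S \<kappa>" for u i
    using patch_classD(1-3)[OF that] S by (intro integrable_bounded_support[OF _ S(1)[of i], of _ 1]) (auto simp: indicator_def)
  show ?thesis unfolding patch_class_def
  proof (intro CollectI conjI allI impI)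
    show "(\<lambda>y. (1 - t) * v y + t * w y) \<in> borel_measurable borel" by measurable
    fix y
    show "0 \<le> (1 - t) * v y + t * w y" using patch_classD(2)[OF v(1), of y] patch_classD(2)[OF v(2), of y] t by simp
    show "(1 - t) * v y + t * w y \<le> 1"
      using convex_bound_le[of "v y" 1 "w y" "1 - t" t] patch_classD(3)[OF v(1), of y] patch_classD(3)[OF v(2), of y] t by simp
  next
    fix y assume "y \<notin> (\<Union>i. S i)"
    then show "(1 - t) * v y + t * w y = 0" using patch_classD(4)[OF v(1), of y] patch_classD(4)[OF v(2), of y] by simp
  next
    fix i
    have "(LINT y|lborel. indicator (S i) y * ((1 - t) * v y + t * w y)) = (LINT y|lborel. (1 - t) * (indicator (S i) y * v y) + t * (indicator (S i) y * w y))"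
      by (simp add: algebra_simps)
    also have "\<dots> = (1 - t) * \<kappa> i + t * \<kappa> i"
      using i[OF v(1), of i] i[OF v(2), of i] patch_classD(5)[OF v(1), of i] patch_classD(5)[OF v(2), of i] by simp
    finally show "(LINT y|lborel. indicator (S i) y * ((1 - t) * v y + t * w y)) = \<kappa> i" by (simp add: algebra_simps)
  qed
qed

section \<open>Convexity of the energy and existence of minimisers\<close>

context dirichlet_domain
begin

lemma admissible_lincomb:
  assumes "admissible B f" "admissible B' g"
  shows "admissible (\<bar>a\<bar> * B + \<bar>b\<bar> * B') (\<lambda>y. a * f y + b * g y)"
proof -
  note [measurable] = admissibleD(1)[OF assms(1)] admissibleD(1)[OF assms(2)]
  have "\<bar>a * f y + b * g y\<bar> \<le> \<bar>a\<bar> * B + \<bar>b\<bar> * B'" for y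
    using abs_triangle_ineq[of "a * f y" "b * g y"] mult_left_mono[OF admissibleD(2)[OF assms(1), of y], of "\<bar>a\<bar>"]
      mult_left_mono[OF admissibleD(2)[OF assms(2), of y], of "\<bar>b\<bar>"] by (simp add: abs_mult)
  then show ?thesis using admissibleD(3)[OF assms(1)] admissibleD(3)[OF assms(2)] by (simp add: admissible_def)
qed

lemma integrable_form:
  assumes f: "admissible B f" and g: "admissible B' g"
  shows "integrable lborel (\<lambda>x. f x * green_pot g x)"
proof -
  obtain K where K: "0 \<le> K" "\<And>B f x. admissible B f \<Longrightarrow> \<bar>green_pot f x\<bar> \<le> K * B"
    using green_pot_bounded by blast
  note [measurable] = admissibleD(1)[OF f] green_pot_measurable[OF admissibleD(1)[OF g]]
  show ?thesis
  proof (rule integrable_bounded_support[OF _ bounded_D])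
    show "\<bar>f x * green_pot g x\<bar> \<le> B * (K * B')" for x
      unfolding abs_mult using K(2)[OF g, of x] admissibleD(2,4)[OF f] by (intro mult_mono) auto
  qed (use admissibleD(3)[OF f] in auto)
qed

lemma integrable_bounded_mult:
  assumes f: "admissible B f" and p: "p \<in> borel_measurable borel" "\<And>x. \<bar>p x\<bar> \<le> P"
  shows "integrable lborel (\<lambda>x. p x * f x)"
proof -
  note [measurable] = admissibleD(1)[OF f] p(1)
  have "0 \<le> P" using p(2)[of 0] by linarith
  then have "\<bar>p x * f x\<bar> \<le> P * B" for x
    unfolding abs_mult using p(2)[of x] admissibleD(2)[OF f, of x] by (intro mult_mono) auto
  then show ?thesis using admissibleD(3)[OF f] by (intro integrable_bounded_support[OF _ bounded_D]) auto
qed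

definition energy :: "(real^2 \<Rightarrow> real) \<Rightarrow> (real^2 \<Rightarrow> real) \<Rightarrow> real" where
  "energy p v = (LINT x|lborel. v x * green_pot v x) / 2 - (LINT x|lborel. p x * v x)"

lemma energy_expand:
  assumes v: "admissible B v" and d: "admissible B' d" and p: "p \<in> borel_measurable borel" "\<And>x. \<bar>p x\<bar> \<le> P"
  shows "energy p (\<lambda>y. v y + t * d y) = energy p v + t * ((LINT x|lborel. d x * green_pot v x) - (LINT x|lborel. p x * d x))
     + t\<^sup>2 / 2 * (LINT x|lborel. d x * green_pot d x)"
proof -
  have g: "green_pot (\<lambda>y. v y + t * d y) x = green_pot v x + t * green_pot d x" for x
    using green_pot_diff(2)[OF v d, of 1 t x] by simp
  note I = integrable_form[OF v v] integrable_form[OF v d] integrable_form[OF d v] integrable_form[OF d d]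
  have "(LINT x|lborel. (v x + t * d x) * green_pot (\<lambda>y. v y + t * d y) x) =
    (LINT x|lborel. v x * green_pot v x + t * (v x * green_pot d x) + t * (d x * green_pot v x) + t\<^sup>2 * (d x * green_pot d x))"
    unfolding g by (intro Bochner_Integration.integral_cong) (auto simp: algebra_simps power2_eq_square)
  also have "\<dots> = (LINT x|lborel. v x * green_pot v x) + t * (LINT x|lborel. v x * green_pot d x) + t * (LINT x|lborel. d x * green_pot v x) + t\<^sup>2 * (LINT x|lborel. d x * green_pot d x)"
    using I by simp
  also have "(LINT x|lborel. v x * green_pot d x) = (LINT x|lborel. d x * green_pot v x)" by (rule green_form_symmetric[OF v d])
  moreover have "(LINT x|lborel. p x * (v x + t * d x)) = (LINT x|lborel. p x * v x) + t * (LINT x|lborel. p x * d x)"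
    using integrable_bounded_mult[OF v p] integrable_bounded_mult[OF d p] by (simp add: distrib_left mult.left_commute)
  ultimately show ?thesis by (simp add: energy_def field_simps)
qed

text \<open>The defect is one eighth of the quadratic form of \<open>green_pot\<close> at
  \<open>w - v\<close>, which is nonnegative.\<close>

lemma energy_midpoint:
  assumes v: "admissible B v" and w: "admissible B' w" and p: "p \<in> borel_measurable borel" "\<And>x. \<bar>p x\<bar> \<le> P"
  shows "energy p (\<lambda>y. v y + (1/2) * (w y - v y)) \<le> (energy p v + energy p w) / 2"
proof -
  have d: "admissible (\<bar>1\<bar> * B' + \<bar>- 1\<bar> * B) (\<lambda>y. w y - v y)" using admissible_lincomb[OF w v, of 1 "- 1"] by simp
  show ?thesis
    using energy_expand[OF v d p, of "1/2"] energy_expand[OF v d p, of 1] green_energy_nonneg[OF d]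
    by (simp add: power2_eq_square field_simps)
qed

text \<open>Dominated convergence is used twice: for the potential at each point, then for the
  energy integrals.\<close>

lemma energy_tendsto:
  assumes v: "\<And>n. admissible 1 (v n)" and w: "admissible 1 w" and lim: "AE x in lborel. (\<lambda>n. v n x) \<longlonglongrightarrow> w x"
    and p: "p \<in> borel_measurable borel" "\<And>x. \<bar>p x\<bar> \<le> P"
  shows "(\<lambda>n. energy p (v n)) \<longlonglongrightarrow> energy p w"
proof -
  obtain K where K: "0 \<le> K" "\<And>B f x. admissible B f \<Longrightarrow> \<bar>green_pot f x\<bar> \<le> K * B"
    using green_pot_bounded by blast
  have one: "admissible 1 (indicator D)" using open_D by (auto simp: admissible_def indicator_def)
  have le1: "\<bar>f x\<bar> \<le> indicator D x" if "admissible 1 f" for f x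
    using admissibleD(2,3)[OF that, of x] by (auto simp: indicator_def)
  note [measurable] = admissibleD(1)[OF v] admissibleD(1)[OF w] p(1)
    green_pot_measurable[OF admissibleD(1)[OF v]] green_pot_measurable[OF admissibleD(1)[OF w]]
  have Gl: "(\<lambda>n. green_pot (v n) x) \<longlonglongrightarrow> green_pot w x" for x
    unfolding green_pot_def
  proof (rule integral_dominated_convergence[where w = "\<lambda>y. \<bar>green x y * indicator D y\<bar>"])
    show "integrable lborel (\<lambda>y. \<bar>green x y * indicator D y\<bar>)" using green_mult(1)[OF one zero_less_one] by simp
    show "AE y in lborel. (\<lambda>n. green x y * v n y) \<longlonglongrightarrow> green x y * w y"
      using lim by eventually_elim (intro tendsto_intros)
    show "AE y in lborel. norm (green x y * v n y) \<le> \<bar>green x y * indicator D y\<bar>" for n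
      using le1[OF v, of n] by (auto intro!: AE_I2 mult_left_mono simp: abs_mult)
  qed measurable
  have 1: "(\<lambda>n. LINT x|lborel. v n x * green_pot (v n) x) \<longlonglongrightarrow> (LINT x|lborel. w x * green_pot w x)"
  proof (rule integral_dominated_convergence[where w = "\<lambda>x. K * indicator D x"])
    show "integrable lborel (\<lambda>x. K * indicator D x)" using admissible_integrable[OF one] by simp
    show "AE x in lborel. (\<lambda>n. v n x * green_pot (v n) x) \<longlonglongrightarrow> w x * green_pot w x"
      using lim by eventually_elim (intro tendsto_intros Gl)
    show "AE x in lborel. norm (v n x * green_pot (v n) x) \<le> K * indicator D x" for n
    proof (rule AE_I2)
      fix x
      have "\<bar>v n x\<bar> * \<bar>green_pot (v n) x\<bar> \<le> indicator D x * K"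
        using le1[OF v, of n x] K(2)[OF v, of n x] by (intro mult_mono) auto
      then show "norm (v n x * green_pot (v n) x) \<le> K * indicator D x" by (simp add: abs_mult mult.commute)
    qed
  qed measurable
  have 2: "(\<lambda>n. LINT x|lborel. p x * v n x) \<longlonglongrightarrow> (LINT x|lborel. p x * w x)"
  proof (rule integral_dominated_convergence[where w = "\<lambda>x. P * indicator D x"])
    show "integrable lborel (\<lambda>x. P * indicator D x)" using admissible_integrable[OF one] by simp
    show "AE x in lborel. (\<lambda>n. p x * v n x) \<longlonglongrightarrow> p x * w x"
      using lim by eventually_elim (intro tendsto_intros)
    have "0 \<le> P" using p(2)[of 0] by linarith
    then show "AE x in lborel. norm (p x * v n x) \<le> P * indicator D x" for n
      using le1[OF v, of n] p(2) unfolding real_norm_def abs_mult by (intro AE_I2 mult_mono) auto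
  qed measurable
  show ?thesis unfolding energy_def by (intro tendsto_intros 1 2) simp
qed

lemma patch_class_admissible:
  assumes "\<And>i. S i \<subseteq> D" "v \<in> patch_class S \<kappa>"
  shows "admissible 1 v"
proof -
  have "v y = 0" if "y \<notin> D" for y using patch_classD(4)[OF assms(2), of y] assms(1) that by blast
  then show ?thesis using patch_classD(1-3)[OF assms(2)] by (simp add: admissible_def)
qed

lemma patch_class_closed:
  fixes S :: "'k::finite \<Rightarrow> (real^2) set"
  assumes S: "\<And>i. S i \<in> sets borel" "\<And>i. S i \<subseteq> D" and v: "\<And>n. v n \<in> patch_class S \<kappa>"
    and lim: "AE x in lborel. convergent (\<lambda>n. v n x)"
  shows "\<exists>w\<in>patch_class S \<kappa>. AE x in lborel. (\<lambda>n. v n x) \<longlonglongrightarrow> w x"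
proof -
  define U where "U = (\<Union>i. S i)"
  note [measurable] = patch_classD(1)[OF v] S(1)
  have U[measurable]: "U \<in> sets borel" unfolding U_def by measurable
  \<comment> \<open>Clamping and cutting off put the limit into the class at every point, also where
    the sequence diverges.\<close>
  define w where "w x = indicator U x * max 0 (min 1 (lim (\<lambda>n. v n x)))" for x
  have wm[measurable]: "w \<in> borel_measurable borel" unfolding w_def[abs_def] by measurable
  have conv: "AE x in lborel. (\<lambda>n. v n x) \<longlonglongrightarrow> w x"
    using lim
  proof eventually_elim
    case (elim x)
    then have l: "(\<lambda>n. v n x) \<longlonglongrightarrow> lim (\<lambda>n. v n x)" by (simp add: convergent_LIMSEQ_iff)
    have "0 \<le> lim (\<lambda>n. v n x)" using patch_classD(2)[OF v] by (intro LIMSEQ_le_const[OF l]) auto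
    moreover have "lim (\<lambda>n. v n x) \<le> 1" using patch_classD(3)[OF v] by (intro LIMSEQ_le_const2[OF l]) auto
    moreover have "x \<notin> U \<Longrightarrow> lim (\<lambda>n. v n x) = 0" using patch_classD(4)[OF v] by (simp add: U_def)
    ultimately show ?case using l by (cases "x \<in> U") (auto simp: w_def)
  qed
  have "w \<in> patch_class S \<kappa>" unfolding patch_class_def
  proof (intro CollectI conjI allI impI wm)
    show "0 \<le> w y" "w y \<le> 1" for y by (auto simp: w_def indicator_def)
    show "w y = 0" if "y \<notin> (\<Union>i. S i)" for y using that by (simp add: w_def U_def)
    fix i
    have "(\<lambda>n. LINT y|lborel. indicator (S i) y * v n y) \<longlonglongrightarrow> (LINT y|lborel. indicator (S i) y * w y)"
    proof (rule integral_dominated_convergence[where w = "indicator D"])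
      show "integrable lborel (indicator D :: real^2 \<Rightarrow> real)"
        by (rule integrable_bounded_support[OF _ bounded_D, of _ 1]) (use open_D in \<open>auto simp: indicator_def\<close>)
      show "AE y in lborel. (\<lambda>n. indicator (S i) y * v n y) \<longlonglongrightarrow> indicator (S i) y * w y"
        using conv by eventually_elim (intro tendsto_intros)
      show "AE y in lborel. norm (indicator (S i) y * v n y) \<le> indicator D y" for n
        using patch_classD(2,3)[OF v, of n] S(2)[of i] by (intro AE_I2) (auto simp: indicator_def subset_iff)
    qed measurable
    then show "(LINT y|lborel. indicator (S i) y * w y) = \<kappa> i"
      using patch_classD(5)[OF v] LIMSEQ_unique[OF tendsto_const[of "\<kappa> i"]] by fastforce
  qed
  then show ?thesis using conv by blast
qed

text \<open>Sublevel sets of the energy are convex, so near-minimal \<open>L\<^sup>2\<close> norms in them give an \<open>L\<^sup>2\<close> Cauchy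
  minimising sequence by the parallelogram identity; this replaces weak compactness.\<close>

lemma energy_minimizer_exists:
  fixes S :: "'k::finite \<Rightarrow> (real^2) set"
  assumes S: "\<And>i. S i \<in> sets borel" "\<And>i. S i \<subseteq> D" and ne: "patch_class S \<kappa> \<noteq> {}"
    and p: "p \<in> borel_measurable borel" "\<And>x. \<bar>p x\<bar> \<le> P"
  shows "\<exists>v\<in>patch_class S \<kappa>. \<forall>w\<in>patch_class S \<kappa>. energy p v \<le> energy p w"
proof -
  let ?K = "patch_class S \<kappa>"
  define V where "V = measure lborel D"
  have V: "0 \<le> V" by (simp add: V_def)
  have one: "admissible 1 (indicator D)" using open_D by (auto simp: admissible_def indicator_def)
  have V': "(LINT x|lborel. indicator D x) = V" using open_D by (simp add: V_def)
  have adm: "admissible 1 v" if "v \<in> ?K" for v using patch_class_admissible[OF S(2) that] .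
  have bS: "bounded (S i)" for i using S(2) bounded_D bounded_subset by blast
  have v01: "\<bar>v x\<bar> \<le> indicator D x" if "v \<in> ?K" for v x
    using admissibleD(2,3)[OF adm[OF that], of x] by (auto simp: indicator_def)
  have bdd: "- (P * V) \<le> energy p v" if v: "v \<in> ?K" for v
  proof -
    have "(LINT x|lborel. p x * v x) \<le> (LINT x|lborel. P * indicator D x)"
    proof (rule integral_mono)
      show "integrable lborel (\<lambda>x. p x * v x)" by (rule integrable_bounded_mult[OF adm[OF v] p])
      show "integrable lborel (\<lambda>x. P * indicator D x)" using admissible_integrable[OF one] by simp
      fix x
      have "\<bar>p x\<bar> * \<bar>v x\<bar> \<le> P * indicator D x" using p(2)[of x] v01[OF v, of x] by (intro mult_mono) auto
      then show "p x * v x \<le> P * indicator D x" using abs_ge_self[of "p x * v x"] by (simp add: abs_mult)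
    qed
    then show ?thesis using green_energy_nonneg[OF adm[OF v]] V' by (simp add: energy_def)
  qed
  define I where "I = Inf (energy p ` ?K)"
  have bb: "bdd_below (energy p ` ?K)" using bdd by (auto simp: bdd_below_def)
  have I_le: "I \<le> energy p v" if "v \<in> ?K" for v unfolding I_def using that bb by (intro cInf_lower) auto
  \<comment> \<open>Near-minimal sublevel sets: nonempty, decreasing in \<open>n\<close> and closed
    under midpoints.\<close>
  define Kn where "Kn n = {v \<in> ?K. energy p v \<le> I + 1 / real (Suc n)}" for n
  define sq where "sq v = (LINT x|lborel. (v x)\<^sup>2)" for v :: "real^2 \<Rightarrow> real"
  have sqi: "integrable lborel (\<lambda>x. (v x)\<^sup>2)" if "admissible B v" for v B
  proof -
    note [measurable] = admissibleD(1)[OF that]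
    show ?thesis
    proof (rule integrable_bounded_support[OF _ bounded_D])
      show "\<bar>(v x)\<^sup>2\<bar> \<le> B\<^sup>2" for x using admissibleD(2)[OF that, of x] power_mono[of "\<bar>v x\<bar>" B 2] by simp
    qed (use admissibleD(3)[OF that] in auto)
  qed
  have sq0: "0 \<le> sq v" for v by (simp add: sq_def)
  have sqV: "sq v \<le> V" if v: "v \<in> ?K" for v
    unfolding sq_def V'[symmetric]
  proof (rule integral_mono[OF sqi[OF adm[OF v]] admissible_integrable[OF one]])
    show "(v x)\<^sup>2 \<le> indicator D x" for x
      using power_mono[OF v01[OF v, of x] abs_ge_zero, of 2] by (auto simp: indicator_def split: if_splits)
  qed
  have Kne: "Kn n \<noteq> {}" for n
  proof -
    have "I < I + 1 / real (Suc n)" by simp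
    then obtain v where "v \<in> ?K" "energy p v < I + 1 / real (Suc n)"
      using cInf_lessD[of "energy p ` ?K"] ne unfolding I_def by blast
    then show ?thesis unfolding Kn_def by (auto intro: less_imp_le)
  qed
  \<comment> \<open>These infima increase because the sets shrink, and they are bounded by the area
    of \<open>D\<close>; their convergence is what makes the chosen sequence Cauchy.\<close>
  define d where "d n = Inf (sq ` Kn n)" for n
  have dbb: "bdd_below (sq ` Kn n)" for n using sq0 by (auto simp: bdd_below_def)
  have d_le: "d n \<le> sq v" if "v \<in> Kn n" for n v unfolding d_def using that dbb by (intro cInf_lower) auto
  have dV: "d n \<le> V" for n
  proof -
    obtain v where "v \<in> Kn n" using Kne by blast
    then show ?thesis using d_le[of v n] sqV[of v] by (simp add: Kn_def)
  qed
  have Kn_mono: "Kn m \<subseteq> Kn n" if "n \<le> m" for m n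
  proof -
    have "1 / real (Suc m) \<le> 1 / real (Suc n)" using that by (intro divide_left_mono) auto
    then show ?thesis unfolding Kn_def by auto
  qed
  have "incseq d"
  proof (rule incseq_SucI)
    show "d n \<le> d (Suc n)" for n
      unfolding d_def using Kne dbb Kn_mono[of n "Suc n"] by (intro cInf_superset_mono image_mono) auto
  qed
  then have "convergent d" using dV by (metis incseq_convergent convergent_def)
  then have dC: "Cauchy d" by (simp add: Cauchy_convergent_iff)
  have "\<exists>v. v \<in> Kn n \<and> sq v < d n + 1 / real (Suc n)" for n
    using cInf_lessD[of "sq ` Kn n" "d n + 1 / real (Suc n)"] Kne[of n] unfolding d_def by auto
  then obtain v where v: "\<And>n. v n \<in> Kn n" "\<And>n. sq (v n) < d n + 1 / real (Suc n)" by metis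
  have vK: "v n \<in> ?K" for n using v(1)[of n] by (simp add: Kn_def)
  have vE: "energy p (v n) \<le> I + 1 / real (Suc n)" for n using v(1)[of n] by (simp add: Kn_def)
  have dm: "admissible 2 (\<lambda>x. v n x - v m x)" for m n
    using admissible_lincomb[OF adm[OF vK[of n]] adm[OF vK[of m]], of 1 "- 1"] by simp
  \<comment> \<open>Parallelogram identity with the midpoint \<open>w\<close>, which lies in
    \<open>Kn n\<close> by convexity, so that \<open>d n \<le> sq w\<close>. The two slacks, each at
    most \<open>1 / (n + 1)\<close>, enter with factor 2.\<close>
  have par: "sq (\<lambda>x. v n x - v m x) \<le> 2 * (d m - d n) + 4 / real (Suc n)" if nm: "n \<le> m" for m n
  proof -
    define w where "w x = v n x + (1/2) * (v m x - v n x)" for x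
    have wK: "w \<in> ?K"
      using patch_class_convex[OF bS S(1) vK[of n] vK[of m], of "1/2"] by (simp add: w_def[abs_def] algebra_simps)
    have "v m \<in> Kn n" using v(1) Kn_mono[OF nm] by blast
    then have "energy p (v m) \<le> I + 1 / real (Suc n)" by (simp add: Kn_def)
    then have "energy p w \<le> I + 1 / real (Suc n)"
      using energy_midpoint[OF adm[OF vK[of n]] adm[OF vK[of m]] p] vE[of n] by (simp add: w_def[abs_def])
    then have "w \<in> Kn n" using wK by (simp add: Kn_def)
    then have "d n \<le> sq w" by (rule d_le)
    moreover have "sq (\<lambda>x. v n x - v m x) = 2 * sq (v n) + 2 * sq (v m) - 4 * sq w"
    proof -
      have "sq (\<lambda>x. v n x - v m x) = (LINT x|lborel. 2 * (v n x)\<^sup>2 + 2 * (v m x)\<^sup>2 - 4 * (w x)\<^sup>2)"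
        unfolding sq_def by (intro Bochner_Integration.integral_cong) (auto simp: w_def power2_eq_square algebra_simps)
      also have "\<dots> = 2 * sq (v n) + 2 * sq (v m) - 4 * sq w"
        unfolding sq_def using sqi[OF adm[OF vK[of n]]] sqi[OF adm[OF vK[of m]]] sqi[OF adm[OF wK]] by simp
      finally show ?thesis .
    qed
    moreover have "1 / real (Suc m) \<le> 1 / real (Suc n)" using nm by (intro divide_left_mono) auto
    ultimately show ?thesis using v(2)[of n] v(2)[of m] by simp
  qed
  \<comment> \<open>From \<open>t \<le> e + t^2 / e\<close>: smallness of the squared norm gives
    smallness of the integral norm, for which Cauchy sequences have almost everywhere Cauchy
    subsequences.\<close>
  have L1: "(LINT x|lborel. \<bar>v n x - v m x\<bar>) \<le> e * V + sq (\<lambda>x. v n x - v m x) / e" if e: "0 < e" for e m n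
  proof -
    have "(LINT x|lborel. \<bar>v n x - v m x\<bar>) \<le> (LINT x|lborel. e * indicator D x + (v n x - v m x)\<^sup>2 / e)"
    proof (rule integral_mono)
      show "integrable lborel (\<lambda>x. \<bar>v n x - v m x\<bar>)" using admissible_integrable[OF dm] by simp
      show "integrable lborel (\<lambda>x. e * indicator D x + (v n x - v m x)\<^sup>2 / e)"
        using sqi[OF dm] admissible_integrable[OF one] by (intro Bochner_Integration.integrable_add) auto
      fix x
      show "\<bar>v n x - v m x\<bar> \<le> e * indicator D x + (v n x - v m x)\<^sup>2 / e"
      proof (cases "x \<in> D")
        case True
        define t where "t = \<bar>v n x - v m x\<bar>"
        have "0 \<le> (t - e)\<^sup>2 + t * e" using e by (simp add: t_def)
        then have "t * e \<le> e * e + t\<^sup>2" by (simp add: power2_eq_square algebra_simps)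
        then have "t \<le> e + t\<^sup>2 / e" using e by (simp add: field_simps power2_eq_square)
        then show ?thesis using True by (simp add: t_def)
      next
        case False
        then show ?thesis using admissibleD(3)[OF dm[of n m], of x] e by simp
      qed
    qed
    also have "\<dots> = e * V + sq (\<lambda>x. v n x - v m x) / e"
      using sqi[OF dm] admissible_integrable[OF one] V' by (simp add: sq_def)
    finally show ?thesis .
  qed
  have cau: "\<exists>N. \<forall>i\<ge>N. \<forall>j\<ge>N. (LINT x|lborel. norm (v i x - v j x)) < e" if e: "0 < e" for e
  proof -
    define e1 where "e1 = e / (2 * (V + 1))"
    have e1: "0 < e1" "e1 * V < e / 2" using e V by (auto simp: e1_def field_simps)
    \<comment> \<open>Then \<open>e2 / e1 = e / 2\<close>, so both terms of the estimate
      \<open>L1\<close> stay below half of \<open>e\<close>.\<close>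
    define e2 where "e2 = e1 * e / 2"
    have e2: "0 < e2" using e e1 by (simp add: e2_def)
    obtain N1 where N1: "\<And>m n. N1 \<le> m \<Longrightarrow> N1 \<le> n \<Longrightarrow> \<bar>d m - d n\<bar> < e2 / 4"
      using dC e2 unfolding Cauchy_def dist_real_def by (metis zero_less_divide_iff zero_less_numeral)
    obtain N2 where N2: "1 / real (Suc N2) < e2 / 8" using nat_approx_posE[of "e2 / 8"] e2 by auto
    have *: "sq (\<lambda>x. v n x - v m x) < e2" if "max N1 N2 \<le> n" "n \<le> m" for m n
    proof -
      have dd: "\<bar>d m - d n\<bar> < e2 / 4" using N1 that by simp
      have "1 / real (Suc n) \<le> 1 / real (Suc N2)" using that by (intro divide_left_mono) auto
      then have "1 / real (Suc n) < e2 / 8" using N2 by (rule le_less_trans)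
      then have "4 / real (Suc n) < e2 / 2" by (simp add: field_simps)
      moreover have "d m - d n < e2 / 4" using dd by linarith
      ultimately have "2 * (d m - d n) + 4 / real (Suc n) < e2" by (simp del: of_nat_Suc)
      then show ?thesis by (rule le_less_trans[OF par[OF that(2)]])
    qed
    have sym: "sq (\<lambda>x. v n x - v m x) = sq (\<lambda>x. v m x - v n x)" for m n
      unfolding sq_def by (simp add: power2_commute)
    have small: "sq (\<lambda>x. v n x - v m x) < e2" if "max N1 N2 \<le> n" "max N1 N2 \<le> m" for m n
      using *[of n m] *[of m n] sym[of n m] that by (cases "n \<le> m") auto
    have "(LINT x|lborel. norm (v n x - v m x)) < e" if "max N1 N2 \<le> n" "max N1 N2 \<le> m" for m n
    proof -
      have "sq (\<lambda>x. v n x - v m x) / e1 < e2 / e1" using small[OF that] e1 by (intro divide_strict_right_mono)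
      also have "\<dots> = e / 2" using e1 by (simp add: e2_def)
      finally have "e1 * V + sq (\<lambda>x. v n x - v m x) / e1 < e / 2 + e / 2" by (rule add_strict_mono[OF e1(2)])
      then have "(LINT x|lborel. \<bar>v n x - v m x\<bar>) < e / 2 + e / 2" by (rule le_less_trans[OF L1[OF e1(1), of n m]])
      then show ?thesis by simp
    qed
    then show ?thesis by blast
  qed
  obtain r where r: "strict_mono r" "AE x in lborel. Cauchy (\<lambda>i. v (r i) x)"
    using cauchy_L1_AE_cauchy_subseq[of lborel v] admissible_integrable[OF adm[OF vK]] cau by blast
  then have "AE x in lborel. convergent (\<lambda>i. v (r i) x)" by (simp add: Cauchy_convergent_iff)
  from patch_class_closed[OF S vK this]
  obtain w where w: "w \<in> ?K" "AE x in lborel. (\<lambda>i. v (r i) x) \<longlonglongrightarrow> w x"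
    by blast
  have "(\<lambda>i. energy p (v (r i))) \<longlonglongrightarrow> energy p w"
    by (rule energy_tendsto[OF adm[OF vK] adm[OF w(1)] w(2) p])
  moreover have "(\<lambda>i. I + 1 / real (Suc (r i))) \<longlonglongrightarrow> I + 0"
  proof (intro tendsto_intros)
    have "(\<lambda>n. 1 / real (Suc n)) \<longlonglongrightarrow> 0" using LIMSEQ_inverse_real_of_nat by (simp add: inverse_eq_divide)
    from LIMSEQ_subseq_LIMSEQ[OF this r(1)] show "(\<lambda>i. 1 / real (Suc (r i))) \<longlonglongrightarrow> 0" by (simp add: comp_def)
  qed
  ultimately have "energy p w \<le> I + 0" by (rule LIMSEQ_le) (use vE in blast)
  then show ?thesis using w(1) I_le by (intro bexI[of _ w]) (auto intro: order_trans)
qed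

text \<open>Along the segment from \<open>v\<close> to \<open>w\<close> the energy is a quadratic
  polynomial in \<open>t\<close> that is minimal at \<open>t = 0\<close>. Its linear coefficient is
  therefore nonnegative, which is the optimality that the bathtub principle consumes.\<close>

lemma energy_first_variation:
  fixes S :: "'k::finite \<Rightarrow> (real^2) set"
  assumes S: "\<And>i. S i \<in> sets borel" "\<And>i. S i \<subseteq> D"
    and v: "v \<in> patch_class S \<kappa>" "\<And>w. w \<in> patch_class S \<kappa> \<Longrightarrow> energy p v \<le> energy p w"
    and p: "p \<in> borel_measurable borel" "\<And>x. \<bar>p x\<bar> \<le> P" and w: "w \<in> patch_class S \<kappa>"
  shows "(LINT x|lborel. (p x - green_pot v x) * w x) \<le> (LINT x|lborel. (p x - green_pot v x) * v x)"
proof -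
  have adm: "admissible 1 u" if "u \<in> patch_class S \<kappa>" for u using patch_class_admissible[OF S(2) that] .
  have bS: "bounded (S i)" for i using S(2) bounded_D bounded_subset by blast
  have d: "admissible 2 (\<lambda>x. w x - v x)" using admissible_lincomb[OF adm[OF w] adm[OF v(1)], of 1 "- 1"] by simp
  define L where "L = (LINT x|lborel. (w x - v x) * green_pot v x) - (LINT x|lborel. p x * (w x - v x))"
  define Q where "Q = (LINT x|lborel. (w x - v x) * green_pot (\<lambda>x. w x - v x) x)"
  have Q: "0 \<le> Q" unfolding Q_def by (rule green_energy_nonneg[OF d])
  have "0 \<le> L + t / 2 * Q" if t: "0 < t" "t \<le> 1" for t
  proof -
    have "(\<lambda>y. v y + t * (w y - v y)) \<in> patch_class S \<kappa>"
      using patch_class_convex[OF bS S(1) v(1) w, of t] t by (simp add: algebra_simps)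
    then have "energy p v \<le> energy p (\<lambda>y. v y + t * (w y - v y))" by (rule v(2))
    then have "0 \<le> t * (L + t / 2 * Q)"
      using energy_expand[OF adm[OF v(1)] d p, of t] by (simp add: L_def Q_def power2_eq_square algebra_simps)
    then show ?thesis using t by (simp add: zero_le_mult_iff)
  qed
  then have "0 \<le> L + e" if e: "0 < e" for e
  proof -
    \<comment> \<open>Small enough for the quadratic term to stay below \<open>e\<close>;
      \<open>Q + 1\<close> keeps the quotient meaningful for \<open>Q = 0\<close>.\<close>
    define t where "t = min 1 (e / (Q + 1))"
    have t: "0 < t" "t \<le> 1" using e Q by (auto simp: t_def)
    have "t \<le> e / (Q + 1)" by (simp add: t_def)
    then have "t / 2 \<le> e / (Q + 1)" using t by linarith
    then have "t / 2 * Q \<le> e / (Q + 1) * Q" using Q by (rule mult_right_mono)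
    also have "\<dots> \<le> e" using Q e by (simp add: field_simps)
    finally show ?thesis using \<open>\<And>t. 0 < t \<Longrightarrow> t \<le> 1 \<Longrightarrow> 0 \<le> L + t / 2 * Q\<close>[OF t] by linarith
  qed
  then have "0 \<le> L" by (rule field_le_epsilon)
  moreover have "L = (LINT x|lborel. (p x - green_pot v x) * v x) - (LINT x|lborel. (p x - green_pot v x) * w x)"
    unfolding L_def
    using integrable_form[OF adm[OF w] adm[OF v(1)]] integrable_form[OF adm[OF v(1)] adm[OF v(1)]]
      integrable_bounded_mult[OF adm[OF w] p] integrable_bounded_mult[OF adm[OF v(1)] p]
    by (simp add: left_diff_distrib right_diff_distrib mult.commute)
  ultimately show ?thesis by simp
qed

end

section \<open>Contact sets\<close>

text \<open>If \<open>norm (x - y) < s\<close> then \<open>norm (x - z) \<le> 2 * s\<close>, where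
  \<open>bump (4 * s)\<close> is at least \<open>27 / (256 * pi * s^2)\<close>. Dividing the maximum
  \<open>3 / (pi * s^2)\<close> of \<open>bump s\<close> by this value gives
  \<open>256 / 9\<close>.\<close>

lemma bump_le_bump:
  fixes x y z :: "real^2"
  assumes s: "0 < s" and yz: "norm (y - z) \<le> s"
  shows "bump s (x - y) \<le> 256 / 9 * bump (4 * s) (x - z)"
proof (cases "norm (x - y) < s")
  case False
  then show ?thesis using s bump_nonneg[of "4 * s" "x - z"] by (simp add: bump_eq_0)
next
  case True
  have "norm (x - z) \<le> 2 * s" using True yz norm_triangle_ineq[of "x - y" "y - z"] by simp
  then have "(x - z) \<bullet> (x - z) \<le> (2 * s)\<^sup>2" using inner_self_le_iff[of "2 * s" "x - z"] s by simp
  then have "12 * s\<^sup>2 \<le> (4 * s)\<^sup>2 - (x - z) \<bullet> (x - z)" by (simp add: power2_eq_square)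
  then have "(12 * s\<^sup>2)\<^sup>2 \<le> (max 0 ((4 * s)\<^sup>2 - (x - z) \<bullet> (x - z)))\<^sup>2" by (intro power_mono) auto
  then have *: "3 / (pi * (4 * s) ^ 6) * (12 * s\<^sup>2)\<^sup>2 \<le> bump (4 * s) (x - z)"
    unfolding bump_def using s by (intro mult_left_mono) auto
  have "3 / (pi * s\<^sup>2) = 256 / 9 * (3 / (pi * (4 * s) ^ 6) * (12 * s\<^sup>2)\<^sup>2)"
    using s by (simp add: field_simps eval_nat_numeral)
  also have "\<dots> \<le> 256 / 9 * bump (4 * s) (x - z)" using * by simp
  finally show ?thesis using bump_le[OF s, of "x - y"] by linarith
qed

text \<open>After exchanging the integrals the inner one is an average of \<open>b\<close>, hence at
  most 1.\<close>

lemma integral_bump_swap_le: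
  fixes b :: "real^2 \<Rightarrow> real"
  assumes r: "0 < r" and E[measurable]: "E \<in> sets borel" and bE: "bounded E"
    and b[measurable]: "b \<in> borel_measurable borel" and b01: "\<And>y. 0 \<le> b y" "\<And>y. b y \<le> 1"
    and C: "bounded C" "\<And>y. y \<notin> C \<Longrightarrow> b y = 0"
  shows "integrable lborel (\<lambda>y. b y * (LINT x|lborel. bump r (x - y) * indicator E x))"
    and "(LINT y|lborel. b y * (LINT x|lborel. bump r (x - y) * indicator E x)) \<le> measure lborel E"
proof -
  let ?P = "\<lambda>(y, x). b y * (bump r (x - y) * indicator E x)"
  have I: "integrable (lborel \<Otimes>\<^sub>M lborel) ?P"
    unfolding lborel_prod
  proof (rule integrable_bounded_support[where S = "C \<times> E" and B = "3 / (pi * r\<^sup>2)"])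
    have "?P \<in> borel_measurable (borel \<Otimes>\<^sub>M borel)" unfolding case_prod_beta by measurable
    then show "?P \<in> borel_measurable borel" by (simp add: borel_prod)
    show "bounded (C \<times> E)" by (intro bounded_Times bE C)
    show "?P p = 0" if "p \<notin> C \<times> E" for p using that C(2)[of "fst p"] by (cases p) auto
    show "\<bar>?P p\<bar> \<le> 3 / (pi * r\<^sup>2)" for p
    proof (cases p)
      case (Pair y x)
      have "b y * (bump r (x - y) * indicator E x) \<le> 1 * (3 / (pi * r\<^sup>2) * 1)"
        using b01[of y] bump_le[OF r, of "x - y"] bump_nonneg[OF r, of "x - y"]
        by (intro mult_mono) (auto simp: indicator_def)
      then show ?thesis using Pair b01[of y] bump_nonneg[OF r, of "x - y"] by (simp add: abs_mult)
    qed
  qed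
  have I1: "integrable lborel (\<lambda>y. LINT x|lborel. ?P (y, x))" by (rule lborel_pair.integrable_fst'[OF I])
  then show "integrable lborel (\<lambda>y. b y * (LINT x|lborel. bump r (x - y) * indicator E x))" by simp
  have I2: "integrable lborel (\<lambda>x. LINT y|lborel. ?P (y, x))"
    using lborel_pair.integrable_snd[OF I] by simp
  have "(LINT y|lborel. b y * (LINT x|lborel. bump r (x - y) * indicator E x)) = (LINT y|lborel. LINT x|lborel. b y * (bump r (x - y) * indicator E x))"
    by simp
  also have "\<dots> = (LINT x|lborel. LINT y|lborel. b y * (bump r (x - y) * indicator E x))"
    using lborel_pair.Fubini_integral[OF I] by simp
  also have "\<dots> \<le> (LINT x|lborel. indicator E x)"
  proof (rule integral_mono)
    show "integrable lborel (\<lambda>x. LINT y|lborel. b y * (bump r (x - y) * indicator E x))" using I2 by simp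
    show "integrable lborel (indicator E :: real^2 \<Rightarrow> real)"
      using emeasure_bounded_finite[OF bE] by (intro integrable_real_indicator) auto
    fix x
    have "(LINT y|lborel. b y * (bump r (x - y) * indicator E x)) = (LINT y|lborel. indicator E x * (bump r (y - x) * b y))"
      by (intro Bochner_Integration.integral_cong) (auto simp: bump_minus[of r x])
    also have "\<dots> = indicator E x * (LINT y|lborel. bump r (y - x) * b y)" by simp
    also have "\<dots> \<le> indicator E x * 1"
    proof (rule mult_left_mono)
      have "(LINT y|lborel. bump r (y - x) * b y) \<le> (LINT y|lborel. bump r (y - x))"
      proof (rule integral_mono[OF _ integrable_bump_diff[OF r]])
        show "integrable lborel (\<lambda>y. bump r (y - x) * b y)"
          by (rule Bochner_Integration.integrable_bound[OF integrable_bump_diff[OF r, of x]])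
            (use b01 bump_nonneg[OF r] in \<open>auto intro!: AE_I2 mult_right_le_one_le\<close>)
        show "bump r (y - x) * b y \<le> bump r (y - x)" for y
          using b01 bump_nonneg[OF r] by (intro mult_right_le_one_le) auto
      qed
      then show "(LINT y|lborel. bump r (y - x) * b y) \<le> 1" using integral_bump_diff[OF r, of x] by simp
    qed simp
    finally show "(LINT y|lborel. b y * (bump r (x - y) * indicator E x)) \<le> indicator E x" by simp
  qed
  also have "\<dots> = measure lborel E" by simp
  finally show "(LINT y|lborel. b y * (LINT x|lborel. bump r (x - y) * indicator E x)) \<le> measure lborel E" .
qed

text \<open>As \<open>Z\<close> is closed, the neighbourhoods without \<open>Z\<close> decrease to
  the empty set. Their vanishing area will force \<open>v = 1\<close> on the contact set.\<close>

lemma measure_shell_tendsto: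
  fixes Z :: "'a::euclidean_space set"
  assumes Z: "compact Z"
  shows "(\<lambda>n. measure lborel ({y. \<exists>z\<in>Z. dist y z < 1 / real (Suc n)} - Z)) \<longlonglongrightarrow> 0"
proof -
  define N where "N n = (\<Union>z\<in>Z. ball z (1 / real (Suc n)))" for n
  have N: "{y. \<exists>z\<in>Z. dist y z < 1 / real (Suc n)} = N n" for n by (auto simp: N_def dist_commute)
  have cl: "closed Z" using Z compact_imp_closed by blast
  obtain R where R: "\<And>z. z \<in> Z \<Longrightarrow> norm z \<le> R" using compact_imp_bounded[OF Z] unfolding bounded_iff by blast
  have bN: "bounded (N n - Z)" for n
  proof -
    have "N n - Z \<subseteq> cball 0 (R + 1)"
    proof
      fix y assume "y \<in> N n - Z"
      then obtain z where z: "z \<in> Z" "dist z y < 1 / real (Suc n)" by (auto simp: N_def)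
      have "dist z y < 1" by (rule less_le_trans[OF z(2)]) simp
      then have "norm y \<le> R + 1" using R[OF z(1)] norm_triangle_ineq2[of y z] by (simp add: dist_norm norm_minus_commute)
      then show "y \<in> cball 0 (R + 1)" by simp
    qed
    then show ?thesis using bounded_cball bounded_subset by blast
  qed
  have "decseq (\<lambda>n. N n - Z)"
  proof (rule decseq_SucI)
    fix n
    have "1 / real (Suc (Suc n)) \<le> 1 / real (Suc n)" by (intro divide_left_mono) auto
    then show "N (Suc n) - Z \<subseteq> N n - Z" unfolding N_def by (auto intro: less_le_trans)
  qed
  moreover have "range (\<lambda>n. N n - Z) \<subseteq> sets lborel"
    using cl by (auto simp: N_def intro!: sets.Diff borel_open open_UN)
  ultimately have "(\<lambda>n. measure lborel (N n - Z)) \<longlonglongrightarrow> measure lborel (\<Inter>n. N n - Z)"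
    using emeasure_bounded_finite[OF bN] by (intro Lim_measure_decseq) (auto simp: less_top)
  moreover have "(\<Inter>n. N n - Z) = {}"
  proof (rule equals0I)
    fix y assume y: "y \<in> (\<Inter>n. N n - Z)"
    have "y \<in> closure Z" unfolding closure_approachable
    proof (intro allI impI)
      fix e :: real assume "0 < e"
      then obtain n where n: "1 / real (Suc n) < e" using nat_approx_posE by blast
      obtain z where "z \<in> Z" "dist z y < 1 / real (Suc n)" using y by (auto simp: N_def)
      then show "\<exists>z\<in>Z. dist z y < e" using n by (intro bexI[of _ z]) auto
    qed
    then show False using y cl by auto
  qed
  ultimately show ?thesis unfolding N by (simp only: measure_empty)
qed

text \<open>The hypothesis \<open>inner\<close> keeps the points where \<open>\<psi>\<close> reaches
  \<open>\<mu>\<close> away from the rim of the disc, so the maximum principle can be run on the set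
  \<open>\<psi> > \<mu>\<close> and the contact set is compact. The function
  \<open>w = \<mu> - \<psi>\<close> is then nonnegative and subharmonic on the disc. Where it
  vanishes, its average equals a \<open>log_gap\<close> integral of order of the squared radius,
  which yields the quadratic bound. For the last claim the missing density on \<open>Z\<close> is
  compared with the values of \<open>w\<close> on a thin shell around \<open>Z\<close>, because
  \<open>w\<close> vanishes on \<open>Z\<close> itself.\<close>

lemma contact_set:
  fixes \<psi> v :: "real^2 \<Rightarrow> real" and \<mu> r :: real and c :: "real^2"
  assumes D: "open D" and \<psi>: "continuous_on D \<psi>" and pois: "poisson_on D \<psi> (\<lambda>x. 1 - v x)"
    and vm[measurable]: "v \<in> borel_measurable borel" and v01: "\<And>y. 0 \<le> v y" "\<And>y. v y \<le> 1"
    and r: "0 < r" "cball c r \<subseteq> D"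
    and bath: "AE y in lborel. y \<in> cball c r \<longrightarrow> (\<mu> < \<psi> y \<longrightarrow> v y = 1) \<and> (\<psi> y < \<mu> \<longrightarrow> v y = 0)"
    and inner: "\<forall>y\<in>cball c r. \<mu> \<le> \<psi> y \<longrightarrow> y \<in> ball c (r / 2)"
  defines "Z \<equiv> {y \<in> ball c r. \<psi> y = \<mu>}"
  shows contact_upper: "\<And>y. y \<in> cball c r \<Longrightarrow> \<psi> y \<le> \<mu>"
    and contact_compact: "compact Z"
    and contact_quadratic: "\<And>y z. z \<in> Z \<Longrightarrow> dist y z < r / 8 \<Longrightarrow> \<mu> - \<psi> y \<le> 29 * (dist y z)\<^sup>2"
    and contact_indicator: "AE y in lborel. y \<in> cball c r \<longrightarrow> v y = indicator Z y"
proof -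
  note inner = inner[rule_format]
  have fm: "(\<lambda>x. 1 - v x) \<in> borel_measurable borel" and f01: "\<bar>1 - v x\<bar> \<le> 1" for x using v01[of x] by auto
  have \<psi>c: "continuous_on (cball c r) \<psi>" using \<psi> r(2) continuous_on_subset by blast
  have bb: "ball c r \<subseteq> cball c r" by auto
  show upper: "\<psi> y \<le> \<mu>" if "y \<in> cball c r" for y
  proof (rule ccontr)
    assume "\<not> \<psi> y \<le> \<mu>"
    then have "\<mu> < \<psi> y" by simp
    define U where "U = ball c r \<inter> \<psi> -` {\<mu><..}"
    have U: "open U" unfolding U_def
      by (rule continuous_open_preimage) (auto intro: continuous_on_subset[OF \<psi>c bb])
    have UD: "U \<subseteq> D" using r(2) bb by (auto simp: U_def)
    have Uc: "continuous_on U \<psi>" using \<psi> UD continuous_on_subset by blast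
    have "poisson_on U \<psi> (\<lambda>_. 0)"
    proof (rule poisson_on_cong_AE[OF poisson_on_subset[OF pois UD] fm])
      show "AE z in lborel. z \<in> U \<longrightarrow> 1 - v z = 0" using bath by eventually_elim (auto simp: U_def)
    qed auto
    then have p: "poisson_on U (\<lambda>x. \<psi> x - \<mu>) (\<lambda>_. 0)" by (rule poisson_on_const_diff(2)[OF _ Uc])
    have "\<psi> y - \<mu> \<le> 0"
    proof (rule poisson_max_principle[OF U _ _ p])
      show "bounded U" by (rule bounded_subset[of "ball c r"]) (auto simp: U_def)
      show "continuous_on U (\<lambda>x. \<psi> x - \<mu>)" by (intro continuous_intros Uc)
      show "y \<in> U" using inner[OF that] \<open>\<mu> < \<psi> y\<close> r by (auto simp: U_def)
      fix e :: real assume e: "0 < e"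
      \<comment> \<open>Compact as a closed part of the disc, and contained in \<open>U\<close>
        because \<open>inner\<close> excludes the rim.\<close>
      let ?C = "cball c r \<inter> \<psi> -` {\<mu> + e..}"
      have "closed ?C" by (rule continuous_closed_preimage[OF \<psi>c]) auto
      then have "compact ?C" by (meson bounded_cball bounded_subset compact_eq_bounded_closed inf_le1)
      moreover have "?C \<subseteq> U" using inner e r by (fastforce simp: U_def)
      moreover have "\<forall>x\<in>U - ?C. \<psi> x - \<mu> \<le> e" by (auto simp: U_def)
      ultimately show "\<exists>C. compact C \<and> C \<subseteq> U \<and> (\<forall>x\<in>U - C. \<psi> x - \<mu> \<le> e)" by blast
    qed auto
    then show False using \<open>\<mu> < \<psi> y\<close> by simp
  qed
  \<comment> \<open>By the upper bound the contact set is a superlevel set of a continuous function,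
    hence closed.\<close>
  have Z_eq: "Z = cball c r \<inter> \<psi> -` {\<mu>..}"
    using upper inner r by (fastforce simp: Z_def intro: antisym)
  have Z_in: "dist c z < r / 2" if "z \<in> Z" for z using that inner[of z] by (auto simp: Z_eq)
  have "closed Z" unfolding Z_eq by (rule continuous_closed_preimage[OF \<psi>c]) auto
  then show Zc: "compact Z" unfolding Z_eq by (meson bounded_cball bounded_subset compact_eq_bounded_closed inf_le1)
  define w where "w y = \<mu> - \<psi> y" for y
  have wc: "continuous_on D w" unfolding w_def[abs_def] by (intro continuous_intros \<psi>)
  have wp: "poisson_on D w (\<lambda>x. - (1 - v x))" unfolding w_def[abs_def] by (rule poisson_on_const_diff(1)[OF pois \<psi>])
  have w0: "0 \<le> w y" if "y \<in> cball c r" for y using upper[OF that] by (simp add: w_def)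
  have gap0: "0 \<le> (LINT z|lborel. log_gap s (z - x) * (1 - v z))" if s: "0 < s" for s x
  proof -
    have "AE z in lborel. z \<noteq> x" by (rule AE_lborel_singleton)
    then show ?thesis using v01
      by (intro integral_nonneg_AE) (auto elim!: eventually_mono intro!: mult_nonneg_nonneg log_gap_nonneg[OF s])
  qed
  have eq: "w x = (LINT z|lborel. bump s (z - x) * w z) - (LINT z|lborel. log_gap s (z - x) * (1 - v z))"
    if "0 < s" "cball x s \<subseteq> D" for x s
  proof -
    have "(LINT z|lborel. log_gap s (z - x) * - (1 - v z)) = - (LINT z|lborel. log_gap s (z - x) * (1 - v z))"
      by (subst integral_minus[symmetric]) (simp add: algebra_simps)
    then show ?thesis using poisson_onD[OF wp that] by simp
  qed
  have bi: "integrable lborel (\<lambda>z. bump s (z - x) * w z)" if "0 < s" "cball x s \<subseteq> D" for x s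
    by (rule integrable_bump_mult[OF that(1) continuous_on_subset[OF wc that(2)]])
  show quad: "\<mu> - \<psi> y \<le> 29 * (dist y z)\<^sup>2" if z: "z \<in> Z" and d: "dist y z < r / 8" for y z
  proof (cases "y = z")
    case True
    then show ?thesis using z by (simp add: Z_def)
  next
    case False
    define s where "s = dist y z"
    have s: "0 < s" "s < r / 8" using False d by (auto simp: s_def)
    \<comment> \<open>Contact points lie within \<open>r / 2\<close> of the centre, and
      \<open>4 * s < r / 2\<close>.\<close>
    have c4: "cball z (4 * s) \<subseteq> cball c r"
    proof
      fix x assume "x \<in> cball z (4 * s)"
      then show "x \<in> cball c r" using Z_in[OF z] s dist_triangle[of c x z] by auto
    qed
    have cy: "cball y s \<subseteq> cball c r"
    proof
      fix x assume "x \<in> cball y s"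
      then have "dist y x \<le> s" by simp
      moreover have "dist z y = s" by (simp add: s_def dist_commute)
      ultimately have "dist z x \<le> 4 * s" using dist_triangle[of z x y] s(1) by linarith
      then show "x \<in> cball c r" using c4 by auto
    qed
    have c4D: "cball z (4 * s) \<subseteq> D" and cyD: "cball y s \<subseteq> D" using c4 cy r(2) by auto
    \<comment> \<open>Subharmonicity bounds \<open>w y\<close> by its average about
      \<open>y\<close>, and comparing bumps bounds this by \<open>256 / 9\<close> times the average
      about \<open>z\<close>. As \<open>w z = 0\<close>, the latter is a
      \<open>log_gap (4 * s)\<close> integral, at most \<open>(4 s)^2 / 16 = s^2\<close>. Finally
      \<open>256 / 9 \<le> 29\<close>.\<close>
    have "w y \<le> (LINT x|lborel. bump s (x - y) * w x)" using eq[OF s(1) cyD] gap0[OF s(1), of y] by simp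
    also have "\<dots> \<le> (LINT x|lborel. 256 / 9 * (bump (4 * s) (x - z) * w x))"
    proof (rule integral_mono[OF bi[OF s(1) cyD]])
      show "integrable lborel (\<lambda>x. 256 / 9 * (bump (4 * s) (x - z) * w x))" using bi[of "4 * s" z] c4D s by simp
      fix x
      show "bump s (x - y) * w x \<le> 256 / 9 * (bump (4 * s) (x - z) * w x)"
      proof (cases "x \<in> cball z (4 * s)")
        case True
        then have "bump s (x - y) * w x \<le> (256 / 9 * bump (4 * s) (x - z)) * w x"
          using w0[of x] c4 s by (intro mult_right_mono bump_le_bump) (auto simp: s_def dist_norm)
        then show ?thesis by (simp add: mult.assoc)
      next
        case False
        have "dist z y = s" "4 * s < dist z x" using False by (simp_all add: s_def dist_commute)
        then have "s \<le> dist y x" using dist_triangle[of z x y] s(1) by linarith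
        then have "s \<le> norm (x - y)" by (simp add: dist_norm norm_minus_commute)
        then show ?thesis using False s by (simp add: bump_eq_0 dist_norm norm_minus_commute)
      qed
    qed
    also have "\<dots> = 256 / 9 * (LINT x|lborel. log_gap (4 * s) (x - z) * (1 - v x))"
      using eq[of "4 * s" z] s c4D z by (simp add: w_def Z_def)
    also have "\<dots> \<le> 256 / 9 * (1 * (4 * s)\<^sup>2 / 16)"
      using log_gap_mult(2)[OF _ fm f01, of "4 * s" z] s by simp
    also have "\<dots> \<le> 29 * s\<^sup>2" by (simp add: power2_eq_square)
    finally show ?thesis by (simp add: w_def s_def)
  qed
  have Zm[measurable]: "Z \<in> sets borel" using Zc by (rule borel_compact)
  \<comment> \<open>The density missing from the contact set; it remains to show that it vanishes
    almost everywhere.\<close>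
  define g where "g x = (1 - v x) * indicator Z x" for x
  have gm[measurable]: "g \<in> borel_measurable borel" unfolding g_def[abs_def] by measurable
  have g01: "0 \<le> g x" "g x \<le> 1 - v x" "\<bar>g x\<bar> \<le> 1" "x \<notin> Z \<Longrightarrow> g x = 0" for x
    using v01[of x] by (auto simp: g_def indicator_def)
  have bZ: "bounded Z" using Zc compact_imp_bounded by blast
  have gi: "integrable lborel g" by (rule integrable_bounded_support[OF gm bZ g01(4,3)])
  \<comment> \<open>For \<open>y\<close> within \<open>\<rho>\<close> of \<open>Z\<close> the
    \<open>log_gap\<close> integral of \<open>g\<close> is at most the \<open>bump\<close> average
    of \<open>w\<close>, which sees only the shell \<open>E\<close>, where
    \<open>w \<le> 29 (2 \<rho>)^2 = 116 \<rho>^2\<close>. Integrating over such \<open>y\<close>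
    gives \<open>\<rho>^2 / 16\<close> times the integral of \<open>g\<close> on one side and
    \<open>116 \<rho>^2\<close> times the area of \<open>E\<close> on the other;
    \<open>1856 = 16 * 116\<close>.\<close>
  have small: "integral\<^sup>L lborel g \<le> 1856 * measure lborel ({y. \<exists>z\<in>Z. dist y z < 2 * \<rho>} - Z)" if \<rho>: "0 < \<rho>" "\<rho> < r / 32" for \<rho>
  proof -
    define N where "N = (\<Union>z\<in>Z. ball z \<rho>)"
    define E where "E = {y. \<exists>z\<in>Z. dist y z < 2 * \<rho>} - Z"
    have E: "E = (\<Union>z\<in>Z. ball z (2 * \<rho>)) - Z" by (auto simp: E_def dist_commute)
    have Em[measurable]: "E \<in> sets borel" unfolding E by (intro sets.Diff Zm borel_open open_UN) auto
    have Nm[measurable]: "N \<in> sets borel" unfolding N_def by (auto intro!: borel_open open_UN)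
    have near: "dist c x \<le> r" if "z \<in> Z" "dist x z < 4 * \<rho>" for x z
      using Z_in[OF that(1)] that(2) \<rho> dist_triangle[of c x z] by (simp add: dist_commute)
    have bN: "bounded N" and bE: "bounded E"
      using near \<rho> by (auto intro!: bounded_subset[OF bounded_cball[of c r]] simp: N_def E_def dist_commute)
    let ?b = "indicator N :: real^2 \<Rightarrow> real"
    have pt: "?b y * (LINT x|lborel. log_gap \<rho> (x - y) * g x) \<le> 116 * \<rho>\<^sup>2 * (?b y * (LINT x|lborel. bump \<rho> (x - y) * indicator E x))" for y
    proof (cases "y \<in> N")
      case True
      then obtain z where z: "z \<in> Z" "dist y z < \<rho>" by (auto simp: N_def dist_commute)
      have x2: "dist x z < 2 * \<rho>" if "norm (x - y) < \<rho>" for x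
        using that z(2) dist_triangle[of x z y] by (simp add: dist_norm)
      have cy: "cball y \<rho> \<subseteq> cball c r"
      proof
        fix x assume "x \<in> cball y \<rho>"
        then have "dist x z < 4 * \<rho>" using z(2) dist_triangle[of x z y] \<rho> by (simp add: dist_commute)
        then show "x \<in> cball c r" using near[OF z(1)] by simp
      qed
      then have cyD: "cball y \<rho> \<subseteq> D" using r(2) by blast
      have "(LINT x|lborel. log_gap \<rho> (x - y) * g x) \<le> (LINT x|lborel. log_gap \<rho> (x - y) * (1 - v x))"
      proof (rule integral_mono_AE)
        show "integrable lborel (\<lambda>x. log_gap \<rho> (x - y) * g x)" by (rule log_gap_mult(1)[OF \<rho>(1) gm g01(3)])
        show "integrable lborel (\<lambda>x. log_gap \<rho> (x - y) * (1 - v x))" by (rule log_gap_mult(1)[OF \<rho>(1) fm f01])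
        have "AE x in lborel. x \<noteq> y" by (rule AE_lborel_singleton)
        then show "AE x in lborel. log_gap \<rho> (x - y) * g x \<le> log_gap \<rho> (x - y) * (1 - v x)"
          by eventually_elim (intro mult_left_mono g01 log_gap_nonneg \<rho>, simp)
      qed
      also have "\<dots> \<le> (LINT x|lborel. bump \<rho> (x - y) * w x)"
      proof -
        have "y \<in> cball c r" using cy \<rho> by (meson centre_in_cball less_imp_le subsetD)
        then show ?thesis using eq[OF \<rho>(1) cyD] w0[of y] by linarith
      qed
      also have "\<dots> \<le> (LINT x|lborel. 116 * \<rho>\<^sup>2 * (bump \<rho> (x - y) * indicator E x))"
      proof (rule integral_mono[OF bi[OF \<rho>(1) cyD]])
        show "integrable lborel (\<lambda>x. 116 * \<rho>\<^sup>2 * (bump \<rho> (x - y) * indicator E x))"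
          using integrable_mult_indicator[of E lborel, OF _ integrable_bump_diff[OF \<rho>(1), of y]]
          by (simp add: mult.commute)
        fix x
        show "bump \<rho> (x - y) * w x \<le> 116 * \<rho>\<^sup>2 * (bump \<rho> (x - y) * indicator E x)"
        proof (cases "norm (x - y) < \<rho>")
          case False
          then show ?thesis using \<rho> by (simp add: bump_eq_0)
        next
          case True
          have "w x \<le> 116 * \<rho>\<^sup>2 * indicator E x"
          proof (cases "x \<in> Z")
            case True
            then show ?thesis by (simp add: w_def Z_def)
          next
            case False
            have "w x \<le> 29 * (dist x z)\<^sup>2" using quad[OF z(1), of x] x2[OF \<open>norm (x - y) < \<rho>\<close>] \<rho> by (simp add: w_def)
            also have "\<dots> \<le> 29 * (2 * \<rho>)\<^sup>2" using x2[OF \<open>norm (x - y) < \<rho>\<close>] by (intro mult_left_mono power_mono) auto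
            finally have "w x \<le> 116 * \<rho>\<^sup>2" by (simp add: power2_eq_square)
            moreover have "x \<in> E" using False x2[OF \<open>norm (x - y) < \<rho>\<close>] z(1) by (auto simp: E_def)
            ultimately show ?thesis by simp
          qed
          then have "bump \<rho> (x - y) * w x \<le> bump \<rho> (x - y) * (116 * \<rho>\<^sup>2 * indicator E x)"
            by (intro mult_left_mono bump_nonneg \<rho>)
          then show ?thesis by (simp add: mult_ac)
        qed
      qed
      finally show ?thesis using True by simp
    qed simp
    have "\<rho>\<^sup>2 / 16 * integral\<^sup>L lborel g = (LINT x|lborel. g x * (LINT y|lborel. log_gap \<rho> (y - x) * ?b y))"
    proof -
      \<comment> \<open>The disc of radius \<open>\<rho>\<close> about a point of \<open>Z\<close>
        lies in \<open>N\<close>, so the indicator does not truncate \<open>log_gap\<close>.\<close>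
      have "(LINT y|lborel. log_gap \<rho> (y - x) * ?b y) = \<rho>\<^sup>2 / 16" if x: "x \<in> Z" for x
      proof -
        have "(\<lambda>y. log_gap \<rho> (y - x) * ?b y) = (\<lambda>y. log_gap \<rho> (y - x))"
        proof
          fix y show "log_gap \<rho> (y - x) * ?b y = log_gap \<rho> (y - x)"
          using x log_gap_eq_0[OF \<rho>(1), of "y - x"] by (cases "norm (y - x) < \<rho>") (auto simp: N_def dist_norm norm_minus_commute indicator_def)
        qed
        then show ?thesis using integral_log_gap_diff(2)[OF \<rho>(1), of x] by (simp only:)
      qed
      then have "g x * (LINT y|lborel. log_gap \<rho> (y - x) * ?b y) = \<rho>\<^sup>2 / 16 * g x" for x
        using g01(4)[of x] by (cases "x \<in> Z") auto
      then have "(\<lambda>x. g x * (LINT y|lborel. log_gap \<rho> (y - x) * ?b y)) = (\<lambda>x. \<rho>\<^sup>2 / 16 * g x)"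
        by (rule ext)
      then show ?thesis by (simp only: integral_mult_right_zero)
    qed
    also have "\<dots> = (LINT y|lborel. ?b y * (LINT x|lborel. log_gap \<rho> (x - y) * g x))"
      by (rule integral_log_gap_swap[OF \<rho>(1) gm g01(3) _ _ bN, of ?b 1, symmetric]) (auto simp: indicator_def)
    also have "\<dots> \<le> (LINT y|lborel. 116 * \<rho>\<^sup>2 * (?b y * (LINT x|lborel. bump \<rho> (x - y) * indicator E x)))"
    proof (rule integral_mono)
      note [measurable] = borel_measurable_kernels(3)[OF \<rho>(1)]
      show "integrable lborel (\<lambda>y. ?b y * (LINT x|lborel. log_gap \<rho> (x - y) * g x))"
      proof (rule integrable_bounded_support[OF _ bN])
        show "\<bar>?b y * (LINT x|lborel. log_gap \<rho> (x - y) * g x)\<bar> \<le> 1 * \<rho>\<^sup>2 / 16" for y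
          using log_gap_mult(2)[OF \<rho>(1) gm g01(3), of y] by (auto simp: indicator_def)
      qed auto
      show "integrable lborel (\<lambda>y. 116 * \<rho>\<^sup>2 * (?b y * (LINT x|lborel. bump \<rho> (x - y) * indicator E x)))"
        by (intro integrable_mult_right integral_bump_swap_le(1)[OF \<rho>(1) Em bE _ _ _ bN]) (auto simp: indicator_def)
    qed (rule pt)
    also have "\<dots> = 116 * \<rho>\<^sup>2 * (LINT y|lborel. ?b y * (LINT x|lborel. bump \<rho> (x - y) * indicator E x))" by simp
    also have "\<dots> \<le> 116 * \<rho>\<^sup>2 * measure lborel E"
      by (intro mult_left_mono integral_bump_swap_le(2)[OF \<rho>(1) Em bE _ _ _ bN]) (auto simp: indicator_def)
    finally have "\<rho>\<^sup>2 * integral\<^sup>L lborel g \<le> \<rho>\<^sup>2 * (1856 * measure lborel E)" by simp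
    then show ?thesis using \<rho> by (simp add: E_def)
  qed
  have "integral\<^sup>L lborel g \<le> 1856 * 0"
  proof (rule LIMSEQ_le_const[OF tendsto_mult[OF tendsto_const measure_shell_tendsto[OF Zc]]])
    obtain n0 where n0: "1 / real (Suc n0) < r / 16" using nat_approx_posE[of "r / 16"] r by auto
    show "\<exists>N. \<forall>n\<ge>N. integral\<^sup>L lborel g \<le> 1856 * measure lborel ({y. \<exists>z\<in>Z. dist y z < 1 / real (Suc n)} - Z)"
    proof (intro exI[of _ n0] allI impI)
      fix n assume "n0 \<le> n"
      define q where "q = 1 / real (Suc n)"
      have "q \<le> 1 / real (Suc n0)" unfolding q_def using \<open>n0 \<le> n\<close> by (intro divide_left_mono) auto
      then have "q < r / 16" using n0 by (rule le_less_trans)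
      moreover have "0 < q" by (simp add: q_def)
      ultimately show "integral\<^sup>L lborel g \<le> 1856 * measure lborel ({y. \<exists>z\<in>Z. dist y z < 1 / real (Suc n)} - Z)"
        using small[of "q / 2"] unfolding q_def[symmetric] by simp
    qed
  qed
  then have "integral\<^sup>L lborel g = 0" using Bochner_Integration.integral_nonneg[of lborel g, OF g01(1)] by linarith
  then have "AE x in lborel. g x = 0" using integral_nonneg_eq_0_iff_AE[OF gi] g01 by simp
  then show "AE y in lborel. y \<in> cball c r \<longrightarrow> v y = indicator Z y"
    using bath
  proof eventually_elim
    case (elim y)
    show ?case
    proof (intro impI)
      assume y: "y \<in> cball c r"
      show "v y = indicator Z y"
      proof (cases "y \<in> Z")
        case True
        then show ?thesis using elim by (simp add: g_def)
      next
        case False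
        then have "\<psi> y < \<mu>" using y by (auto simp: Z_eq)
        then show ?thesis using elim y False by simp
      qed
    qed
  qed
qed

section \<open>Gradients at contact sets\<close>

lemma quadratic_bound_has_derivative:
  fixes f :: "'a::real_inner \<Rightarrow> real"
  assumes e: "0 < e" and bound: "\<And>y. dist y x < e \<Longrightarrow> \<bar>f y - f x - (y - x) \<bullet> g\<bar> \<le> C * (dist y x)\<^sup>2"
  shows "(f has_derivative (\<lambda>v. v \<bullet> g)) (at x)"
proof (rule has_derivativeI_sandwich[OF e])
  show "bounded_linear (\<lambda>v. v \<bullet> g)" by (rule bounded_linear_inner_left)
  fix y assume y: "y \<noteq> x" "dist y x < e"
  show "norm (f y - f x - (y - x) \<bullet> g) / norm (y - x) \<le> C * dist y x"
    using bound[OF y(2)] y(1) by (simp add: dist_norm field_simps power2_eq_square)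
next
  have "((\<lambda>y. C * dist y x) \<longlongrightarrow> C * dist x x) (at x)" by (intro tendsto_intros)
  then show "((\<lambda>y. C * dist y x) \<longlongrightarrow> 0) (at x)" by simp
qed

text \<open>\<open>bump r\<close> is a multiple of the squared positive part of
  \<open>r^2 - w \<bullet> w\<close>, and squaring a positive part has a first-order Taylor error of
  at most the squared increment. Near the disc this increment is at most
  \<open>(2 * r + 3) * norm v\<close>; farther away all terms vanish.\<close>

lemma bump_taylor:
  fixes w v :: "real^2"
  assumes r: "0 < r" and v: "norm v \<le> 1"
  shows "\<bar>bump r (w - v) - bump r w - 12 / (pi * r ^ 6) * max 0 (r\<^sup>2 - w \<bullet> w) * (w \<bullet> v)\<bar>
    \<le> 3 / (pi * r ^ 6) * ((2 * r + 3)\<^sup>2 + 2 * r\<^sup>2) * (norm v)\<^sup>2"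
proof (cases "norm w \<le> r + 1")
  case False
  then have "norm w \<ge> r" "norm (w - v) \<ge> r" using v norm_triangle_ineq2[of w v] by linarith+
  then have "bump r (w - v) = 0" "bump r w = 0" "max 0 (r\<^sup>2 - w \<bullet> w) = 0"
    using bump_eq_0[OF r] inner_self_less_iff[OF r, of w] by (auto simp: max_def)
  then show ?thesis using r by simp
next
  case True
  define a b where "a = r\<^sup>2 - (w - v) \<bullet> (w - v)" and "b = r\<^sup>2 - w \<bullet> w"
  have ab: "a - b = 2 * (w \<bullet> v) - (norm v)\<^sup>2"
    by (simp add: a_def b_def inner_diff_left inner_diff_right inner_commute power2_norm_eq_inner)
  have wv: "\<bar>w \<bullet> v\<bar> \<le> (r + 1) * norm v"
    using Cauchy_Schwarz_ineq2[of w v] mult_right_mono[OF True norm_ge_zero[of v]] by linarith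
  have vv: "(norm v)\<^sup>2 \<le> norm v" using v by (simp add: power2_eq_square mult_left_le_one_le)
  have "\<bar>a - b\<bar> \<le> 2 * ((r + 1) * norm v) + norm v"
    unfolding ab using wv vv zero_le_power2[of "norm v"] by linarith
  then have "\<bar>a - b\<bar> \<le> (2 * r + 3) * norm v" by (simp add: algebra_simps)
  then have "\<bar>a - b\<bar>\<^sup>2 \<le> ((2 * r + 3) * norm v)\<^sup>2" by (rule power_mono) simp
  then have 1: "(a - b)\<^sup>2 \<le> (2 * r + 3)\<^sup>2 * (norm v)\<^sup>2" by (simp add: power_mult_distrib)
  \<comment> \<open>Equality holds if both arguments are nonnegative; the other sign patterns only
    make the error smaller.\<close>
  have 2: "\<bar>(max 0 a)\<^sup>2 - (max 0 b)\<^sup>2 - 2 * max 0 b * (a - b)\<bar> \<le> (a - b)\<^sup>2"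
  proof -
    consider "0 \<le> a" "0 \<le> b" | "a < 0" "0 \<le> b" | "b < 0" by linarith
    then show ?thesis
    proof cases
      case 1
      then have "(max 0 a)\<^sup>2 - (max 0 b)\<^sup>2 - 2 * max 0 b * (a - b) = (a - b)\<^sup>2"
        by (simp add: power2_eq_square algebra_simps)
      then show ?thesis by simp
    next
      case 2
      then have "(max 0 a)\<^sup>2 - (max 0 b)\<^sup>2 - 2 * max 0 b * (a - b) = b\<^sup>2 - 2 * a * b"
        by (simp add: power2_eq_square algebra_simps)
      moreover have "0 \<le> b\<^sup>2 - 2 * a * b" using 2 by (simp add: mult_nonpos_nonneg order_trans[of _ 0])
      moreover have "b\<^sup>2 - 2 * a * b \<le> (a - b)\<^sup>2" by (simp add: power2_diff)
      ultimately show ?thesis by simp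
    next
      case 3
      have "(max 0 a)\<^sup>2 \<le> (a - b)\<^sup>2"
      proof (cases "0 \<le> a")
        case True
        then show ?thesis using 3 by (auto intro!: power_mono)
      qed simp
      then show ?thesis using 3 by simp
    qed
  qed
  have b2: "max 0 b \<le> r\<^sup>2" by (simp add: b_def)
  have "\<bar>(max 0 a)\<^sup>2 - (max 0 b)\<^sup>2 - 4 * max 0 b * (w \<bullet> v)\<bar> \<le> (a - b)\<^sup>2 + 2 * max 0 b * (norm v)\<^sup>2"
  proof -
    have "(max 0 a)\<^sup>2 - (max 0 b)\<^sup>2 - 4 * max 0 b * (w \<bullet> v) =
      ((max 0 a)\<^sup>2 - (max 0 b)\<^sup>2 - 2 * max 0 b * (a - b)) - 2 * max 0 b * (norm v)\<^sup>2"
      unfolding ab by (simp add: algebra_simps)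
    moreover have "0 \<le> 2 * max 0 b * (norm v)\<^sup>2" by simp
    ultimately show ?thesis using 2 by linarith
  qed
  also have "\<dots> \<le> ((2 * r + 3)\<^sup>2 + 2 * r\<^sup>2) * (norm v)\<^sup>2"
    using 1 mult_right_mono[OF b2 zero_le_power2[of "norm v"]] by (simp add: algebra_simps)
  finally have *: "\<bar>(max 0 a)\<^sup>2 - (max 0 b)\<^sup>2 - 4 * max 0 b * (w \<bullet> v)\<bar> \<le> ((2 * r + 3)\<^sup>2 + 2 * r\<^sup>2) * (norm v)\<^sup>2" .
  have eq: "bump r (w - v) - bump r w - 12 / (pi * r ^ 6) * max 0 (r\<^sup>2 - w \<bullet> w) * (w \<bullet> v)
    = 3 / (pi * r ^ 6) * ((max 0 a)\<^sup>2 - (max 0 b)\<^sup>2 - 4 * max 0 b * (w \<bullet> v))"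
    by (simp add: bump_def a_def b_def right_diff_distrib)
  have k0: "0 \<le> 3 / (pi * r ^ 6)" using r by simp
  show ?thesis unfolding eq abs_mult[of "3 / (pi * r ^ 6)"] abs_of_nonneg[OF k0] mult.assoc[of "3 / (pi * r ^ 6)"]
    by (rule mult_left_mono[OF * k0])
qed

text \<open>For the right-hand side 1 the \<open>log_gap\<close> term is the constant
  \<open>r^2 / 16\<close>, so near \<open>x\<close> the function is its own \<open>bump\<close>
  average plus a constant and inherits differentiability from \<open>bump\<close>. The gradient of
  the kernel is bounded by \<open>12 / (pi r^3)\<close> on an area \<open>pi r^2\<close>, whence the
  factor \<open>12 / r\<close>.\<close>

lemma poisson_gradient:
  fixes \<psi> :: "real^2 \<Rightarrow> real"
  assumes pois: "poisson_on U \<psi> (\<lambda>_. 1)" and \<psi>: "continuous_on U \<psi>" and r: "0 < r" "cball x (2 * r) \<subseteq> U"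
    and M: "\<And>y. y \<in> cball x r \<Longrightarrow> \<bar>\<psi> y - a\<bar> \<le> M"
  shows "\<exists>g. (\<psi> has_derivative (\<lambda>v. v \<bullet> g)) (at x) \<and> norm g \<le> 12 / r * M"
proof -
  \<comment> \<open>Subtracting \<open>a\<close> leaves the gradient unchanged and lets the bound
    depend on the oscillation only. The cut-off makes one integrable function serve the averages
    about all points near \<open>x\<close>.\<close>
  define f where "f z = indicator (cball x (2 * r)) z *\<^sub>R (\<psi> z - a)" for z
  have c: "continuous_on (cball x (2 * r)) (\<lambda>z. \<psi> z - a)"
    by (intro continuous_intros continuous_on_subset[OF \<psi> r(2)])
  have fm[measurable]: "f \<in> borel_measurable borel"
    unfolding f_def[abs_def] by (rule borel_measurable_continuous_on_indicator[OF _ c]) simp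
  have fi: "integrable lborel f" unfolding f_def[abs_def] by (rule borel_integrable_compact[OF compact_cball c])
  have M0: "0 \<le> M" using M[of x] r by fastforce
  have fM: "\<bar>f z\<bar> \<le> M" if "norm (z - x) \<le> r" for z
    using M[of z] that r M0 by (auto simp: f_def indicator_def dist_norm norm_minus_commute)
  have bf: "integrable lborel (\<lambda>z. bump r (z - y) * f z)" for y
  proof (rule Bochner_Integration.integrable_bound[OF integrable_mult_right[OF integrable_abs[OF fi], of "3 / (pi * r\<^sup>2)"]])
    show "AE z in lborel. norm (bump r (z - y) * f z) \<le> norm (3 / (pi * r\<^sup>2) * \<bar>f z\<bar>)"
    proof (rule AE_I2)
      fix z
      have "\<bar>bump r (z - y)\<bar> \<le> \<bar>3 / (pi * r\<^sup>2)\<bar>" using bump_le[OF r(1), of "z - y"] bump_nonneg[OF r(1), of "z - y"] by linarith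
      then show "norm (bump r (z - y) * f z) \<le> norm (3 / (pi * r\<^sup>2) * \<bar>f z\<bar>)"
        unfolding real_norm_def abs_mult abs_abs by (rule mult_right_mono) simp
    qed
  qed measurable
  have rep: "\<psi> y - a = (LINT z|lborel. bump r (z - y) * f z) + r\<^sup>2 / 16" if y: "dist y x < r" for y
  proof -
    have cy: "cball y r \<subseteq> cball x (2 * r)"
    proof
      fix z assume "z \<in> cball y r"
      then show "z \<in> cball x (2 * r)" using y dist_triangle[of x z y] by (simp add: dist_commute)
    qed
    then have cyU: "cball y r \<subseteq> U" using r(2) by blast
    have "\<psi> y - (LINT z|lborel. bump r (z - y) * \<psi> z) = r\<^sup>2 / 16"
      using poisson_onD[OF pois r(1) cyU] integral_log_gap_diff(2)[OF r(1), of y] by simp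
    moreover have "(LINT z|lborel. bump r (z - y) * f z) = (LINT z|lborel. bump r (z - y) * \<psi> z - bump r (z - y) * a)"
    proof (intro Bochner_Integration.integral_cong refl)
      fix z
      show "bump r (z - y) * f z = bump r (z - y) * \<psi> z - bump r (z - y) * a"
        using bump_eq_0[OF r(1), of "z - y"] cy
        by (cases "z \<in> cball y r") (auto simp: f_def right_diff_distrib dist_norm norm_minus_commute indicator_def subset_iff)
    qed
    moreover have "\<dots> = (LINT z|lborel. bump r (z - y) * \<psi> z) - a"
      using integrable_bump_mult[OF r(1) continuous_on_subset[OF \<psi> cyU]] integrable_bump_diff[OF r(1), of y] integral_bump_diff[OF r(1), of y]
      by simp
    ultimately show ?thesis by simp
  qed
  let ?k = "12 / (pi * r ^ 6)"
  \<comment> \<open>The gradient of \<open>bump r (z - y)\<close> with respect to \<open>y\<close>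
    at \<open>y = x\<close>, times \<open>f z\<close>; its integral is the gradient of
    \<open>\<psi>\<close>.\<close>
  define G where "G z = (?k * max 0 (r\<^sup>2 - (z - x) \<bullet> (z - x)) * f z) *\<^sub>R (z - x)" for z
  have Gm[measurable]: "G \<in> borel_measurable borel" unfolding G_def[abs_def] by measurable
  have Gb: "norm (G z) \<le> 12 * M / (pi * r ^ 3) * indicator (ball x r) z" for z
  proof (cases "norm (z - x) < r")
    case True
    have "?k * max 0 (r\<^sup>2 - (z - x) \<bullet> (z - x)) * \<bar>f z\<bar> * norm (z - x) \<le> ?k * r\<^sup>2 * M * r"
      using fM[of z] True r by (intro mult_mono) auto
    also have "\<dots> = 12 * M / (pi * r ^ 3)" using r by (simp add: field_simps eval_nat_numeral)
    finally show ?thesis using True r by (simp add: G_def abs_mult dist_norm norm_minus_commute)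
  next
    case False
    then have "max 0 (r\<^sup>2 - (z - x) \<bullet> (z - x)) = 0" using inner_self_less_iff[OF r(1), of "z - x"] by (simp add: max_def)
    then show ?thesis using M0 r by (simp add: G_def)
  qed
  have ii: "integrable lborel (\<lambda>z. 12 * M / (pi * r ^ 3) * indicator (ball x r) z)"
    using emeasure_lborel_ball_finite by (intro integrable_mult_right integrable_real_indicator) auto
  have Gi: "integrable lborel G"
    by (rule Bochner_Integration.integrable_bound[OF ii]) (use Gb M0 r in \<open>auto intro!: AE_I2\<close>)
  define g where "g = integral\<^sup>L lborel G"
  have "norm g \<le> (LINT z|lborel. norm (G z))" unfolding g_def by (rule integral_norm_bound)
  also have "\<dots> \<le> (LINT z|lborel. 12 * M / (pi * r ^ 3) * indicator (ball x r) z)"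
    by (rule integral_mono[OF _ ii Gb]) (use Gi in simp)
  also have "\<dots> = 12 * M / (pi * r ^ 3) * (r\<^sup>2 * pi)" using circle_area[of r x] r by simp
  also have "\<dots> = 12 / r * M" using r by (simp add: field_simps eval_nat_numeral)
  finally have gM: "norm g \<le> 12 / r * M" .
  define C where "C = 3 / (pi * r ^ 6) * ((2 * r + 3)\<^sup>2 + 2 * r\<^sup>2) * (LINT z|lborel. \<bar>f z\<bar>)"
  have "(\<psi> has_derivative (\<lambda>v. v \<bullet> g)) (at x)"
  proof (rule quadratic_bound_has_derivative[of "min 1 r"])
    fix y assume y: "dist y x < min 1 r"
    define v where "v = y - x"
    have v: "norm v \<le> 1" using y by (simp add: v_def dist_norm)
    have vg: "v \<bullet> g = (LINT z|lborel. v \<bullet> G z)" unfolding g_def using Gi by simp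
    have vi: "integrable lborel (\<lambda>z. v \<bullet> G z)" using Gi by simp
    have "\<psi> y - \<psi> x - (y - x) \<bullet> g = (LINT z|lborel. bump r (z - y) * f z) - (LINT z|lborel. bump r (z - x) * f z) - (LINT z|lborel. v \<bullet> G z)"
      using rep[of y] rep[of x] y r vg by (simp add: v_def)
    also have "\<dots> = (LINT z|lborel. bump r (z - y) * f z - bump r (z - x) * f z - v \<bullet> G z)"
      using bf vi by simp
    also have "\<bar>\<dots>\<bar> \<le> (LINT z|lborel. \<bar>bump r (z - y) * f z - bump r (z - x) * f z - v \<bullet> G z\<bar>)"
      by (rule integral_abs_bound)
    also have "\<dots> \<le> (LINT z|lborel. 3 / (pi * r ^ 6) * ((2 * r + 3)\<^sup>2 + 2 * r\<^sup>2) * (norm v)\<^sup>2 * \<bar>f z\<bar>)"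
    proof (rule integral_mono)
      show "integrable lborel (\<lambda>z. \<bar>bump r (z - y) * f z - bump r (z - x) * f z - v \<bullet> G z\<bar>)"
        using bf vi by (intro integrable_abs Bochner_Integration.integrable_diff)
      show "integrable lborel (\<lambda>z. 3 / (pi * r ^ 6) * ((2 * r + 3)\<^sup>2 + 2 * r\<^sup>2) * (norm v)\<^sup>2 * \<bar>f z\<bar>)"
        by (intro integrable_mult_right integrable_abs fi)
      fix z
      have zy: "z - y = (z - x) - v" by (simp add: v_def)
      have "bump r (z - y) * f z - bump r (z - x) * f z - v \<bullet> G z
        = (bump r ((z - x) - v) - bump r (z - x) - ?k * max 0 (r\<^sup>2 - (z - x) \<bullet> (z - x)) * ((z - x) \<bullet> v)) * f z"
        unfolding zy G_def inner_scaleR_right inner_commute[of v] by (simp only: left_diff_distrib right_diff_distrib mult_ac)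
      then show "\<bar>bump r (z - y) * f z - bump r (z - x) * f z - v \<bullet> G z\<bar>
         \<le> 3 / (pi * r ^ 6) * ((2 * r + 3)\<^sup>2 + 2 * r\<^sup>2) * (norm v)\<^sup>2 * \<bar>f z\<bar>"
        using mult_right_mono[OF bump_taylor[OF r(1) v, of "z - x"] abs_ge_zero[of "f z"]] by (simp only: abs_mult)
    qed
    also have "\<dots> = C * (dist y x)\<^sup>2" by (simp add: C_def v_def dist_norm mult_ac)
    finally show "\<bar>\<psi> y - \<psi> x - (y - x) \<bullet> g\<bar> \<le> C * (dist y x)\<^sup>2" .
  qed (use r in simp)
  then show ?thesis using gM by blast
qed

text \<open>On \<open>A\<close> the quadratic bound gives gradient 0. At distance \<open>t\<close>
  from \<open>A\<close> the interior estimate on a disc of radius \<open>t / 3\<close> sees an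
  oscillation of order \<open>t^2\<close>, so the gradient is of order \<open>t\<close> and stays
  bounded up to \<open>A\<close>.\<close>

lemma obstacle_gradient:
  fixes \<psi> :: "real^2 \<Rightarrow> real"
  assumes D: "open D" and \<psi>: "continuous_on D \<psi>" and A: "compact A" "A \<subseteq> D"
    and pois: "poisson_on (D - A) \<psi> (\<lambda>_. 1)" and eta: "0 < \<eta>"
    and quad: "\<And>y z. z \<in> A \<Longrightarrow> dist y z < \<eta> \<Longrightarrow> \<bar>\<psi> y - \<psi> z\<bar> \<le> C0 * (dist y z)\<^sup>2"
  shows "\<exists>G. (\<forall>x\<in>D. (\<psi> has_derivative (\<lambda>v. v \<bullet> G x)) (at x)) \<and> (\<forall>x\<in>A. G x = 0) \<and>
     (\<forall>K. compact K \<longrightarrow> K \<subseteq> D \<longrightarrow> (\<exists>B. \<forall>x\<in>K. norm (G x) \<le> B))"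
proof -
  have zero: "(\<psi> has_derivative (\<lambda>v. v \<bullet> 0)) (at x)" if "x \<in> A" for x
    by (rule quadratic_bound_has_derivative[OF eta]) (use quad[OF that] in simp)
  have oDA: "open (D - A)" using D A by (simp add: compact_imp_closed open_Diff)
  have \<psi>c: "continuous_on (D - A) \<psi>" using \<psi> continuous_on_subset by blast
  have ex: "\<exists>g. (\<psi> has_derivative (\<lambda>v. v \<bullet> g)) (at x)" if x: "x \<in> D - A" for x
  proof -
    obtain d where d: "0 < d" "cball x d \<subseteq> D - A" using oDA x open_contains_cball by blast
    have "bounded (\<psi> ` cball x (d / 2))"
      using d subset_cball[of "d / 2" d x] \<psi>c by (intro compact_imp_bounded compact_continuous_image) (auto elim!: continuous_on_subset)
    then obtain M where "\<And>y. y \<in> cball x (d / 2) \<Longrightarrow> \<bar>\<psi> y - 0\<bar> \<le> M" unfolding bounded_iff by fastforce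
    then show ?thesis using poisson_gradient[OF pois \<psi>c, of "d / 2" x 0 M] d by auto
  qed
  have "\<forall>x\<in>D. \<exists>g. (\<psi> has_derivative (\<lambda>v. v \<bullet> g)) (at x)" using ex zero by blast
  then obtain G where G: "\<And>x. x \<in> D \<Longrightarrow> (\<psi> has_derivative (\<lambda>v. v \<bullet> G x)) (at x)" by metis
  have uniq: "G x = g" if "x \<in> D" "(\<psi> has_derivative (\<lambda>v. v \<bullet> g)) (at x)" for x g
  proof -
    have "v \<bullet> G x = v \<bullet> g" for v using has_derivative_unique[OF G[OF that(1)] that(2)] by meson
    from this[of "G x - g"] have "(G x - g) \<bullet> (G x - g) = 0" by (simp add: inner_diff_right)
    then show ?thesis by simp
  qed
  have G0: "G x = 0" if "x \<in> A" for x using uniq[of x 0] zero[OF that] A that by blast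
  have "\<exists>B. \<forall>x\<in>K. norm (G x) \<le> B" if K: "compact K" "K \<subseteq> D" for K
  proof -
    obtain d where d: "0 < d" "(\<Union>x\<in>K. cball x d) \<subseteq> D"
      using compact_subset_open_imp_cball_epsilon_subset[OF K(1) D K(2)] by blast
    \<comment> \<open>\<open>2 * \<rho> \<le> d\<close> keeps the discs in \<open>D\<close>. If the
      nearest point of \<open>A\<close> is within \<open>3 * \<rho>\<close>, then
      \<open>5 * \<rho> \<le> \<eta>\<close> keeps all points compared with it in the range of
      \<open>quad\<close>.\<close>
    define \<rho> where "\<rho> = min (d / 2) (\<eta> / 5)"
    have \<rho>: "0 < \<rho>" "2 * \<rho> \<le> d" "5 * \<rho> \<le> \<eta>" using d eta by (auto simp: \<rho>_def)
    have nb: "compact {x + y |x y. x \<in> K \<and> y \<in> cball (0::real^2) \<rho>}" by (intro compact_sums K compact_cball)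
    have nbD: "{x + y |x y. x \<in> K \<and> y \<in> cball (0::real^2) \<rho>} \<subseteq> D"
    proof
      fix p assume "p \<in> {x + y |x y. x \<in> K \<and> y \<in> cball (0::real^2) \<rho>}"
      then obtain x y where p: "p = x + y" "x \<in> K" "norm y \<le> \<rho>" by auto
      then have "p \<in> cball x d" using \<rho> by (simp add: dist_norm)
      then show "p \<in> D" using d p by blast
    qed
    have "bounded (\<psi> ` {x + y |x y. x \<in> K \<and> y \<in> cball (0::real^2) \<rho>})"
      by (intro compact_imp_bounded compact_continuous_image nb continuous_on_subset[OF \<psi> nbD])
    then obtain M where M: "\<And>p. p \<in> {x + y |x y. x \<in> K \<and> y \<in> cball (0::real^2) \<rho>} \<Longrightarrow> \<bar>\<psi> p\<bar> \<le> M"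
      unfolding bounded_iff by auto
    have M': "\<bar>\<psi> y - 0\<bar> \<le> \<bar>M\<bar>" if "x \<in> K" "y \<in> cball x \<rho>" for x y
    proof -
      have "y \<in> {x + y |x y. x \<in> K \<and> y \<in> cball (0::real^2) \<rho>}"
        using that by (intro CollectI exI[of _ x] exI[of _ "y - x"]) (auto simp: dist_norm norm_minus_commute)
      then show ?thesis using M[of y] by linarith
    qed
    have main: "norm (G x) \<le> max (12 / \<rho> * \<bar>M\<bar>) (144 * \<bar>C0\<bar> * \<eta>)" if x: "x \<in> K" for x
    proof (cases "x \<in> A")
      case True
      then show ?thesis using G0 \<rho> by (simp add: le_max_iff_disj)
    next
      case xA: False
      have xD: "x \<in> D" using x K by blast
      have cD: "cball x (2 * \<rho>) \<subseteq> D" using d x \<rho> subset_cball[of "2 * \<rho>" d x] by blast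
      show ?thesis
      proof (cases "\<exists>z\<in>A. dist x z \<le> 3 * \<rho>")
        case False
        then have "cball x (2 * \<rho>) \<subseteq> D - A" using cD \<rho> by force
        from poisson_gradient[OF pois \<psi>c \<rho>(1) this M'[OF x]]
        obtain g where "(\<psi> has_derivative (\<lambda>v. v \<bullet> g)) (at x)" "norm g \<le> 12 / \<rho> * \<bar>M\<bar>" by blast
        then show ?thesis using uniq[OF xD] by auto
      next
        case True
        then have ne: "A \<noteq> {}" by blast
        obtain z where z: "z \<in> A" "\<And>y. y \<in> A \<Longrightarrow> dist x z \<le> dist x y"
          using distance_attains_inf[OF compact_imp_closed[OF A(1)] ne, of x] by blast
        define t where "t = dist x z"
        have t: "0 < t" "t \<le> 3 * \<rho>" using True z xA by (force simp: t_def)+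
        have c: "cball x (2 * (t / 3)) \<subseteq> D - A"
        proof
          fix y assume "y \<in> cball x (2 * (t / 3))"
          then have y: "dist x y \<le> 2 * (t / 3)" by simp
          then have "y \<notin> A" using z(2)[of y] t(1) unfolding t_def[symmetric] by (intro notI) linarith
          moreover have "y \<in> cball x (2 * \<rho>)" using y t by simp
          ultimately show "y \<in> D - A" using cD by blast
        qed
        have b: "\<bar>\<psi> y - \<psi> z\<bar> \<le> \<bar>C0\<bar> * (2 * t)\<^sup>2" if "y \<in> cball x (t / 3)" for y
        proof -
          have yx: "dist x y \<le> t / 3" using that by simp
          have yz: "dist y z \<le> 4 / 3 * t" using dist_triangle[of y z x] yx by (simp add: t_def dist_commute)
          then have "dist y z < \<eta>" "dist y z \<le> 2 * t" using t \<rho> by linarith+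
          then have "\<bar>\<psi> y - \<psi> z\<bar> \<le> C0 * (dist y z)\<^sup>2" using quad[OF z(1)] by blast
          also have "\<dots> \<le> \<bar>C0\<bar> * (2 * t)\<^sup>2" using \<open>dist y z \<le> 2 * t\<close> by (intro mult_mono power_mono) auto
          finally show ?thesis .
        qed
        have t3: "0 < t / 3" using t by simp
        from poisson_gradient[OF pois \<psi>c t3 c b]
        obtain g where g: "(\<psi> has_derivative (\<lambda>v. v \<bullet> g)) (at x)" "norm g \<le> 12 / (t / 3) * (\<bar>C0\<bar> * (2 * t)\<^sup>2)" by blast
        have "12 / (t / 3) * (\<bar>C0\<bar> * (2 * t)\<^sup>2) = 144 * \<bar>C0\<bar> * t" using t by (simp add: field_simps power2_eq_square)
        also have "\<dots> \<le> 144 * \<bar>C0\<bar> * \<eta>" using t \<rho> by (intro mult_left_mono) auto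
        finally show ?thesis using uniq[OF xD g(1)] g(2) by auto
      qed
    qed
    then show ?thesis by blast
  qed
  then show ?thesis using G G0 by blast
qed

text \<open>The mean value theorem is applied along axis \<open>i\<close> to the difference in
  direction \<open>j\<close>, then along axis \<open>j\<close> to the resulting partial
  derivative.\<close>

lemma mixed_difference:
  fixes \<phi> :: "real^2 \<Rightarrow> real"
  assumes \<phi>: "Ck_on 2 \<phi> UNIV" and t: "0 < t"
  shows "\<exists>\<sigma> \<tau>. 0 < \<sigma> \<and> \<sigma> < t \<and> 0 < \<tau> \<and> \<tau> < t \<and>
    \<phi> (x + t *\<^sub>R axis i 1 + t *\<^sub>R axis j 1) - \<phi> (x + t *\<^sub>R axis i 1) - \<phi> (x + t *\<^sub>R axis j 1) + \<phi> x
     = t * t * partial_deriv j (partial_deriv i \<phi>) (x + \<sigma> *\<^sub>R axis i 1 + \<tau> *\<^sub>R axis j 1)"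
proof -
  let ?ei = "axis i 1 :: real^2" and ?ej = "axis j 1 :: real^2"
  note d = Ck_on_2_derivatives(1)[OF \<phi> open_UNIV UNIV_I] Ck_on_2_derivatives(2)[OF \<phi> open_UNIV UNIV_I]
    Ck_on_2_derivatives(3)[OF \<phi> open_UNIV]
  have line: "((\<lambda>s. f (p + s *\<^sub>R axis k 1)) has_real_derivative partial_deriv k f (p + s *\<^sub>R axis k 1)) (at s)"
    if "\<And>z. (f has_derivative (\<lambda>v. v \<bullet> grad f z)) (at z)" for f :: "real^2 \<Rightarrow> real" and p k s
  proof -
    have "((\<lambda>s. f (p + s *\<^sub>R axis k 1)) has_derivative (\<lambda>h. (h *\<^sub>R axis k 1) \<bullet> grad f (p + s *\<^sub>R axis k 1))) (at s)"
      by (rule has_derivative_compose[of "\<lambda>s. p + s *\<^sub>R axis k 1" "\<lambda>h. h *\<^sub>R axis k 1" s UNIV f])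
        (use that in \<open>auto intro!: derivative_eq_intros\<close>)
    then show ?thesis by (simp add: has_field_derivative_def inner_axis' grad_def mult_commute_abs)
  qed
  have d2: "(partial_deriv i \<phi> has_derivative (\<lambda>v. v \<bullet> grad (partial_deriv i \<phi>) z)) (at z)" for z
    using d(2)[of i z] by (simp add: grad_def)
  define g where "g s = \<phi> ((x + t *\<^sub>R ?ej) + s *\<^sub>R ?ei) - \<phi> (x + s *\<^sub>R ?ei)" for s
  have "(g has_real_derivative (partial_deriv i \<phi> ((x + t *\<^sub>R ?ej) + s *\<^sub>R ?ei) - partial_deriv i \<phi> (x + s *\<^sub>R ?ei))) (at s)" for s
    unfolding g_def[abs_def] by (intro DERIV_diff line d(1))
  from MVT2[OF t this] obtain \<sigma> where \<sigma>: "0 < \<sigma>" "\<sigma> < t"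
    "g t - g 0 = t * (partial_deriv i \<phi> ((x + t *\<^sub>R ?ej) + \<sigma> *\<^sub>R ?ei) - partial_deriv i \<phi> (x + \<sigma> *\<^sub>R ?ei))"
    by auto
  have "((\<lambda>s. partial_deriv i \<phi> ((x + \<sigma> *\<^sub>R ?ei) + s *\<^sub>R ?ej)) has_real_derivative
     partial_deriv j (partial_deriv i \<phi>) ((x + \<sigma> *\<^sub>R ?ei) + s *\<^sub>R ?ej)) (at s)" for s
    by (rule line[OF d2])
  from MVT2[OF t this] obtain \<tau> where \<tau>: "0 < \<tau>" "\<tau> < t"
    "partial_deriv i \<phi> ((x + \<sigma> *\<^sub>R ?ei) + t *\<^sub>R ?ej) - partial_deriv i \<phi> (x + \<sigma> *\<^sub>R ?ei) =
      t * partial_deriv j (partial_deriv i \<phi>) ((x + \<sigma> *\<^sub>R ?ei) + \<tau> *\<^sub>R ?ej)"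
    by auto
  have "g t - g 0 = t * t * partial_deriv j (partial_deriv i \<phi>) (x + \<sigma> *\<^sub>R ?ei + \<tau> *\<^sub>R ?ej)"
    using \<sigma>(3) \<tau>(3) by (simp add: add_ac)
  then show ?thesis using \<sigma>(1,2) \<tau>(1,2) by (intro exI[of _ \<sigma>] exI[of _ \<tau>]) (simp add: g_def add_ac)
qed

text \<open>The second difference quotient is symmetric in \<open>i\<close> and \<open>j\<close> and
  approximates either mixed derivative.\<close>

lemma partial_deriv_commute:
  fixes \<phi> :: "real^2 \<Rightarrow> real"
  assumes \<phi>: "Ck_on 2 \<phi> UNIV"
  shows "partial_deriv i (partial_deriv j \<phi>) x = partial_deriv j (partial_deriv i \<phi>) x"
proof -
  have c: "isCont (partial_deriv j (partial_deriv i \<phi>)) x" for i j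
    using \<phi> by (auto simp: numeral_2_eq_2 continuous_on_eq_continuous_at)
  have "\<bar>partial_deriv i (partial_deriv j \<phi>) x - partial_deriv j (partial_deriv i \<phi>) x\<bar> \<le> 0 + e" if e: "0 < e" for e
  proof -
    have half: "0 < e / 2" using e by simp
    obtain d1 where d1: "0 < d1" "\<And>y. dist y x < d1 \<Longrightarrow> \<bar>partial_deriv i (partial_deriv j \<phi>) y - partial_deriv i (partial_deriv j \<phi>) x\<bar> < e / 2"
      using c[of i j] half unfolding continuous_at_eps_delta dist_real_def by blast
    obtain d2 where d2: "0 < d2" "\<And>y. dist y x < d2 \<Longrightarrow> \<bar>partial_deriv j (partial_deriv i \<phi>) y - partial_deriv j (partial_deriv i \<phi>) x\<bar> < e / 2"
      using c[of j i] half unfolding continuous_at_eps_delta dist_real_def by blast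
    define t where "t = min d1 d2 / 2"
    have t: "0 < t" "2 * t \<le> d1" "2 * t \<le> d2" using d1 d2 by (auto simp: t_def)
    have near: "dist (x + \<sigma> *\<^sub>R axis k 1 + \<tau> *\<^sub>R axis l 1) x < 2 * t" if "0 < \<sigma>" "\<sigma> < t" "0 < \<tau>" "\<tau> < t" for \<sigma> \<tau> and k l :: 2
    proof -
      have "norm (\<sigma> *\<^sub>R axis k 1 + \<tau> *\<^sub>R axis l 1 :: real^2) \<le> \<sigma> + \<tau>"
        using norm_triangle_ineq[of "\<sigma> *\<^sub>R axis k 1 :: real^2" "\<tau> *\<^sub>R axis l 1"] that by simp
      then show ?thesis using that by (simp add: dist_norm)
    qed
    obtain s1 t1 where 1: "0 < s1" "s1 < t" "0 < t1" "t1 < t"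
      "\<phi> (x + t *\<^sub>R axis i 1 + t *\<^sub>R axis j 1) - \<phi> (x + t *\<^sub>R axis i 1) - \<phi> (x + t *\<^sub>R axis j 1) + \<phi> x
     = t * t * partial_deriv j (partial_deriv i \<phi>) (x + s1 *\<^sub>R axis i 1 + t1 *\<^sub>R axis j 1)"
      using mixed_difference[OF \<phi> t(1), of x i j] by blast
    obtain s2 t2 where 2: "0 < s2" "s2 < t" "0 < t2" "t2 < t"
      "\<phi> (x + t *\<^sub>R axis j 1 + t *\<^sub>R axis i 1) - \<phi> (x + t *\<^sub>R axis j 1) - \<phi> (x + t *\<^sub>R axis i 1) + \<phi> x
     = t * t * partial_deriv i (partial_deriv j \<phi>) (x + s2 *\<^sub>R axis j 1 + t2 *\<^sub>R axis i 1)"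
      using mixed_difference[OF \<phi> t(1), of x j i] by blast
    have "t * t * partial_deriv i (partial_deriv j \<phi>) (x + s2 *\<^sub>R axis j 1 + t2 *\<^sub>R axis i 1)
      = t * t * partial_deriv j (partial_deriv i \<phi>) (x + s1 *\<^sub>R axis i 1 + t1 *\<^sub>R axis j 1)"
      unfolding 1(5)[symmetric] 2(5)[symmetric] by (simp add: add_ac)
    then have eq: "partial_deriv i (partial_deriv j \<phi>) (x + s2 *\<^sub>R axis j 1 + t2 *\<^sub>R axis i 1)
      = partial_deriv j (partial_deriv i \<phi>) (x + s1 *\<^sub>R axis i 1 + t1 *\<^sub>R axis j 1)" using t(1) by simp
    have "\<bar>partial_deriv i (partial_deriv j \<phi>) (x + s2 *\<^sub>R axis j 1 + t2 *\<^sub>R axis i 1) - partial_deriv i (partial_deriv j \<phi>) x\<bar> < e / 2"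
      by (rule d1(2)) (use near[OF 2(1-4), of j i] t in linarith)
    moreover have "\<bar>partial_deriv j (partial_deriv i \<phi>) (x + s1 *\<^sub>R axis i 1 + t1 *\<^sub>R axis j 1) - partial_deriv j (partial_deriv i \<phi>) x\<bar> < e / 2"
      by (rule d2(2)) (use near[OF 1(1-4), of i j] t in linarith)
    ultimately show ?thesis using eq by linarith
  qed
  then have "\<bar>partial_deriv i (partial_deriv j \<phi>) x - partial_deriv j (partial_deriv i \<phi>) x\<bar> \<le> 0"
    by (rule field_le_epsilon)
  then show ?thesis by simp
qed

text \<open>The integrand is the derivative along axis 2 of
  \<open>\<psi> * partial_deriv 1 \<phi>\<close> minus the derivative along axis 1 of
  \<open>\<psi> * partial_deriv 2 \<phi>\<close>, because the mixed derivatives of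
  \<open>\<phi>\<close> cancel. All second derivatives fall on the test function, since
  \<open>\<psi>\<close> is only known to be differentiable once.\<close>

lemma integral_perp_gradient:
  fixes \<psi> \<phi> :: "real^2 \<Rightarrow> real" and G :: "real^2 \<Rightarrow> real^2"
  assumes D: "open D" and G: "\<And>x. x \<in> D \<Longrightarrow> (\<psi> has_derivative (\<lambda>v. v \<bullet> G x)) (at x)"
    and bd: "\<And>K. compact K \<Longrightarrow> K \<subseteq> D \<Longrightarrow> \<exists>B. \<forall>x\<in>K. norm (G x) \<le> B"
    and \<phi>: "Ck_on 2 \<phi> UNIV" and K: "compact K" "K \<subseteq> D" "\<And>x. x \<notin> K \<Longrightarrow> \<phi> x = 0"
  shows "has_bochner_integral lborel (\<lambda>x. indicator D x * (perp (G x) \<bullet> grad \<phi> x)) 0"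
proof -
  note d = Ck_on_2_derivatives(1)[OF \<phi> open_UNIV UNIV_I] Ck_on_2_derivatives(2)[OF \<phi> open_UNIV UNIV_I]
    Ck_on_2_derivatives(3)[OF \<phi> open_UNIV]
  have clK: "closed K" using K(1) compact_imp_closed by blast
  have g0: "grad \<phi> z = 0" if "z \<notin> K" for z
    using gradient_zero_outside_support[OF d(1) clK K(3) that] .
  have p0: "partial_deriv j \<phi> z = 0" if "z \<notin> K" for z j
    using g0[OF that] by (simp add: grad_def vec_eq_iff)
  have h0: "grad (partial_deriv j \<phi>) z = 0" if "z \<notin> K" for z j
  proof -
    have "(partial_deriv j \<phi> has_derivative (\<lambda>v. v \<bullet> grad (partial_deriv j \<phi>) z)) (at z)"
      using d(2)[of j z] by (simp add: grad_def)
    from gradient_zero_outside_support[OF this clK p0 that] show ?thesis .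
  qed
  have d2: "(partial_deriv j \<phi> has_derivative (\<lambda>v. v \<bullet> grad (partial_deriv j \<phi>) z)) (at z)" for z j
    using d(2)[of j z] by (simp add: grad_def)
  define g where "g j z = (if z \<in> D then partial_deriv j \<phi> z *\<^sub>R G z + \<psi> z *\<^sub>R grad (partial_deriv j \<phi>) z else 0)" for j z
  define F where "F j z = (if z \<in> D then \<psi> z * partial_deriv j \<phi> z else 0)" for j z
  have zero: "F j z = 0" "g j z = 0" if "z \<notin> K" for j z
    using p0[OF that] h0[OF that] by (auto simp: F_def g_def)
  have deriv: "(F j has_derivative (\<lambda>v. v \<bullet> g j z)) (at z)" for j z
  proof (cases "z \<in> D")
    case True
    have "((\<lambda>z. \<psi> z * partial_deriv j \<phi> z) has_derivative (\<lambda>v. v \<bullet> g j z)) (at z)"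
      using True by (auto intro!: derivative_eq_intros G d2 simp: g_def algebra_simps inner_simps)
    then show ?thesis
      by (rule has_derivative_transform_within_open[OF _ D True]) (simp add: F_def)
  next
    case False
    then have "z \<notin> K" using K by auto
    then have "g j z = 0" by (rule zero)
    moreover have "(F j has_derivative (\<lambda>v. 0)) (at z)"
      by (rule has_derivative_transform_within_open[of "\<lambda>_. 0" "\<lambda>_. 0" z UNIV "- K"])
        (use clK \<open>z \<notin> K\<close> zero in auto)
    ultimately show ?thesis by simp
  qed
  obtain R where R: "\<And>z. z \<in> K \<Longrightarrow> norm z \<le> R"
    using compact_imp_bounded[OF K(1)] unfolding bounded_iff by blast
  obtain B1 where B1: "\<And>x. x \<in> K \<Longrightarrow> norm (G x) \<le> B1" using bd[OF K(1,2)] by blast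
  have \<psi>c: "continuous_on K \<psi>"
    using G K(2) by (intro continuous_at_imp_continuous_on ballI has_derivative_continuous) blast
  have pc: "continuous_on K (partial_deriv j \<phi>)" for j
    using d2 by (intro continuous_at_imp_continuous_on ballI has_derivative_continuous) blast
  have hc: "continuous_on K (grad (partial_deriv j \<phi>))" for j
    by (rule continuous_on_subset[OF d(3)]) simp
  have *: "integrable lborel (\<lambda>x. g j x $ i)" "integral\<^sup>L lborel (\<lambda>x. g j x $ i) = 0" for i j
  proof -
    have "bounded (\<psi> ` K)" "bounded (partial_deriv j \<phi> ` K)" "bounded (grad (partial_deriv j \<phi>) ` K)"
      by (intro compact_imp_bounded compact_continuous_image \<psi>c pc hc K)+
    then obtain B2 B3 B4 where B: "\<And>x. x \<in> K \<Longrightarrow> \<bar>\<psi> x\<bar> \<le> B2" "\<And>x. x \<in> K \<Longrightarrow> \<bar>partial_deriv j \<phi> x\<bar> \<le> B3"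
      "\<And>x. x \<in> K \<Longrightarrow> norm (grad (partial_deriv j \<phi>) x) \<le> B4"
      unfolding bounded_iff by fastforce
    have "norm (g j z) \<le> \<bar>B3 * B1\<bar> + \<bar>B2 * B4\<bar>" for z
    proof (cases "z \<in> K")
      case True
      have "norm (g j z) \<le> \<bar>partial_deriv j \<phi> z\<bar> * norm (G z) + \<bar>\<psi> z\<bar> * norm (grad (partial_deriv j \<phi>) z)"
        using True K(2) norm_triangle_ineq[of "partial_deriv j \<phi> z *\<^sub>R G z" "\<psi> z *\<^sub>R grad (partial_deriv j \<phi>) z"] by (auto simp: g_def)
      also have "\<dots> \<le> \<bar>B3\<bar> * \<bar>B1\<bar> + \<bar>B2\<bar> * \<bar>B4\<bar>"
        using B(1-3)[OF True] B1[OF True] by (intro add_mono mult_mono) auto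
      finally show ?thesis by (simp add: abs_mult)
    qed (simp add: zero)
    from integral_gradient_eq_0[OF deriv _ this, of R]
    show "integrable lborel (\<lambda>x. g j x $ i)" "integral\<^sup>L lborel (\<lambda>x. g j x $ i) = 0"
      using R zero(1) leD by blast+
  qed
  have "indicator D x * (perp (G x) \<bullet> grad \<phi> x) = g 1 x $ 2 - g 2 x $ 1" for x
  proof -
    have "perp (G x) \<bullet> grad \<phi> x = G x $ 2 * partial_deriv 1 \<phi> x - G x $ 1 * partial_deriv 2 \<phi> x"
      by (simp add: perp_def grad_def inner_vec_def sum_2 vector_2)
    moreover have "partial_deriv 2 (partial_deriv 1 \<phi>) x = partial_deriv 1 (partial_deriv 2 \<phi>) x"
      by (rule partial_deriv_commute[OF \<phi>])
    ultimately show ?thesis by (simp add: g_def grad_def algebra_simps)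
  qed
  then show ?thesis using *[of 1 2] *[of 2 1] by (simp add: has_bochner_integral_iff)
qed

section \<open>Patches near the peaks\<close>

locale poisson_peaks = dirichlet_domain D h for D h +
  fixes \<psi>\<^sub>0 :: "real^2 \<Rightarrow> real" and c :: "'k::finite \<Rightarrow> real^2" and r\<^sub>0 :: real
  assumes \<psi>\<^sub>0_poisson: "poisson_on D \<psi>\<^sub>0 (\<lambda>_. 1)" and \<psi>\<^sub>0_cont: "continuous_on (closure D) \<psi>\<^sub>0"
    and \<psi>\<^sub>0_frontier: "\<And>z. z \<in> frontier D \<Longrightarrow> \<psi>\<^sub>0 z = 0"
    and r0: "0 < r\<^sub>0" and balls: "\<And>i. cball (c i) r\<^sub>0 \<subseteq> D"
    and disjoint: "\<And>i j. i \<noteq> j \<Longrightarrow> cball (c i) r\<^sub>0 \<inter> cball (c j) r\<^sub>0 = {}"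
    and peak: "\<And>i y. y \<in> cball (c i) r\<^sub>0 \<Longrightarrow> y \<noteq> c i \<Longrightarrow> \<psi>\<^sub>0 y < \<psi>\<^sub>0 (c i)"
begin

abbreviation S :: "'k \<Rightarrow> (real^2) set" where "S i \<equiv> cball (c i) r\<^sub>0"

definition stream :: "(real^2 \<Rightarrow> real) \<Rightarrow> real^2 \<Rightarrow> real" where
  "stream v y = \<psi>\<^sub>0 y - green_pot v y"

definition bathtub_level :: "(real^2 \<Rightarrow> real) \<Rightarrow> ('k \<Rightarrow> real) \<Rightarrow> bool" where
  "bathtub_level v \<mu> \<longleftrightarrow> (\<forall>i. AE y in lborel. y \<in> S i \<longrightarrow> (\<mu> i < stream v y \<longrightarrow> v y = 1) \<and> (stream v y < \<mu> i \<longrightarrow> v y = 0))"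

lemma S_sets: "S i \<in> sets borel" by simp

lemma \<psi>\<^sub>0_cont_D: "continuous_on D \<psi>\<^sub>0"
  by (rule continuous_on_subset[OF \<psi>\<^sub>0_cont closure_subset])

lemma center_in: "c i \<in> D" using balls[of i] r0 by auto

text \<open>As a Green potential \<open>\<psi>\<^sub>0\<close> is nonnegative, and at the centre it
  exceeds its average by \<open>r\<^sub>0^2 / 16\<close>.\<close>

lemma \<psi>\<^sub>0_pos: "0 < \<psi>\<^sub>0 (c i)"
proof -
  have one: "admissible 1 (indicator D)" using open_D by (auto simp: admissible_def indicator_def)
  have nn: "0 \<le> \<psi>\<^sub>0 x" if "x \<in> D" for x
    using green_pot_one[OF \<psi>\<^sub>0_poisson \<psi>\<^sub>0_cont \<psi>\<^sub>0_frontier that] green_pot_nonneg[of "indicator D" x] by simp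
  have "\<psi>\<^sub>0 (c i) - (LINT z|lborel. bump r\<^sub>0 (z - c i) * \<psi>\<^sub>0 z) = r\<^sub>0\<^sup>2 / 16"
    using poisson_onD[OF \<psi>\<^sub>0_poisson r0 balls[of i]] integral_log_gap_diff(2)[OF r0, of "c i"] by simp
  moreover have "0 \<le> (LINT z|lborel. bump r\<^sub>0 (z - c i) * \<psi>\<^sub>0 z)"
  proof (rule Bochner_Integration.integral_nonneg)
    fix z
    show "0 \<le> bump r\<^sub>0 (z - c i) * \<psi>\<^sub>0 z"
    proof (cases "z \<in> S i")
      case True
      then show ?thesis using nn[of z] balls[of i] bump_nonneg[OF r0] by auto
    next
      case False
      then show ?thesis using r0 by (simp add: bump_eq_0 dist_norm norm_minus_commute)
    qed
  qed
  ultimately show ?thesis using r0 by (smt (verit) zero_less_divide_iff zero_less_power)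
qed

lemma patch_integral_le:
  assumes v: "v \<in> patch_class S \<kappa>"
  shows "(LINT y|lborel. \<bar>v y\<bar>) \<le> (\<Sum>i\<in>UNIV. \<kappa> i)"
proof -
  have adm: "admissible 1 v" by (rule patch_class_admissible[OF balls v])
  note [measurable] = patch_classD(1)[OF v]
  have i: "integrable lborel (\<lambda>y. indicator (S i) y * v y)" for i
    by (rule integrable_bounded_support[of _ "S i" 1]) (use patch_classD(2,3)[OF v] in \<open>auto simp: indicator_def\<close>)
  have "(LINT y|lborel. \<bar>v y\<bar>) \<le> (LINT y|lborel. (\<Sum>i\<in>UNIV. indicator (S i) y * v y))"
  proof (rule integral_mono)
    show "integrable lborel (\<lambda>y. \<bar>v y\<bar>)" using admissible_integrable[OF adm] by simp
    show "integrable lborel (\<lambda>y. \<Sum>i\<in>UNIV. indicator (S i) y * v y)" by (rule Bochner_Integration.integrable_sum) (rule i)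
    fix y
    show "\<bar>v y\<bar> \<le> (\<Sum>i\<in>UNIV. indicator (S i) y * v y)"
    proof (cases "y \<in> (\<Union>i. S i)")
      case True
      then obtain j where "y \<in> S j" by auto
      then have "\<bar>v y\<bar> = indicator (S j) y * v y" using patch_classD(2)[OF v, of y] by simp
      also have "\<dots> \<le> (\<Sum>i\<in>UNIV. indicator (S i) y * v y)"
        by (rule member_le_sum) (use patch_classD(2)[OF v, of y] in auto)
      finally show ?thesis .
    next
      case False
      then show ?thesis using patch_classD(4)[OF v False] by simp
    qed
  qed
  also have "\<dots> = (\<Sum>i\<in>UNIV. LINT y|lborel. indicator (S i) y * v y)"
    by (rule Bochner_Integration.integral_sum) (rule i)
  also have "\<dots> = (\<Sum>i\<in>UNIV. \<kappa> i)" by (simp only: patch_classD(5)[OF v])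
  finally show ?thesis .
qed

text \<open>Compactness of the disc minus a smaller one turns the strict maximum into a gap. The
  factor 2 leaves room both for a level below the peak value and for the perturbation by the patch
  potential.\<close>

lemma peak_gap:
  assumes e: "0 < e"
  shows "\<exists>\<eta>>0. \<forall>i. \<eta> < \<psi>\<^sub>0 (c i) \<and> (\<forall>y\<in>S i. e \<le> dist (c i) y \<longrightarrow> \<psi>\<^sub>0 y \<le> \<psi>\<^sub>0 (c i) - 2 * \<eta>)"
proof -
  have "\<exists>\<eta>>0. \<eta> < \<psi>\<^sub>0 (c i) \<and> (\<forall>y\<in>S i. e \<le> dist (c i) y \<longrightarrow> \<psi>\<^sub>0 y \<le> \<psi>\<^sub>0 (c i) - 2 * \<eta>)" for i
  proof (cases "S i - ball (c i) e = {}")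
    case True
    then have "dist (c i) y < e" if "y \<in> S i" for y using that by auto
    then show ?thesis using \<psi>\<^sub>0_pos[of i] by (intro exI[of _ "\<psi>\<^sub>0 (c i) / 2"]) fastforce
  next
    case False
    have K: "compact (S i - ball (c i) e)" by (intro compact_diff compact_cball open_ball)
    have "continuous_on (S i - ball (c i) e) \<psi>\<^sub>0"
      by (rule continuous_on_subset[OF \<psi>\<^sub>0_cont_D]) (use balls[of i] in auto)
    from continuous_attains_sup[OF K False this]
    obtain p where p: "p \<in> S i - ball (c i) e" "\<And>y. y \<in> S i - ball (c i) e \<Longrightarrow> \<psi>\<^sub>0 y \<le> \<psi>\<^sub>0 p" by blast
    have "p \<noteq> c i" using p(1) e by auto
    then have lt: "\<psi>\<^sub>0 p < \<psi>\<^sub>0 (c i)" using peak[of p i] p(1) by blast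
    define \<eta> where "\<eta> = min ((\<psi>\<^sub>0 (c i) - \<psi>\<^sub>0 p) / 2) (\<psi>\<^sub>0 (c i) / 2)"
    have "\<eta> \<le> (\<psi>\<^sub>0 (c i) - \<psi>\<^sub>0 p) / 2" unfolding \<eta>_def by (rule min.cobounded1)
    moreover have "\<eta> \<le> \<psi>\<^sub>0 (c i) / 2" unfolding \<eta>_def by (rule min.cobounded2)
    moreover have "0 < \<eta>" using lt \<psi>\<^sub>0_pos[of i] by (simp add: \<eta>_def)
    ultimately have "0 < \<eta>" "\<eta> < \<psi>\<^sub>0 (c i)" "2 * \<eta> \<le> \<psi>\<^sub>0 (c i) - \<psi>\<^sub>0 p" using \<psi>\<^sub>0_pos[of i] by (auto simp: field_simps)
    moreover have "\<psi>\<^sub>0 y \<le> \<psi>\<^sub>0 (c i) - 2 * \<eta>" if "y \<in> S i" "e \<le> dist (c i) y" for y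
      using p(2)[of y] that \<open>2 * \<eta> \<le> \<psi>\<^sub>0 (c i) - \<psi>\<^sub>0 p\<close> by (auto simp: not_less)
    ultimately show ?thesis by blast
  qed
  then have "\<forall>i. \<exists>\<eta>>0. \<eta> < \<psi>\<^sub>0 (c i) \<and> (\<forall>y\<in>S i. e \<le> dist (c i) y \<longrightarrow> \<psi>\<^sub>0 y \<le> \<psi>\<^sub>0 (c i) - 2 * \<eta>)" by blast
  then obtain \<eta> where \<eta>: "\<And>i. 0 < \<eta> i" "\<And>i. \<eta> i < \<psi>\<^sub>0 (c i)"
     "\<And>i y. y \<in> S i \<Longrightarrow> e \<le> dist (c i) y \<Longrightarrow> \<psi>\<^sub>0 y \<le> \<psi>\<^sub>0 (c i) - 2 * \<eta> i" by metis
  define m where "m = Min (range \<eta>)"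
  have m: "m \<le> \<eta> i" for i unfolding m_def by (rule Min_le) auto
  have "m \<in> range \<eta>" unfolding m_def by (rule Min_in) auto
  then have "0 < m" using \<eta>(1) by auto
  moreover have "m < \<psi>\<^sub>0 (c i)" for i using m[of i] \<eta>(2)[of i] by linarith
  moreover have "\<psi>\<^sub>0 y \<le> \<psi>\<^sub>0 (c i) - 2 * m" if "y \<in> S i" "e \<le> dist (c i) y" for i y
    using \<eta>(3)[OF that] m[of i] by linarith
  ultimately show ?thesis by blast
qed

text \<open>If a level were below the peak value by more than \<open>\<eta>\<close>, the stream
  function would exceed it on a disc of fixed radius \<open>m\<close>, where then
  \<open>v = 1\<close>, against the small mass. Above such a level the gap of
  \<open>2 * \<eta>\<close> excludes points far from the centre.\<close>

lemma localization:
  assumes e: "0 < e"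
  shows "\<exists>d>0. \<forall>\<kappa> v \<mu>. v \<in> patch_class S \<kappa> \<longrightarrow> (\<forall>i. 0 < \<kappa> i) \<longrightarrow> (\<Sum>i\<in>UNIV. \<kappa> i) < d \<longrightarrow> bathtub_level v \<mu> \<longrightarrow>
     (\<forall>i. 0 < \<mu> i \<and> (\<forall>y\<in>S i. \<mu> i \<le> stream v y \<longrightarrow> y \<in> ball (c i) e))"
proof -
  obtain \<eta> where \<eta>: "0 < \<eta>" "\<And>i. \<eta> < \<psi>\<^sub>0 (c i)" "\<And>i y. y \<in> S i \<Longrightarrow> e \<le> dist (c i) y \<Longrightarrow> \<psi>\<^sub>0 y \<le> \<psi>\<^sub>0 (c i) - 2 * \<eta>"
    using peak_gap[OF e] by blast
  have "\<exists>s>0. s \<le> r\<^sub>0 \<and> (\<forall>y\<in>ball (c i) s. \<psi>\<^sub>0 (c i) - \<eta> / 2 < \<psi>\<^sub>0 y)" for i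
  proof -
    have "isCont \<psi>\<^sub>0 (c i)" using \<psi>\<^sub>0_cont_D open_D center_in by (simp add: continuous_on_eq_continuous_at)
    then obtain s where s: "0 < s" "\<And>y. dist y (c i) < s \<Longrightarrow> \<bar>\<psi>\<^sub>0 y - \<psi>\<^sub>0 (c i)\<bar> < \<eta> / 2"
      using \<eta>(1) unfolding continuous_at_eps_delta dist_real_def by (metis half_gt_zero)
    have "\<psi>\<^sub>0 (c i) - \<eta> / 2 < \<psi>\<^sub>0 y" if "y \<in> ball (c i) (min s r\<^sub>0)" for y
    proof -
      have "\<bar>\<psi>\<^sub>0 y - \<psi>\<^sub>0 (c i)\<bar> < \<eta> / 2" by (rule s(2)) (use that in \<open>simp add: dist_commute\<close>)
      then show ?thesis by linarith
    qed
    then show ?thesis using s(1) r0 by (intro exI[of _ "min s r\<^sub>0"]) auto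
  qed
  then obtain s where s: "\<And>i. 0 < s i" "\<And>i. s i \<le> r\<^sub>0" "\<And>i y. y \<in> ball (c i) (s i) \<Longrightarrow> \<psi>\<^sub>0 (c i) - \<eta> / 2 < \<psi>\<^sub>0 y" by metis
  define m where "m = Min (range s)"
  have m: "m \<le> s i" for i unfolding m_def by (rule Min_le) auto
  have "m \<in> range s" unfolding m_def by (rule Min_in) auto
  then have m0: "0 < m" using s(1) by auto
  obtain d1 where d1: "0 < d1" "\<And>f x. admissible 1 f \<Longrightarrow> (LINT y|lborel. \<bar>f y\<bar>) \<le> d1 \<Longrightarrow> \<bar>green_pot f x\<bar> \<le> \<eta> / 2"
    using green_pot_small_mass[of "\<eta> / 2" 1] \<eta>(1) by auto
  \<comment> \<open>\<open>d1\<close> keeps the patch potential below \<open>\<eta> / 2\<close>;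
    \<open>pi * m^2\<close> is the area that too low a level would fill.\<close>
  define d where "d = min d1 (pi * m\<^sup>2)"
  have d: "0 < d" "d \<le> d1" "d \<le> pi * m\<^sup>2" using d1 m0 by (auto simp: d_def)
  have "0 < \<mu> i \<and> (\<forall>y\<in>S i. \<mu> i \<le> stream v y \<longrightarrow> y \<in> ball (c i) e)"
    if v: "v \<in> patch_class S \<kappa>" and \<kappa>: "\<And>i. 0 < \<kappa> i" "(\<Sum>i\<in>UNIV. \<kappa> i) < d" and bt: "bathtub_level v \<mu>" for \<kappa> v \<mu> i
  proof -
    have adm: "admissible 1 v" by (rule patch_class_admissible[OF balls v])
    have "(LINT y|lborel. \<bar>v y\<bar>) \<le> d1" using patch_integral_le[OF v] \<kappa>(2) d(2) by linarith
    then have G: "\<bar>green_pot v y\<bar> \<le> \<eta> / 2" for y by (rule d1(2)[OF adm])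
    have \<mu>: "\<psi>\<^sub>0 (c i) - \<eta> \<le> \<mu> i"
    proof (rule ccontr)
      assume "\<not> \<psi>\<^sub>0 (c i) - \<eta> \<le> \<mu> i"
      then have lt: "\<mu> i < stream v y" if "y \<in> ball (c i) m" for y
        using s(3)[of y i] m[of i] that G[of y] by (simp add: stream_def abs_le_iff)
      have sub: "ball (c i) m \<subseteq> S i" using m[of i] s(2)[of i] by auto
      have "AE y in lborel. y \<in> S i \<longrightarrow> (\<mu> i < stream v y \<longrightarrow> v y = 1)"
        using bt unfolding bathtub_level_def by (auto elim!: allE[of _ i] eventually_mono)
      then have one: "AE y in lborel. y \<in> ball (c i) m \<longrightarrow> v y = 1"
        by eventually_elim (use lt sub in blast)
      have "pi * m\<^sup>2 = (LINT y|lborel. indicator (ball (c i) m) y)" using circle_area[of m "c i"] m0 by simp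
      also have "\<dots> \<le> (LINT y|lborel. indicator (S i) y * v y)"
      proof (rule integral_mono_AE)
        show "integrable lborel (indicator (ball (c i) m) :: real^2 \<Rightarrow> real)"
          using emeasure_lborel_ball_finite by (intro integrable_real_indicator) auto
        show "integrable lborel (\<lambda>y. indicator (S i) y * v y)"
          by (rule integrable_bounded_support[of _ "S i" 1]) (use patch_classD(1-3)[OF v] in \<open>auto simp: indicator_def\<close>)
        show "AE y in lborel. indicator (ball (c i) m) y \<le> indicator (S i) y * v y"
          using one
        proof eventually_elim
          case (elim y)
          show ?case
          proof (cases "y \<in> ball (c i) m")
            case True
            then have "y \<in> S i" "v y = 1" using sub elim by blast+
            then show ?thesis by (simp add: indicator_def)
          next
            case False
            then show ?thesis using patch_classD(2)[OF v, of y] by (simp add: indicator_def)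
          qed
        qed
      qed
      also have "\<dots> = \<kappa> i" by (rule patch_classD(5)[OF v])
      also have "\<dots> \<le> (\<Sum>i\<in>UNIV. \<kappa> i)" by (rule member_le_sum) (use \<kappa>(1) in \<open>auto intro: less_imp_le\<close>)
      finally show False using \<kappa>(2) d(3) by linarith
    qed
    have "y \<in> ball (c i) e" if y: "y \<in> S i" "\<mu> i \<le> stream v y" for y
    proof (rule ccontr)
      assume "y \<notin> ball (c i) e"
      then have "\<psi>\<^sub>0 y \<le> \<psi>\<^sub>0 (c i) - 2 * \<eta>" using \<eta>(3)[OF y(1)] by (simp add: not_less)
      then show False using y(2) \<mu> G[of y] \<eta>(1) by (simp add: stream_def abs_le_iff)
    qed
    moreover have "0 < \<mu> i" using \<mu> \<eta>(2)[of i] by linarith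
    ultimately show ?thesis by blast
  qed
  then show ?thesis using d(1) by (intro exI[of _ d]) blast
qed

lemma patch_class_nonempty:
  assumes \<kappa>: "\<And>i. 0 \<le> \<kappa> i" "\<And>i. \<kappa> i \<le> pi * r\<^sub>0\<^sup>2"
  shows "patch_class S \<kappa> \<noteq> {}"
proof -
  define v where "v y = (\<Sum>i\<in>UNIV. \<kappa> i / (pi * r\<^sub>0\<^sup>2) * indicator (S i) y)" for y
  have vS: "v y = \<kappa> i / (pi * r\<^sub>0\<^sup>2)" if "y \<in> S i" for y i
  proof -
    have "v y = (\<Sum>j\<in>{i}. \<kappa> j / (pi * r\<^sub>0\<^sup>2) * indicator (S j) y)"
      unfolding v_def
    proof (rule sum.mono_neutral_right)
      show "\<forall>j\<in>UNIV - {i}. \<kappa> j / (pi * r\<^sub>0\<^sup>2) * indicator (S j) y = 0"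
      proof
        fix j assume "j \<in> UNIV - {i}"
        then have "y \<notin> S j" using disjoint[of i j] that by blast
        then show "\<kappa> j / (pi * r\<^sub>0\<^sup>2) * indicator (S j) y = 0" by simp
      qed
    qed auto
    then show ?thesis using that by simp
  qed
  have v0: "v y = 0" if "y \<notin> (\<Union>i. S i)" for y using that by (simp add: v_def)
  have "v \<in> patch_class S \<kappa>" unfolding patch_class_def
  proof (intro CollectI conjI allI impI)
    show "v \<in> borel_measurable borel" unfolding v_def[abs_def]
      by (intro borel_measurable_sum borel_measurable_times borel_measurable_const borel_measurable_indicator S_sets)
    fix y
    have "0 \<le> v y \<and> v y \<le> 1"
    proof (cases "y \<in> (\<Union>i. S i)")
      case True
      then obtain i where "y \<in> S i" by auto
      then show ?thesis using vS[of y i] \<kappa>[of i] r0 by (simp add: divide_le_eq_1)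
    qed (simp add: v0)
    then show "0 \<le> v y" "v y \<le> 1" by auto
  next
    fix i
    have "(\<lambda>y. indicator (S i) y * v y) = (\<lambda>y. \<kappa> i / (pi * r\<^sub>0\<^sup>2) * indicator (S i) y)"
      using vS by (auto simp: fun_eq_iff indicator_def)
    moreover have "measure lborel (S i) = pi * r\<^sub>0\<^sup>2" using circle_area[of r\<^sub>0 "c i"] r0 by (simp add: content_cball_conv_ball)
    ultimately show "(LINT y|lborel. indicator (S i) y * v y) = \<kappa> i" using r0 by simp
  qed (use v0 in auto)
  then show ?thesis by blast
qed

lemma bathtub_level_exists:
  assumes \<kappa>: "\<And>i. 0 < \<kappa> i" "\<And>i. \<kappa> i \<le> pi * r\<^sub>0\<^sup>2"
  shows "\<exists>v\<in>patch_class S \<kappa>. \<exists>\<mu>. bathtub_level v \<mu>"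
proof -
  have \<kappa>0: "0 \<le> \<kappa> i" for i using \<kappa>(1)[of i] by simp
  \<comment> \<open>\<open>\<psi>\<^sub>0\<close> is unconstrained outside the closure of
    \<open>D\<close>; the cut-off makes the weight bounded and measurable on the plane.\<close>
  define p where "p y = indicator D y *\<^sub>R \<psi>\<^sub>0 y" for y
  have pm[measurable]: "p \<in> borel_measurable borel" unfolding p_def[abs_def]
    by (rule borel_measurable_continuous_on_indicator[OF _ \<psi>\<^sub>0_cont_D]) (use open_D in simp)
  have "bounded (\<psi>\<^sub>0 ` closure D)" by (intro compact_imp_bounded compact_continuous_image \<psi>\<^sub>0_cont compact_closure_D)
  then obtain P where "\<And>y. y \<in> closure D \<Longrightarrow> \<bar>\<psi>\<^sub>0 y\<bar> \<le> P" unfolding bounded_iff by fastforce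
  then have pP: "\<bar>p y\<bar> \<le> \<bar>P\<bar>" for y using closure_subset[of D] by (force simp: p_def indicator_def)
  obtain v where v: "v \<in> patch_class S \<kappa>" "\<And>w. w \<in> patch_class S \<kappa> \<Longrightarrow> energy p v \<le> energy p w"
    using energy_minimizer_exists[OF S_sets balls patch_class_nonempty[of \<kappa>, OF \<kappa>0 \<kappa>(2)] pm pP] by blast
  have adm: "admissible 1 u" if "u \<in> patch_class S \<kappa>" for u by (rule patch_class_admissible[OF balls that])
  note vm[measurable] = patch_classD(1)[OF v(1)]
  define q where "q y = p y - green_pot v y" for y
  have gm[measurable]: "green_pot v \<in> borel_measurable borel" by (rule green_pot_measurable[OF vm])
  have qm[measurable]: "q \<in> borel_measurable borel" unfolding q_def[abs_def] by measurable
  obtain K where K: "0 \<le> K" "\<And>B f x. admissible B f \<Longrightarrow> \<bar>green_pot f x\<bar> \<le> K * B" using green_pot_bounded by blast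
  have qB: "\<bar>q y\<bar> \<le> \<bar>P\<bar> + K * 1" for y using pP[of y] K(2)[OF adm[OF v(1)], of y] by (simp add: q_def)
  have "\<exists>\<mu>. AE y in lborel. y \<in> S i \<longrightarrow> (\<mu> < q y \<longrightarrow> v y = 1) \<and> (q y < \<mu> \<longrightarrow> v y = 0)" for i
  proof (rule bathtub[OF S_sets bounded_cball qm qB vm patch_classD(2)[OF v(1)] patch_classD(3)[OF v(1)]])
    show "0 < (LINT y|lborel. indicator (S i) y * v y)" using patch_classD(5)[OF v(1), of i] \<kappa>(1)[of i] by simp
    fix w :: "real^2 \<Rightarrow> real"
    assume w: "w \<in> borel_measurable borel" "\<And>y. 0 \<le> w y" "\<And>y. w y \<le> 1" "\<And>y. y \<notin> S i \<Longrightarrow> w y = v y"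
      "(LINT y|lborel. indicator (S i) y * w y) = (LINT y|lborel. indicator (S i) y * v y)"
    \<comment> \<open>The competitor changes \<open>v\<close> on one disc only, and disjointness of
      the discs preserves the other masses.\<close>
    have wK: "w \<in> patch_class S \<kappa>" unfolding patch_class_def
    proof (intro CollectI conjI allI impI w)
      show "w y = 0" if "y \<notin> (\<Union>i. S i)" for y using that w(4)[of y] patch_classD(4)[OF v(1) that] by auto
      fix j
      show "(LINT y|lborel. indicator (S j) y * w y) = \<kappa> j"
      proof (cases "j = i")
        case True
        then show ?thesis using w(5) patch_classD(5)[OF v(1)] by simp
      next
        case False
        have "indicator (S j) y * w y = indicator (S j) y * v y" for y
        proof (cases "y \<in> S j")
          case True
          then have "y \<notin> S i" using disjoint[OF False] by blast
          then show ?thesis using w(4)[of y] by simp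
        qed simp
        then have "(\<lambda>y. indicator (S j) y * w y) = (\<lambda>y. indicator (S j) y * v y)" by (rule ext)
        then show ?thesis using patch_classD(5)[OF v(1), of j] by (simp only:)
      qed
    qed
    have "(LINT x|lborel. q x * w x) \<le> (LINT x|lborel. q x * v x)"
      using energy_first_variation[OF S_sets balls v pm pP wK] by (simp add: q_def)
    \<comment> \<open>Off \<open>S i\<close> the competitor agrees with \<open>v\<close>, so the
      inequality between the full integrals localises to \<open>S i\<close>.\<close>
    moreover have "(LINT x|lborel. q x * u x) = (LINT y|lborel. indicator (S i) y * (q y * u y)) + (LINT y|lborel. indicator (- S i) y * (q y * v y))"
      if u: "u \<in> patch_class S \<kappa>" "\<And>y. y \<notin> S i \<Longrightarrow> u y = v y" for u
    proof -
      have "q x * u x = indicator (S i) x * (q x * u x) + indicator (- S i) x * (q x * v x)" for x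
        using u(2)[of x] by (auto simp: indicator_def)
      moreover have "integrable lborel (\<lambda>x. indicator (S i) x * (q x * u x))"
        using integrable_mult_indicator[OF _ integrable_bounded_mult[OF adm[OF u(1)] qm qB], of "S i"] by simp
      moreover have "integrable lborel (\<lambda>x. indicator (- S i) x * (q x * v x))"
        using integrable_mult_indicator[OF _ integrable_bounded_mult[OF adm[OF v(1)] qm qB], of "- S i"] by simp
      ultimately show ?thesis by (metis (no_types, lifting) Bochner_Integration.integral_add Bochner_Integration.integral_cong)
    qed
    ultimately show "(LINT y|lborel. indicator (S i) y * (q y * w y)) \<le> (LINT y|lborel. indicator (S i) y * (q y * v y))"
      using wK v(1) w(4) by fastforce
  qed
  then have "\<forall>i. \<exists>\<mu>. AE y in lborel. y \<in> S i \<longrightarrow> (\<mu> < q y \<longrightarrow> v y = 1) \<and> (q y < \<mu> \<longrightarrow> v y = 0)" by blast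
  from choice[OF this] obtain \<mu> where \<mu>: "\<forall>i. AE y in lborel. y \<in> S i \<longrightarrow> (\<mu> i < q y \<longrightarrow> v y = 1) \<and> (q y < \<mu> i \<longrightarrow> v y = 0)" ..
  have "q y = stream v y" if "y \<in> S i" for y i using balls[of i] that by (auto simp: q_def p_def stream_def)
  then have "bathtub_level v \<mu>" using \<mu> unfolding bathtub_level_def by (simp cong: conj_cong imp_cong)
  then show ?thesis using v(1) by blast
qed

text \<open>The patch vorticity extended by zero outside \<open>D\<close>, which makes it an
  admissible density for \<open>green_pot\<close>.\<close>

definition vortex :: "('k \<Rightarrow> (real^2) set) \<Rightarrow> real^2 \<Rightarrow> real" where
  "vortex Z y = indicator D y - indicator (\<Union>i. Z i) y"

text \<open>Interface between the variational part and the vorticity equation. The level sets refer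
  to the vorticity built from the same sets \<open>Z\<close>, and the gradient field comes with its
  zeros and local bounds.\<close>

definition good_patch :: "('k \<Rightarrow> real) \<Rightarrow> ('k \<Rightarrow> (real^2) set) \<Rightarrow> ('k \<Rightarrow> real) \<Rightarrow> bool" where
  "good_patch \<kappa> Z \<mu> \<longleftrightarrow> (\<forall>i. compact (Z i) \<and> measure lborel (Z i) = \<kappa> i \<and> 0 < \<mu> i \<and>
      Z i = {y \<in> ball (c i) r\<^sub>0. green_pot (vortex Z) y = \<mu> i}) \<and>
    (\<exists>G. (\<forall>x\<in>D. (green_pot (vortex Z) has_derivative (\<lambda>v. v \<bullet> G x)) (at x)) \<and> (\<forall>i. \<forall>x\<in>Z i. G x = 0) \<and>
       (\<forall>K. compact K \<longrightarrow> K \<subseteq> D \<longrightarrow> (\<exists>B. \<forall>x\<in>K. norm (G x) \<le> B)))"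

lemma good_patch_of_level:
  assumes v: "v \<in> patch_class S \<kappa>" and bt: "bathtub_level v \<mu>"
    and loc: "\<And>i. 0 < \<mu> i" "\<And>i y. y \<in> S i \<Longrightarrow> \<mu> i \<le> stream v y \<Longrightarrow> y \<in> ball (c i) (r\<^sub>0 / 2)"
  defines "Z \<equiv> \<lambda>i. {y \<in> ball (c i) r\<^sub>0. stream v y = \<mu> i}"
  shows "good_patch \<kappa> Z \<mu>"
proof -
  have adm: "admissible 1 v" by (rule patch_class_admissible[OF balls v])
  note vm[measurable] = patch_classD(1)[OF v]
  have one: "admissible 1 (indicator D)" using open_D by (auto simp: admissible_def indicator_def)
  have sc: "continuous_on D (stream v)" unfolding stream_def[abs_def]
    by (intro continuous_on_diff \<psi>\<^sub>0_cont_D continuous_green_pot[OF adm])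
  have sp: "poisson_on D (stream v) (\<lambda>x. 1 - v x)" unfolding stream_def[abs_def]
    by (rule poisson_on_diff[OF \<psi>\<^sub>0_poisson \<psi>\<^sub>0_cont_D poisson_on_green_pot[OF adm] continuous_green_pot[OF adm], of 1 1])
       (use admissibleD[OF adm] in auto)
  have bath: "AE y in lborel. y \<in> S i \<longrightarrow> (\<mu> i < stream v y \<longrightarrow> v y = 1) \<and> (stream v y < \<mu> i \<longrightarrow> v y = 0)" for i
    using bt unfolding bathtub_level_def by blast
  have loc': "\<forall>y\<in>S i. \<mu> i \<le> stream v y \<longrightarrow> y \<in> ball (c i) (r\<^sub>0 / 2)" for i using loc(2) by blast
  have Zi: "Z i = {y \<in> ball (c i) r\<^sub>0. stream v y = \<mu> i}" for i by (simp add: Z_def)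
  note contact = contact_set[OF open_D sc sp vm patch_classD(2,3)[OF v] r0 balls bath loc', folded Zi]
  have upper: "stream v y \<le> \<mu> i" if "y \<in> S i" for i y by (rule contact(1)[OF that])
  have Zc: "compact (Z i)" for i by (rule contact(2))
  have quad: "\<mu> i - stream v y \<le> 29 * (dist y z)\<^sup>2" if "z \<in> Z i" "dist y z < r\<^sub>0 / 8" for i y z
    by (rule contact(3)[OF that])
  have ind: "AE y in lborel. y \<in> S i \<longrightarrow> v y = indicator (Z i) y" for i by (rule contact(4))
  have ZS: "Z i \<subseteq> S i" for i by (auto simp: Z_def)
  have ZD: "Z i \<subseteq> D" for i using ZS balls by blast
  have Zm[measurable]: "Z i \<in> sets borel" for i using Zc borel_compact by blast
  have "AE y in lborel. \<forall>i. y \<in> S i \<longrightarrow> v y = indicator (Z i) y"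
    using ind by (rule AE_all_countable[THEN iffD2, OF allI])
  then have all: "AE y in lborel. v y = indicator (\<Union>i. Z i) y"
  proof eventually_elim
    case (elim y)
    show ?case
    proof (cases "y \<in> (\<Union>i. S i)")
      case True
      then obtain i where i: "y \<in> S i" by auto
      then have "y \<notin> Z j" if "j \<noteq> i" for j using disjoint[OF that] ZS by blast
      then have "y \<in> (\<Union>i. Z i) \<longleftrightarrow> y \<in> Z i" by (metis UNIV_I UN_iff)
      then show ?thesis using elim i by (simp add: indicator_def)
    next
      case False
      then have "y \<notin> (\<Union>i. Z i)" using ZS by blast
      then show ?thesis using patch_classD(4)[OF v False] by simp
    qed
  qed
  have Ua: "admissible 1 (indicator (\<Union>i. Z i))"
    using ZD by (auto simp: admissible_def indicator_def subset_iff)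
  \<comment> \<open>\<open>v\<close> is the indicator of the patches almost everywhere, so the two
    potentials agree at every point and the level sets of the stream function become level sets of
    the potential of the vorticity.\<close>
  have gp: "green_pot v x = green_pot (indicator (\<Union>i. Z i)) x" for x
    unfolding green_pot_def using all by (intro integral_cong_AE) (auto elim!: eventually_mono)
  have eqD: "green_pot (vortex Z) y = stream v y" if y: "y \<in> D" for y
  proof -
    have "green_pot (vortex Z) y = green_pot (indicator D) y - green_pot (indicator (\<Union>i. Z i)) y"
      using green_pot_diff(1)[OF one Ua, of 1 1 y] by (simp add: vortex_def[abs_def])
    then show ?thesis using green_pot_one[OF \<psi>\<^sub>0_poisson \<psi>\<^sub>0_cont \<psi>\<^sub>0_frontier y] gp by (simp add: stream_def)
  qed
  have meas: "measure lborel (Z i) = \<kappa> i" for i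
  proof -
    have "(LINT y|lborel. indicator (S i) y * v y) = (LINT y|lborel. indicator (Z i) y)"
    proof (rule integral_cong_AE)
      show "AE y in lborel. indicator (S i) y * v y = indicator (Z i) y"
        using ind[of i] by eventually_elim (use ZS[of i] in \<open>auto simp: indicator_def\<close>)
      show "(\<lambda>y. indicator (S i) y * v y) \<in> borel_measurable lborel"
        by (intro borel_measurable_times borel_measurable_indicator) (use S_sets[of i] vm in simp_all)
      show "(\<lambda>y. indicator (Z i) y :: real) \<in> borel_measurable lborel"
        by (rule borel_measurable_indicator) (use Zm[of i] in simp)
    qed
    then show ?thesis using patch_classD(5)[OF v, of i] by simp
  qed
  have lev: "Z i = {y \<in> ball (c i) r\<^sub>0. green_pot (vortex Z) y = \<mu> i}" for i
  proof -
    have "ball (c i) r\<^sub>0 \<subseteq> D" using balls[of i] ball_subset_cball[of "c i" r\<^sub>0] by blast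
    then have "green_pot (vortex Z) y = stream v y" if "y \<in> ball (c i) r\<^sub>0" for y using eqD that by blast
    then show ?thesis unfolding Zi[of i] by (intro Collect_cong conj_cong) simp_all
  qed
  define A where "A = (\<Union>i. Z i)"
  have A: "compact A" "A \<subseteq> D" unfolding A_def using Zc ZD by (auto intro!: compact_UN)
  have "\<exists>G. (\<forall>x\<in>D. (stream v has_derivative (\<lambda>v. v \<bullet> G x)) (at x)) \<and> (\<forall>x\<in>A. G x = 0) \<and>
     (\<forall>K. compact K \<longrightarrow> K \<subseteq> D \<longrightarrow> (\<exists>B. \<forall>x\<in>K. norm (G x) \<le> B))"
  proof (rule obstacle_gradient[OF open_D sc A, of "r\<^sub>0 / 8" 29])
    show "poisson_on (D - A) (stream v) (\<lambda>_. 1)"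
    proof (rule poisson_on_cong_AE[OF poisson_on_subset[OF sp]])
      show "AE z in lborel. z \<in> D - A \<longrightarrow> 1 - v z = 1" using all by eventually_elim (auto simp: A_def)
    qed auto
    show "0 < r\<^sub>0 / 8" using r0 by simp
    fix y z assume z: "z \<in> A" "dist y z < r\<^sub>0 / 8"
    then obtain i where i: "z \<in> Z i" by (auto simp: A_def)
    then have "dist (c i) z < r\<^sub>0 / 2" using loc(2)[of z i] by (auto simp: Z_def)
    \<comment> \<open>Since \<open>r\<^sub>0 / 2 + r\<^sub>0 / 8 < r\<^sub>0\<close>, the upper
      bound for the stream function applies at \<open>y\<close>; it removes the absolute value in
      the claim.\<close>
    then have "y \<in> S i" using z(2) r0 dist_triangle[of "c i" y z] by (simp add: dist_commute)
    then have "stream v y \<le> \<mu> i" by (rule upper)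
    then show "\<bar>stream v y - stream v z\<bar> \<le> 29 * (dist y z)\<^sup>2" using quad[OF i z(2)] i by (simp add: Z_def)
  qed
  then obtain G where G: "\<forall>x\<in>D. (stream v has_derivative (\<lambda>v. v \<bullet> G x)) (at x)" "\<forall>x\<in>A. G x = 0"
     "\<forall>K. compact K \<longrightarrow> K \<subseteq> D \<longrightarrow> (\<exists>B. \<forall>x\<in>K. norm (G x) \<le> B)" by (elim exE conjE) rule
  have "\<forall>x\<in>D. (green_pot (vortex Z) has_derivative (\<lambda>v. v \<bullet> G x)) (at x)"
  proof
    fix x assume x: "x \<in> D"
    show "(green_pot (vortex Z) has_derivative (\<lambda>v. v \<bullet> G x)) (at x)"
      by (rule has_derivative_transform_within_open[OF bspec[OF G(1) x] open_D x]) (rule eqD[symmetric])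
  qed
  moreover have "\<forall>i. \<forall>x\<in>Z i. G x = 0" using G(2) unfolding A_def by blast
  moreover have "compact (Z i) \<and> measure lborel (Z i) = \<kappa> i \<and> 0 < \<mu> i \<and> Z i = {y \<in> ball (c i) r\<^sub>0. green_pot (vortex Z) y = \<mu> i}" for i
    by (intro conjI Zc meas loc(1) lev)
  ultimately show ?thesis unfolding good_patch_def using G(3) by blast
qed

text \<open>The thresholds \<open>\<delta> e\<close> are fixed before \<open>\<kappa>\<close>, so
  the one patch chosen for \<open>\<kappa>\<close> meets the shrinking condition for all
  \<open>e\<close> at once.\<close>

lemma good_patches_exist:
  "\<exists>\<delta>::real \<Rightarrow> real. \<exists>\<delta>\<^sub>0>0. (\<forall>e>0. 0 < \<delta> e) \<and> (\<forall>\<kappa>. (\<forall>i. 0 < \<kappa> i) \<longrightarrow> (\<Sum>i\<in>UNIV. \<kappa> i) < \<delta>\<^sub>0 \<longrightarrow>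
     (\<exists>Z \<mu>. good_patch \<kappa> Z \<mu> \<and> (\<forall>e>0. (\<Sum>i\<in>UNIV. \<kappa> i) < \<delta> e \<longrightarrow> (\<forall>i. Z i \<subseteq> ball (c i) e))))"
proof -
  have "\<forall>e\<in>{0<..}. \<exists>d>0. \<forall>\<kappa> v \<mu>. v \<in> patch_class S \<kappa> \<longrightarrow> (\<forall>i. 0 < \<kappa> i) \<longrightarrow> (\<Sum>i\<in>UNIV. \<kappa> i) < d \<longrightarrow> bathtub_level v \<mu> \<longrightarrow>
     (\<forall>i. 0 < \<mu> i \<and> (\<forall>y\<in>S i. \<mu> i \<le> stream v y \<longrightarrow> y \<in> ball (c i) e))"
    using localization by blast
  from bchoice[OF this]
  obtain \<delta> where \<delta>': "\<forall>e\<in>{0<..}. 0 < \<delta> e \<and> (\<forall>\<kappa> v \<mu>. v \<in> patch_class S \<kappa> \<longrightarrow> (\<forall>i. 0 < \<kappa> i) \<longrightarrow> (\<Sum>i\<in>UNIV. \<kappa> i) < \<delta> e \<longrightarrow> bathtub_level v \<mu> \<longrightarrow>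
     (\<forall>i. 0 < \<mu> i \<and> (\<forall>y\<in>S i. \<mu> i \<le> stream v y \<longrightarrow> y \<in> ball (c i) e)))" ..
  then have \<delta>: "0 < \<delta> e" if "0 < e" for e using that by simp
  have loc: "0 < \<mu> i \<and> (\<forall>y\<in>S i. \<mu> i \<le> stream v y \<longrightarrow> y \<in> ball (c i) e)"
    if "0 < e" "v \<in> patch_class S \<kappa>" "\<forall>i. 0 < \<kappa> i" "(\<Sum>i\<in>UNIV. \<kappa> i) < \<delta> e" "bathtub_level v \<mu>" for e \<kappa> v \<mu> i
    using bspec[OF \<delta>', of e] that by simp
  \<comment> \<open>\<open>\<delta> (r\<^sub>0 / 2)\<close> supplies the localisation for the
    contact argument; \<open>pi * r\<^sub>0^2\<close> makes the prescribed masses fit into the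
    discs.\<close>
  define d0 where "d0 = min (\<delta> (r\<^sub>0 / 2)) (pi * r\<^sub>0\<^sup>2)"
  have d0: "0 < d0" "d0 \<le> \<delta> (r\<^sub>0 / 2)" "d0 \<le> pi * r\<^sub>0\<^sup>2" using \<delta>[of "r\<^sub>0 / 2"] r0 by (auto simp: d0_def)
  have "\<exists>Z \<mu>. good_patch \<kappa> Z \<mu> \<and> (\<forall>e>0. (\<Sum>i\<in>UNIV. \<kappa> i) < \<delta> e \<longrightarrow> (\<forall>i. Z i \<subseteq> ball (c i) e))"
    if \<kappa>: "\<forall>i. 0 < \<kappa> i" "(\<Sum>i\<in>UNIV. \<kappa> i) < d0" for \<kappa> :: "'k \<Rightarrow> real"
  proof -
    have "\<kappa> i \<le> (\<Sum>i\<in>UNIV. \<kappa> i)" for i by (rule member_le_sum) (use \<kappa>(1) in \<open>auto intro: less_imp_le\<close>)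
    then have le: "\<kappa> i \<le> pi * r\<^sub>0\<^sup>2" for i using \<kappa>(2) d0(3) by (meson less_imp_le order_trans)
    obtain v \<mu> where v: "v \<in> patch_class S \<kappa>" and bt: "bathtub_level v \<mu>"
      using bathtub_level_exists[of \<kappa>] \<kappa>(1) le by blast
    let ?Z = "\<lambda>i. {y \<in> ball (c i) r\<^sub>0. stream v y = \<mu> i}"
    have r2: "0 < r\<^sub>0 / 2" "(\<Sum>i\<in>UNIV. \<kappa> i) < \<delta> (r\<^sub>0 / 2)" using r0 \<kappa>(2) d0(2) by linarith+
    have "good_patch \<kappa> ?Z \<mu>"
      by (rule good_patch_of_level[OF v bt]) (use loc[OF r2(1) v \<kappa>(1) r2(2) bt] in blast)+
    moreover have "?Z i \<subseteq> ball (c i) e" if "0 < e" "(\<Sum>i\<in>UNIV. \<kappa> i) < \<delta> e" for e i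
      using loc[OF that(1) v \<kappa>(1) that(2) bt, of i] by auto
    ultimately show ?thesis by blast
  qed
  then show ?thesis using \<delta> d0(1) by blast
qed

end

section \<open>The vorticity equation\<close>

text \<open>\<open>G\<close> is unconstrained on the diagonal, so the two integrands may differ at
  the single point \<open>x\<close>; correcting by a multiple of the indicator of \<open>{x}\<close>
  yields measurability.\<close>

lemma (in dirichlet_domain) green_op_eq_green_pot:
  assumes G: "\<And>x y. x \<in> D \<Longrightarrow> y \<in> D \<Longrightarrow> x \<noteq> y \<Longrightarrow> G x y = log_kernel (x - y) + h y x"
    and w[measurable]: "w \<in> borel_measurable borel" and eq: "\<And>y. y \<in> D \<Longrightarrow> \<omega> y = w y" and x: "x \<in> D"
  shows "green_op D G \<omega> x = green_pot w x"
proof -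
  define f where "f y = indicator D y * (G x y * \<omega> y)" for y
  define g where "g y = green x y * w y" for y
  have ne: "f y = g y" if "y \<noteq> x" for y
    using that G[OF x, of y] eq[of y] x by (auto simp: f_def g_def green_def indicator_def)
  have fg: "f = (\<lambda>y. g y + (f x - g x) * indicator {x} y)"
    using ne by (auto simp: fun_eq_iff indicator_def)
  have gm[measurable]: "g \<in> borel_measurable borel" unfolding g_def[abs_def] by measurable
  have fm: "f \<in> borel_measurable borel" by (subst fg) measurable
  have "green_op D G \<omega> x = (LINT y|lebesgue. f y)"
    unfolding green_op_def f_def using open_D
    by (subst integral_restrict_space) (auto simp: borel_open)
  also have "\<dots> = (LINT y|lborel. f y)"
    using fm by (intro integral_completion) simp
  also have "\<dots> = (LINT y|lborel. g y)"
  proof (rule integral_cong_AE)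
    show "AE y in lborel. f y = g y" using AE_lborel_singleton[of x] by eventually_elim (rule ne)
  qed (use fm gm in simp_all)
  finally show ?thesis by (simp add: green_pot_def g_def)
qed

lemma perp_zero: "perp 0 = 0"
  by (simp add: perp_def vec_eq_iff forall_2)

context poisson_peaks
begin

section \<open>Properties of the constructed vorticity\<close>

context
  fixes G :: "real^2 \<Rightarrow> real^2 \<Rightarrow> real" and \<kappa> :: "'k \<Rightarrow> real" and Z :: "'k \<Rightarrow> (real^2) set" and \<mu> :: "'k \<Rightarrow> real"
    and \<omega> :: "real^2 \<Rightarrow> real"
  assumes G: "\<And>x y. x \<in> D \<Longrightarrow> y \<in> D \<Longrightarrow> x \<noteq> y \<Longrightarrow> G x y = log_kernel (x - y) + h y x"
    and good: "good_patch \<kappa> Z \<mu>"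
  defines "\<omega> \<equiv> \<lambda>y. 1 - indicator (\<Union>i. Z i) y"
begin

lemma patch_compact: "compact (Z i)" and patch_measure: "measure lborel (Z i) = \<kappa> i" and level_pos: "0 < \<mu> i"
  and patch_level_set: "Z i = {y \<in> ball (c i) r\<^sub>0. green_pot (vortex Z) y = \<mu> i}"
  using spec[OF conjunct1[OF good[unfolded good_patch_def]], of i] by blast+

lemma ball_subset_D: "ball (c i) r\<^sub>0 \<subseteq> D"
  using balls[of i] ball_subset_cball[of "c i" r\<^sub>0] by blast

lemma patch_subset: "Z i \<subseteq> D"
  using ball_subset_D[of i] patch_level_set[of i] by blast

lemma patches_borel: "(\<Union>i. Z i) \<in> sets borel"
  by (intro sets.countable_UN') (auto intro: borel_compact patch_compact)

lemma \<omega>_measurable: "\<omega> \<in> borel_measurable borel"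
  unfolding \<omega>_def using patches_borel by (intro borel_measurable_diff borel_measurable_indicator) auto

lemma patch_green_op:
  assumes y: "y \<in> D"
  shows "green_op D G \<omega> y = green_pot (vortex Z) y"
proof (rule green_op_eq_green_pot[OF G _ _ y])
  show "vortex Z \<in> borel_measurable borel" unfolding vortex_def[abs_def]
    using patches_borel open_D by (intro borel_measurable_diff borel_measurable_indicator) auto
qed (simp_all add: \<omega>_def vortex_def)

lemma patch_eq: "Z i = {y \<in> D. green_op D G \<omega> y = \<mu> i} \<inter> ball (c i) r\<^sub>0"
proof (intro set_eqI iffI)
  fix y assume y: "y \<in> Z i"
  then have "y \<in> D" using patch_subset[of i] by blast
  moreover have "y \<in> ball (c i) r\<^sub>0" "green_pot (vortex Z) y = \<mu> i" using y patch_level_set[of i] by blast+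
  ultimately show "y \<in> {y \<in> D. green_op D G \<omega> y = \<mu> i} \<inter> ball (c i) r\<^sub>0" using patch_green_op[of y] by auto
next
  fix y assume y: "y \<in> {y \<in> D. green_op D G \<omega> y = \<mu> i} \<inter> ball (c i) r\<^sub>0"
  then have "green_pot (vortex Z) y = \<mu> i" using patch_green_op[of y] by auto
  then show "y \<in> Z i" using y patch_level_set[of i] by blast
qed

lemma patch_lmeasurable: "Z i \<in> lmeasurable" "measure lebesgue (Z i) = \<kappa> i"
  using lmeasurable_compact[OF patch_compact[of i]] patch_measure[of i] borel_compact[OF patch_compact[of i]]
  by (simp_all add: measure_completion)

lemma patch_velocity:
  "\<exists>g. (\<forall>y\<in>D. (green_pot (vortex Z) has_derivative (\<lambda>v. v \<bullet> g y)) (at y) \<and> perp_grad (green_op D G \<omega>) y = perp (g y)) \<and>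
     (\<forall>i. \<forall>y\<in>Z i. g y = 0) \<and> (\<forall>K. compact K \<longrightarrow> K \<subseteq> D \<longrightarrow> (\<exists>B. \<forall>x\<in>K. norm (g x) \<le> B))"
proof -
  obtain g where g: "\<forall>y\<in>D. (green_pot (vortex Z) has_derivative (\<lambda>v. v \<bullet> g y)) (at y)" "\<forall>i. \<forall>y\<in>Z i. g y = 0"
      "\<forall>K. compact K \<longrightarrow> K \<subseteq> D \<longrightarrow> (\<exists>B. \<forall>x\<in>K. norm (g x) \<le> B)"
    using good unfolding good_patch_def by (elim exE conjE) rule
  have "perp_grad (green_op D G \<omega>) y = perp (g y)" if y: "y \<in> D" for y
  proof -
    have "(green_op D G \<omega> has_derivative (\<lambda>v. v \<bullet> g y)) (at y)"
      by (rule has_derivative_transform_within_open[OF bspec[OF g(1) y] open_D y]) (rule patch_green_op[symmetric])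
    then show ?thesis by (simp add: perp_grad_def grad_eqI)
  qed
  then show ?thesis using g by blast
qed

lemma patch_velocity_zero:
  assumes y: "y \<in> Z i"
  shows "perp_grad (green_op D G \<omega>) y = 0"
proof -
  have "y \<in> D" using y patch_subset[of i] by blast
  then obtain g where "perp_grad (green_op D G \<omega>) y = perp (g y)" "g y = 0" using patch_velocity y by blast
  then show ?thesis by (simp add: perp_zero)
qed

lemma patch_weak_solution: "weak_vorticity_solution D G \<omega>"
  unfolding weak_vorticity_solution_def
proof (intro conjI allI impI)
  have "\<omega> \<in> borel_measurable (lebesgue_on D)"
    using \<omega>_measurable by (intro measurable_restrict_space1 measurable_completion) simp
  moreover have "\<bar>\<omega> x\<bar> \<le> 1" for x by (simp add: \<omega>_def indicator_def)
  ultimately show "\<omega> \<in> L_infinity D" unfolding L_infinity_def by auto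
  fix \<phi> assume \<phi>: "test_function D \<phi>"
  obtain g where g: "\<forall>y\<in>D. (green_pot (vortex Z) has_derivative (\<lambda>v. v \<bullet> g y)) (at y) \<and> perp_grad (green_op D G \<omega>) y = perp (g y)"
      "\<forall>i. \<forall>y\<in>Z i. g y = 0" "\<forall>K. compact K \<longrightarrow> K \<subseteq> D \<longrightarrow> (\<exists>B. \<forall>x\<in>K. norm (g x) \<le> B)"
    using patch_velocity by (elim exE conjE) rule
  have "has_bochner_integral lborel (\<lambda>x. indicator D x * (perp (g x) \<bullet> grad \<phi> x)) 0"
  proof (rule integral_perp_gradient[OF open_D, where K = "closure {x. \<phi> x \<noteq> 0}"])
    show "Ck_on 2 \<phi> UNIV" using \<phi> by (simp add: test_function_def smooth_on_def)
    show "compact (closure {x. \<phi> x \<noteq> 0})" "closure {x. \<phi> x \<noteq> 0} \<subseteq> D" using \<phi> by (simp_all add: test_function_def)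
    show "\<phi> x = 0" if "x \<notin> closure {x. \<phi> x \<noteq> 0}" for x using that closure_subset[of "{x. \<phi> x \<noteq> 0}"] by blast
    show "(green_pot (vortex Z) has_derivative (\<lambda>v. v \<bullet> g x)) (at x)" if "x \<in> D" for x using g(1) that by simp
    show "\<exists>B. \<forall>x\<in>K. norm (g x) \<le> B" if "compact K" "K \<subseteq> D" for K using mp[OF mp[OF spec[OF g(3), of K] that(1)] that(2)] .
  qed
  note * = integrable.intros[OF this] has_bochner_integral_integral_eq[OF this]
  have "has_bochner_integral lebesgue (\<lambda>x. indicator D x * (perp (g x) \<bullet> grad \<phi> x)) 0"
    unfolding has_bochner_integral_iff integrable_completion[OF borel_measurable_integrable[OF *(1)]]
      integral_completion[OF borel_measurable_integrable[OF *(1)]] using * by (rule conjI)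
  \<comment> \<open>On the patches both sides vanish, the left with \<open>\<omega>\<close> and the
    right with the gradient; elsewhere in \<open>D\<close> the vorticity is 1.\<close>
  moreover have "indicator D x *\<^sub>R (\<omega> x * (perp_grad (green_op D G \<omega>) x \<bullet> grad \<phi> x)) = indicator D x * (perp (g x) \<bullet> grad \<phi> x)" for x
  proof (cases "x \<in> (\<Union>i. Z i)")
    case True
    then have "g x = 0" using g(2) by blast
    moreover have "\<omega> x = 0" using True by (simp add: \<omega>_def del: UN_iff)
    ultimately show ?thesis by (simp add: perp_zero)
  next
    case False
    then have "\<omega> x = 1" by (simp add: \<omega>_def del: UN_iff)
    then show ?thesis using g(1) by (cases "x \<in> D") simp_all
  qed
  moreover have "D \<inter> space lebesgue \<in> sets lebesgue" using open_D by (simp add: borel_open)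
  ultimately show "has_bochner_integral (lebesgue_on D) (\<lambda>x. \<omega> x * (perp_grad (green_op D G \<omega>) x \<bullet> grad \<phi> x)) 0"
    by (simp only: has_bochner_integral_restrict_space)
qed

end

end

text \<open>Each requirement holds for all sufficiently small radii, so finitely many of them can be
  met by one radius.\<close>

lemma peak_radius:
  fixes D :: "(real^2) set" and f :: "real^2 \<Rightarrow> real" and x :: "'k::finite \<Rightarrow> real^2"
  assumes D: "open D" and x: "inj x" "\<And>i. x i \<in> D" "\<And>i. isolated_max_point f (x i)"
  shows "\<exists>r>0. (\<forall>i. cball (x i) r \<subseteq> D) \<and> (\<forall>i j. i \<noteq> j \<longrightarrow> cball (x i) r \<inter> cball (x j) r = {}) \<and>
    (\<forall>i. \<forall>y\<in>cball (x i) r. y \<noteq> x i \<longrightarrow> f y < f (x i))"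
proof -
  have small: "\<forall>\<^sub>F r in at_right 0. r < d" if "0 < d" for d :: real
    using that eventually_at_right_field by blast
  have "\<forall>\<^sub>F r in at_right 0. cball (x i) r \<subseteq> D" for i
  proof -
    obtain d where d: "0 < d" "cball (x i) d \<subseteq> D" using D x(2)[of i] open_contains_cball by blast
    show ?thesis using small[OF d(1)] by eventually_elim (use d(2) in auto)
  qed
  moreover have "\<forall>\<^sub>F r in at_right 0. i \<noteq> j \<longrightarrow> cball (x i) r \<inter> cball (x j) r = {}" for i j
  proof (cases "i = j")
    case False
    then have "0 < dist (x i) (x j) / 2" using x(1) by (auto simp: inj_def)
    from small[OF this] show ?thesis
    proof eventually_elim
      case (elim r)
      have "dist (x i) (x j) \<le> 2 * r" if "dist (x i) z \<le> r" "dist (x j) z \<le> r" for z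
        using that dist_triangle2[of "x i" "x j" z] by linarith
      then show ?case using elim by fastforce
    qed
  qed simp
  moreover have "\<forall>\<^sub>F r in at_right 0. \<forall>y\<in>cball (x i) r. y \<noteq> x i \<longrightarrow> f y < f (x i)" for i
    using x(3)[of i] unfolding isolated_max_point_def
  proof eventually_elim
    case (elim r)
    have le: "f z \<le> f (x i)" if "z \<in> cball (x i) r" for z using elim that by blast
    show ?case
    proof (intro ballI impI, rule ccontr)
      fix y assume y: "y \<in> cball (x i) r" "y \<noteq> x i" "\<not> f y < f (x i)"
      then have "f z \<le> f y" if "z \<in> cball (x i) r" for z using le[OF that] by linarith
      then have "y \<in> {x i}" using elim y(1) by blast
      then show False using y(2) by simp
    qed
  qed
  moreover have "\<forall>\<^sub>F r::real in at_right 0. 0 < r" by (rule eventually_at_right_less)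
  ultimately have "\<forall>\<^sub>F r in at_right 0. 0 < r \<and> (\<forall>i. cball (x i) r \<subseteq> D) \<and> (\<forall>i j. i \<noteq> j \<longrightarrow> cball (x i) r \<inter> cball (x j) r = {}) \<and>
    (\<forall>i. \<forall>y\<in>cball (x i) r. y \<noteq> x i \<longrightarrow> f y < f (x i))"
    by (intro eventually_conj eventually_all_finite) auto
  then show ?thesis using eventually_happens' trivial_limit_at_right_real by blast
qed

theorem theorem2p4:
  fixes D :: "(real^2) set"
    and \<psi>\<^sub>0 :: "real^2 \<Rightarrow> real"
    and G :: "real^2 \<Rightarrow> real^2 \<Rightarrow> real"
    and \<alpha> :: real
    and x :: "'k::finite \<Rightarrow> real^2"
  assumes "open D" and "connected D" and "bounded D" and "simply_connected D"
    and "smooth_boundary D"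
    and "solves_unit_poisson D \<psi>\<^sub>0"
    and "dirichlet_green D G"
    and "\<alpha> > 0"
    and "inj x"
    and "\<And>i. x i \<in> D"
    and "\<And>i. isolated_max_point \<psi>\<^sub>0 (x i)"
  shows "\<exists>r\<^sub>0 > 0. \<exists>\<delta>\<^sub>0 > 0.
    \<exists>(\<omega> :: real^'k \<Rightarrow> real^2 \<Rightarrow> real) (A :: real^'k \<Rightarrow> 'k \<Rightarrow> (real^2) set) (\<mu> :: real^'k \<Rightarrow> 'k \<Rightarrow> real).
      (\<forall>\<kappa> \<in> strengths \<alpha>. total_strength \<kappa> < \<delta>\<^sub>0 \<longrightarrow>
         weak_vorticity_solution D G (\<omega> \<kappa>) \<and>
         (\<forall>y\<in>D. \<omega> \<kappa> y = 1 - indicator (\<Union>i. A \<kappa> i) y) \<and>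
         (\<forall>i. A \<kappa> i \<in> lmeasurable \<and> measure lebesgue (A \<kappa> i) = \<kappa> $ i \<and>
              \<mu> \<kappa> i > 0 \<and>
              A \<kappa> i = {y \<in> D. green_op D G (\<omega> \<kappa>) y = \<mu> \<kappa> i} \<inter> ball (x i) r\<^sub>0 \<and>
              (AE y in lebesgue. y \<in> A \<kappa> i \<longrightarrow> perp_grad (green_op D G (\<omega> \<kappa>)) y = 0))) \<and>
      (\<forall>\<epsilon> > 0. \<exists>\<delta>. 0 < \<delta> \<and> \<delta> < \<delta>\<^sub>0 \<and>
         (\<forall>\<kappa> \<in> strengths \<alpha>. total_strength \<kappa> < \<delta> \<longrightarrow> (\<forall>i. A \<kappa> i \<subseteq> ball (x i) \<epsilon>)))"
proof -
  have "\<forall>y\<in>D. \<exists>h. harmonic_on h D \<and> continuous_on (closure D) h \<and>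
     (\<forall>x\<in>closure D - {y}. G x y = - ln (norm (x - y)) / (2 * pi) + h x) \<and> (\<forall>x\<in>frontier D. G x y = 0)"
    using assms(7) unfolding dirichlet_green_def .
  \<comment> \<open>One correction per pole in \<open>D\<close>, which turns \<open>G\<close> into
    the setting of the locale.\<close>
  from bchoice[OF this] obtain h where h: "\<forall>y\<in>D. harmonic_on (h y) D \<and> continuous_on (closure D) (h y) \<and>
     (\<forall>x\<in>closure D - {y}. G x y = - ln (norm (x - y)) / (2 * pi) + h y x) \<and> (\<forall>x\<in>frontier D. G x y = 0)" ..
  have G: "G z y = log_kernel (z - y) + h y z" if "y \<in> D" "z \<in> closure D" "z \<noteq> y" for y z
    using h that unfolding log_kernel_def by blast
  have hf: "h y z = - log_kernel (z - y)" if y: "y \<in> D" and z: "z \<in> frontier D" for y z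
  proof -
    have "z \<notin> D" using z assms(1) by (simp add: frontier_def interior_open)
    then have "z \<noteq> y" using y by blast
    moreover have "z \<in> closure D" using z by (simp add: frontier_def)
    moreover have "G z y = 0" using h y z by blast
    ultimately show ?thesis using G[OF y, of z] by linarith
  qed
  obtain r\<^sub>0 where r0: "0 < r\<^sub>0" "\<forall>i. cball (x i) r\<^sub>0 \<subseteq> D" "\<forall>i j. i \<noteq> j \<longrightarrow> cball (x i) r\<^sub>0 \<inter> cball (x j) r\<^sub>0 = {}"
      "\<forall>i. \<forall>y\<in>cball (x i) r\<^sub>0. y \<noteq> x i \<longrightarrow> \<psi>\<^sub>0 y < \<psi>\<^sub>0 (x i)"
    using peak_radius[OF assms(1,9,10,11)] by (elim exE conjE) rule
  note u = assms(6)[unfolded solves_unit_poisson_def]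
  interpret poisson_peaks D h \<psi>\<^sub>0 x r\<^sub>0
  proof
    show "poisson_on D (h y) (\<lambda>_. 0)" if y: "y \<in> D" for y
      by (rule classical_poisson_on[OF _ assms(1)]) (use h y in \<open>auto simp: harmonic_on_def\<close>)
    show "poisson_on D \<psi>\<^sub>0 (\<lambda>_. 1)"
      by (rule classical_poisson_on[OF _ assms(1)]) (use u in force)+
    show "continuous_on (closure D) (h y)" if "y \<in> D" for y using h that by blast
    show "cball (x i) r\<^sub>0 \<inter> cball (x j) r\<^sub>0 = {}" if "i \<noteq> j" for i j using r0(3) that by blast
  qed (use assms(1,3) hf u r0(1,2,4) in simp_all)
  obtain \<delta> \<delta>\<^sub>0 where \<delta>: "0 < \<delta>\<^sub>0" "\<forall>e>0. 0 < \<delta> e" and ex: "\<forall>\<kappa>. (\<forall>i. 0 < \<kappa> i) \<longrightarrow> (\<Sum>i\<in>UNIV. \<kappa> i) < \<delta>\<^sub>0 \<longrightarrow>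
     (\<exists>Z \<mu>. good_patch \<kappa> Z \<mu> \<and> (\<forall>e>0. (\<Sum>i\<in>UNIV. \<kappa> i) < \<delta> e \<longrightarrow> (\<forall>i. Z i \<subseteq> ball (x i) e)))"
    using good_patches_exist by (elim exE conjE) rule
  \<comment> \<open>Patches are chosen for the vectors below the threshold; for all others the
    choice is arbitrary.\<close>
  define Ks :: "(real^'k) set" where "Ks = {\<kappa>\<in>strengths \<alpha>. total_strength \<kappa> < \<delta>\<^sub>0}"
  have "\<forall>\<kappa>\<in>Ks. \<exists>p. good_patch (($) \<kappa>) (fst p) (snd p) \<and>
      (\<forall>e>0. total_strength \<kappa> < \<delta> e \<longrightarrow> (\<forall>i. fst p i \<subseteq> ball (x i) e))"
  proof
    fix \<kappa> :: "real^'k" assume "\<kappa> \<in> Ks"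
    then have "\<forall>i. 0 < \<kappa> $ i" "(\<Sum>i\<in>UNIV. \<kappa> $ i) < \<delta>\<^sub>0" by (auto simp: Ks_def strengths_def total_strength_def)
    then obtain Z \<mu> where "good_patch (($) \<kappa>) Z \<mu>" "\<forall>e>0. (\<Sum>i\<in>UNIV. \<kappa> $ i) < \<delta> e \<longrightarrow> (\<forall>i. Z i \<subseteq> ball (x i) e)"
      using spec[OF ex, of "($) \<kappa>"] by blast
    then show "\<exists>p. good_patch (($) \<kappa>) (fst p) (snd p) \<and> (\<forall>e>0. total_strength \<kappa> < \<delta> e \<longrightarrow> (\<forall>i. fst p i \<subseteq> ball (x i) e))"
      unfolding total_strength_def by (intro exI[of _ "(Z, \<mu>)"]) simp
  qed
  from bchoice[OF this] obtain p where p: "\<forall>\<kappa>\<in>Ks. good_patch (($) \<kappa>) (fst (p \<kappa>)) (snd (p \<kappa>)) \<and>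
      (\<forall>e>0. total_strength \<kappa> < \<delta> e \<longrightarrow> (\<forall>i. fst (p \<kappa>) i \<subseteq> ball (x i) e))" ..
  define A where "A \<kappa> = fst (p \<kappa>)" for \<kappa>
  define \<mu> where "\<mu> \<kappa> = snd (p \<kappa>)" for \<kappa>
  define \<omega> :: "real^'k \<Rightarrow> real^2 \<Rightarrow> real" where "\<omega> \<kappa> = (\<lambda>y. 1 - indicator (\<Union>i. A \<kappa> i) y)" for \<kappa>
  have G': "G x y = log_kernel (x - y) + h y x" if "x \<in> D" "y \<in> D" "x \<noteq> y" for x y
    by (rule G) (use that closure_subset[of D] in auto)
  show ?thesis
  proof (rule exI[of _ r\<^sub>0], rule conjI[OF r0(1)], rule exI[of _ \<delta>\<^sub>0], rule conjI[OF \<delta>(1)], rule exI[of _ \<omega>],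
      rule exI[of _ A], rule exI[of _ \<mu>], intro conjI ballI impI allI)
    fix \<kappa> :: "real^'k" assume \<kappa>: "\<kappa> \<in> strengths \<alpha>" "total_strength \<kappa> < \<delta>\<^sub>0"
    then have good: "good_patch (($) \<kappa>) (A \<kappa>) (\<mu> \<kappa>)" using p unfolding A_def \<mu>_def Ks_def by blast
    show "weak_vorticity_solution D G (\<omega> \<kappa>)" unfolding \<omega>_def by (rule patch_weak_solution[OF G' good])
    show "\<omega> \<kappa> y = 1 - indicator (\<Union>i. A \<kappa> i) y" for y by (simp add: \<omega>_def)
    fix i
    show "A \<kappa> i \<in> lmeasurable" by (rule patch_lmeasurable(1)[OF G' good])
    show "measure lebesgue (A \<kappa> i) = \<kappa> $ i" by (rule patch_lmeasurable(2)[OF G' good])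
    show "0 < \<mu> \<kappa> i" by (rule level_pos[OF G' good])
    show "A \<kappa> i = {y \<in> D. green_op D G (\<omega> \<kappa>) y = \<mu> \<kappa> i} \<inter> ball (x i) r\<^sub>0"
      unfolding \<omega>_def by (rule patch_eq[OF G' good])
    show "AE y in lebesgue. y \<in> A \<kappa> i \<longrightarrow> perp_grad (green_op D G (\<omega> \<kappa>)) y = 0"
      unfolding \<omega>_def by (intro AE_I2 impI) (rule patch_velocity_zero[OF G' good])
  next
    fix e :: real assume e: "0 < e"
    \<comment> \<open>The bound \<open>\<delta>\<^sub>0 / 2\<close> makes the new threshold strictly
      smaller than \<open>\<delta>\<^sub>0\<close> and ensures that \<open>\<kappa>\<close> is one
      of the vectors for which a patch was chosen.\<close>
    show "\<exists>d. 0 < d \<and> d < \<delta>\<^sub>0 \<and> (\<forall>\<kappa> \<in> strengths \<alpha>. total_strength \<kappa> < d \<longrightarrow> (\<forall>i. A \<kappa> i \<subseteq> ball (x i) e))"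
    proof (intro exI[of _ "min (\<delta> e) (\<delta>\<^sub>0 / 2)"] conjI ballI impI)
      show "0 < min (\<delta> e) (\<delta>\<^sub>0 / 2)" "min (\<delta> e) (\<delta>\<^sub>0 / 2) < \<delta>\<^sub>0" using \<delta> e by auto
      fix \<kappa> :: "real^'k" assume \<kappa>: "\<kappa> \<in> strengths \<alpha>" "total_strength \<kappa> < min (\<delta> e) (\<delta>\<^sub>0 / 2)"
      then have "total_strength \<kappa> < \<delta>\<^sub>0" "total_strength \<kappa> < \<delta> e" using \<delta>(1) by auto
      then show "\<forall>i. A \<kappa> i \<subseteq> ball (x i) e" using p \<kappa>(1) e unfolding A_def Ks_def by blast
    qed
  qed
qed

end
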